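(* Let $(\mathbf{u},p)$ be the solution of the displacement-pressure problem and $(\mathbf{u}_h,p_h)$ the solution of its nonconforming discretization (both as defined in the context), and assume $\mathbf{f}=\mathcal{P}_h\mathbf{f}$ and $\mathbf{g}=\mathcal{P}_h^{\Gamma_N}\mathbf{g}$. Let $\boldsymbol{\sigma}_h^S$ be a stress reconstruction whose rows lie in the next-to-lowest order Raviart-Thomas space $RT_1\subset H(\mathrm{div},\Omega)$ on $\mathcal{T}_h$, such that $\mathrm{div}\,\boldsymbol{\sigma}_h^S+\mathcal{P}_h\mathbf{f}=\mathbf{0}$ in $\Omega$, $\boldsymbol{\sigma}_h^S\cdot\mathbf{n}=\mathcal{P}_h^{\Gamma_N}\mathbf{g}$ on $\Gamma_N$, and $$(\mathrm{as}\,\boldsymbol{\sigma}_h^S,\mathbf{J})_{L^2(T)}=0\quad\text{for all }T\in\mathcal{T}_h .$$ Let $\mathbf{u}_h^C\in H^1_{\Gamma_D}(\Omega)^2$ be a conforming approximation satisfying $$(\mathrm{div}\,\mathbf{u}_h^C,1)_{L^2(T)}=(\mathrm{div}\,\mathbf{u}_h,1)_{L^2(T)}\quad\text{for all }T\in\mathcal{T}_h .$$ Define $$\eta_h^R=\|\boldsymbol{\sigma}_h^S-2\mu\boldsymbol{\varepsilon}(\mathbf{u}_h)-p_h\mathbf{I}\|_{\mathcal{A},h},\qquad \eta_h^C=\sqrt{2\mu}\,\|\boldsymbol{\varepsilon}(\mathbf{u}_h^C-\mathbf{u}_h)\|_h,\qquad \eta_h^S=\|\mathrm{as}\,\boldsymbol{\sigma}_h^S\|/\sqrt{2\mu}.$$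 Let $C_K'=\max\{C_{K,T}':T\in\mathcal{T}_h\}$, where $C'_{K,T}$ is a constant for which Korn's inequality on $T$, $$\inf_{\boldsymbol{\rho}_T\in RM(T)}\|\nabla(\mathbf{v}-\boldsymbol{\rho}_T)\|_{L^2(T)}\le C_{K,T}'\,\|\boldsymbol{\varepsilon}(\mathbf{v})\|_{L^2(T)}\quad\text{for all }\mathbf{v}\in H^1(T)^2,$$ holds. Then $$|||(\mathbf{u}-\mathbf{u}_h,p-p_h)|||\le\Big(2(\eta_h^R)^2+\big(2(C_K')^2+1\big)(\eta_h^C)^2+8(C_K')^2(\eta_h^S)^2\Big)^{1/2}.$$
   Context: **Problem.** $\Omega\subset\mathbb{R}^2$ is a bounded polygonal domain, triangulated by $\mathcal{T}_h$ (the union of the elements is $\Omega$) with set of edges $\mathcal{E}_h$. The boundary is split into $\Gamma_D$ (of positive length) and $\Gamma_N=\partial\Omega\setminus\Gamma_D$, each a union of edges of $\mathcal{T}_h$. $\mu>0$ and $\lambda\in(0,\infty]$ are the Lamé parameters; for $\lambda=\infty$ (incompressible limit) $1/\lambda$ is read as $0$ and $\lambda/(2(\mu+\lambda))$ as $1/2$. $\mathbf{f}\in L^2(\Omega)^2$, $\mathbf{g}\in L^2(\Gamma_N)^2$. $(\cdot,\cdot)$, $\|\cdot\|$ are the $L^2(\Omega)$ inner product and norm; $(\cdot,\cdot)_h$, $\|\cdot\|_h$ are computed with piecewise derivatives elementwise and summed over $T\in\mathcal{T}_h$. $H^1_{\Gamma_D}(\Omega)$ is the space of $H^1$ functions vanishing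 on $\Gamma_D$. $\boldsymbol{\varepsilon}(\mathbf{v})=\frac12(\nabla\mathbf{v}+\nabla\mathbf{v}^T)$. The divergence of a matrix field is taken row-wise. The continuous problem: $\mathbf{u}\in H^1_{\Gamma_D}(\Omega)^2$, $p\in L^2(\Omega)$ with $2\mu(\boldsymbol{\varepsilon}(\mathbf{u}),\boldsymbol{\varepsilon}(\mathbf{v}))+(p,\mathrm{div}\,\mathbf{v})=(\mathbf{f},\mathbf{v})+\langle\mathbf{g},\mathbf{v}\rangle_{L^2(\Gamma_N)}$ and $(\mathrm{div}\,\mathbf{u},q)-\frac1\lambda(p,q)=0$ for all $\mathbf{v}\in H^1_{\Gamma_D}(\Omega)^2$, $q\in L^2(\Omega)$. **Discretization.** $V_h$ is the space of $v_h\in L^2(\Omega)$ with $v_h|_T\in P_2(T)$ for all $T\in\mathcal{T}_h$, $\langle[\![v_h]\!]_E,z\rangle_{L^2(E)}=0$ for all $z\in P_1(E)$ and all interior edges $E$ (with $[\![\cdot]\!]_E$ the jump across $E$), and $\langle v_h,z\rangle_{L^2(E)}=0$ for all $z\in P_1(E)$ and all edges $E\subset\Gamma_D$. $\mathbf{V}_h=V_h^2$, and $Q_h$ is the space of discontinuous piecewise linear functions. $\mathcal{P}_h$ is the componentwise $L^2(\Omega)$-orthogonal projection onto discontinuous piecewise linear functions on $\mathcal{T}_h$, and $\mathcal{P}_h^{\Gamma_N}$ the componentwise $L^2(\Gamma_N)$-orthogonal projection onto discontinuous edgewise linear functions on $\Gamma_N$. The discrete problem: $\mathbf{u}_h\in\mathbf{V}_h$,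 $p_h\in Q_h$ with $2\mu(\boldsymbol{\varepsilon}(\mathbf{u}_h),\boldsymbol{\varepsilon}(\mathbf{v}_h))_h+(p_h,\mathrm{div}\,\mathbf{v}_h)_h=(\mathcal{P}_h\mathbf{f},\mathbf{v}_h)+\langle\mathcal{P}_h^{\Gamma_N}\mathbf{g},\mathbf{v}_h\rangle_{\Gamma_N}$ and $(\mathrm{div}\,\mathbf{u}_h,q_h)_h-\frac1\lambda(p_h,q_h)=0$ for all $\mathbf{v}_h\in\mathbf{V}_h$, $q_h\in Q_h$. **Norms and notation.** Energy norm: $|||(\mathbf{u}-\mathbf{u}_h,p-p_h)|||=\big(2\mu\|\boldsymbol{\varepsilon}(\mathbf{u}-\mathbf{u}_h)\|_h^2+\frac1\lambda\|p-p_h\|^2\big)^{1/2}$. The map $\mathcal{A}$ is $\mathcal{A}\boldsymbol{\tau}=\frac1{2\mu}\big(\boldsymbol{\tau}-\frac{\lambda}{2(\mu+\lambda)}(\mathrm{tr}\,\boldsymbol{\tau})\mathbf{I}\big)$ and $\|\boldsymbol{\tau}\|_{\mathcal{A},h}=(\mathcal{A}\boldsymbol{\tau},\boldsymbol{\tau})_h^{1/2}$. $\mathrm{as}\,\boldsymbol{\tau}=\frac12(\boldsymbol{\tau}-\boldsymbol{\tau}^T)$, $\mathbf{J}=\begin{pmatrix}0&1\\-1&0\end{pmatrix}$. $RM(T)$ is the space of rigid-body modes on $T$ (restrictions to $T$ of $x\mapsto \mathbf{a}+\alpha\,(x_2,-x_1)^T$, $\mathbf{a}\in\mathbb{R}^2,\alpha\in\mathbb{R}$).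 *)

theory Defs
  imports "HOL-Analysis.Analysis"
begin

text \<open>
  Functions on (subsets of) the plane are total functions on \<^typ>\<open>real^2\<close>, and elements of
  Lebesgue and Sobolev spaces are represented by arbitrary representatives: all notions below
  depend only on the almost-everywhere class. Elements (closed triangles) and edges (closed
  segments) are sets of points. The inner product and the norm of \<^typ>\<open>real^2^2\<close> are the
  Frobenius ones.
\<close>

type_synonym point = "real^2"
type_synonym scalar_field = "point \<Rightarrow> real"
type_synonym vector_field = "point \<Rightarrow> real^2"
type_synonym tensor_field = "point \<Rightarrow> real^2^2"

definition L2 :: "'a measure \<Rightarrow> ('a \<Rightarrow> 'b::euclidean_space) set" where
  "L2 M = {f \<in> borel_measurable M. integrable M (\<lambda>x. (norm (f x))\<^sup>2)}"

definition L2_inner :: "'a measure \<Rightarrow> ('a \<Rightarrow> 'b::euclidean_space) \<Rightarrow> ('a \<Rightarrow> 'b) \<Rightarrow> real" where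
  "L2_inner M f g = (LINT x|M. f x \<bullet> g x)"

definition L2_norm :: "'a measure \<Rightarrow> ('a \<Rightarrow> 'b::euclidean_space) \<Rightarrow> real" where
  "L2_norm M f = sqrt (L2_inner M f f)"

definition componentwise :: "scalar_field set \<Rightarrow> vector_field set" where
  "componentwise S = {v. \<forall>i. (\<lambda>x. v x $ i) \<in> S}"

definition gradient :: "scalar_field \<Rightarrow> vector_field" where
  "gradient \<phi> x = (\<chi> i. frechet_derivative \<phi> (at x) (axis i 1))"

primrec Ck :: "nat \<Rightarrow> scalar_field \<Rightarrow> bool" where
  "Ck 0 \<phi> \<longleftrightarrow> continuous_on UNIV \<phi>"
| "Ck (Suc k) \<phi> \<longleftrightarrow> (\<forall>x. \<phi> differentiable (at x)) \<and> (\<forall>i. Ck k (\<lambda>x. gradient \<phi> x $ i))"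

definition smooth :: "scalar_field \<Rightarrow> bool" where
  "smooth \<phi> \<longleftrightarrow> (\<forall>k. Ck k \<phi>)"

definition test_functions :: "point set \<Rightarrow> scalar_field set" where
  "test_functions U = {\<phi>. smooth \<phi> \<and> (\<exists>K. compact K \<and> K \<subseteq> U \<and> (\<forall>x. x \<notin> K \<longrightarrow> \<phi> x = 0))}"

definition is_weak_gradient :: "point set \<Rightarrow> scalar_field \<Rightarrow> vector_field \<Rightarrow> bool" where
  "is_weak_gradient U v G \<longleftrightarrow> G \<in> L2 (lebesgue_on U) \<and>
    (\<forall>\<phi> \<in> test_functions U. \<forall>i.
      (LINT x|lebesgue_on U. v x * gradient \<phi> x $ i) = - (LINT x|lebesgue_on U. G x $ i * \<phi> x))"

definition H1 :: "point set \<Rightarrow> scalar_field set" where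
  "H1 U = {v \<in> L2 (lebesgue_on U). \<exists>G. is_weak_gradient U v G}"

definition weak_gradient :: "point set \<Rightarrow> scalar_field \<Rightarrow> vector_field" where
  "weak_gradient U v = (SOME G. is_weak_gradient U v G)"

text \<open>Row \<open>i\<close> of the gradient of a vector field is the gradient of its component \<open>i\<close>.\<close>

definition grad :: "point set \<Rightarrow> vector_field \<Rightarrow> tensor_field" where
  "grad U v x = (\<chi> i. weak_gradient U (\<lambda>y. v y $ i) x)"

definition eps :: "point set \<Rightarrow> vector_field \<Rightarrow> tensor_field" where
  "eps U v x = (1/2) *\<^sub>R (grad U v x + transpose (grad U v x))"

text \<open>\<^const>\<open>trace\<close> is the matrix trace; boundary traces are called \<open>edge_trace\<close> below.\<close>

definition divergence :: "point set \<Rightarrow> vector_field \<Rightarrow> scalar_field" where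
  "divergence U v x = trace (grad U v x)"

definition is_weak_div :: "point set \<Rightarrow> vector_field \<Rightarrow> scalar_field \<Rightarrow> bool" where
  "is_weak_div U w d \<longleftrightarrow> d \<in> L2 (lebesgue_on U) \<and>
    (\<forall>\<phi> \<in> test_functions U.
      (LINT x|lebesgue_on U. w x \<bullet> gradient \<phi> x) = - (LINT x|lebesgue_on U. d x * \<phi> x))"

definition Hdiv :: "point set \<Rightarrow> vector_field set" where
  "Hdiv U = {w \<in> L2 (lebesgue_on U). \<exists>d. is_weak_div U w d}"

definition weak_div :: "point set \<Rightarrow> vector_field \<Rightarrow> scalar_field" where
  "weak_div U w = (SOME d. is_weak_div U w d)"

definition row_div :: "point set \<Rightarrow> tensor_field \<Rightarrow> vector_field" where
  "row_div U \<tau> x = (\<chi> i. weak_div U (\<lambda>y. \<tau> y $ i) x)"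

text \<open>The condition \<open>\<Omega> = interior (closure \<Omega>)\<close> excludes slits.\<close>

definition polygonal_domain :: "point set \<Rightarrow> bool" where
  "polygonal_domain \<Omega> \<longleftrightarrow>
     open \<Omega> \<and> connected \<Omega> \<and> \<Omega> \<noteq> {} \<and> bounded \<Omega> \<and> \<Omega> = interior (closure \<Omega>) \<and>
     (\<exists>S. finite S \<and> (\<forall>E\<in>S. \<exists>a b. E = closed_segment a b) \<and> frontier \<Omega> = \<Union>S)"

definition triangulates :: "point set set \<Rightarrow> point set \<Rightarrow> bool" where
  "triangulates \<T> \<Omega> \<longleftrightarrow> triangulation \<T> \<and> (\<forall>T\<in>\<T>. 2 simplex T) \<and> \<Union>\<T> = closure \<Omega>"

definition edges :: "point set set \<Rightarrow> point set set" where
  "edges \<T> = {E. \<exists>T\<in>\<T>. E edge_of T}"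

definition boundary_edges :: "point set \<Rightarrow> point set set \<Rightarrow> point set set" where
  "boundary_edges \<Omega> \<T> = {E \<in> edges \<T>. E \<subseteq> frontier \<Omega>}"

definition interior_edges :: "point set \<Rightarrow> point set set \<Rightarrow> point set set" where
  "interior_edges \<Omega> \<T> = edges \<T> - boundary_edges \<Omega> \<T>"

text \<open>
  The Dirichlet part of the boundary is given by its (nonempty) set of edges \<open>\<D>\<close>; up to finitely
  many vertices the Neumann part is the union of the remaining boundary edges.
\<close>

definition neumann_edges :: "point set \<Rightarrow> point set set \<Rightarrow> point set set \<Rightarrow> point set set" where
  "neumann_edges \<Omega> \<T> \<D> = boundary_edges \<Omega> \<T> - \<D>"

text \<open>Arc length integration on an edge through an affine parametrization over \<open>{0..1}\<close>.\<close>

definition edge_path :: "point set \<Rightarrow> real \<Rightarrow> point" where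
  "edge_path E = (SOME \<gamma>. \<exists>a b. E = closed_segment a b \<and> \<gamma> = linepath a b)"

definition edge_integral :: "point set \<Rightarrow> scalar_field \<Rightarrow> real" where
  "edge_integral E f =
     dist (edge_path E 0) (edge_path E 1) * (LINT t|lebesgue_on {0..1}. f (edge_path E t))"

definition L2_edge :: "point set \<Rightarrow> (point \<Rightarrow> 'b::euclidean_space) set" where
  "L2_edge E = {f. (\<lambda>t. f (edge_path E t)) \<in> L2 (lebesgue_on {0..1})}"

definition AE_edge :: "point set \<Rightarrow> (point \<Rightarrow> bool) \<Rightarrow> bool" where
  "AE_edge E P \<longleftrightarrow> (AE t in lebesgue_on {0..1}. P (edge_path E t))"

definition outward_normal :: "point set \<Rightarrow> point set \<Rightarrow> real^2" where
  "outward_normal T E = (SOME n. norm n = 1 \<and> (\<forall>x\<in>E. \<forall>y\<in>E. n \<bullet> (x - y) = 0) \<and>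
     (\<forall>x\<in>T. \<forall>y\<in>E. n \<bullet> (x - y) \<le> 0))"

text \<open>
  The trace on the edge \<open>E\<close> of \<open>v \<in> H\<^sup>1(T)\<close> is the continuous extension of the restriction of
  smooth functions: it is the \<open>L\<^sup>2(E)\<close> limit of the restrictions to \<open>E\<close> of smooth functions
  that converge to \<open>v\<close> in \<open>H\<^sup>1(T)\<close>.
\<close>

definition is_edge_trace :: "point set \<Rightarrow> point set \<Rightarrow> scalar_field \<Rightarrow> scalar_field \<Rightarrow> bool" where
  "is_edge_trace T E v g \<longleftrightarrow> v \<in> H1 (interior T) \<and> g \<in> L2_edge E \<and>
    (\<exists>\<phi>. (\<forall>n::nat. smooth (\<phi> n)) \<and>
      (\<lambda>n. L2_norm (lebesgue_on T) (\<lambda>x. \<phi> n x - v x)) \<longlonglongrightarrow> 0 \<and>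
      (\<lambda>n. L2_norm (lebesgue_on T) (\<lambda>x. gradient (\<phi> n) x - weak_gradient (interior T) v x)) \<longlonglongrightarrow> 0 \<and>
      (\<lambda>n. edge_integral E (\<lambda>x. (\<phi> n x - g x)\<^sup>2)) \<longlonglongrightarrow> 0)"

definition edge_trace :: "point set \<Rightarrow> point set \<Rightarrow> scalar_field \<Rightarrow> scalar_field" where
  "edge_trace T E v = (SOME g. is_edge_trace T E v g)"

text \<open>Meant for boundary edges, which belong to exactly one element.\<close>

definition element_of :: "point set set \<Rightarrow> point set \<Rightarrow> point set" where
  "element_of \<T> E = (THE T. T \<in> \<T> \<and> E edge_of T)"

definition boundary_trace :: "point set set \<Rightarrow> point set \<Rightarrow> scalar_field \<Rightarrow> scalar_field" where
  "boundary_trace \<T> E v = edge_trace (element_of \<T> E) E v"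

definition boundary_trace_vec :: "point set set \<Rightarrow> point set \<Rightarrow> vector_field \<Rightarrow> vector_field" where
  "boundary_trace_vec \<T> E v x = (\<chi> i. boundary_trace \<T> E (\<lambda>y. v y $ i) x)"

definition normal_trace :: "point set set \<Rightarrow> point set \<Rightarrow> tensor_field \<Rightarrow> vector_field" where
  "normal_trace \<T> E \<tau> x =
     (\<chi> i. boundary_trace_vec \<T> E (\<lambda>y. \<tau> y $ i) x \<bullet> outward_normal (element_of \<T> E) E)"

definition H1_D :: "point set \<Rightarrow> point set set \<Rightarrow> point set set \<Rightarrow> scalar_field set" where
  "H1_D \<Omega> \<T> \<D> = {v \<in> H1 \<Omega>. \<forall>E\<in>\<D>. AE_edge E (\<lambda>x. boundary_trace \<T> E v x = 0)}"

definition Pk :: "nat \<Rightarrow> scalar_field set" where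
  "Pk k = {q. \<exists>c :: nat \<Rightarrow> nat \<Rightarrow> real.
     q = (\<lambda>x. \<Sum>(i, j) \<in> {(i, j). i + j \<le> k}. c i j * (x $ 1) ^ i * (x $ 2) ^ j)}"

definition DG :: "nat \<Rightarrow> point set set \<Rightarrow> scalar_field set" where
  "DG k \<T> = {v. \<forall>T\<in>\<T>. \<exists>q \<in> Pk k. AE x in lebesgue_on T. v x = q x}"

definition V_h :: "point set \<Rightarrow> point set set \<Rightarrow> point set set \<Rightarrow> scalar_field set" where
  "V_h \<Omega> \<T> \<D> = {v \<in> DG 2 \<T>. v \<in> L2 (lebesgue_on \<Omega>) \<and>
     (\<forall>E \<in> interior_edges \<Omega> \<T>. \<forall>T1\<in>\<T>. \<forall>T2\<in>\<T>. T1 \<noteq> T2 \<and> E edge_of T1 \<and> E edge_of T2 \<longrightarrow>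
        (\<forall>z \<in> Pk 1. edge_integral E (\<lambda>x. (edge_trace T1 E v x - edge_trace T2 E v x) * z x) = 0)) \<and>
     (\<forall>E \<in> \<D>. \<forall>z \<in> Pk 1. edge_integral E (\<lambda>x. boundary_trace \<T> E v x * z x) = 0)}"

definition RT1_local :: "vector_field set" where
  "RT1_local = {w. \<exists>q \<in> componentwise (Pk 1). \<exists>r \<in> Pk 1. w = (\<lambda>x. q x + r x *\<^sub>R x)}"

definition RT1 :: "point set \<Rightarrow> point set set \<Rightarrow> vector_field set" where
  "RT1 \<Omega> \<T> = {w \<in> Hdiv \<Omega>. \<forall>T\<in>\<T>. \<exists>q \<in> RT1_local. AE x in lebesgue_on T. w x = q x}"

definition proj_scalar :: "point set \<Rightarrow> point set set \<Rightarrow> scalar_field \<Rightarrow> scalar_field" where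
  "proj_scalar \<Omega> \<T> v =
     (SOME w. w \<in> DG 1 \<T> \<and> (\<forall>z \<in> DG 1 \<T>. L2_inner (lebesgue_on \<Omega>) (\<lambda>x. v x - w x) z = 0))"

definition proj :: "point set \<Rightarrow> point set set \<Rightarrow> vector_field \<Rightarrow> vector_field" where
  "proj \<Omega> \<T> f x = (\<chi> i. proj_scalar \<Omega> \<T> (\<lambda>y. f y $ i) x)"

definition edgewise_linear :: "point set set \<Rightarrow> scalar_field set" where
  "edgewise_linear \<N> = {z. \<forall>E\<in>\<N>. \<exists>q \<in> Pk 1. AE_edge E (\<lambda>x. z x = q x)}"

definition edge_proj_scalar :: "point set set \<Rightarrow> scalar_field \<Rightarrow> scalar_field" where
  "edge_proj_scalar \<N> g = (SOME w. w \<in> edgewise_linear \<N> \<and>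
     (\<forall>z \<in> edgewise_linear \<N>. (\<Sum>E\<in>\<N>. edge_integral E (\<lambda>x. (g x - w x) * z x)) = 0))"

definition edge_proj :: "point set set \<Rightarrow> vector_field \<Rightarrow> vector_field" where
  "edge_proj \<N> g x = (\<chi> i. edge_proj_scalar \<N> (\<lambda>y. g y $ i) x)"

text \<open>At \<open>lam = \<infinity>\<close> (incompressible limit) both take their limit values.\<close>

definition inv_lam :: "ereal \<Rightarrow> real" where
  "inv_lam lam = (if lam = \<infinity> then 0 else 1 / real_of_ereal lam)"

definition lam_ratio :: "real \<Rightarrow> ereal \<Rightarrow> real" where
  "lam_ratio \<mu> lam =
     (if lam = \<infinity> then 1/2 else real_of_ereal lam / (2 * (\<mu> + real_of_ereal lam)))"

definition neumann_load ::
  "point set set \<Rightarrow> point set set \<Rightarrow> vector_field \<Rightarrow> vector_field \<Rightarrow> real" where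
  "neumann_load \<T> \<N> g v = (\<Sum>E\<in>\<N>. edge_integral E (\<lambda>x. g x \<bullet> boundary_trace_vec \<T> E v x))"

definition continuous_solution ::
  "point set \<Rightarrow> point set set \<Rightarrow> point set set \<Rightarrow> real \<Rightarrow> ereal \<Rightarrow> vector_field \<Rightarrow> vector_field \<Rightarrow>
   vector_field \<Rightarrow> scalar_field \<Rightarrow> bool" where
  "continuous_solution \<Omega> \<T> \<D> \<mu> lam f g u p \<longleftrightarrow>
     u \<in> componentwise (H1_D \<Omega> \<T> \<D>) \<and> p \<in> L2 (lebesgue_on \<Omega>) \<and>
     (\<forall>v \<in> componentwise (H1_D \<Omega> \<T> \<D>).
        2 * \<mu> * L2_inner (lebesgue_on \<Omega>) (eps \<Omega> u) (eps \<Omega> v)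
          + L2_inner (lebesgue_on \<Omega>) p (divergence \<Omega> v)
        = L2_inner (lebesgue_on \<Omega>) f v + neumann_load \<T> (neumann_edges \<Omega> \<T> \<D>) g v) \<and>
     (\<forall>q \<in> L2 (lebesgue_on \<Omega>).
        L2_inner (lebesgue_on \<Omega>) (divergence \<Omega> u) q
          - inv_lam lam * L2_inner (lebesgue_on \<Omega>) p q = 0)"

text \<open>
  Elementwise inner product and norm. The arguments are families of fields indexed by the element,
  such as \<open>\<lambda>T. eps (interior T) v\<close>, the elementwise symmetric gradient of \<open>v\<close>.
\<close>

definition inner_h :: "point set set \<Rightarrow> (point set \<Rightarrow> point \<Rightarrow> 'b::euclidean_space) \<Rightarrow>
    (point set \<Rightarrow> point \<Rightarrow> 'b) \<Rightarrow> real" where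
  "inner_h \<T> F G = (\<Sum>T\<in>\<T>. L2_inner (lebesgue_on T) (F T) (G T))"

definition norm_h :: "point set set \<Rightarrow> (point set \<Rightarrow> point \<Rightarrow> 'b::euclidean_space) \<Rightarrow> real" where
  "norm_h \<T> F = sqrt (inner_h \<T> F F)"

definition eps_h :: "vector_field \<Rightarrow> point set \<Rightarrow> tensor_field" where
  "eps_h v T = eps (interior T) v"

definition div_h :: "vector_field \<Rightarrow> point set \<Rightarrow> scalar_field" where
  "div_h v T = divergence (interior T) v"

definition discrete_solution ::
  "point set \<Rightarrow> point set set \<Rightarrow> point set set \<Rightarrow> real \<Rightarrow> ereal \<Rightarrow> vector_field \<Rightarrow> vector_field \<Rightarrow>
   vector_field \<Rightarrow> scalar_field \<Rightarrow> bool" where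
  "discrete_solution \<Omega> \<T> \<D> \<mu> lam f g u\<^sub>h p\<^sub>h \<longleftrightarrow>
     u\<^sub>h \<in> componentwise (V_h \<Omega> \<T> \<D>) \<and> p\<^sub>h \<in> DG 1 \<T> \<and>
     (\<forall>v\<^sub>h \<in> componentwise (V_h \<Omega> \<T> \<D>).
        2 * \<mu> * inner_h \<T> (eps_h u\<^sub>h) (eps_h v\<^sub>h) + inner_h \<T> (\<lambda>T. p\<^sub>h) (div_h v\<^sub>h)
        = L2_inner (lebesgue_on \<Omega>) (proj \<Omega> \<T> f) v\<^sub>h
          + neumann_load \<T> (neumann_edges \<Omega> \<T> \<D>) (edge_proj (neumann_edges \<Omega> \<T> \<D>) g) v\<^sub>h) \<and>
     (\<forall>q\<^sub>h \<in> DG 1 \<T>.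
        inner_h \<T> (div_h u\<^sub>h) (\<lambda>T. q\<^sub>h)
          - inv_lam lam * L2_inner (lebesgue_on \<Omega>) p\<^sub>h q\<^sub>h = 0)"

definition energy_norm ::
  "point set \<Rightarrow> point set set \<Rightarrow> real \<Rightarrow> ereal \<Rightarrow> vector_field \<Rightarrow> scalar_field \<Rightarrow> real" where
  "energy_norm \<Omega> \<T> \<mu> lam v q =
     sqrt (2 * \<mu> * (norm_h \<T> (eps_h v))\<^sup>2 + inv_lam lam * (L2_norm (lebesgue_on \<Omega>) q)\<^sup>2)"

definition A_map :: "real \<Rightarrow> ereal \<Rightarrow> real^2^2 \<Rightarrow> real^2^2" where
  "A_map \<mu> lam \<tau> = (1 / (2 * \<mu>)) *\<^sub>R (\<tau> - (lam_ratio \<mu> lam * trace \<tau>) *\<^sub>R mat 1)"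

definition A_norm_h ::
  "real \<Rightarrow> ereal \<Rightarrow> point set set \<Rightarrow> (point set \<Rightarrow> tensor_field) \<Rightarrow> real" where
  "A_norm_h \<mu> lam \<T> \<tau> = sqrt (inner_h \<T> (\<lambda>T x. A_map \<mu> lam (\<tau> T x)) \<tau>)"

definition skew_part :: "real^2^2 \<Rightarrow> real^2^2" where
  "skew_part \<tau> = (1/2) *\<^sub>R (\<tau> - transpose \<tau>)"

definition J_mat :: "real^2^2" where
  "J_mat = vector [vector [0, 1], vector [-1, 0]]"

definition eta_R :: "real \<Rightarrow> ereal \<Rightarrow> point set set \<Rightarrow> tensor_field \<Rightarrow> vector_field \<Rightarrow> scalar_field \<Rightarrow> real"
  where "eta_R \<mu> lam \<T> \<sigma> u\<^sub>h p\<^sub>h =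
     A_norm_h \<mu> lam \<T> (\<lambda>T x. \<sigma> x - (2 * \<mu>) *\<^sub>R eps_h u\<^sub>h T x - p\<^sub>h x *\<^sub>R mat 1)"

definition eta_C :: "real \<Rightarrow> point set set \<Rightarrow> vector_field \<Rightarrow> vector_field \<Rightarrow> real" where
  "eta_C \<mu> \<T> u\<^sub>C u\<^sub>h = sqrt (2 * \<mu>) * norm_h \<T> (eps_h (\<lambda>x. u\<^sub>C x - u\<^sub>h x))"

definition eta_S :: "real \<Rightarrow> point set \<Rightarrow> tensor_field \<Rightarrow> real" where
  "eta_S \<mu> \<Omega> \<sigma> = L2_norm (lebesgue_on \<Omega>) (\<lambda>x. skew_part (\<sigma> x)) / sqrt (2 * \<mu>)"

definition RM :: "vector_field set" where
  "RM = {\<rho>. \<exists>(a :: real^2) (\<alpha> :: real). \<rho> = (\<lambda>x. a + \<alpha> *\<^sub>R vector [x $ 2, - (x $ 1)])}"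

definition korn_constant :: "point set \<Rightarrow> real \<Rightarrow> bool" where
  "korn_constant T C \<longleftrightarrow> (\<forall>v \<in> componentwise (H1 (interior T)).
     (INF \<rho>\<in>RM. L2_norm (lebesgue_on T) (grad (interior T) (\<lambda>x. v x - \<rho> x)))
       \<le> C * L2_norm (lebesgue_on T) (eps (interior T) v))"

definition equilibrated_stress ::
  "point set \<Rightarrow> point set set \<Rightarrow> point set set \<Rightarrow> vector_field \<Rightarrow> vector_field \<Rightarrow> tensor_field \<Rightarrow> bool"
  where "equilibrated_stress \<Omega> \<T> \<D> f g \<sigma> \<longleftrightarrow>
     (\<forall>i. (\<lambda>x. \<sigma> x $ i) \<in> RT1 \<Omega> \<T>) \<and>
     (AE x in lebesgue_on \<Omega>. row_div \<Omega> \<sigma> x + proj \<Omega> \<T> f x = 0) \<and>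
     (\<forall>E \<in> neumann_edges \<Omega> \<T> \<D>.
        AE_edge E (\<lambda>x. normal_trace \<T> E \<sigma> x = edge_proj (neumann_edges \<Omega> \<T> \<D>) g x)) \<and>
     (\<forall>T\<in>\<T>. L2_inner (lebesgue_on T) (\<lambda>x. skew_part (\<sigma> x)) (\<lambda>x. J_mat) = 0)"

end

theory Submission
  imports Defs
begin

text \<open>
  Let \<open>\<tau>\<close> be the difference between the exact stress and the reconstruction \<open>\<sigma>\<close>. Since \<open>A_map\<close> inverts the
  stress-strain relation, expanding squares writes the squared energy error as \<open>eta_R\<^sup>2\<close>, minus the
  \<open>A_map\<close> energy of \<open>\<tau>\<close>, plus twice the product of \<open>\<tau>\<close> with the strain of \<open>u - u\<^sub>h = (u - u\<^sub>C) + (u\<^sub>C - u\<^sub>h)\<close>.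

  Green's formula and the weak form show that \<open>\<tau>\<close> is orthogonal to the gradient of the conforming part
  \<open>u - u\<^sub>C\<close>, so that only the skew part of \<open>\<sigma>\<close> contributes to the product of \<open>\<tau>\<close> with the
  strain of \<open>u - u\<^sub>C\<close>. That skew part has mean zero on each element, hence rigid body modes can be
  subtracted and Korn's inequality applies.

  On an element the rows of \<open>\<tau>\<close> are divergence free, hence rotated gradients of a stream function \<open>\<psi>\<close>.
  The strain of \<open>\<psi>\<close> has the norm of the deviator of \<open>\<tau>\<close>, and the mean value condition on the
  divergence of \<open>u\<^sub>C - u\<^sub>h\<close> makes its rotated strain orthogonal to the gradients of rigid body modes. Korn's
  inequality for \<open>\<psi>\<close> therefore bounds the nonconforming part by the deviator of \<open>\<tau>\<close>, which the \<open>A_map\<close> energy of \<open>\<tau>\<close>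
  controls uniformly in \<open>lam\<close>. Young's inequality gives the constants.
\<close>

subsection \<open>Square integrable functions\<close>

text \<open>All estimates are local to one element, with one exception: the product of \<tau> with
  the gradient of the conforming part has no sign on a single element. It is carried along there and
  cancels only in the sum over the mesh. The deviator of \<tau>, kept on the left when the squares
  are expanded, pays for the nonconforming term; half of the strain error is absorbed on the left,
  which doubles the remaining terms. The analytic obstacle is that a polygonal domain is in general
  not convex. Smoothing here pulls points towards the interior of a convex set and is therefore
  available on triangles and boxes only. Green's formula on the domain has to be assembled from
  formulas on triangles, and cutoff functions supported inside the domain show that the
  contributions of interior edges cancel in total. Weak gradients, traces, normals and edge
  parametrizations are choices, so each of them first needs existence and a uniqueness statement: up
  to null sets for gradients and traces, up to reversal for parametrizations.\<close>

lemma L2_measurable: "f \<in> L2 M \<Longrightarrow> f \<in> borel_measurable M"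
  and L2_integrable_square: "f \<in> L2 M \<Longrightarrow> integrable M (\<lambda>x. (norm (f x))\<^sup>2)"
  by (auto simp: L2_def)

lemma L2I:
  "f \<in> borel_measurable M \<Longrightarrow> integrable M (\<lambda>x. (norm (f x))\<^sup>2) \<Longrightarrow> f \<in> L2 M"
  by (auto simp: L2_def)

lemma L2_bounded_by:
  assumes g: "g \<in> borel_measurable M" and h: "integrable M h"
    and le: "\<And>x. (norm (g x))\<^sup>2 \<le> h x"
  shows "g \<in> L2 M"
proof (rule L2I[OF g])
  show "integrable M (\<lambda>x. (norm (g x))\<^sup>2)"
  proof (rule Bochner_Integration.integrable_bound[OF h])
    show "AE x in M. norm ((norm (g x))\<^sup>2) \<le> norm (h x)"
      using le by (auto intro: order_trans[OF _ abs_ge_self])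
  qed (use g in measurable)
qed

lemma L2_zero [simp]: "(\<lambda>x. 0) \<in> L2 M"
  by (simp add: L2_def)

lemma square_norm_add_le:
  fixes a b :: "'a::real_normed_vector"
  shows "(norm (a + b))\<^sup>2 \<le> 2 * (norm a)\<^sup>2 + 2 * (norm b)\<^sup>2"
proof -
  have "(norm (a + b))\<^sup>2 \<le> (norm a + norm b)\<^sup>2"
    by (simp add: norm_triangle_ineq power_mono)
  also have "\<dots> \<le> 2 * (norm a)\<^sup>2 + 2 * (norm b)\<^sup>2"
    using sum_squares_bound[of "norm a" "norm b"] by (simp add: power2_sum)
  finally show ?thesis .
qed

lemma L2_add:
  assumes "f \<in> L2 M" "g \<in> L2 M"
  shows "(\<lambda>x. f x + g x) \<in> L2 M"
proof (rule L2_bounded_by)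
  show "(\<lambda>x. f x + g x) \<in> borel_measurable M"
    using assms by (auto dest!: L2_measurable)
  show "integrable M (\<lambda>x. 2 * (norm (f x))\<^sup>2 + 2 * (norm (g x))\<^sup>2)"
    using assms by (auto dest!: L2_integrable_square)
qed (rule square_norm_add_le)

lemma L2_bounded_linear:
  assumes "bounded_linear L" "f \<in> L2 M"
  shows "(\<lambda>x. L (f x)) \<in> L2 M"
proof -
  obtain K where K: "\<And>x. norm (L x) \<le> norm x * K" and "K > 0"
    using bounded_linear.pos_bounded[OF assms(1)] by auto
  show ?thesis
  proof (rule L2_bounded_by)
    show "(\<lambda>x. L (f x)) \<in> borel_measurable M"
      using L2_measurable[OF assms(2)]
      by (rule borel_measurable_continuous_on[OF linear_continuous_on[OF assms(1)]])
    show "integrable M (\<lambda>x. (norm (f x))\<^sup>2 * K\<^sup>2)"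
      using assms by (auto dest!: L2_integrable_square)
    show "(norm (L (f x)))\<^sup>2 \<le> (norm (f x))\<^sup>2 * K\<^sup>2" for x
      using power_mono[OF K norm_ge_zero, of "f x" 2] by (simp add: power_mult_distrib)
  qed
qed

lemma L2_scaleR: "f \<in> L2 M \<Longrightarrow> (\<lambda>x. c *\<^sub>R f x) \<in> L2 M"
  by (rule L2_bounded_linear[OF bounded_linear_scaleR_right])

lemma L2_uminus: "f \<in> L2 M \<Longrightarrow> (\<lambda>x. - f x) \<in> L2 M"
  using L2_scaleR[of f M "-1"] by simp

lemma L2_diff: "f \<in> L2 M \<Longrightarrow> g \<in> L2 M \<Longrightarrow> (\<lambda>x. f x - g x) \<in> L2 M"
  using L2_add[of f M "\<lambda>x. - g x"] L2_uminus by auto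

lemma L2_nth: "f \<in> L2 M \<Longrightarrow> (\<lambda>x. f x $ i) \<in> L2 M"
  by (rule L2_bounded_linear[OF bounded_linear_vec_nth])

lemma L2_sum: "(\<And>i. i \<in> I \<Longrightarrow> f i \<in> L2 M) \<Longrightarrow> (\<lambda>x. \<Sum>i\<in>I. f i x) \<in> L2 M"
  by (induction I rule: infinite_finite_induct) (auto intro: L2_add)

lemma L2_cong_AE:
  assumes "f \<in> L2 M" "g \<in> borel_measurable M" "AE x in M. f x = g x"
  shows "g \<in> L2 M"
proof (rule L2I[OF assms(2)])
  have "integrable M (\<lambda>x. (norm (f x))\<^sup>2) = integrable M (\<lambda>x. (norm (g x))\<^sup>2)"
    using assms by (intro integrable_cong_AE) (auto dest: L2_measurable)
  then show "integrable M (\<lambda>x. (norm (g x))\<^sup>2)"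
    using L2_integrable_square[OF assms(1)] by simp
qed

lemma L2_vec:
  fixes f :: "'a \<Rightarrow> ('b::euclidean_space)^'n"
  assumes "\<And>i. (\<lambda>x. f x $ i) \<in> L2 M"
  shows "f \<in> L2 M"
proof -
  have lin: "bounded_linear (\<lambda>y. axis i y :: 'b^'n)" for i
  proof (rule bounded_linear_intro[where K=1])
    fix x :: 'b show "norm (axis i x :: 'b^'n) \<le> norm x * 1"
      by (simp add: axis_def norm_vec_def L2_set_def if_distrib[of "\<lambda>y. (norm y)\<^sup>2"] sum.delta cong: if_cong)
  qed (auto simp: axis_def vec_eq_iff)
  have "(\<lambda>x. \<Sum>i\<in>UNIV. axis i (f x $ i) :: 'b^'n) \<in> L2 M"
    by (intro L2_sum L2_bounded_linear[OF lin] assms)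
  moreover have "(\<Sum>i\<in>UNIV. axis i (f x $ i)) = f x" for x
    by (simp add: vec_eq_iff axis_def sum.delta if_distrib[of "\<lambda>v. v $ _"] sum.delta' cong: if_cong)
  ultimately show ?thesis by simp
qed

lemma L2_inner_integrable:
  assumes "f \<in> L2 M" "g \<in> L2 M"
  shows "integrable M (\<lambda>x. f x \<bullet> g x)"
proof (rule Bochner_Integration.integrable_bound)
  show "integrable M (\<lambda>x. (norm (f x))\<^sup>2 + (norm (g x))\<^sup>2)"
    using assms by (auto dest!: L2_integrable_square)
  show "(\<lambda>x. f x \<bullet> g x) \<in> borel_measurable M"
    using assms by (auto dest!: L2_measurable)
  have "\<bar>a \<bullet> b\<bar> \<le> (norm a)\<^sup>2 + (norm b)\<^sup>2" for a b :: 'b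
    using Cauchy_Schwarz_ineq2[of a b] sum_squares_bound[of "norm a" "norm b"]
      mult_nonneg_nonneg[OF norm_ge_zero[of a] norm_ge_zero[of b]] by linarith
  then show "AE x in M. norm (f x \<bullet> g x) \<le> norm ((norm (f x))\<^sup>2 + (norm (g x))\<^sup>2)"
    by simp
qed

lemma L2_mult_integrable:
  fixes f g :: "'a \<Rightarrow> real"
  shows "f \<in> L2 M \<Longrightarrow> g \<in> L2 M \<Longrightarrow> integrable M (\<lambda>x. f x * g x)"
  using L2_inner_integrable[of f M g] by simp

lemma L2_inner_add_left:
  "f \<in> L2 M \<Longrightarrow> g \<in> L2 M \<Longrightarrow> h \<in> L2 M \<Longrightarrow>
    L2_inner M (\<lambda>x. f x + g x) h = L2_inner M f h + L2_inner M g h"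
  by (simp add: L2_inner_def inner_add_left L2_inner_integrable)

lemma L2_inner_diff_left:
  "f \<in> L2 M \<Longrightarrow> g \<in> L2 M \<Longrightarrow> h \<in> L2 M \<Longrightarrow>
    L2_inner M (\<lambda>x. f x - g x) h = L2_inner M f h - L2_inner M g h"
  by (simp add: L2_inner_def inner_diff_left L2_inner_integrable)

lemma L2_inner_commute: "L2_inner M f g = L2_inner M g f"
  by (simp add: L2_inner_def inner_commute)

lemma L2_inner_add_right:
  "f \<in> L2 M \<Longrightarrow> g \<in> L2 M \<Longrightarrow> h \<in> L2 M \<Longrightarrow>
    L2_inner M h (\<lambda>x. f x + g x) = L2_inner M h f + L2_inner M h g"
  by (simp add: L2_inner_def inner_add_right L2_inner_integrable)

lemma L2_inner_diff_right:
  "f \<in> L2 M \<Longrightarrow> g \<in> L2 M \<Longrightarrow> h \<in> L2 M \<Longrightarrow>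
    L2_inner M h (\<lambda>x. f x - g x) = L2_inner M h f - L2_inner M h g"
  by (simp add: L2_inner_def inner_diff_right L2_inner_integrable)

lemma L2_inner_scaleR_left [simp]: "L2_inner M (\<lambda>x. c *\<^sub>R f x) g = c * L2_inner M f g"
  by (simp add: L2_inner_def)

lemma L2_inner_scaleR_right [simp]: "L2_inner M f (\<lambda>x. c *\<^sub>R g x) = c * L2_inner M f g"
  by (simp add: L2_inner_def)

lemma L2_inner_cong_AE:
  assumes "f \<in> borel_measurable M" "f' \<in> borel_measurable M" "g \<in> borel_measurable M"
    "g' \<in> borel_measurable M" "AE x in M. f x = f' x" "AE x in M. g x = g' x"
  shows "L2_inner M f g = L2_inner M f' g'"
  unfolding L2_inner_def using assms by (intro integral_cong_AE) auto

lemma L2_inner_self_nonneg [simp]: "0 \<le> L2_inner M f f"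
  by (simp add: L2_inner_def)

lemma L2_norm_nonneg [simp]: "0 \<le> L2_norm M f"
  by (simp add: L2_norm_def)

lemma L2_norm_square: "(L2_norm M f)\<^sup>2 = L2_inner M f f"
  by (simp add: L2_norm_def)

lemma L2_norm_square_integral: "(L2_norm M f)\<^sup>2 = (LINT x|M. (norm (f x))\<^sup>2)"
  by (simp add: L2_norm_square L2_inner_def power2_norm_eq_inner)

text \<open>The squared norm of f + t g is a nonnegative quadratic polynomial in t, and its minimum
  gives the inequality. If g has norm zero the polynomial is affine, which is treated apart.\<close>

lemma L2_Cauchy_Schwarz:
  assumes f: "f \<in> L2 M" and g: "g \<in> L2 M"
  shows "\<bar>L2_inner M f g\<bar> \<le> L2_norm M f * L2_norm M g"
proof -
  have *: "0 \<le> L2_inner M f f + 2 * t * L2_inner M f g + t\<^sup>2 * L2_inner M g g" for t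
  proof -
    have "0 \<le> L2_inner M (\<lambda>x. f x + t *\<^sub>R g x) (\<lambda>x. f x + t *\<^sub>R g x)" by simp
    also have "\<dots> = L2_inner M f f + 2 * t * L2_inner M f g + t\<^sup>2 * L2_inner M g g"
      using f g L2_inner_commute[of M g f]
      by (simp add: L2_inner_add_left L2_inner_add_right L2_add L2_scaleR power2_eq_square algebra_simps)
    finally show ?thesis .
  qed
  let ?a = "L2_inner M f f" and ?b = "L2_inner M f g" and ?c = "L2_inner M g g"
  have "?b\<^sup>2 \<le> ?a * ?c"
  proof (cases "?c = 0")
    case True
    have "?b = 0"
    proof (rule ccontr)
      assume "?b \<noteq> 0"
      \<comment> \<open>This value of t makes the affine polynomial equal to -1.\<close>
      have "0 \<le> ?a + 2 * (- (?a + 1) / (2 * ?b)) * ?b" using *[of "- (?a + 1) / (2 * ?b)"] True by simp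
      also have "\<dots> = - 1" using \<open>?b \<noteq> 0\<close> by (simp add: field_simps)
      finally show False by simp
    qed
    then show ?thesis using True by simp
  next
    case False
    then have c: "0 < ?c" using L2_inner_self_nonneg[of M g] by linarith
    have "0 \<le> ?a - ?b\<^sup>2 / ?c"
      using *[of "- ?b / ?c"] c by (simp add: power2_eq_square field_simps)
    then show ?thesis using c by (simp add: field_simps)
  qed
  then have "sqrt (?b\<^sup>2) \<le> sqrt (?a * ?c)" by (rule real_sqrt_le_mono)
  then show ?thesis by (simp add: L2_norm_def real_sqrt_mult)
qed

lemma L2_norm_triangle:
  assumes f: "f \<in> L2 M" and g: "g \<in> L2 M"
  shows "L2_norm M (\<lambda>x. f x + g x) \<le> L2_norm M f + L2_norm M g"
proof (rule power2_le_imp_le)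
  have "(L2_norm M (\<lambda>x. f x + g x))\<^sup>2 = L2_inner M f f + 2 * L2_inner M f g + L2_inner M g g"
    using f g L2_inner_commute[of M g f]
    by (simp add: L2_norm_square L2_inner_add_left L2_inner_add_right L2_add)
  also have "\<dots> \<le> (L2_norm M f)\<^sup>2 + 2 * (L2_norm M f * L2_norm M g) + (L2_norm M g)\<^sup>2"
    using L2_Cauchy_Schwarz[OF f g] by (simp add: L2_norm_square)
  finally show "(L2_norm M (\<lambda>x. f x + g x))\<^sup>2 \<le> (L2_norm M f + L2_norm M g)\<^sup>2"
    by (simp add: power2_sum)
qed simp

lemma L2_norm_scaleR: "L2_norm M (\<lambda>x. c *\<^sub>R f x) = \<bar>c\<bar> * L2_norm M f"
  by (simp add: L2_norm_def real_sqrt_mult mult.assoc[symmetric])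

lemma L2_norm_uminus: "L2_norm M (\<lambda>x. - f x) = L2_norm M f"
  by (simp add: L2_norm_def L2_inner_def)

lemma L2_norm_minus_commute: "L2_norm M (\<lambda>x. f x - g x) = L2_norm M (\<lambda>x. g x - f x)"
  using L2_norm_uminus[of M "\<lambda>x. f x - g x"] by simp

lemma L2_norm_triangle_diff:
  assumes "f \<in> L2 M" "g \<in> L2 M" "h \<in> L2 M"
  shows "L2_norm M (\<lambda>x. f x - h x) \<le> L2_norm M (\<lambda>x. f x - g x) + L2_norm M (\<lambda>x. g x - h x)"
  using L2_norm_triangle[of "\<lambda>x. f x - g x" M "\<lambda>x. g x - h x"] assms by (simp add: L2_diff)

lemma L2_norm_cong_AE:
  assumes "f \<in> borel_measurable M" "g \<in> borel_measurable M" "AE x in M. f x = g x"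
  shows "L2_norm M f = L2_norm M g"
  unfolding L2_norm_def by (subst L2_inner_cong_AE[OF assms(1,2,1,2,3,3)]) simp

lemma L2_norm_zero_iff:
  assumes f: "f \<in> L2 M"
  shows "L2_norm M f = 0 \<longleftrightarrow> (AE x in M. f x = 0)"
proof -
  have "L2_norm M f = 0 \<longleftrightarrow> (LINT x|M. (norm (f x))\<^sup>2) = 0"
    by (metis L2_norm_square_integral power_eq_0_iff zero_neq_numeral pos2)
  also have "\<dots> \<longleftrightarrow> (AE x in M. (norm (f x))\<^sup>2 = 0)"
    using f by (intro integral_nonneg_eq_0_iff_AE) (auto dest: L2_integrable_square)
  finally show ?thesis by simp
qed

lemma L2_norm_mono:
  assumes f: "f \<in> borel_measurable M" and g: "g \<in> L2 M"
    and le: "AE x in M. norm (f x) \<le> K * norm (g x)" and K: "0 \<le> K"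
  shows "L2_norm M f \<le> K * L2_norm M g"
proof (rule power2_le_imp_le)
  have "(L2_norm M f)\<^sup>2 = (LINT x|M. (norm (f x))\<^sup>2)" by (rule L2_norm_square_integral)
  also have "\<dots> \<le> (LINT x|M. K\<^sup>2 * (norm (g x))\<^sup>2)"
  proof (rule integral_mono_AE')
    show "integrable M (\<lambda>x. K\<^sup>2 * (norm (g x))\<^sup>2)"
      using g by (auto dest!: L2_integrable_square)
    show "AE x in M. (norm (f x))\<^sup>2 \<le> K\<^sup>2 * (norm (g x))\<^sup>2"
      using le
    proof eventually_elim
      case (elim x)
      from power_mono[OF this norm_ge_zero, of 2] show ?case by (simp add: power_mult_distrib)
    qed
  qed simp
  also have "\<dots> = (K * L2_norm M g)\<^sup>2"
    by (simp add: power_mult_distrib L2_norm_square_integral)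
  finally show "(L2_norm M f)\<^sup>2 \<le> (K * L2_norm M g)\<^sup>2" .
qed (use K in simp)

lemma L2_inner_tendsto:
  assumes f: "f \<in> L2 M" "\<And>n. F n \<in> L2 M" and g: "g \<in> L2 M"
    and lim: "(\<lambda>n. L2_norm M (\<lambda>x. F n x - f x)) \<longlonglongrightarrow> 0"
  shows "(\<lambda>n. L2_inner M (F n) g) \<longlonglongrightarrow> L2_inner M f g"
proof (rule Lim_transform2[OF tendsto_const])
  have "(\<lambda>n. L2_norm M (\<lambda>x. F n x - f x) * L2_norm M g) \<longlonglongrightarrow> 0"
    using tendsto_mult_right[OF lim, of "L2_norm M g"] by simp
  then show "(\<lambda>n. L2_inner M f g - L2_inner M (F n) g) \<longlonglongrightarrow> 0"
  proof (rule Lim_null_comparison[rotated], intro always_eventually allI)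
    fix n
    have "L2_inner M f g - L2_inner M (F n) g = - L2_inner M (\<lambda>x. F n x - f x) g"
      using assms by (simp add: L2_inner_diff_left)
    then show "norm (L2_inner M f g - L2_inner M (F n) g) \<le> L2_norm M (\<lambda>x. F n x - f x) * L2_norm M g"
      using L2_Cauchy_Schwarz[of "\<lambda>x. F n x - f x" M g] assms by (simp add: L2_diff)
  qed
qed

lemma L2_const [simp]: "finite_measure M \<Longrightarrow> (\<lambda>x. c) \<in> L2 M"
  by (auto intro!: L2I finite_measure.integrable_const)

lemma L2_bounded:
  assumes "finite_measure M" "f \<in> borel_measurable M" "\<And>x. x \<in> space M \<Longrightarrow> norm (f x) \<le> B"
  shows "f \<in> L2 M"
proof (rule L2I[OF assms(2)])
  show "integrable M (\<lambda>x. (norm (f x))\<^sup>2)"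
  proof (rule finite_measure.integrable_const_bound[OF assms(1), where B="B\<^sup>2"])
    show "AE x in M. norm ((norm (f x))\<^sup>2) \<le> B\<^sup>2"
      using assms(3) by (intro AE_I2) (auto intro: power_mono)
  qed (use assms(2) in measurable)
qed

lemma L2_imp_integrable:
  assumes "finite_measure M" "f \<in> L2 M"
  shows "integrable M f"
proof (rule Bochner_Integration.integrable_bound)
  show "integrable M (\<lambda>x. 1 + (norm (f x))\<^sup>2)"
    using assms by (auto dest!: L2_integrable_square intro: finite_measure.integrable_const)
  show "f \<in> borel_measurable M" using assms by (auto dest: L2_measurable)
  have "t \<le> 1 + t\<^sup>2" for t :: real
    using zero_le_power2[of "t - 1"] zero_le_power2[of t] unfolding power2_diff by (simp; linarith)
  then show "AE x in M. norm (f x) \<le> norm (1 + (norm (f x))\<^sup>2)" by simp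
qed

lemma L2_bounded_mult:
  fixes h :: "'a \<Rightarrow> real"
  assumes "f \<in> L2 M" "h \<in> borel_measurable M" "\<And>x. x \<in> space M \<Longrightarrow> \<bar>h x\<bar> \<le> B"
  shows "(\<lambda>x. h x *\<^sub>R f x) \<in> L2 M"
proof (rule L2I)
  show "(\<lambda>x. h x *\<^sub>R f x) \<in> borel_measurable M" using assms by (auto dest: L2_measurable)
  show "integrable M (\<lambda>x. (norm (h x *\<^sub>R f x))\<^sup>2)"
  proof (rule Bochner_Integration.integrable_bound)
    show "integrable M (\<lambda>x. B\<^sup>2 * (norm (f x))\<^sup>2)" using assms by (auto dest: L2_integrable_square)
    show "(\<lambda>x. (norm (h x *\<^sub>R f x))\<^sup>2) \<in> borel_measurable M" using assms by (auto dest!: L2_measurable)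
    show "AE x in M. norm ((norm (h x *\<^sub>R f x))\<^sup>2) \<le> norm (B\<^sup>2 * (norm (f x))\<^sup>2)"
    proof (rule AE_I2)
      fix x assume "x \<in> space M"
      from power_mono[OF assms(3)[OF this] abs_ge_zero, of 2]
      have "(h x)\<^sup>2 \<le> B\<^sup>2" by simp
      then show "norm ((norm (h x *\<^sub>R f x))\<^sup>2) \<le> norm (B\<^sup>2 * (norm (f x))\<^sup>2)"
        by (simp add: power_mult_distrib mult_right_mono)
    qed
  qed
qed

subsection \<open>Gradients and smooth functions\<close>

lemma gradient_nth:
  assumes "(\<phi> has_derivative D) (at x)"
  shows "gradient \<phi> x $ i = D (axis i 1)"
  using frechet_derivative_at[OF assms] by (simp add: gradient_def)

lemma has_derivative_gradient:
  assumes "\<phi> differentiable (at x)"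
  shows "(\<phi> has_derivative (\<lambda>h. gradient \<phi> x \<bullet> h)) (at x)"
proof -
  let ?D = "frechet_derivative \<phi> (at x)"
  have D: "(\<phi> has_derivative ?D) (at x)"
    using assms by (simp add: frechet_derivative_works)
  then interpret linear ?D by (rule has_derivative_linear)
  have "?D h = gradient \<phi> x \<bullet> h" for h :: "real^2"
  proof -
    have h: "h = h $ 1 *\<^sub>R axis 1 1 + h $ 2 *\<^sub>R axis 2 1"
      by (simp add: vec_eq_iff axis_def forall_2)
    have "?D h = h $ 1 * ?D (axis 1 1) + h $ 2 * ?D (axis 2 1)"
      by (subst h) (simp add: add scale)
    then show ?thesis by (simp add: gradient_def inner_vec_def sum_2 mult.commute)
  qed
  then have "?D = (\<lambda>h. gradient \<phi> x \<bullet> h)" by blast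
  with D show ?thesis by metis
qed

lemma gradient_eqI:
  assumes "(\<phi> has_derivative (\<lambda>h. w \<bullet> h)) (at x)"
  shows "gradient \<phi> x = w"
  by (simp add: vec_eq_iff gradient_nth[OF assms] inner_axis)

lemma gradient_const [simp]: "gradient (\<lambda>x. c) x = 0"
  by (rule gradient_eqI) simp

lemma has_derivative_vec_nth: "((\<lambda>x::real^'n. x $ i) has_derivative (\<lambda>h. h $ i)) F"
  by (rule bounded_linear_imp_has_derivative[OF bounded_linear_vec_nth])

lemma gradient_vec_nth: "gradient (\<lambda>x. x $ i) x = axis i 1"
  by (rule gradient_eqI) (simp add: has_derivative_vec_nth inner_axis')

lemma gradient_add:
  assumes "\<phi> differentiable (at x)" "\<psi> differentiable (at x)"
  shows "gradient (\<lambda>x. \<phi> x + \<psi> x) x = gradient \<phi> x + gradient \<psi> x"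
  by (rule gradient_eqI)
    (auto intro!: derivative_eq_intros has_derivative_gradient assms simp: inner_add_left)

lemma gradient_mult:
  assumes "\<phi> differentiable (at x)" "\<psi> differentiable (at x)"
  shows "gradient (\<lambda>x. \<phi> x * \<psi> x) x = \<phi> x *\<^sub>R gradient \<psi> x + \<psi> x *\<^sub>R gradient \<phi> x"
  by (rule gradient_eqI)
    (auto intro!: derivative_eq_intros has_derivative_gradient assms simp: inner_add_left)

lemma has_derivative_compose_affine:
  assumes "\<phi> differentiable (at (a *\<^sub>R x + b))"
  shows "((\<lambda>x. \<phi> (a *\<^sub>R x + b)) has_derivative (\<lambda>h. (a *\<^sub>R gradient \<phi> (a *\<^sub>R x + b)) \<bullet> h)) (at x)"
proof -
  have "((\<lambda>x. a *\<^sub>R x + b) has_derivative (\<lambda>h. a *\<^sub>R h)) (at x)"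
    by (auto intro!: derivative_eq_intros)
  from has_derivative_compose[OF this has_derivative_gradient[OF assms]]
  show ?thesis by (rule has_derivative_eq_rhs) auto
qed

lemmas gradient_affine = gradient_eqI[OF has_derivative_compose_affine]

lemma Ck_Suc_imp: "Ck (Suc k) \<phi> \<Longrightarrow> Ck k \<phi>"
proof (induction k arbitrary: \<phi>)
  case 0
  then show ?case
    by (auto simp: continuous_on_eq_continuous_at intro: differentiable_imp_continuous_within)
next
  case (Suc k)
  then show ?case by (metis Ck.simps(2))
qed

lemma Ck_imp_continuous: "Ck k \<phi> \<Longrightarrow> continuous_on S \<phi>"
  by (induction k) (auto dest!: Ck_Suc_imp simp del: Ck.simps(2) intro: continuous_on_subset)

lemma Ck_const: "Ck k (\<lambda>x. c)"
  by (induction k arbitrary: c) auto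

lemma Ck_vec_nth: "Ck k (\<lambda>x. x $ i)"
proof (cases k)
  case 0
  then show ?thesis by (auto intro!: continuous_intros)
next
  case (Suc m)
  have "(\<lambda>x::point. x $ i) differentiable (at x)" for x
    by (rule differentiableI[OF has_derivative_vec_nth])
  then show ?thesis using Suc by (auto simp: gradient_vec_nth Ck_const)
qed

lemma Ck_add: "Ck k \<phi> \<Longrightarrow> Ck k \<psi> \<Longrightarrow> Ck k (\<lambda>x. \<phi> x + \<psi> x)"
  by (induction k arbitrary: \<phi> \<psi>) (auto simp: gradient_add intro!: continuous_on_add)

lemma Ck_mult: "Ck k \<phi> \<Longrightarrow> Ck k \<psi> \<Longrightarrow> Ck k (\<lambda>x. \<phi> x * \<psi> x)"
proof (induction k arbitrary: \<phi> \<psi>)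
  case 0
  then show ?case by (auto intro!: continuous_on_mult)
next
  case (Suc k)
  then have "Ck k \<phi>" "Ck k \<psi>" by (auto intro: Ck_Suc_imp simp del: Ck.simps)
  with Suc show ?case by (auto simp: gradient_mult intro!: Ck_add)
qed

lemma Ck_affine: "Ck k \<phi> \<Longrightarrow> Ck k (\<lambda>x. \<phi> (a *\<^sub>R x + b))"
proof (induction k arbitrary: \<phi>)
  case 0
  then show ?case by (auto intro!: continuous_intros continuous_on_compose2[of UNIV \<phi>])
next
  case (Suc k)
  have d: "(\<lambda>x. \<phi> (a *\<^sub>R x + b)) differentiable (at x)" for x
    using Suc.prems by (intro differentiableI[OF has_derivative_compose_affine]) simp
  show ?case
    using Suc d by (auto simp: gradient_affine intro!: Ck_mult Ck_const)
qed

lemma smooth_const [intro]: "smooth (\<lambda>x. c)"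
  and smooth_vec_nth [intro]: "smooth (\<lambda>x. x $ i)"
  and smooth_add [intro]: "smooth \<phi> \<Longrightarrow> smooth \<psi> \<Longrightarrow> smooth (\<lambda>x. \<phi> x + \<psi> x)"
  and smooth_mult [intro]: "smooth \<phi> \<Longrightarrow> smooth \<psi> \<Longrightarrow> smooth (\<lambda>x. \<phi> x * \<psi> x)"
  and smooth_affine: "smooth \<phi> \<Longrightarrow> smooth (\<lambda>x. \<phi> (a *\<^sub>R x + b))"
  by (auto simp: smooth_def intro: Ck_const Ck_vec_nth Ck_add Ck_mult Ck_affine)

lemma smooth_uminus [intro]: "smooth \<phi> \<Longrightarrow> smooth (\<lambda>x. - \<phi> x)"
  using smooth_mult[OF smooth_const[of "-1"]] by simp

lemma smooth_diff [intro]: "smooth \<phi> \<Longrightarrow> smooth \<psi> \<Longrightarrow> smooth (\<lambda>x. \<phi> x - \<psi> x)"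
  using smooth_add[of \<phi> "\<lambda>x. - \<psi> x"] by auto

lemma smooth_sum [intro]: "(\<And>i. i \<in> I \<Longrightarrow> smooth (\<phi> i)) \<Longrightarrow> smooth (\<lambda>x. \<Sum>i\<in>I. \<phi> i x)"
  by (induction I rule: infinite_finite_induct) auto

lemma smooth_prod [intro]: "(\<And>i. i \<in> I \<Longrightarrow> smooth (\<phi> i)) \<Longrightarrow> smooth (\<lambda>x. \<Prod>i\<in>I. \<phi> i x)"
  by (induction I rule: infinite_finite_induct) auto

lemma smooth_power [intro]: "smooth \<phi> \<Longrightarrow> smooth (\<lambda>x. \<phi> x ^ n)"
  by (induction n) auto

lemma smooth_differentiable: "smooth \<phi> \<Longrightarrow> \<phi> differentiable (at x)"
  unfolding smooth_def using Ck.simps(2)[of 0] by blast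

lemma smooth_gradient [intro]: "smooth \<phi> \<Longrightarrow> smooth (\<lambda>x. gradient \<phi> x $ i)"
  unfolding smooth_def using Ck.simps(2) by blast

lemma smooth_continuous: "smooth \<phi> \<Longrightarrow> continuous_on S \<phi>"
  unfolding smooth_def using Ck_imp_continuous by blast

lemma smooth_gradient_continuous: "smooth \<phi> \<Longrightarrow> continuous_on S (gradient \<phi>)"
  using continuous_on_vec_lambda[of S "\<lambda>i x. gradient \<phi> x $ i"] by (simp add: smooth_continuous smooth_gradient)

lemma gradient_diff:
  assumes "\<phi> differentiable (at x)" "\<psi> differentiable (at x)"
  shows "gradient (\<lambda>x. \<phi> x - \<psi> x) x = gradient \<phi> x - gradient \<psi> x"
  by (rule gradient_eqI)
    (auto intro!: derivative_eq_intros has_derivative_gradient assms simp: inner_diff_left)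

lemma smooth_Pk: "q \<in> Pk k \<Longrightarrow> smooth q"
  by (auto simp: Pk_def case_prod_beta intro!: smooth_sum smooth_mult smooth_power)

subsection \<open>Bump functions\<close>

text \<open>The family is closed under differentiation: \<open>flat m' = flat (m + 2) - m * flat (m + 1)\<close>.\<close>

definition flat :: "nat \<Rightarrow> real \<Rightarrow> real" where
  "flat m t = (if 0 < t then exp (- (1 / t)) / t ^ m else 0)"

lemma flat_nonneg: "0 \<le> flat m t"
  by (simp add: flat_def)

text \<open>From the right, the substitution s = 1/t turns \<open>flat m t\<close> into s^m / exp s,
  where the exponential wins; from the left the function is zero.\<close>

lemma flat_tendsto_0: "(flat m \<longlongrightarrow> 0) (at 0)"
proof (rule filterlim_split_at)
  have "((\<lambda>t. (1/t) ^ m / exp (1/t)) \<longlongrightarrow> 0) (at_right (0::real))"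
    using filterlim_compose[OF tendsto_power_div_exp_0 filterlim_inverse_at_top_right]
    by (simp add: inverse_eq_divide)
  then show "(flat m \<longlongrightarrow> 0) (at_right 0)"
    by (rule Lim_transform_eventually)
      (auto simp: eventually_at_filter flat_def exp_minus field_simps power_divide)
  show "(flat m \<longlongrightarrow> 0) (at_left 0)"
    by (rule Lim_transform_eventually[OF tendsto_const])
      (auto simp: eventually_at_filter flat_def)
qed

lemma flat_has_derivative:
  "(flat m has_real_derivative (flat (m + 2) t - real m * flat (m + 1) t)) (at t)"
proof -
  consider "t < 0" | "t = 0" | "0 < t" by linarith
  then show ?thesis
  proof cases
    case 1
    have "((\<lambda>t. 0) has_real_derivative 0) (at t)" by simp
    then have "(flat m has_real_derivative 0) (at t)"
      by (rule DERIV_cong_ev[THEN iffD1, rotated -1, OF _ ])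
        (use 1 in \<open>auto simp: flat_def eventually_nhds intro!: exI[of _ "{..<0}"]\<close>)
    then show ?thesis using 1 by (simp add: flat_def)
  next
    case 2
    \<comment> \<open>The difference quotient of \<open>flat m\<close> at 0 is
      \<open>flat (Suc m)\<close>, which tends to 0.\<close>
    have "((\<lambda>h. (flat m (0 + h) - flat m 0) / h) \<longlongrightarrow> 0) (at 0)"
      using flat_tendsto_0[of "Suc m"]
      by (rule Lim_transform_eventually) (auto simp: eventually_at_filter flat_def)
    then show ?thesis using 2 by (simp add: DERIV_def flat_def)
  next
    case 3
    have p: "real m * t ^ (m - Suc 0) = real m * t ^ m / t"
      using 3 by (cases m) auto
    have "((\<lambda>t. exp (- (1 / t)) / t ^ m) has_real_derivative
        ((exp (- (1 / t)) * (1 / (t * t))) * t ^ m - exp (- (1 / t)) * (real m * t ^ (m - Suc 0)))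
          / (t ^ m * t ^ m)) (at t)"
      using 3 by (auto intro!: derivative_eq_intros)
    also have "((exp (- (1 / t)) * (1 / (t * t))) * t ^ m - exp (- (1 / t)) * (real m * t ^ (m - Suc 0)))
          / (t ^ m * t ^ m) = flat (m + 2) t - real m * flat (m + 1) t"
      unfolding p using 3 by (simp add: flat_def field_simps)
    finally have "((\<lambda>t. exp (- (1 / t)) / t ^ m) has_real_derivative
        (flat (m + 2) t - real m * flat (m + 1) t)) (at t)" .
    then show ?thesis
      by (rule DERIV_cong_ev[THEN iffD1, rotated -1, OF _])
        (use 3 in \<open>auto simp: flat_def eventually_nhds intro!: exI[of _ "{0<..}"]\<close>)
  qed
qed

text \<open>The induction generalizes over m, because the derivative of one member of the family is
  a combination of two others. The affine argument covers both the rising and the falling factors of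
  \<open>bump\<close>.\<close>

lemma Ck_flat: "Ck k (\<lambda>x. flat m (a * x $ i + b))"
proof (induction k arbitrary: m)
  case 0
  have "continuous_on UNIV (flat m)"
    using flat_has_derivative by (intro DERIV_continuous_on) (blast intro: has_field_derivative_at_within)
  then show ?case by (auto intro!: continuous_on_compose2[of UNIV "flat m"] continuous_intros)
next
  case (Suc k)
  let ?d = "\<lambda>x::point. a * (flat (m + 2) (a * x $ i + b) - real m * flat (m + 1) (a * x $ i + b))"
  have D: "((\<lambda>x. flat m (a * x $ i + b)) has_derivative (\<lambda>h. (?d x *\<^sub>R axis i 1) \<bullet> h)) (at x)" for x
  proof -
    have "((\<lambda>x::point. a * x $ i + b) has_derivative (\<lambda>h. a * h $ i)) (at x)"
      by (auto intro!: derivative_eq_intros has_derivative_vec_nth)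
    from has_derivative_compose[OF this
        flat_has_derivative[of m "a * x $ i + b", unfolded has_field_derivative_def]]
    show ?thesis by (simp add: inner_axis' algebra_simps)
  qed
  have "gradient (\<lambda>x. flat m (a * x $ i + b)) x = ?d x *\<^sub>R axis i 1" for x
    by (rule gradient_eqI[OF D])
  moreover have "Ck k (\<lambda>x. (?d x *\<^sub>R axis i 1 :: point) $ j)" for j
  proof -
    have "Ck k (\<lambda>x. (a * axis i 1 $ j) * (flat (m + 2) (a * x $ i + b) + (- real m) * flat (m + 1) (a * x $ i + b)))"
      by (intro Ck_mult Ck_add Ck_const Suc)
    then show ?thesis by (simp add: mult.assoc mult.commute mult.left_commute)
  qed
  ultimately show ?case using D by (auto simp: differentiable_def simp del: vector_scaleR_component)
qed

text \<open>For c > 0 the function is positive exactly on \<open>box a b\<close>. The parameter c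
  only sharpens it: as c grows, the values tend to 1 at every point of the box while the support
  stays the same.\<close>

definition bump :: "point \<Rightarrow> point \<Rightarrow> real \<Rightarrow> scalar_field" where
  "bump a b c x = (\<Prod>i\<in>UNIV. flat 0 (c * (x $ i - a $ i)) * flat 0 (c * (b $ i - x $ i)))"

lemma smooth_bump: "smooth (bump a b c)"
proof -
  have "smooth (\<lambda>x. flat 0 (c * (x $ i - a $ i)))" "smooth (\<lambda>x. flat 0 (c * (b $ i - x $ i)))" for i
    using Ck_flat[of _ 0 c i "- c * a $ i"] Ck_flat[of _ 0 "-c" i "c * b $ i"]
    by (simp_all add: smooth_def algebra_simps)
  then show ?thesis unfolding bump_def by (intro smooth_prod smooth_mult)
qed

lemma flat_0_le_1: "flat 0 t \<le> 1"
  by (simp add: flat_def)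

lemma bump_nonneg: "0 \<le> bump a b c x" and bump_le_1: "bump a b c x \<le> 1"
  by (auto simp: bump_def intro!: prod_nonneg prod_le_1 mult_le_one mult_nonneg_nonneg flat_nonneg flat_0_le_1)

lemma bump_pos_iff: "0 < c \<Longrightarrow> 0 < bump a b c x \<longleftrightarrow> x \<in> box a b"
  by (auto simp: bump_def mem_box_cart flat_def UNIV_2 forall_2 zero_less_mult_iff)

lemma bump_eq_0: "0 < c \<Longrightarrow> x \<notin> box a b \<Longrightarrow> bump a b c x = 0"
  using bump_pos_iff[of c a b x] bump_nonneg[of a b c x] by linarith

lemma bump_tendsto_1:
  assumes "x \<in> box a b"
  shows "(\<lambda>n. bump a b (real n) x) \<longlonglongrightarrow> 1"
proof -
  have *: "(\<lambda>n. flat 0 (real n * t)) \<longlonglongrightarrow> 1" if "0 < t" for t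
  proof -
    have "(\<lambda>n. exp (- (1 / t * inverse (real n)))) \<longlonglongrightarrow> exp (- (1 / t * 0))"
      by (intro tendsto_intros LIMSEQ_inverse_real_of_nat lim_inverse_n)
    then have "(\<lambda>n. exp (- (1 / t * inverse (real n)))) \<longlonglongrightarrow> 1" by simp
    then show ?thesis
      by (rule Lim_transform_eventually)
        (use that in \<open>auto simp: flat_def field_simps intro!: eventually_sequentiallyI[of 1]\<close>)
  qed
  have "(\<lambda>n. bump a b (real n) x) \<longlonglongrightarrow> (\<Prod>i\<in>(UNIV::2 set). 1 * 1)"
    unfolding bump_def using assms by (intro tendsto_prod tendsto_mult *) (auto simp: mem_box_cart)
  then show ?thesis by simp
qed

lemma test_functionsI:
  "smooth \<phi> \<Longrightarrow> compact K \<Longrightarrow> K \<subseteq> U \<Longrightarrow> (\<And>x. x \<notin> K \<Longrightarrow> \<phi> x = 0) \<Longrightarrow> \<phi> \<in> test_functions U"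
  by (auto simp: test_functions_def)

lemma test_functions_smooth: "\<phi> \<in> test_functions U \<Longrightarrow> smooth \<phi>"
  by (auto simp: test_functions_def)

lemma test_functions_mono: "U \<subseteq> V \<Longrightarrow> test_functions U \<subseteq> test_functions V"
  unfolding test_functions_def by (safe, meson order_trans)

lemma test_functions_eq_0: "\<phi> \<in> test_functions U \<Longrightarrow> x \<notin> U \<Longrightarrow> \<phi> x = 0"
  unfolding test_functions_def by blast

text \<open>The complement of K is open, so \<phi> vanishes near x and not only at x.\<close>

lemma gradient_eq_0_outside:
  assumes "closed K" "\<And>x. x \<notin> K \<Longrightarrow> \<phi> x = 0" "x \<notin> K"
  shows "gradient \<phi> x = 0"
proof (rule gradient_eqI)
  have "((\<lambda>x. 0) has_derivative (\<lambda>h. 0 \<bullet> h)) (at x)" by simp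
  then show "(\<phi> has_derivative (\<lambda>h. 0 \<bullet> h)) (at x)"
    by (rule has_derivative_transform_within_open[of _ _ _ _ "- K"]) (use assms in auto)
qed

lemma test_functions_gradient_eq_0:
  assumes "\<phi> \<in> test_functions U" "x \<notin> U" shows "gradient \<phi> x = 0"
proof -
  obtain K where "compact K" "K \<subseteq> U" "\<And>x. x \<notin> K \<Longrightarrow> \<phi> x = 0"
    using assms(1) unfolding test_functions_def by blast
  then show ?thesis using assms(2) by (intro gradient_eq_0_outside[of K]) (auto intro: compact_imp_closed)
qed

lemma test_functions_mult:
  assumes "\<phi> \<in> test_functions U" "smooth \<psi>"
  shows "(\<lambda>x. \<psi> x * \<phi> x) \<in> test_functions U"
proof -
  obtain K where "compact K" "K \<subseteq> U" "\<And>x. x \<notin> K \<Longrightarrow> \<phi> x = 0" "smooth \<phi>"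
    using assms(1) unfolding test_functions_def by blast
  then show ?thesis using assms(2) by (intro test_functionsI[of _ K]) auto
qed

lemma bump_test_function:
  "0 < c \<Longrightarrow> cbox a b \<subseteq> U \<Longrightarrow> bump a b c \<in> test_functions U"
  by (rule test_functionsI[OF smooth_bump compact_cbox])
    (use box_subset_cbox[of a b] in \<open>auto intro!: bump_eq_0\<close>)

subsection \<open>Integration of continuous functions\<close>

lemma finite_measure_lebesgue_on:
  assumes "bounded S" "S \<in> sets lebesgue"
  shows "finite_measure (lebesgue_on S)"
proof (rule finite_measureI)
  have "S \<in> lmeasurable" using assms by (rule bounded_set_imp_lmeasurable)
  then show "emeasure (lebesgue_on S) (space (lebesgue_on S)) \<noteq> \<infinity>"
    using assms fmeasurableD2[of S lebesgue] by (simp add: space_restrict_space emeasure_restrict_space)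
qed

lemma L2_continuous:
  fixes f :: "'a::euclidean_space \<Rightarrow> 'b::euclidean_space"
  assumes "continuous_on UNIV f" "bounded S" "S \<in> sets lebesgue"
  shows "f \<in> L2 (lebesgue_on S)"
proof -
  obtain B where B: "\<And>x. x \<in> S \<Longrightarrow> norm (f x) \<le> B"
  proof -
    have "compact (f ` closure S)"
      by (rule compact_continuous_image[OF continuous_on_subset[OF assms(1) subset_UNIV]])
        (simp add: compact_closure assms(2))
    then obtain B where "\<forall>y\<in>f ` closure S. norm y \<le> B"
      by (meson bounded_iff compact_imp_bounded)
    then show thesis using closure_subset by (intro that[of B]) blast
  qed
  show ?thesis
  proof (rule L2_bounded[OF finite_measure_lebesgue_on[OF assms(2,3)]])
    show "f \<in> borel_measurable (lebesgue_on S)"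
      by (rule continuous_imp_measurable_on_sets_lebesgue[OF continuous_on_subset[OF assms(1) subset_UNIV] assms(3)])
    show "norm (f x) \<le> B" if "x \<in> space (lebesgue_on S)" for x
      using that B by (simp add: space_restrict_space)
  qed
qed

lemma L2_smooth: "smooth \<phi> \<Longrightarrow> bounded S \<Longrightarrow> S \<in> sets lebesgue \<Longrightarrow> \<phi> \<in> L2 (lebesgue_on S)"
  by (intro L2_continuous smooth_continuous)

lemma L2_gradient_smooth:
  "smooth \<phi> \<Longrightarrow> bounded S \<Longrightarrow> S \<in> sets lebesgue \<Longrightarrow> gradient \<phi> \<in> L2 (lebesgue_on S)"
  by (intro L2_continuous smooth_gradient_continuous)

subsection \<open>Null sets and the domain of integration\<close>

text \<open>Weak derivatives refer to the open triangle, norms and integrals to the closed one.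
  After extension by zero the two are indistinguishable almost everywhere, which is the basis of
  every passage between them.\<close>

lemma zero_extension_AE_eq:
  assumes "S \<subseteq> T" "negligible (T - S)"
  shows "AE x in lebesgue. (if x \<in> S then f x else 0) = (if x \<in> T then f x else 0)"
proof -
  have "AE x in lebesgue. x \<notin> T - S"
    using assms(2) by (intro AE_not_in) (simp add: negligible_iff_null_sets)
  then show ?thesis by eventually_elim (use assms(1) in auto)
qed

lemma borel_measurable_lebesgue_on_null_change:
  fixes f :: "'a::euclidean_space \<Rightarrow> 'b::euclidean_space"
  assumes "S \<in> sets lebesgue" "T \<in> sets lebesgue" "S \<subseteq> T" "negligible (T - S)"
  shows "f \<in> borel_measurable (lebesgue_on S) \<longleftrightarrow> f \<in> borel_measurable (lebesgue_on T)"
proof -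
  note ae = zero_extension_AE_eq[OF assms(3,4), of f]
  have ae': "AE x in lebesgue. (if x \<in> T then f x else 0) = (if x \<in> S then f x else 0)"
    using ae by eventually_elim auto
  show ?thesis
    unfolding borel_measurable_if[OF assms(1), symmetric] borel_measurable_if[OF assms(2), symmetric]
    using borel_measurable_AE[OF _ ae] borel_measurable_AE[OF _ ae'] by blast
qed

lemma integral_lebesgue_on:
  fixes f :: "'a::euclidean_space \<Rightarrow> 'b::euclidean_space"
  assumes "S \<in> sets lebesgue"
  shows "(LINT x|lebesgue_on S. f x) = (LINT x|lebesgue. (if x \<in> S then f x else 0))"
    and "integrable (lebesgue_on S) f \<longleftrightarrow> integrable lebesgue (\<lambda>x. if x \<in> S then f x else 0)"
proof -
  have "(\<lambda>x. indicator S x *\<^sub>R f x) = (\<lambda>x. if x \<in> S then f x else 0)" by auto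
  then show "(LINT x|lebesgue_on S. f x) = (LINT x|lebesgue. (if x \<in> S then f x else 0))"
    and "integrable (lebesgue_on S) f \<longleftrightarrow> integrable lebesgue (\<lambda>x. if x \<in> S then f x else 0)"
    using assms by (simp_all add: integral_restrict_space integrable_restrict_space)
qed

lemma integrable_lebesgue_on_null_change:
  fixes f :: "'a::euclidean_space \<Rightarrow> 'b::euclidean_space"
  assumes "S \<in> sets lebesgue" "T \<in> sets lebesgue" "S \<subseteq> T" "negligible (T - S)"
  shows "integrable (lebesgue_on S) f \<longleftrightarrow> integrable (lebesgue_on T) f"
proof (cases "f \<in> borel_measurable (lebesgue_on T)")
  case True
  then show ?thesis
    using True borel_measurable_lebesgue_on_null_change[OF assms, of f] assms(1,2)
      zero_extension_AE_eq[OF assms(3,4), of f]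
    unfolding integral_lebesgue_on(2)[OF assms(1)] integral_lebesgue_on(2)[OF assms(2)]
    by (intro integrable_cong_AE) (auto intro: borel_measurable_if_I)
next
  case False
  then show ?thesis
    using borel_measurable_lebesgue_on_null_change[OF assms, of f] borel_measurable_integrable by blast
qed

lemma integral_lebesgue_on_null_change:
  fixes f :: "'a::euclidean_space \<Rightarrow> 'b::euclidean_space"
  assumes "S \<in> sets lebesgue" "T \<in> sets lebesgue" "S \<subseteq> T" "negligible (T - S)"
  shows "(LINT x|lebesgue_on S. f x) = (LINT x|lebesgue_on T. f x)"
proof (cases "f \<in> borel_measurable (lebesgue_on T)")
  case True
  then show ?thesis
    using True borel_measurable_lebesgue_on_null_change[OF assms, of f] assms(1,2)
      zero_extension_AE_eq[OF assms(3,4), of f]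
    unfolding integral_lebesgue_on(1)[OF assms(1)] integral_lebesgue_on(1)[OF assms(2)]
    by (intro integral_cong_AE) (auto intro: borel_measurable_if_I)
next
  \<comment> \<open>Without measurability neither side is integrable and both integrals take the
    default value 0.\<close>
  case False
  then show ?thesis
    using borel_measurable_lebesgue_on_null_change[OF assms, of f] borel_measurable_integrable
      not_integrable_integral_eq by metis
qed

lemma AE_lebesgue_on_null_change:
  assumes "S \<in> sets lebesgue" "T \<in> sets lebesgue" "S \<subseteq> T" "negligible (T - S)"
  shows "(AE x in lebesgue_on S. P x) \<longleftrightarrow> (AE x in lebesgue_on T. P x)"
proof -
  have *: "AE x in lebesgue. x \<notin> T - S"
    using assms(4) by (intro AE_not_in) (simp add: negligible_iff_null_sets)
  show ?thesis
  proof
    assume "AE x in lebesgue_on S. P x"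
    then have "AE x in lebesgue. x \<in> S \<longrightarrow> P x" using assms by (simp add: AE_restrict_space_iff)
    with * have "AE x in lebesgue. x \<in> T \<longrightarrow> P x" by eventually_elim auto
    then show "AE x in lebesgue_on T. P x" using assms by (simp add: AE_restrict_space_iff)
  next
    assume "AE x in lebesgue_on T. P x"
    then have "AE x in lebesgue. x \<in> T \<longrightarrow> P x" using assms by (simp add: AE_restrict_space_iff)
    then have "AE x in lebesgue. x \<in> S \<longrightarrow> P x" by eventually_elim (use assms(3) in auto)
    then show "AE x in lebesgue_on S. P x" using assms by (simp add: AE_restrict_space_iff)
  qed
qed

lemma L2_lebesgue_on_null_change:
  fixes f :: "'a::euclidean_space \<Rightarrow> 'b::euclidean_space"
  assumes "S \<in> sets lebesgue" "T \<in> sets lebesgue" "S \<subseteq> T" "negligible (T - S)"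
  shows "f \<in> L2 (lebesgue_on S) \<longleftrightarrow> f \<in> L2 (lebesgue_on T)"
  using borel_measurable_lebesgue_on_null_change[OF assms, of f]
    integrable_lebesgue_on_null_change[OF assms, of "\<lambda>x. (norm (f x))\<^sup>2"] by (simp add: L2_def)

lemma AE_lebesgue_on_subset:
  assumes "S \<in> sets lebesgue" "T \<in> sets lebesgue" "S \<subseteq> T" "AE x in lebesgue_on T. P x"
  shows "AE x in lebesgue_on S. P x"
proof -
  have "AE x in lebesgue. x \<in> T \<longrightarrow> P x" using assms by (simp add: AE_restrict_space_iff)
  then have "AE x in lebesgue. x \<in> S \<longrightarrow> P x" by eventually_elim (use assms(3) in auto)
  then show ?thesis using assms by (simp add: AE_restrict_space_iff)
qed

text \<open>Only one of the two functions is assumed measurable; completeness of Lebesgue measure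
  gives the other. This suits chosen representatives, which are known only up to null sets.\<close>

lemma borel_measurable_lebesgue_on_cong_AE:
  fixes f :: "'a::euclidean_space \<Rightarrow> 'b::euclidean_space"
  assumes S: "S \<in> sets lebesgue" and f: "f \<in> borel_measurable (lebesgue_on S)"
    and ae: "AE x in lebesgue_on S. f x = g x"
  shows "g \<in> borel_measurable (lebesgue_on S)"
proof -
  have "AE x in lebesgue. x \<in> S \<longrightarrow> f x = g x"
    using ae S by (simp add: AE_restrict_space_iff)
  then have "AE x in lebesgue. (if x \<in> S then f x else 0) = (if x \<in> S then g x else 0)"
    by eventually_elim auto
  from borel_measurable_AE[OF borel_measurable_if_I[OF f S] this] show ?thesis
    by (rule borel_measurable_if_D)
qed

lemma L2_lebesgue_on_cong_AE:
  fixes f :: "'a::euclidean_space \<Rightarrow> 'b::euclidean_space"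
  assumes "S \<in> sets lebesgue" "f \<in> L2 (lebesgue_on S)" "AE x in lebesgue_on S. f x = g x"
  shows "g \<in> L2 (lebesgue_on S)"
  by (rule L2_cong_AE[OF assms(2) borel_measurable_lebesgue_on_cong_AE[OF assms(1)] assms(3)])
    (use assms in \<open>auto dest: L2_measurable\<close>)

lemma L2_lebesgue_on_subset:
  fixes f :: "'a::euclidean_space \<Rightarrow> 'b::euclidean_space"
  assumes "S \<in> sets lebesgue" "T \<in> sets lebesgue" "S \<subseteq> T" "f \<in> L2 (lebesgue_on T)"
  shows "f \<in> L2 (lebesgue_on S)"
proof (rule L2I)
  have f: "f \<in> borel_measurable (lebesgue_on T)" using assms by (auto dest: L2_measurable)
  then show m: "f \<in> borel_measurable (lebesgue_on S)"
    by (rule measurable_restrict_mono[OF _ assms(3)])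
  have i: "integrable lebesgue (\<lambda>x. if x \<in> T then (norm (f x))\<^sup>2 else 0)"
    unfolding integral_lebesgue_on(2)[OF assms(2), symmetric] by (rule L2_integrable_square[OF assms(4)])
  have "integrable lebesgue (\<lambda>x. if x \<in> S then (norm (f x))\<^sup>2 else 0)"
  proof (rule Bochner_Integration.integrable_bound[OF i])
    show "(\<lambda>x. if x \<in> S then (norm (f x))\<^sup>2 else 0) \<in> borel_measurable lebesgue"
      using m assms(1) by (intro borel_measurable_if_I) auto
  qed (use assms(3) in auto)
  then show "integrable (lebesgue_on S) (\<lambda>x. (norm (f x))\<^sup>2)"
    unfolding integral_lebesgue_on(2)[OF assms(1)] .
qed

lemma integrable_continuous_mult:
  fixes h :: "'a::euclidean_space \<Rightarrow> real" and F :: "'a \<Rightarrow> real"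
  assumes F: "integrable (lebesgue_on S) F" and S: "bounded S" "S \<in> sets lebesgue"
    and h: "continuous_on UNIV h"
  shows "integrable (lebesgue_on S) (\<lambda>x. h x * F x)"
proof -
  have "compact (h ` closure S)"
    by (rule compact_continuous_image[OF continuous_on_subset[OF h subset_UNIV]]) (simp add: S)
  then obtain B where B: "\<And>y. y \<in> h ` closure S \<Longrightarrow> norm y \<le> B"
    by (meson bounded_iff compact_imp_bounded)
  have B': "\<bar>h x\<bar> \<le> B" if "x \<in> S" for x
    using B[of "h x"] that closure_subset[of S] by auto
  show ?thesis
  proof (rule Bochner_Integration.integrable_bound)
    show "integrable (lebesgue_on S) (\<lambda>x. B * F x)" using F by simp
    have "h \<in> borel_measurable (lebesgue_on S)"
      by (rule continuous_imp_measurable_on_sets_lebesgue[OF continuous_on_subset[OF h subset_UNIV] S(2)])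
    then show "(\<lambda>x. h x * F x) \<in> borel_measurable (lebesgue_on S)" using F by auto
    show "AE x in lebesgue_on S. norm (h x * F x) \<le> norm (B * F x)"
    proof (rule AE_I2)
      fix x assume "x \<in> space (lebesgue_on S)"
      then have "\<bar>h x\<bar> \<le> B" using B' by (simp add: space_restrict_space)
      then have "\<bar>h x\<bar> \<le> \<bar>B\<bar>" by linarith
      then show "norm (h x * F x) \<le> norm (B * F x)" by (simp add: abs_mult mult_right_mono)
    qed
  qed
qed

subsection \<open>Integrals depending on a parameter\<close>

lemma C1_differentiable: "Ck 1 \<phi> \<Longrightarrow> \<phi> differentiable (at x)"
  by simp

lemma C1_gradient_continuous: "Ck 1 \<phi> \<Longrightarrow> continuous_on S (gradient \<phi>)"
  using continuous_on_vec_lambda[of S "\<lambda>i x. gradient \<phi> x $ i"]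
  by (auto intro: continuous_on_subset)

lemma smooth_Ck: "smooth \<phi> \<Longrightarrow> Ck k \<phi>"
  by (simp add: smooth_def)

text \<open>The gradient is uniformly continuous on the ball of radius \<open>R + 1\<close>, and the
  mean value inequality for \<open>K\<close> minus its linear part at z bounds the remainder.
  Uniformity in z is what allows the remainder to be integrated.\<close>

lemma C1_uniform_differentiability:
  assumes K: "Ck 1 K" and "0 < e"
  obtains d where "0 < d" "\<And>z h. z \<in> cball 0 R \<Longrightarrow> norm h < d \<Longrightarrow>
     \<bar>K (z + h) - K z - gradient K z \<bullet> h\<bar> \<le> e * norm h"
proof -
  have "uniformly_continuous_on (cball 0 (R + 1)) (gradient K)"
    by (intro compact_uniformly_continuous C1_gradient_continuous K compact_cball)
  then obtain d' where d': "0 < d'" and uc: "\<And>x y. x \<in> cball 0 (R + 1) \<Longrightarrow> y \<in> cball 0 (R + 1) \<Longrightarrow>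
      dist y x < d' \<Longrightarrow> dist (gradient K y) (gradient K x) < e"
    using \<open>0 < e\<close> unfolding uniformly_continuous_on_def by metis
  define d where "d = min d' 1"
  show ?thesis
  proof (rule that[of d])
    show "0 < d" using d' by (simp add: d_def)
    fix z h :: point assume z: "z \<in> cball 0 R" and h: "norm h < d"
    let ?g = "\<lambda>y. K y - gradient K z \<bullet> y"
    have "norm (?g (z + h) - ?g z) \<le> e * norm (z + h - z)"
    proof (rule differentiable_bound[of "ball z d" ?g "\<lambda>y h. (gradient K y - gradient K z) \<bullet> h"])
      fix y assume y: "y \<in> ball z d"
      show "(?g has_derivative (\<lambda>h. (gradient K y - gradient K z) \<bullet> h)) (at y within ball z d)"
        by (rule has_derivative_at_withinI)
          (auto intro!: derivative_eq_intros has_derivative_gradient C1_differentiable K simp: inner_diff_left)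
      have "norm y \<le> norm z + dist z y"
        using norm_triangle_sub[of y z] by (simp add: dist_norm norm_minus_commute)
      then have "y \<in> cball 0 (R + 1)" using z y by (auto simp: d_def)
      moreover have "z \<in> cball 0 (R + 1)" using z by auto
      ultimately have "norm (gradient K y - gradient K z) < e"
        using uc[of z y] y by (simp add: d_def dist_norm norm_minus_commute)
      then show "onorm (\<lambda>h. (gradient K y - gradient K z) \<bullet> h) \<le> e"
      proof (intro onorm_le)
        fix h :: point
        assume "norm (gradient K y - gradient K z) < e"
        then have "norm (gradient K y - gradient K z) * norm h \<le> e * norm h" by (simp add: mult_right_mono)
        then show "norm ((gradient K y - gradient K z) \<bullet> h) \<le> e * norm h"
          using Cauchy_Schwarz_ineq2[of "gradient K y - gradient K z" h] by simp
      qed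
    qed (use h \<open>0 < d\<close> in \<open>auto simp: dist_norm\<close>)
    then show "\<bar>K (z + h) - K z - gradient K z \<bullet> h\<bar> \<le> e * norm h"
      by (simp add: inner_add_right algebra_simps)
  qed
qed

text \<open>The kernel argument is affine in both variables, as in \<open>kern\<close>. Since F is
  merely integrable, the remainder of the kernel is bounded uniformly over S and then multiplied by
  the absolute value of F.\<close>

lemma has_derivative_integral_parameter:
  assumes K: "smooth K" and S: "bounded S" "S \<in> sets lebesgue" and F: "integrable (lebesgue_on S) F"
  shows "((\<lambda>x. LINT y|lebesgue_on S. K (a *\<^sub>R y + b *\<^sub>R x) * F y) has_derivative
     (\<lambda>h. (\<chi> j. LINT y|lebesgue_on S. b * gradient K (a *\<^sub>R y + b *\<^sub>R x) $ j * F y) \<bullet> h)) (at x)"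
proof -
  let ?M = "lebesgue_on S"
  let ?I = "\<lambda>x. LINT y|?M. K (a *\<^sub>R y + b *\<^sub>R x) * F y"
  let ?w = "(\<chi> j. LINT y|?M. b * gradient K (a *\<^sub>R y + b *\<^sub>R x) $ j * F y) :: point"
  have int: "integrable ?M (\<lambda>y. K (a *\<^sub>R y + b *\<^sub>R x) * F y)" for x
    by (rule integrable_continuous_mult[OF F S])
      (intro continuous_on_compose2[OF smooth_continuous[OF K, of UNIV]] continuous_intros, auto)
  have intg: "integrable ?M (\<lambda>y. b * gradient K (a *\<^sub>R y + b *\<^sub>R x) $ j * F y)" for x j
    by (rule integrable_continuous_mult[OF F S])
      (intro continuous_on_compose2[OF smooth_gradient_continuous[OF K, of UNIV]] continuous_intros, auto)
  have wh: "?w \<bullet> h = (LINT y|?M. (b *\<^sub>R gradient K (a *\<^sub>R y + b *\<^sub>R x)) \<bullet> h * F y)" for h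
  proof -
    have "?w \<bullet> h = (LINT y|?M. b * gradient K (a *\<^sub>R y + b *\<^sub>R x) $ 1 * F y * h $ 1
        + b * gradient K (a *\<^sub>R y + b *\<^sub>R x) $ 2 * F y * h $ 2)"
      using intg[of x 1] intg[of x 2] by (simp add: inner_vec_def sum_2)
    also have "\<dots> = (LINT y|?M. (b *\<^sub>R gradient K (a *\<^sub>R y + b *\<^sub>R x)) \<bullet> h * F y)"
      by (intro Bochner_Integration.integral_cong) (auto simp: inner_vec_def sum_2 algebra_simps)
    finally show ?thesis .
  qed
  have intw: "integrable ?M (\<lambda>y. (b *\<^sub>R gradient K (a *\<^sub>R y + b *\<^sub>R x)) \<bullet> h * F y)" for h
    by (rule integrable_continuous_mult[OF F S])
      (intro continuous_intros continuous_on_compose2[OF smooth_gradient_continuous[OF K, of UNIV]], auto)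
  obtain B where B: "\<And>y. y \<in> S \<Longrightarrow> norm y \<le> B" using S(1) by (meson bounded_iff)
  let ?R = "\<bar>a\<bar> * B + \<bar>b\<bar> * norm x"
  let ?N = "LINT y|?M. \<bar>F y\<bar>"
  have N: "0 \<le> ?N" by simp
  show ?thesis
    unfolding has_derivative_at_alt
  proof (intro conjI allI impI)
    show "bounded_linear (\<lambda>h. ?w \<bullet> h)" by (rule bounded_linear_inner_right)
    fix e :: real assume e: "0 < e"
    \<comment> \<open>The summands 1 keep X positive when b = 0 or F = 0, and X still dominates
      \<open>\<bar>b\<bar> * ?N\<close>.\<close>
    define X where "X = (\<bar>b\<bar> + 1) * (?N + 1)"
    have X: "0 < X" unfolding X_def using N by (intro mult_pos_pos) linarith+
    define e' where "e' = e / X"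
    have e': "0 < e'" using e X by (simp add: e'_def)
    obtain d where d: "0 < d" and dK: "\<And>z h. z \<in> cball 0 ?R \<Longrightarrow> norm h < d \<Longrightarrow>
       \<bar>K (z + h) - K z - gradient K z \<bullet> h\<bar> \<le> e' * norm h"
      using C1_uniform_differentiability[OF smooth_Ck[OF K] e'] by blast
    show "\<exists>d>0. \<forall>x'. norm (x' - x) < d \<longrightarrow> norm (?I x' - ?I x - ?w \<bullet> (x' - x)) \<le> e * norm (x' - x)"
    proof (intro exI conjI allI impI)
      show "0 < d / (\<bar>b\<bar> + 1)" using d by simp
      fix x' assume x': "norm (x' - x) < d / (\<bar>b\<bar> + 1)"
      let ?h = "x' - x"
      let ?D = "\<lambda>y. (K (a *\<^sub>R y + b *\<^sub>R x') - K (a *\<^sub>R y + b *\<^sub>R x) - (b *\<^sub>R gradient K (a *\<^sub>R y + b *\<^sub>R x)) \<bullet> ?h) * F y"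
      have eq: "?I x' - ?I x - ?w \<bullet> ?h = (LINT y|?M. ?D y)"
        unfolding wh using int intw by (simp add: left_diff_distrib)
      have "norm (?I x' - ?I x - ?w \<bullet> ?h) \<le> (LINT y|?M. norm (?D y))"
        unfolding eq by (rule integral_norm_bound)
      also have "\<dots> \<le> (LINT y|?M. (e' * (\<bar>b\<bar> * norm ?h)) * \<bar>F y\<bar>)"
      proof (rule integral_mono')
        show "integrable ?M (\<lambda>y. (e' * (\<bar>b\<bar> * norm ?h)) * \<bar>F y\<bar>)" using F by auto
        fix y assume "y \<in> space ?M"
        then have "y \<in> S" by (simp add: space_restrict_space)
        have "norm (a *\<^sub>R y + b *\<^sub>R x) \<le> norm (a *\<^sub>R y) + norm (b *\<^sub>R x)" by (rule norm_triangle_ineq)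
        also have "\<dots> \<le> ?R" using B[OF \<open>y \<in> S\<close>] by (simp add: mult_left_mono)
        finally have z: "a *\<^sub>R y + b *\<^sub>R x \<in> cball 0 ?R" by simp
        have "(\<bar>b\<bar> + 1) * norm ?h < d" using x' by (simp add: field_simps)
        then have "\<bar>b\<bar> * norm ?h < d" using norm_ge_zero[of ?h] unfolding distrib_right by linarith
        then have "norm (b *\<^sub>R ?h) < d" by simp
        moreover have eqs: "a *\<^sub>R y + b *\<^sub>R x + b *\<^sub>R ?h = a *\<^sub>R y + b *\<^sub>R x'" "norm (b *\<^sub>R ?h) = \<bar>b\<bar> * norm ?h"
          by (simp add: scaleR_diff_right, rule norm_scaleR)
        ultimately have "\<bar>K (a *\<^sub>R y + b *\<^sub>R x') - K (a *\<^sub>R y + b *\<^sub>R x) - gradient K (a *\<^sub>R y + b *\<^sub>R x) \<bullet> (b *\<^sub>R ?h)\<bar> \<le> e' * (\<bar>b\<bar> * norm ?h)"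
          using dK[OF z, of "b *\<^sub>R ?h"] unfolding eqs by blast
        then
        have "\<bar>K (a *\<^sub>R y + b *\<^sub>R x') - K (a *\<^sub>R y + b *\<^sub>R x) - (b *\<^sub>R gradient K (a *\<^sub>R y + b *\<^sub>R x)) \<bullet> ?h\<bar>
          \<le> e' * (\<bar>b\<bar> * norm ?h)"
          by (simp only: inner_scaleR_left inner_scaleR_right)
        then show "norm (?D y) \<le> (e' * (\<bar>b\<bar> * norm ?h)) * \<bar>F y\<bar>"
          by (simp add: abs_mult mult_right_mono)
      qed (use e' in auto)
      also have "\<dots> = e' * (\<bar>b\<bar> * ?N) * norm ?h" by simp
      also have "\<dots> \<le> e * norm ?h"
      proof (rule mult_right_mono)
        have "\<bar>b\<bar> * ?N \<le> (\<bar>b\<bar> + 1) * (?N + 1)" using N by (intro mult_mono) auto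
        then have "e' * (\<bar>b\<bar> * ?N) \<le> e' * ((\<bar>b\<bar> + 1) * (?N + 1))" using e' by simp
        also have "\<dots> = e"
          using X unfolding X_def[symmetric] by (simp add: e'_def)
        finally show "e' * (\<bar>b\<bar> * ?N) \<le> e" .
      qed simp
      finally show "norm (?I x' - ?I x - ?w \<bullet> ?h) \<le> e * norm ?h" .
    qed
  qed
qed

lemma gradient_integral_parameter:
  assumes "smooth K" "bounded S" "S \<in> sets lebesgue" "integrable (lebesgue_on S) F"
  shows "gradient (\<lambda>x. LINT y|lebesgue_on S. K (a *\<^sub>R y + b *\<^sub>R x) * F y) x $ j
     = (LINT y|lebesgue_on S. b * gradient K (a *\<^sub>R y + b *\<^sub>R x) $ j * F y)"
  by (simp add: gradient_eqI[OF has_derivative_integral_parameter[OF assms]])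

text \<open>The partial derivatives are integrals of the same form with a component of
  \<open>b * gradient K\<close> as kernel, hence an induction on the order with K arbitrary.\<close>

lemma smooth_integral_parameter:
  assumes "smooth K" "bounded S" "S \<in> sets lebesgue" "integrable (lebesgue_on S) F"
  shows "smooth (\<lambda>x. LINT y|lebesgue_on S. K (a *\<^sub>R y + b *\<^sub>R x) * F y)"
proof -
  have "Ck n (\<lambda>x. LINT y|lebesgue_on S. K (a *\<^sub>R y + b *\<^sub>R x) * F y)" for n
    using assms(1)
  proof (induction n arbitrary: K)
    case 0
    then show ?case
      using has_derivative_continuous[OF has_derivative_integral_parameter[OF 0 assms(2-4)]]
      by (auto simp: continuous_on_eq_continuous_at)
  next
    case (Suc n)
    have "smooth (\<lambda>z. b * gradient K z $ j)" for j
      using Suc.prems by auto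
    from Suc.IH[OF this] show ?case
      using differentiableI[OF has_derivative_integral_parameter[OF Suc.prems assms(2-4)]]
      by (simp add: gradient_integral_parameter[OF Suc.prems assms(2-4)])
  qed
  then show ?thesis by (simp add: smooth_def)
qed

subsection \<open>Smoothing on convex sets\<close>

lemma
  fixes f :: "point \<Rightarrow> real"
  assumes c: "c \<noteq> 0" and f: "f \<in> borel_measurable borel"
  shows integral_lborel_affine: "(LINT x|lborel. f (t + c *\<^sub>R x)) = (LINT x|lborel. f x) / c\<^sup>2"
    and integrable_lborel_affine: "integrable lborel f \<Longrightarrow> integrable lborel (\<lambda>x. f (t + c *\<^sub>R x))"
proof -
  let ?D = "density (distr lborel borel (\<lambda>x::point. t + c *\<^sub>R x)) (\<lambda>_. ennreal (\<bar>c\<bar> ^ DIM(point)))"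
  note L = lborel_affine[OF c, of t]
  have dim: "\<bar>c\<bar> ^ DIM(point) = c\<^sup>2" by simp
  have m: "(\<lambda>x. t + c *\<^sub>R x) \<in> borel_measurable lborel" by simp
  have "(LINT x|lborel. f x) = (LINT x|?D. f x)" using L by metis
  also have "\<dots> = c\<^sup>2 * (LINT x|lborel. f (t + c *\<^sub>R x))"
    using f unfolding dim by (subst integral_density) (auto simp: integral_distr[OF m])
  finally show "(LINT x|lborel. f (t + c *\<^sub>R x)) = (LINT x|lborel. f x) / c\<^sup>2"
    using c by simp
  assume "integrable lborel f"
  then have "integrable ?D f" using L by metis
  then have "integrable lborel (\<lambda>x. c\<^sup>2 *\<^sub>R f (t + c *\<^sub>R x))"
    using f unfolding dim by (subst (asm) integrable_density) (auto simp: integrable_distr_eq[OF m])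
  then have "integrable lborel (\<lambda>x. (1 / c\<^sup>2) *\<^sub>R (c\<^sup>2 *\<^sub>R f (t + c *\<^sub>R x)))"
    by (rule integrable_scaleR_right)
  then show "integrable lborel (\<lambda>x. f (t + c *\<^sub>R x))" using c by simp
qed

text \<open>\<open>smoothing S k e F x\<close> is the average of \<open>F ((1 - e) x + e z)\<close> over \<open>z\<close> with respect to the
  density \<open>k\<close>. As \<open>k\<close> is supported in the interior of the convex set \<open>S\<close>, this only involves values
  of \<open>F\<close> inside \<open>S\<close>, up to the boundary of \<open>S\<close>.\<close>

definition mollifier :: "point set \<Rightarrow> scalar_field \<Rightarrow> bool" where
  "mollifier S k \<longleftrightarrow> k \<in> test_functions (interior S) \<and> (\<forall>x. 0 \<le> k x) \<and> (LINT x|lborel. k x) = 1"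

text \<open>Solving y = (1 - e) x + e z for z gives the argument of k; the divisor
  \<open>e\<^sup>2\<close> is the Jacobian of this substitution in the plane.\<close>

definition kern :: "scalar_field \<Rightarrow> real \<Rightarrow> point \<Rightarrow> scalar_field" where
  "kern k e x y = k ((1/e) *\<^sub>R y + (- (1 - e) / e) *\<^sub>R x) / e\<^sup>2"

definition smoothing :: "point set \<Rightarrow> scalar_field \<Rightarrow> real \<Rightarrow> scalar_field \<Rightarrow> scalar_field" where
  "smoothing S k e F x = (LINT y|lebesgue_on S. kern k e x y * F y)"

lemma integrable_lborel_test_function:
  assumes "k \<in> test_functions U" shows "integrable lborel k"
proof -
  obtain K where K: "compact K" "\<And>x. x \<notin> K \<Longrightarrow> k x = 0" and k: "smooth k"
    using assms unfolding test_functions_def by blast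
  have "(\<lambda>x. indicat_real K x *\<^sub>R k x) = k"
    using K(2) by (auto simp: indicator_def fun_eq_iff)
  with borel_integrable_compact[OF K(1) smooth_continuous[OF k]] show ?thesis by simp
qed

lemma mollifier_exists:
  assumes "interior S \<noteq> {}"
  obtains k where "mollifier S k"
proof -
  obtain c where "c \<in> interior S" using assms by blast
  then obtain a b where ab: "c \<in> box a b" "cbox a b \<subseteq> interior S"
    using open_contains_cbox[of "interior S"] by (metis open_interior)
  let ?k = "bump a b 1"
  have t: "?k \<in> test_functions (interior S)" using ab by (intro bump_test_function) auto
  have int: "integrable lborel ?k" by (rule integrable_lborel_test_function[OF t])
  let ?I = "LINT x|lborel. ?k x"
  \<comment> \<open>A zero integral would make the bump vanish almost everywhere, although it is
    positive on a nonempty box.\<close>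
  have "?I \<noteq> 0"
  proof
    assume "?I = 0"
    then have "AE x in lborel. ?k x = 0"
      using int by (subst (asm) integral_nonneg_eq_0_iff_AE) (auto intro: bump_nonneg)
    then have ae: "AE x in lborel. x \<notin> box a b"
      by eventually_elim (use bump_pos_iff[of 1 a b] in force)
    have "emeasure lborel (box a b) = 0"
      using ae AE_iff_measurable[of "box a b" lborel "\<lambda>x. x \<notin> box a b"] by auto
    then have "box a b \<in> null_sets lborel" by auto
    then have "negligible (box a b)"
      by (simp add: negligible_iff_null_sets null_sets_completionI)
    then show False using ab(1) negligible_interval(2)[of a b] by blast
  qed
  then have "0 < ?I" using Bochner_Integration.integral_nonneg[of lborel ?k] bump_nonneg[of a b 1] by (simp add: less_le)
  then have "mollifier S (\<lambda>x. (1 / ?I) * ?k x)"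
    unfolding mollifier_def using test_functions_mult[OF t smooth_const[of "1/?I"]]
    by (simp add: bump_nonneg)
  then show ?thesis by (rule that)
qed

context
  fixes S :: "point set" and k :: scalar_field
  assumes S: "compact S" "convex S" and k: "mollifier S k"
begin

lemma mollifier_smooth: "smooth k"
  using k test_functions_smooth by (auto simp: mollifier_def)

lemma mollifier_nonneg: "0 \<le> k x"
  using k by (auto simp: mollifier_def)

lemma kernel_nonneg: "0 \<le> kern k e x y"
  by (simp add: kern_def mollifier_nonneg)

lemma S_lebesgue: "S \<in> sets lebesgue" and S_bounded: "bounded S"
  using S by (simp_all add: compact_imp_bounded compact_imp_closed lmeasurable_compact fmeasurableD)

lemma smooth_kernel: "smooth (kern k e x)"
proof -
  have "smooth (\<lambda>y. k ((1/e) *\<^sub>R y + (- (1 - e) / e) *\<^sub>R x) * (1 / e\<^sup>2))"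
    by (rule smooth_mult[OF smooth_affine[OF mollifier_smooth] smooth_const])
  then show ?thesis by (simp add: kern_def[abs_def])
qed

lemma kernel_measurable [measurable]: "(\<lambda>(x, y). kern k e x y) \<in> borel_measurable borel"
  unfolding kern_def case_prod_beta divide_inverse
  by (intro borel_measurable_continuous_onI continuous_intros
        continuous_on_compose2[OF smooth_continuous[OF mollifier_smooth, of UNIV]]) auto

lemma integral_kernel:
  assumes "0 < e"
  shows "(LINT y|lborel. kern k e x y) = 1" and "integrable lborel (kern k e x)"
proof -
  have km: "k \<in> borel_measurable borel"
    by (rule borel_measurable_continuous_onI[OF smooth_continuous[OF mollifier_smooth]])
  have ki: "integrable lborel k" using k integrable_lborel_test_function by (auto simp: mollifier_def)
  have *: "kern k e x = (\<lambda>y. k ((- (1 - e) / e) *\<^sub>R x + (1/e) *\<^sub>R y) / e\<^sup>2)"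
    by (simp add: kern_def fun_eq_iff add.commute)
  show "(LINT y|lborel. kern k e x y) = 1"
    unfolding * using assms integral_lborel_affine[OF _ km, of "1/e" "(- (1 - e) / e) *\<^sub>R x"] k
    by (simp add: mollifier_def power_divide)
  show "integrable lborel (kern k e x)"
    unfolding * using assms integrable_lborel_affine[OF _ km ki, of "1/e" "(- (1 - e) / e) *\<^sub>R x"]
    by (intro integrable_divide) simp
qed

text \<open>In the variable x the argument of k scales by (1 - e)/e instead of 1/e, so the mass is 1
  / (1 - e)^2 instead of 1. This is the price of pulling points inwards; its square root is the
  operator bound in \<open>L2_norm_smoothing_le\<close>.\<close>

lemma nn_integral_kernel_first:
  assumes "0 < e" "e < 1"
  shows "(\<integral>\<^sup>+x. ennreal (kern k e x y) \<partial>lborel) = ennreal (1 / (1 - e)\<^sup>2)"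
proof -
  have km: "k \<in> borel_measurable borel"
    by (rule borel_measurable_continuous_onI[OF smooth_continuous[OF mollifier_smooth]])
  have ki: "integrable lborel k" using k integrable_lborel_test_function by (auto simp: mollifier_def)
  have nz: "- (1 - e) / e \<noteq> 0" using assms by simp
  have "integrable lborel (\<lambda>x. kern k e x y)"
    unfolding kern_def using integrable_lborel_affine[OF nz km ki, of "(1/e) *\<^sub>R y"]
    by (intro integrable_divide) simp
  moreover have "(LINT x|lborel. kern k e x y) = 1 / (1 - e)\<^sup>2"
    unfolding kern_def using integral_lborel_affine[OF nz km, of "(1/e) *\<^sub>R y"] k assms
    by (simp add: mollifier_def power_divide power2_commute)
  ultimately show ?thesis
    by (subst nn_integral_eq_integral) (auto simp: kernel_nonneg)
qed

lemma kernel_support: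
  assumes "kern k e x y \<noteq> 0" "0 < e"
  obtains z where "z \<in> S" "y = (1 - e) *\<^sub>R x + e *\<^sub>R z"
proof (rule that[of "(1/e) *\<^sub>R y + (- (1 - e) / e) *\<^sub>R x"])
  let ?z = "(1/e) *\<^sub>R y + (- (1 - e) / e) *\<^sub>R x"
  have "k ?z \<noteq> 0" using assms by (auto simp: kern_def)
  then show "?z \<in> S"
    using k test_functions_eq_0[of k "interior S" ?z] interior_subset[of S] by (auto simp: mollifier_def)
  show "y = (1 - e) *\<^sub>R x + e *\<^sub>R ?z"
    using assms by (simp add: scaleR_add_right) (simp add: algebra_simps)
qed

text \<open>For x in S, boundary included, the map taking z to (1 - e) x + e z sends the interior of
  the convex set S into itself. The kernel is therefore an admissible test function for every x in
  S, which makes the smoothing of weak derivatives valid up to the boundary.\<close>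

lemma kernel_test_function:
  assumes x: "x \<in> S" and e: "0 < e" "e < 1"
  shows "kern k e x \<in> test_functions (interior S)"
proof -
  obtain K where K: "compact K" "K \<subseteq> interior S" "\<And>x. x \<notin> K \<Longrightarrow> k x = 0"
    using k unfolding mollifier_def test_functions_def by blast
  let ?f = "\<lambda>z. (1 - e) *\<^sub>R x + e *\<^sub>R z"
  show ?thesis
  proof (rule test_functionsI[OF smooth_kernel, of "?f ` K"])
    show "compact (?f ` K)" by (intro compact_continuous_image K continuous_intros)
    show "?f ` K \<subseteq> interior S"
    proof safe
      fix z assume "z \<in> K"
      then have "x - e *\<^sub>R (x - z) \<in> interior S"
        using K(2) x e S by (intro mem_interior_convex_shrink) auto
      then show "?f z \<in> interior S" by (simp add: algebra_simps)
    qed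
    fix y assume y: "y \<notin> ?f ` K"
    let ?z = "(1/e) *\<^sub>R y + (- (1 - e) / e) *\<^sub>R x"
    have "y = ?f ?z" using e by (simp add: scaleR_add_right) (simp add: algebra_simps)
    then have "?z \<notin> K" using y by blast
    then show "kern k e x y = 0" using K(3) by (simp add: kern_def)
  qed
qed

lemma integral_kernel_on:
  assumes x: "x \<in> S" and e: "0 < e" "e < 1"
  shows "(LINT y|lebesgue_on S. kern k e x y) = 1"
proof -
  have m: "kern k e x \<in> borel_measurable borel"
    by (rule borel_measurable_continuous_onI[OF smooth_continuous[OF smooth_kernel]])
  have "(LINT y|lebesgue_on S. kern k e x y) = (LINT y|lebesgue. (if y \<in> S then kern k e x y else 0))"
    by (rule integral_lebesgue_on(1)[OF S_lebesgue])
  also have "(\<lambda>y. if y \<in> S then kern k e x y else 0) = kern k e x"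
  proof
    fix y
    show "(if y \<in> S then kern k e x y else 0) = kern k e x y"
      using test_functions_eq_0[OF kernel_test_function[OF assms], of y] interior_subset[of S]
      by (cases "y \<in> S") auto
  qed
  also have "(LINT y|lebesgue. kern k e x y) = 1"
    using integral_kernel(1)[OF e(1)] m by (simp add: integral_completion)
  finally show ?thesis .
qed

lemma integrable_kernel_mult:
  assumes "integrable (lebesgue_on S) F"
  shows "integrable (lebesgue_on S) (\<lambda>y. kern k e x y * F y)"
  by (rule integrable_continuous_mult[OF assms S_bounded S_lebesgue smooth_continuous[OF smooth_kernel]])

lemma L2_integrable_on: "F \<in> L2 (lebesgue_on S) \<Longrightarrow> integrable (lebesgue_on S) F"
  for F :: "point \<Rightarrow> 'b::euclidean_space"
  by (rule L2_imp_integrable[OF finite_measure_lebesgue_on[OF S_bounded S_lebesgue]])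

lemma smoothing_eq:
  "smoothing S k e F x = (LINT y|lebesgue_on S. (\<lambda>z. k z * (1 / e\<^sup>2)) ((1/e) *\<^sub>R y + (- (1 - e) / e) *\<^sub>R x) * F y)"
  by (simp add: smoothing_def kern_def)

lemma smooth_smoothing:
  assumes "integrable (lebesgue_on S) F" shows "smooth (smoothing S k e F)"
  unfolding smoothing_eq[abs_def]
  by (rule smooth_integral_parameter[OF _ S_bounded S_lebesgue assms])
    (rule smooth_mult[OF mollifier_smooth smooth_const])

text \<open>The kernel depends on x and y through one affine combination, so its derivative in x is
  -(1 - e) times its derivative in y. The derivative in y is the one that a weak gradient or a weak
  divergence of F can take over.\<close>

lemma gradient_smoothing:
  assumes F: "integrable (lebesgue_on S) F"
  shows "gradient (smoothing S k e F) x $ j = - (1 - e) * (LINT y|lebesgue_on S. gradient (kern k e x) y $ j * F y)"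
proof -
  let ?K = "\<lambda>z. k z * (1 / e\<^sup>2)"
  have K: "smooth ?K" by (rule smooth_mult[OF mollifier_smooth smooth_const])
  have "gradient (kern k e x) y = (1/e) *\<^sub>R gradient ?K ((1/e) *\<^sub>R y + (- (1 - e) / e) *\<^sub>R x)" for y
    using gradient_affine[where a="1/e" and x=y and b="(- (1 - e) / e) *\<^sub>R x", OF smooth_differentiable[OF K]]
    by (simp add: kern_def[abs_def])
  then have "(\<lambda>y. (- (1 - e) / e) * gradient ?K ((1/e) *\<^sub>R y + (- (1 - e) / e) *\<^sub>R x) $ j * F y)
     = (\<lambda>y. - (1 - e) * (gradient (kern k e x) y $ j * F y))"
    by (simp add: fun_eq_iff)
  then show ?thesis
    unfolding smoothing_eq[abs_def]
    by (subst gradient_integral_parameter[OF K S_bounded S_lebesgue F]) simp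
qed

lemma smoothing_diff:
  assumes "integrable (lebesgue_on S) F" "integrable (lebesgue_on S) G"
  shows "smoothing S k e (\<lambda>x. F x - G x) x = smoothing S k e F x - smoothing S k e G x"
  unfolding smoothing_def using integrable_kernel_mult[OF assms(1)] integrable_kernel_mult[OF assms(2)]
  by (simp add: right_diff_distrib)

text \<open>Jensen's inequality for the probability density \<open>kern k e x\<close>: the variance
  of F under it is nonnegative.\<close>

lemma smoothing_square_le:
  assumes F: "F \<in> L2 (lebesgue_on S)" and x: "x \<in> S" and e: "0 < e" "e < 1"
  shows "(smoothing S k e F x)\<^sup>2 \<le> (LINT y|lebesgue_on S. kern k e x y * (F y)\<^sup>2)"
proof -
  let ?M = "lebesgue_on S" and ?m = "smoothing S k e F x"
  have F1: "integrable ?M F" and F2: "integrable ?M (\<lambda>y. (F y)\<^sup>2)"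
    using L2_integrable_on[OF F] L2_integrable_square[OF F] by simp_all
  have c: "integrable ?M (\<lambda>y. 1)"
    by (rule finite_measure.integrable_const[OF finite_measure_lebesgue_on[OF S_bounded S_lebesgue]])
  note i = integrable_kernel_mult[OF F1, of e x] integrable_kernel_mult[OF F2, of e x] integrable_kernel_mult[OF c, of e x]
  have "0 \<le> (LINT y|?M. kern k e x y * (F y - ?m)\<^sup>2)"
    by (intro Bochner_Integration.integral_nonneg) (auto simp: kernel_nonneg)
  also have "\<dots> = (LINT y|?M. kern k e x y * (F y)\<^sup>2 - 2 * ?m * (kern k e x y * F y) + ?m\<^sup>2 * (kern k e x y * 1))"
    by (intro Bochner_Integration.integral_cong) (auto simp: power2_diff algebra_simps)
  also have "\<dots> = (LINT y|?M. kern k e x y * (F y)\<^sup>2) - 2 * ?m * ?m + ?m\<^sup>2"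
    using i integral_kernel_on[OF x e] by (simp add: smoothing_def)
  finally show ?thesis by (simp add: power2_eq_square)
qed

text \<open>After Jensen's inequality, Tonelli's theorem exchanges the integrals, and what remains
  is the mass of the kernel in its first variable.\<close>

lemma L2_norm_smoothing_le:
  assumes F: "F \<in> L2 (lebesgue_on S)" and e: "0 < e" "e < 1"
  shows "L2_norm (lebesgue_on S) (smoothing S k e F) \<le> 1 / (1 - e) * L2_norm (lebesgue_on S) F"
proof -
  let ?M = "lebesgue_on S" and ?s = "smoothing S k e F"
  have F1: "integrable ?M F" and F2: "integrable ?M (\<lambda>y. (F y)\<^sup>2)"
    using L2_integrable_on[OF F] L2_integrable_square[OF F] by simp_all
  have s2: "integrable ?M (\<lambda>x. (?s x)\<^sup>2)"
    using L2_integrable_square[OF L2_smooth[OF smooth_smoothing[OF F1] S_bounded S_lebesgue]] by simp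
  \<comment> \<open>Tonelli's theorem on the Borel product asks for a Borel function, while F is
    only Lebesgue measurable; G is a Borel representative of the square of F extended by
    zero.\<close>
  have "(\<lambda>y. if y \<in> S then (F y)\<^sup>2 else 0) \<in> borel_measurable (completion lborel)"
    using F2 S_lebesgue by (intro borel_measurable_if_I) auto
  then obtain G where G: "G \<in> borel_measurable lborel"
      and FG: "AE y in lborel. (if y \<in> S then (F y)\<^sup>2 else 0) = G y"
    using completion_ex_borel_measurable_real by blast
  have G[measurable]: "G \<in> borel_measurable borel" using G by simp
  have pt: "ennreal ((?s x)\<^sup>2) \<le> (\<integral>\<^sup>+y. ennreal (kern k e x y) * ennreal (G y) \<partial>lborel)" if x: "x \<in> S" for x
  proof -
    have "ennreal ((?s x)\<^sup>2) \<le> ennreal (LINT y|?M. kern k e x y * (F y)\<^sup>2)"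
      by (intro ennreal_leI smoothing_square_le[OF F x e])
    also have "\<dots> = (\<integral>\<^sup>+y. ennreal (kern k e x y * (F y)\<^sup>2) \<partial>?M)"
      by (rule nn_integral_eq_integral[symmetric, OF integrable_kernel_mult[OF F2]]) (simp add: kernel_nonneg)
    also have "\<dots> = (\<integral>\<^sup>+y. ennreal (kern k e x y * (F y)\<^sup>2) * indicator S y \<partial>lborel)"
      using S_lebesgue by (simp add: nn_integral_restrict_space nn_integral_completion)
    also have "\<dots> = (\<integral>\<^sup>+y. ennreal (kern k e x y) * ennreal (G y) \<partial>lborel)"
    proof (rule nn_integral_cong_AE, use FG in eventually_elim)
      fix y assume "(if y \<in> S then (F y)\<^sup>2 else 0) = G y"
      then show "ennreal (kern k e x y * (F y)\<^sup>2) * indicator S y = ennreal (kern k e x y) * ennreal (G y)"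
        by (cases "y \<in> S") (auto simp: ennreal_mult' kernel_nonneg)
    qed
    finally show ?thesis .
  qed
  have "ennreal (LINT x|?M. (?s x)\<^sup>2) = (\<integral>\<^sup>+x. ennreal ((?s x)\<^sup>2) \<partial>?M)"
    by (rule nn_integral_eq_integral[symmetric, OF s2]) simp
  also have "\<dots> = (\<integral>\<^sup>+x. ennreal ((?s x)\<^sup>2) * indicator S x \<partial>lborel)"
    using S_lebesgue by (simp add: nn_integral_restrict_space nn_integral_completion)
  also have "\<dots> \<le> (\<integral>\<^sup>+x. (\<integral>\<^sup>+y. ennreal (kern k e x y) * ennreal (G y) \<partial>lborel) \<partial>lborel)"
    by (intro nn_integral_mono) (auto simp: indicator_def pt)
  also have "\<dots> = (\<integral>\<^sup>+y. (\<integral>\<^sup>+x. ennreal (kern k e x y) * ennreal (G y) \<partial>lborel) \<partial>lborel)"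
  proof (rule lborel_pair.Fubini'[symmetric])
    have "(\<lambda>p. kern k e (fst p) (snd p)) \<in> borel_measurable (lborel \<Otimes>\<^sub>M lborel)"
      using kernel_measurable[of e] by (simp add: case_prod_unfold lborel_prod)
    then show "(\<lambda>(x, y). ennreal (kern k e x y) * ennreal (G y)) \<in> borel_measurable (lborel \<Otimes>\<^sub>M lborel)"
      unfolding case_prod_beta by measurable
  qed
  also have "\<dots> = (\<integral>\<^sup>+y. ennreal (1 / (1 - e)\<^sup>2) * ennreal (G y) \<partial>lborel)"
  proof (rule nn_integral_cong)
    fix y
    have "(\<lambda>x. kern k e x y) \<in> borel_measurable borel"
      unfolding kern_def divide_inverse by (intro borel_measurable_continuous_onI continuous_intros
        continuous_on_compose2[OF smooth_continuous[OF mollifier_smooth, of UNIV]]) auto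
    then show "(\<integral>\<^sup>+x. ennreal (kern k e x y) * ennreal (G y) \<partial>lborel) = ennreal (1 / (1 - e)\<^sup>2) * ennreal (G y)"
      by (subst nn_integral_multc) (auto simp: nn_integral_kernel_first[OF e])
  qed
  also have "\<dots> = ennreal (1 / (1 - e)\<^sup>2) * (\<integral>\<^sup>+y. ennreal (G y) \<partial>lborel)"
    by (rule nn_integral_cmult) measurable
  also have "(\<integral>\<^sup>+y. ennreal (G y) \<partial>lborel) = (\<integral>\<^sup>+y. ennreal ((F y)\<^sup>2) * indicator S y \<partial>lborel)"
  proof (rule nn_integral_cong_AE, use FG in eventually_elim)
    fix y assume "(if y \<in> S then (F y)\<^sup>2 else 0) = G y"
    then show "ennreal (G y) = ennreal ((F y)\<^sup>2) * indicator S y"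
      by (cases "y \<in> S") auto
  qed
  also have "\<dots> = (\<integral>\<^sup>+y. ennreal ((F y)\<^sup>2) \<partial>?M)"
    using S_lebesgue by (simp add: nn_integral_restrict_space nn_integral_completion)
  also have "\<dots> = ennreal (LINT y|?M. (F y)\<^sup>2)"
    by (rule nn_integral_eq_integral[OF F2]) simp
  also have "ennreal (1 / (1 - e)\<^sup>2) * ennreal (LINT y|?M. (F y)\<^sup>2) = ennreal (1 / (1 - e)\<^sup>2 * (LINT y|?M. (F y)\<^sup>2))"
    by (rule ennreal_mult'[symmetric]) simp
  finally have "ennreal (LINT x|?M. (?s x)\<^sup>2) \<le> ennreal (1 / (1 - e)\<^sup>2 * (LINT y|?M. (F y)\<^sup>2))" .
  then have "(LINT x|?M. (?s x)\<^sup>2) \<le> 1 / (1 - e)\<^sup>2 * (LINT y|?M. (F y)\<^sup>2)"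
    by (rule ennreal_le_iff[THEN iffD1, rotated]) simp
  then have "(L2_norm ?M ?s)\<^sup>2 \<le> (1 / (1 - e) * L2_norm ?M F)\<^sup>2"
    by (simp add: L2_norm_square_integral power_mult_distrib power_divide)
  then show ?thesis by (rule power2_le_imp_le) (use e in simp)
qed

end

text \<open>F is truncated to the interval from -N to N, and the truncation is an almost everywhere
  limit of continuous functions. Dominated convergence handles both approximations; clamping the
  continuous functions to the same interval provides the constant majorant for the second.\<close>

lemma L2_dense_continuous:
  fixes F :: "'a::euclidean_space \<Rightarrow> real"
  assumes S: "bounded S" "S \<in> sets lebesgue" and F: "F \<in> L2 (lebesgue_on S)" and d: "0 < d"
  obtains g where "continuous_on UNIV g" "L2_norm (lebesgue_on S) (\<lambda>x. F x - g x) < d"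
proof -
  let ?M = "lebesgue_on S"
  have Fm[measurable]: "F \<in> borel_measurable ?M" and F2: "integrable ?M (\<lambda>x. (F x)\<^sup>2)"
    using L2_measurable[OF F] L2_integrable_square[OF F] by simp_all
  define T where "T N x = max (- real N) (min (real N) (F x))" for N x
  have Tm[measurable]: "T N \<in> borel_measurable ?M" for N unfolding T_def by measurable
  have "(\<lambda>N. LINT x|?M. (F x - T N x)\<^sup>2) \<longlonglongrightarrow> (LINT x|?M. 0)"
  proof (rule integral_dominated_convergence[where w="\<lambda>x. (F x)\<^sup>2"])
    show "AE x in ?M. (\<lambda>N. (F x - T N x)\<^sup>2) \<longlonglongrightarrow> 0"
    proof (rule AE_I2)
      fix x
      obtain N0 where "\<bar>F x\<bar> \<le> real N0" using real_arch_simple by blast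
      then have "eventually (\<lambda>N. 0 = (F x - T N x)\<^sup>2) sequentially"
        by (intro eventually_sequentiallyI[of N0]) (auto simp: T_def max_def min_def)
      then show "(\<lambda>N. (F x - T N x)\<^sup>2) \<longlonglongrightarrow> 0" by (rule Lim_transform_eventually[OF tendsto_const])
    qed
    show "AE x in ?M. norm ((F x - T N x)\<^sup>2) \<le> (F x)\<^sup>2" for N
      by (rule AE_I2) (auto simp: T_def max_def min_def intro!: abs_le_square_iff[THEN iffD1])
  qed (use F2 in measurable)
  then have "(\<lambda>N. LINT x|?M. (F x - T N x)\<^sup>2) \<longlonglongrightarrow> 0" by simp
  from order_tendstoD(2)[OF this, of "(d/2)\<^sup>2"] d
  obtain N where N: "(LINT x|?M. (F x - T N x)\<^sup>2) < (d/2)\<^sup>2"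
    by (auto simp: eventually_sequentially)
  have N': "L2_norm ?M (\<lambda>x. F x - T N x) < d/2"
    using N d by (intro power2_less_imp_less[of _ "d/2"]) (auto simp: L2_norm_square_integral)
  have "(\<lambda>x. if x \<in> S then T N x else 0) \<in> borel_measurable lebesgue"
    by (rule borel_measurable_if_I[OF Tm S(2)])
  from lebesgue_measurable_imp_measurable_on[OF this S(2)]
  obtain X g where X: "negligible X" and gc: "\<And>n. continuous_on UNIV (g n)"
    and gl: "\<And>x. x \<notin> X \<Longrightarrow> (\<lambda>n. g n x) \<longlonglongrightarrow> (if x \<in> S then if x \<in> S then T N x else 0 else 0)"
    unfolding measurable_on_def by blast
  define h where "h n x = max (- real N) (min (real N) (g n x))" for n x
  have hc: "continuous_on UNIV (h n)" for n
    unfolding h_def by (intro continuous_intros gc)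
  have hm[measurable]: "h n \<in> borel_measurable ?M" for n
    by (rule continuous_imp_measurable_on_sets_lebesgue[OF continuous_on_subset[OF hc subset_UNIV] S(2)])
  have "(\<lambda>n. LINT x|?M. (T N x - h n x)\<^sup>2) \<longlonglongrightarrow> (LINT x|?M. 0)"
  proof (rule integral_dominated_convergence[where w="\<lambda>x. (2 * real N)\<^sup>2"])
    show "AE x in ?M. (\<lambda>n. (T N x - h n x)\<^sup>2) \<longlonglongrightarrow> 0"
    proof -
      have "AE x in lebesgue. x \<notin> X" using X by (intro AE_not_in) (simp add: negligible_iff_null_sets)
      then have "AE x in lebesgue. x \<in> S \<longrightarrow> (\<lambda>n. (T N x - h n x)\<^sup>2) \<longlonglongrightarrow> 0"
      proof eventually_elim
        case (elim x)
        show ?case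
        proof
          assume "x \<in> S"
          with gl[OF elim] have "(\<lambda>n. g n x) \<longlonglongrightarrow> T N x" by simp
          then have "(\<lambda>n. h n x) \<longlonglongrightarrow> max (- real N) (min (real N) (T N x))"
            unfolding h_def by (intro tendsto_max tendsto_min tendsto_const)
          also have "max (- real N) (min (real N) (T N x)) = T N x" by (auto simp: T_def)
          finally have "(\<lambda>n. (T N x - h n x)\<^sup>2) \<longlonglongrightarrow> (T N x - T N x)\<^sup>2"
            by (intro tendsto_intros)
          then show "(\<lambda>n. (T N x - h n x)\<^sup>2) \<longlonglongrightarrow> 0" by simp
        qed
      qed
      then show ?thesis using S(2) by (simp add: AE_restrict_space_iff)
    qed
    show "AE x in ?M. norm ((T N x - h n x)\<^sup>2) \<le> (2 * real N)\<^sup>2" for n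
    proof (rule AE_I2)
      fix x
      have "\<bar>T N x - h n x\<bar> \<le> 2 * real N" by (auto simp: T_def h_def max_def min_def)
      from power_mono[OF this abs_ge_zero, of 2] show "norm ((T N x - h n x)\<^sup>2) \<le> (2 * real N)\<^sup>2" by simp
    qed
    show "integrable ?M (\<lambda>x. (2 * real N)\<^sup>2)"
      by (rule finite_measure.integrable_const[OF finite_measure_lebesgue_on[OF S]])
  qed measurable
  then have "(\<lambda>n. LINT x|?M. (T N x - h n x)\<^sup>2) \<longlonglongrightarrow> 0" by simp
  from order_tendstoD(2)[OF this, of "(d/2)\<^sup>2"] d
  obtain n where n: "(LINT x|?M. (T N x - h n x)\<^sup>2) < (d/2)\<^sup>2"
    by (auto simp: eventually_sequentially)
  have n': "L2_norm ?M (\<lambda>x. T N x - h n x) < d/2"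
    using n d by (intro power2_less_imp_less[of _ "d/2"]) (auto simp: L2_norm_square_integral)
  have TL: "T N \<in> L2 ?M"
    by (rule L2_bounded[OF finite_measure_lebesgue_on[OF S] Tm, where B="real N"]) (auto simp: T_def)
  have "L2_norm ?M (\<lambda>x. F x - h n x) < d"
    using L2_norm_triangle_diff[OF F TL L2_continuous[OF hc S], of n] N' n' by linarith
  with hc show ?thesis by (rule that)
qed

context
  fixes S :: "point set" and k :: scalar_field
  assumes S: "compact S" "convex S" and k: "mollifier S k"
begin

text \<open>The kernel at x is supported within distance \<open>e * diameter S\<close> of x, so
  uniform continuity of g on S bounds the deviation of the average from g x.\<close>

lemma smoothing_continuous_close:
  assumes g: "continuous_on UNIV g" and d: "0 < d"
  obtains e0 where "0 < e0" "\<And>e. 0 < e \<Longrightarrow> e < e0 \<Longrightarrow> e < 1 \<Longrightarrow>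
    L2_norm (lebesgue_on S) (\<lambda>x. smoothing S k e g x - g x) \<le> d"
proof -
  let ?M = "lebesgue_on S"
  let ?c = "L2_norm ?M (\<lambda>x. 1::real)"
  note S_leb = S_lebesgue[OF S k] and S_bdd = S_bounded[OF S k]
  have gL: "g \<in> L2 ?M" by (rule L2_continuous[OF g S_bdd S_leb])
  have gi: "integrable ?M g" by (rule L2_integrable_on[OF S k gL])
  have oneL: "(\<lambda>x. 1::real) \<in> L2 ?M" by (rule L2_continuous[OF _ S_bdd S_leb]) simp
  have onei: "integrable ?M (\<lambda>x. 1::real)" by (rule L2_integrable_on[OF S k oneL])
  define r where "r = d / (?c + 1)"
  have c0: "0 \<le> ?c" by simp
  have r: "0 < r" "r * ?c \<le> d"
  proof -
    have c1: "0 < ?c + 1" using c0 by linarith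
    then show "0 < r" unfolding r_def using d by (rule divide_pos_pos[rotated])
    have "d * ?c \<le> d * (?c + 1)" using d by (intro mult_left_mono) linarith+
    then show "r * ?c \<le> d" unfolding r_def using c1 by (simp add: divide_le_eq)
  qed
  have "uniformly_continuous_on S g"
    by (rule compact_uniformly_continuous[OF continuous_on_subset[OF g subset_UNIV] S(1)])
  then obtain w where w: "0 < w" and uc: "\<And>x y. x \<in> S \<Longrightarrow> y \<in> S \<Longrightarrow> dist y x < w \<Longrightarrow> dist (g y) (g x) < r"
    using r(1) unfolding uniformly_continuous_on_def by metis
  have D: "0 \<le> diameter S" by (rule diameter_ge_0[OF S_bdd])
  show ?thesis
  proof (rule that[of "w / (diameter S + 1)"])
    show "0 < w / (diameter S + 1)" using w D by simp
    fix e :: real assume e: "0 < e" "e < w / (diameter S + 1)" "e < 1"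
    have ew: "e * diameter S < w" using e D by (simp add: field_simps)
    have pt: "\<bar>smoothing S k e g x - g x\<bar> \<le> r" if x: "x \<in> S" for x
    proof -
      note ik = integrable_kernel_mult[OF S k gi, of e x] integrable_kernel_mult[OF S k onei, of e x]
      have eq: "smoothing S k e g x - g x = (LINT y|?M. kern k e x y * (g y - g x))"
        unfolding smoothing_def using ik integral_kernel_on[OF S k x e(1,3)] by (simp add: right_diff_distrib)
      have "\<bar>smoothing S k e g x - g x\<bar> \<le> (LINT y|?M. \<bar>kern k e x y * (g y - g x)\<bar>)"
        unfolding eq by (rule integral_abs_bound)
      also have "\<dots> \<le> (LINT y|?M. kern k e x y * r)"
      proof (rule integral_mono')
        show "integrable ?M (\<lambda>y. kern k e x y * r)" using ik(2) by simp
        fix y assume "y \<in> space ?M"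
        then have y: "y \<in> S" by (simp add: space_restrict_space)
        show "\<bar>kern k e x y * (g y - g x)\<bar> \<le> kern k e x y * r"
        proof (cases "kern k e x y = 0")
          case False
          then obtain z where z: "z \<in> S" "y = (1 - e) *\<^sub>R x + e *\<^sub>R z"
            using kernel_support[OF S k False e(1)] by blast
          have "y - x = e *\<^sub>R (z - x)" using z(2) by (simp add: algebra_simps)
          then have "dist y x = e * dist z x" using e(1) by (simp add: dist_norm)
          also have "\<dots> \<le> e * diameter S"
            using diameter_bounded_bound[OF S_bdd z(1) x] e(1) by simp
          finally have "dist (g y) (g x) < r" using ew uc[OF x y] by simp
          then show ?thesis
            using kernel_nonneg[OF S k, of e x y] by (simp add: abs_mult dist_real_def mult_left_mono)
        qed simp
        show "0 \<le> kern k e x y * r" using kernel_nonneg[OF S k, of e x y] r(1) by simp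
      qed
      also have "\<dots> = r" using integral_kernel_on[OF S k x e(1,3)] by simp
      finally show ?thesis .
    qed
    have sm: "smoothing S k e g \<in> L2 ?M"
      by (rule L2_smooth[OF smooth_smoothing[OF S k gi] S_bdd S_leb])
    have "L2_norm ?M (\<lambda>x. smoothing S k e g x - g x) \<le> r * ?c"
    proof (rule L2_norm_mono[OF L2_measurable[OF L2_diff[OF sm gL]] oneL])
      show "AE x in ?M. norm (smoothing S k e g x - g x) \<le> r * norm (1::real)"
        by (rule AE_I2) (simp add: space_restrict_space pt)
    qed (use r in simp)
    with r(2) show "L2_norm ?M (\<lambda>x. smoothing S k e g x - g x) \<le> d" by simp
  qed
qed

text \<open>A continuous g close to F is changed little by smoothing, and the difference of F and g
  is amplified at most by the operator bound.\<close>

lemma smoothing_tendsto: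
  assumes F: "F \<in> L2 (lebesgue_on S)"
  shows "(\<lambda>n. L2_norm (lebesgue_on S) (\<lambda>x. smoothing S k (1 / (real n + 2)) F x - F x)) \<longlonglongrightarrow> 0"
proof (rule LIMSEQ_I)
  fix d :: real assume d: "0 < d"
  let ?M = "lebesgue_on S" and ?s = "\<lambda>n. smoothing S k (1 / (real n + 2))"
  note S_leb = S_lebesgue[OF S k] and S_bdd = S_bounded[OF S k]
  have L2s: "?s n G \<in> L2 ?M" if "G \<in> L2 ?M" for n G
    by (rule L2_smooth[OF smooth_smoothing[OF S k L2_integrable_on[OF S k that]] S_bdd S_leb])
  obtain g where gc: "continuous_on UNIV g" and gF: "L2_norm ?M (\<lambda>x. F x - g x) < d/8"
    using L2_dense_continuous[OF S_bdd S_leb F, of "d/8"] d by auto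
  have g: "g \<in> L2 ?M" by (rule L2_continuous[OF gc S_bdd S_leb])
  obtain e0 where e0: "0 < e0" and close: "\<And>e. 0 < e \<Longrightarrow> e < e0 \<Longrightarrow> e < 1 \<Longrightarrow>
    L2_norm ?M (\<lambda>x. smoothing S k e g x - g x) \<le> d/4"
    using smoothing_continuous_close[OF gc, of "d/4"] d by auto
  obtain n0 :: nat where n0: "1 / e0 < real n0" using reals_Archimedean2 by blast
  show "\<exists>no. \<forall>n\<ge>no. norm (L2_norm ?M (\<lambda>x. ?s n F x - F x) - 0) < d"
  proof (intro exI allI impI)
    fix n assume n: "n0 \<le> n"
    let ?e = "1 / (real n + 2)"
    have "1 / e0 < real n + 2" using n0 n by linarith
    then have e: "0 < ?e" "?e < e0" "?e < 1" using e0 by (auto simp: field_simps)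
    \<comment> \<open>The shift by 2 keeps \<open>?e\<close> at most 1/2, so the operator bound is
      uniform in n.\<close>
    have e2: "1 / (1 - ?e) \<le> 2" by (simp add: field_simps)
    have sd: "L2_norm ?M (\<lambda>x. ?s n F x - ?s n g x) \<le> 2 * L2_norm ?M (\<lambda>x. F x - g x)"
    proof -
      have "(\<lambda>x. ?s n F x - ?s n g x) = ?s n (\<lambda>x. F x - g x)"
        using smoothing_diff[OF S k L2_integrable_on[OF S k F] L2_integrable_on[OF S k g]] by auto
      then have "L2_norm ?M (\<lambda>x. ?s n F x - ?s n g x) \<le> 1 / (1 - ?e) * L2_norm ?M (\<lambda>x. F x - g x)"
        using L2_norm_smoothing_le[OF S k L2_diff[OF F g] e(1,3)] by simp
      also have "\<dots> \<le> 2 * L2_norm ?M (\<lambda>x. F x - g x)" by (rule mult_right_mono[OF e2]) simp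
      finally show ?thesis .
    qed
    have "L2_norm ?M (\<lambda>x. ?s n F x - F x) \<le> L2_norm ?M (\<lambda>x. ?s n F x - ?s n g x) + L2_norm ?M (\<lambda>x. ?s n g x - F x)"
      by (rule L2_norm_triangle_diff[OF L2s[OF F] L2s[OF g] F])
    moreover have "L2_norm ?M (\<lambda>x. ?s n g x - F x) \<le> L2_norm ?M (\<lambda>x. ?s n g x - g x) + L2_norm ?M (\<lambda>x. g x - F x)"
      by (rule L2_norm_triangle_diff[OF L2s[OF g] g F])
    moreover have "L2_norm ?M (\<lambda>x. g x - F x) < d/8" using gF L2_norm_minus_commute[of ?M g F] by simp
    \<comment> \<open>The three contributions are at most d/4, d/4 and d/8.\<close>
    ultimately have "L2_norm ?M (\<lambda>x. ?s n F x - F x) < d" using sd gF close[OF e] d by linarith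
    then show "norm (L2_norm ?M (\<lambda>x. ?s n F x - F x) - 0) < d" by simp
  qed
qed

end

text \<open>The smoothing of F at a point of S is a test of F against a kernel and hence zero. Since
  the smoothings also converge to F, the norm of F is zero.\<close>

lemma fundamental_lemma:
  fixes F :: scalar_field
  assumes S: "compact S" "convex S" "interior S \<noteq> {}" and F: "F \<in> L2 (lebesgue_on S)"
    and zero: "\<And>\<phi>. \<phi> \<in> test_functions (interior S) \<Longrightarrow> (LINT x|lebesgue_on S. F x * \<phi> x) = 0"
  shows "AE x in lebesgue_on S. F x = 0"
proof -
  obtain k where k: "mollifier S k" using mollifier_exists[OF S(3)] .
  let ?M = "lebesgue_on S" and ?s = "\<lambda>n. smoothing S k (1 / (real n + 2))"
  have "L2_norm ?M (\<lambda>x. ?s n F x - F x) = L2_norm ?M F" for n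
  proof -
    have "?s n F x = 0" if "x \<in> S" for x
      using zero[OF kernel_test_function[OF S(1,2) k that, of "1 / (real n + 2)"]]
      by (simp add: smoothing_def mult.commute)
    then have "AE x in ?M. ?s n F x - F x = - F x"
      by (intro AE_I2) (simp add: space_restrict_space)
    moreover have "?s n F \<in> L2 ?M"
      by (rule L2_smooth[OF smooth_smoothing[OF S(1,2) k L2_integrable_on[OF S(1,2) k F]] S_bounded[OF S(1,2) k] S_lebesgue[OF S(1,2) k]])
    ultimately have "L2_norm ?M (\<lambda>x. ?s n F x - F x) = L2_norm ?M (\<lambda>x. - F x)"
      using F by (intro L2_norm_cong_AE) (auto dest!: L2_measurable)
    then show ?thesis by (simp add: L2_norm_uminus)
  qed
  with smoothing_tendsto[OF S(1,2) k F] have "L2_norm ?M F = 0"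
    by (simp add: LIMSEQ_const_iff)
  then show ?thesis using L2_norm_zero_iff[OF F] by simp
qed

subsection \<open>Weak gradients\<close>

text \<open>By translation invariance the increments of f over a step h in direction i integrate to
  zero. Uniform differentiability identifies the increment with h times the derivative up to e h on
  a fixed ball; division by h leaves a bound proportional to the arbitrary number e.\<close>

lemma integral_gradient_eq_0:
  assumes f: "Ck 1 f" and K: "compact K" "\<And>x. x \<notin> K \<Longrightarrow> f x = 0"
  shows "(LINT x|lebesgue. gradient f x $ i) = 0"
proof -
  have gK: "gradient f x = 0" if "x \<notin> K" for x
    by (rule gradient_eq_0_outside[OF compact_imp_closed[OF K(1)] K(2) that])
  have fc: "continuous_on UNIV f" using Ck_imp_continuous[OF f] .
  have gc: "continuous_on UNIV (\<lambda>x. gradient f x $ i)"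
    using C1_gradient_continuous[OF f] by (intro continuous_intros)
  have fm: "f \<in> borel_measurable borel" and gm: "(\<lambda>x. gradient f x $ i) \<in> borel_measurable borel"
    using fc gc by (auto intro: borel_measurable_continuous_onI)
  have fi: "integrable lborel f"
  proof -
    have "(\<lambda>x. indicat_real K x *\<^sub>R f x) = f" using K(2) by (auto simp: indicator_def fun_eq_iff)
    with borel_integrable_compact[OF K(1) continuous_on_subset[OF fc subset_UNIV]] show ?thesis by simp
  qed
  have gi: "integrable lborel (\<lambda>x. gradient f x $ i)"
  proof -
    have "(\<lambda>x. indicat_real K x *\<^sub>R gradient f x $ i) = (\<lambda>x. gradient f x $ i)"
      using gK by (auto simp: indicator_def fun_eq_iff)
    with borel_integrable_compact[OF K(1) continuous_on_subset[OF gc subset_UNIV]] show ?thesis by simp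
  qed
  let ?I = "LINT x|lborel. gradient f x $ i"
  obtain R where R: "0 < R" "K \<subseteq> ball 0 R"
    using bounded_subset_ballD[OF compact_imp_bounded[OF K(1)], of 0] by auto
  let ?B = "cball (0::point) (R + 1)"
  let ?m = "measure lborel ?B"
  have "\<bar>?I\<bar> \<le> e * (?m + 1)" if e: "0 < e" for e
  proof -
    obtain d where d: "0 < d" and D: "\<And>z h. z \<in> ?B \<Longrightarrow> norm h < d \<Longrightarrow>
        \<bar>f (z + h) - f z - gradient f z \<bullet> h\<bar> \<le> e * norm h"
      using C1_uniform_differentiability[OF f e] by blast
    \<comment> \<open>The bound h < 1 keeps the support of f and its translate inside the ball of
      radius R + 1.\<close>
    define h where "h = min (d/2) (1/2)"
    have h: "0 < h" "h < d" "h < 1" using d by (auto simp: h_def)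
    have nh: "norm (h *\<^sub>R axis i 1 :: point) = h" using h by simp
    have shift: "(LINT x|lborel. f (x + h *\<^sub>R axis i 1)) = (LINT x|lborel. f x)"
      and si: "integrable lborel (\<lambda>x. f (x + h *\<^sub>R axis i 1))"
      using integral_lborel_affine[OF _ fm, of 1 "h *\<^sub>R axis i 1"]
        integrable_lborel_affine[OF _ fm fi, of 1 "h *\<^sub>R axis i 1"] by (simp_all add: add.commute)
    have eq: "h * ?I = - (LINT x|lborel. f (x + h *\<^sub>R axis i 1) - f x - gradient f x \<bullet> (h *\<^sub>R axis i 1))"
      using shift si fi gi by (simp add: inner_axis)
    have "\<bar>h * ?I\<bar> \<le> (LINT x|lborel. \<bar>f (x + h *\<^sub>R axis i 1) - f x - gradient f x \<bullet> (h *\<^sub>R axis i 1)\<bar>)"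
      unfolding eq abs_minus_cancel by (rule integral_abs_bound)
    also have "\<dots> \<le> (LINT x|lborel. (e * h) * indicator ?B x)"
    proof (rule integral_mono')
      show "integrable lborel (\<lambda>x. (e * h) * indicator ?B x)"
        by (intro integrable_mult_right integrable_real_indicator) (use emeasure_bounded_finite[OF bounded_cball] in auto)
      fix x
      show "\<bar>f (x + h *\<^sub>R axis i 1) - f x - gradient f x \<bullet> (h *\<^sub>R axis i 1)\<bar> \<le> (e * h) * indicator ?B x"
      proof (cases "x \<in> ?B")
        case True
        then show ?thesis using D[of x "h *\<^sub>R axis i 1"] h(2) nh by simp
      next
        case False
        have "norm x \<le> norm (x + h *\<^sub>R axis i 1) + h"
          using norm_triangle_ineq4[of "x + h *\<^sub>R axis i 1" "h *\<^sub>R axis i 1"] nh by simp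
        then have "x + h *\<^sub>R axis i 1 \<notin> K" "x \<notin> K" using False R(2) h(3) by auto
        then show ?thesis using False K(2) gK by simp
      qed
    qed (use e h in simp)
    also have "\<dots> = (e * h) * ?m" by simp
    also have "\<dots> \<le> (e * h) * (?m + 1)" using e h by (intro mult_left_mono) auto
    finally have "h * \<bar>?I\<bar> \<le> h * (e * (?m + 1))"
      using h by (simp add: abs_mult mult_ac)
    then show ?thesis using h by simp
  qed
  note bound = this
  have "?I = 0"
  proof (rule ccontr)
    assume "?I \<noteq> 0"
    define m where "m = ?m + 1"
    have m: "0 < m" unfolding m_def using measure_nonneg[of lborel ?B] by linarith
    have "0 < \<bar>?I\<bar> / (2 * m)" using \<open>?I \<noteq> 0\<close> m by simp
    from bound[OF this] have "\<bar>?I\<bar> \<le> \<bar>?I\<bar> / 2" using m unfolding m_def[symmetric] by simp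
    with \<open>?I \<noteq> 0\<close> show False by simp
  qed
  then show ?thesis using gm by (simp add: integral_completion)
qed

definition bounded_open :: "point set \<Rightarrow> bool" where
  "bounded_open U \<longleftrightarrow> open U \<and> bounded U"

lemma bounded_openD: "bounded_open U \<Longrightarrow> open U" "bounded_open U \<Longrightarrow> bounded U"
  "bounded_open U \<Longrightarrow> U \<in> sets lebesgue"
  by (auto simp: bounded_open_def)

lemma integral_test_function_mono:
  fixes h :: "point \<Rightarrow> real"
  assumes "U \<in> sets lebesgue" "V \<in> sets lebesgue" "U \<subseteq> V" "\<And>x. x \<in> V - U \<Longrightarrow> h x = 0"
  shows "(LINT x|lebesgue_on U. h x) = (LINT x|lebesgue_on V. h x)"
proof -
  have "(\<lambda>x. if x \<in> U then h x else 0) = (\<lambda>x. if x \<in> V then h x else 0)"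
    using assms by (auto simp: fun_eq_iff)
  then show ?thesis using assms by (simp add: integral_lebesgue_on(1))
qed

lemma L2_test_function:
  assumes "bounded U" "U \<in> sets lebesgue" "\<phi> \<in> test_functions V"
  shows "\<phi> \<in> L2 (lebesgue_on U)" "(\<lambda>x. gradient \<phi> x $ i) \<in> L2 (lebesgue_on U)"
    "gradient \<phi> \<in> L2 (lebesgue_on U)"
  using L2_smooth L2_gradient_smooth test_functions_smooth[OF assms(3)] assms smooth_gradient by blast+

lemma L2_C1:
  assumes "Ck 1 f" "bounded U" "U \<in> sets lebesgue"
  shows "f \<in> L2 (lebesgue_on U)" "gradient f \<in> L2 (lebesgue_on U)"
  by (rule L2_continuous[OF Ck_imp_continuous[OF assms(1)] assms(2,3)],
      rule L2_continuous[OF C1_gradient_continuous[OF assms(1)] assms(2,3)])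

text \<open>The product of f and \<phi> has compact support in U, so its derivatives integrate to
  zero over the plane, and the product rule does the rest. Only C1 regularity is asked for, which
  covers the stream functions built later.\<close>

lemma is_weak_gradient_C1:
  assumes f: "Ck 1 f" and U: "bounded_open U"
  shows "is_weak_gradient U f (gradient f)"
  unfolding is_weak_gradient_def
proof (intro conjI ballI allI)
  note U' = bounded_openD[OF U]
  show "gradient f \<in> L2 (lebesgue_on U)" by (rule L2_C1[OF f U'(2,3)])
  fix \<phi> i assume t: "\<phi> \<in> test_functions U"
  then obtain K where K: "compact K" "K \<subseteq> U" "\<And>x. x \<notin> K \<Longrightarrow> \<phi> x = 0" and \<phi>: "smooth \<phi>"
    unfolding test_functions_def by blast
  note L = L2_test_function[OF U'(2,3) t] L2_C1[OF f U'(2,3)]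
  have gr: "gradient (\<lambda>x. f x * \<phi> x) x = f x *\<^sub>R gradient \<phi> x + \<phi> x *\<^sub>R gradient f x" for x
    by (rule gradient_mult[OF C1_differentiable[OF f] smooth_differentiable[OF \<phi>]])
  have "(LINT x|lebesgue_on U. f x * gradient \<phi> x $ i) + (LINT x|lebesgue_on U. gradient f x $ i * \<phi> x)
    = (LINT x|lebesgue_on U. f x * gradient \<phi> x $ i + gradient f x $ i * \<phi> x)"
    using L2_mult_integrable[OF L(4) L(2)] L2_mult_integrable[OF L2_nth[OF L(5)] L(1)] by simp
  also have "\<dots> = (LINT x|lebesgue_on U. gradient (\<lambda>x. f x * \<phi> x) x $ i)"
    by (intro Bochner_Integration.integral_cong refl, subst gr) (simp add: mult.commute)
  also have "\<dots> = (LINT x|lebesgue_on UNIV. gradient (\<lambda>x. f x * \<phi> x) x $ i)"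
    using U' test_functions_eq_0[OF t] test_functions_gradient_eq_0[OF t]
    by (intro integral_test_function_mono) (auto simp: gr)
  also have "\<dots> = 0"
    unfolding lebesgue_on_UNIV_eq
    by (rule integral_gradient_eq_0[OF Ck_mult[OF f smooth_Ck[OF \<phi>]] K(1)]) (simp add: K(3))
  finally show "(LINT x|lebesgue_on U. f x * gradient \<phi> x $ i) = - (LINT x|lebesgue_on U. gradient f x $ i * \<phi> x)"
    by simp
qed

lemma is_weak_gradient_L2: "is_weak_gradient U v G \<Longrightarrow> G \<in> L2 (lebesgue_on U)"
  by (simp add: is_weak_gradient_def)

lemma is_weak_gradientD:
  "is_weak_gradient U v G \<Longrightarrow> \<phi> \<in> test_functions U \<Longrightarrow>
    (LINT x|lebesgue_on U. v x * gradient \<phi> x $ i) = - (LINT x|lebesgue_on U. G x $ i * \<phi> x)"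
  by (simp add: is_weak_gradient_def)

lemma H1_weak_gradient: "v \<in> H1 U \<Longrightarrow> is_weak_gradient U v (weak_gradient U v)"
  unfolding H1_def weak_gradient_def using someI_ex[of "is_weak_gradient U v"] by blast

lemma H1_L2: "v \<in> H1 U \<Longrightarrow> v \<in> L2 (lebesgue_on U)"
  by (simp add: H1_def)

lemma H1I: "v \<in> L2 (lebesgue_on U) \<Longrightarrow> is_weak_gradient U v G \<Longrightarrow> v \<in> H1 U"
  by (auto simp: H1_def)

lemma weak_gradient_L2: "v \<in> H1 U \<Longrightarrow> weak_gradient U v \<in> L2 (lebesgue_on U)"
  by (rule is_weak_gradient_L2[OF H1_weak_gradient])

lemma is_weak_gradient_restrict:
  assumes w: "is_weak_gradient U v G" and UV: "bounded_open U" "bounded_open V" "V \<subseteq> U"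
  shows "is_weak_gradient V v G"
  unfolding is_weak_gradient_def
proof (intro conjI ballI allI)
  show "G \<in> L2 (lebesgue_on V)"
    by (rule L2_lebesgue_on_subset[OF _ _ UV(3) is_weak_gradient_L2[OF w]]) (use UV bounded_openD in auto)
  fix \<phi> i assume t: "\<phi> \<in> test_functions V"
  then have t': "\<phi> \<in> test_functions U" using test_functions_mono[OF UV(3)] by blast
  have "(LINT x|lebesgue_on V. v x * gradient \<phi> x $ i) = (LINT x|lebesgue_on U. v x * gradient \<phi> x $ i)"
    using UV bounded_openD test_functions_gradient_eq_0[OF t] by (intro integral_test_function_mono) auto
  moreover have "(LINT x|lebesgue_on V. G x $ i * \<phi> x) = (LINT x|lebesgue_on U. G x $ i * \<phi> x)"
    using UV bounded_openD test_functions_eq_0[OF t] by (intro integral_test_function_mono) auto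
  ultimately show "(LINT x|lebesgue_on V. v x * gradient \<phi> x $ i) = - (LINT x|lebesgue_on V. G x $ i * \<phi> x)"
    using is_weak_gradientD[OF w t'] by simp
qed

lemma is_weak_gradient_linear:
  assumes v: "v \<in> L2 (lebesgue_on U)" "is_weak_gradient U v G"
    and w: "w \<in> L2 (lebesgue_on U)" "is_weak_gradient U w H" and U: "bounded_open U"
  shows "is_weak_gradient U (\<lambda>x. a * v x + b * w x) (\<lambda>x. a *\<^sub>R G x + b *\<^sub>R H x)"
  unfolding is_weak_gradient_def
proof (intro conjI ballI allI)
  note G = is_weak_gradient_L2[OF v(2)] and H = is_weak_gradient_L2[OF w(2)]
  show "(\<lambda>x. a *\<^sub>R G x + b *\<^sub>R H x) \<in> L2 (lebesgue_on U)" by (intro L2_add L2_scaleR G H)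
  fix \<phi> i assume t: "\<phi> \<in> test_functions U"
  note L = L2_test_function[OF bounded_openD(2)[OF U] bounded_openD(3)[OF U] t]
  note i = L2_mult_integrable[OF v(1) L(2)] L2_mult_integrable[OF w(1) L(2)]
    L2_mult_integrable[OF L2_nth[OF G] L(1)] L2_mult_integrable[OF L2_nth[OF H] L(1)]
  show "(LINT x|lebesgue_on U. (a * v x + b * w x) * gradient \<phi> x $ i)
     = - (LINT x|lebesgue_on U. (a *\<^sub>R G x + b *\<^sub>R H x) $ i * \<phi> x)"
    using i is_weak_gradientD[OF v(2) t, of i] is_weak_gradientD[OF w(2) t, of i]
    by (simp add: distrib_right mult.assoc)
qed

lemma is_weak_gradient_cong_AE:
  assumes w: "is_weak_gradient U v G" and v: "v \<in> borel_measurable (lebesgue_on U)"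
    and U: "bounded_open U"
    and ae: "AE x in lebesgue_on U. v x = v' x" "AE x in lebesgue_on U. G x = G' x"
  shows "is_weak_gradient U v' G'"
  unfolding is_weak_gradient_def
proof (intro conjI ballI allI)
  note U' = bounded_openD[OF U]
  note G = is_weak_gradient_L2[OF w]
  show G': "G' \<in> L2 (lebesgue_on U)" by (rule L2_lebesgue_on_cong_AE[OF U'(3) G ae(2)])
  have v': "v' \<in> borel_measurable (lebesgue_on U)"
    by (rule borel_measurable_lebesgue_on_cong_AE[OF U'(3) v ae(1)])
  fix \<phi> i assume t: "\<phi> \<in> test_functions U"
  note m = L2_measurable[OF L2_test_function(1)[OF U'(2,3) t]] L2_measurable[OF L2_test_function(2)[OF U'(2,3) t]]
    L2_measurable[OF L2_nth[OF G]] L2_measurable[OF L2_nth[OF G']]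
  have "(LINT x|lebesgue_on U. v' x * gradient \<phi> x $ i) = (LINT x|lebesgue_on U. v x * gradient \<phi> x $ i)"
    using ae(1) by (intro integral_cong_AE borel_measurable_times v v' m) auto
  moreover have "(LINT x|lebesgue_on U. G' x $ i * \<phi> x) = (LINT x|lebesgue_on U. G x $ i * \<phi> x)"
    using ae(2) by (intro integral_cong_AE borel_measurable_times m) auto
  ultimately show "(LINT x|lebesgue_on U. v' x * gradient \<phi> x $ i) = - (LINT x|lebesgue_on U. G' x $ i * \<phi> x)"
    using is_weak_gradientD[OF w t] by simp
qed

definition convex_body :: "point set \<Rightarrow> bool" where
  "convex_body S \<longleftrightarrow> compact S \<and> convex S \<and> interior S \<noteq> {}"

lemma convex_bodyD:
  assumes "convex_body S"
  shows "compact S" "convex S" "interior S \<noteq> {}" "bounded S" "closed S" "S \<in> sets lebesgue"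
    "interior S \<in> sets lebesgue" "negligible (S - interior S)" "bounded_open (interior S)"
proof -
  show S: "compact S" "convex S" "interior S \<noteq> {}" using assms by (auto simp: convex_body_def)
  show "bounded S" "closed S" using S by (auto simp: compact_imp_bounded compact_imp_closed)
  then show "S \<in> sets lebesgue" using S by (simp add: lmeasurable_compact fmeasurableD)
  show "interior S \<in> sets lebesgue" by simp
  have "S - interior S \<subseteq> frontier S" unfolding frontier_def using closure_subset by blast
  then show "negligible (S - interior S)"
    using negligible_convex_frontier[OF S(2)] negligible_subset by blast
  show "bounded_open (interior S)"
    using \<open>bounded S\<close> by (auto simp: bounded_open_def bounded_interior)
qed

context
  fixes S assumes S: "convex_body S"
begin

text \<open>The boundary of a convex set is a null set. In this form open and closed elements are
  interchanged from here on.\<close>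

lemma interior_null_change:
  shows "integral\<^sup>L (lebesgue_on (interior S)) f = integral\<^sup>L (lebesgue_on S) (f :: point \<Rightarrow> 'b::euclidean_space)"
    and "h \<in> L2 (lebesgue_on (interior S)) \<longleftrightarrow> (h :: point \<Rightarrow> 'b) \<in> L2 (lebesgue_on S)"
    and "(AE x in lebesgue_on (interior S). P x) \<longleftrightarrow> (AE x in lebesgue_on S. P x)"
    and "h \<in> borel_measurable (lebesgue_on (interior S)) \<longleftrightarrow> h \<in> borel_measurable (lebesgue_on S)"
proof -
  note a = convex_bodyD(7)[OF S] convex_bodyD(6)[OF S] interior_subset convex_bodyD(8)[OF S]
  show "integral\<^sup>L (lebesgue_on (interior S)) f = integral\<^sup>L (lebesgue_on S) f"
    by (rule integral_lebesgue_on_null_change[OF a])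
  show "h \<in> L2 (lebesgue_on (interior S)) \<longleftrightarrow> h \<in> L2 (lebesgue_on S)"
    by (rule L2_lebesgue_on_null_change[OF a])
  show "(AE x in lebesgue_on (interior S). P x) \<longleftrightarrow> (AE x in lebesgue_on S. P x)"
    by (rule AE_lebesgue_on_null_change[OF a])
  show "h \<in> borel_measurable (lebesgue_on (interior S)) \<longleftrightarrow> h \<in> borel_measurable (lebesgue_on S)"
    by (rule borel_measurable_lebesgue_on_null_change[OF a])
qed

lemma fundamental_lemma_body:
  fixes F :: scalar_field
  assumes "F \<in> L2 (lebesgue_on S)"
    "\<And>\<phi>. \<phi> \<in> test_functions (interior S) \<Longrightarrow> (LINT x|lebesgue_on S. F x * \<phi> x) = 0"
  shows "AE x in lebesgue_on S. F x = 0"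
  using fundamental_lemma[OF convex_bodyD(1-3)[OF S]] assms by blast

text \<open>\<open>weak_gradient\<close> is a chosen representative, so every concrete computation
  of it rests on uniqueness, which is the fundamental lemma for the components of G - H.\<close>

lemma is_weak_gradient_unique:
  assumes v: "is_weak_gradient (interior S) v G" and w: "is_weak_gradient (interior S) w H"
    and m: "v \<in> borel_measurable (lebesgue_on S)" and vw: "AE x in lebesgue_on S. v x = w x"
  shows "AE x in lebesgue_on S. G x = H x"
proof -
  let ?M = "lebesgue_on S"
  have v': "is_weak_gradient (interior S) w G"
    by (rule is_weak_gradient_cong_AE[OF v _ convex_bodyD(9)[OF S]])
      (use m vw in \<open>simp_all add: interior_null_change\<close>)
  have G: "G \<in> L2 ?M" and H: "H \<in> L2 ?M"
    using is_weak_gradient_L2[OF v] is_weak_gradient_L2[OF w] by (simp_all add: interior_null_change)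
  have "AE x in ?M. (G x - H x) $ i = 0" for i
  proof (rule fundamental_lemma_body[OF L2_nth[OF L2_diff[OF G H]]])
    fix \<phi> assume t: "\<phi> \<in> test_functions (interior S)"
    note \<phi> = L2_test_function(1)[OF convex_bodyD(4)[OF S] convex_bodyD(6)[OF S] t]
    have "(LINT x|?M. G x $ i * \<phi> x) = (LINT x|?M. H x $ i * \<phi> x)"
      using is_weak_gradientD[OF v' t, of i] is_weak_gradientD[OF w t, of i]
      by (simp add: interior_null_change)
    then show "(LINT x|?M. (G x - H x) $ i * \<phi> x) = 0"
      using L2_mult_integrable[OF L2_nth[OF G] \<phi>] L2_mult_integrable[OF L2_nth[OF H] \<phi>]
      by (simp add: left_diff_distrib)
  qed
  from this[of 1] this[of 2] show ?thesis
    by eventually_elim (simp add: vec_eq_iff forall_2)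
qed

lemma weak_gradient_eq:
  assumes "is_weak_gradient (interior S) v G" "v \<in> L2 (lebesgue_on S)"
  shows "AE x in lebesgue_on S. weak_gradient (interior S) v x = G x"
proof -
  have "v \<in> H1 (interior S)" using assms by (auto intro: H1I simp: interior_null_change)
  from is_weak_gradient_unique[OF H1_weak_gradient[OF this] assms(1)] show ?thesis
    using assms(2) by (auto dest: L2_measurable)
qed

lemma weak_gradient_C1:
  assumes "Ck 1 f" shows "AE x in lebesgue_on S. weak_gradient (interior S) f x = gradient f x"
  by (rule weak_gradient_eq[OF is_weak_gradient_C1[OF assms convex_bodyD(9)[OF S]] L2_C1(1)[OF assms convex_bodyD(4)[OF S] convex_bodyD(6)[OF S]]])

lemma H1_C1: "Ck 1 f \<Longrightarrow> f \<in> H1 (interior S)"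
  by (rule H1I[OF L2_C1(1) is_weak_gradient_C1]) (use convex_bodyD[OF S] in \<open>auto simp: bounded_interior\<close>)

lemma weak_gradient_diff:
  assumes "v \<in> H1 (interior S)" "w \<in> H1 (interior S)"
  shows "AE x in lebesgue_on S. weak_gradient (interior S) (\<lambda>x. v x - w x) x
      = weak_gradient (interior S) v x - weak_gradient (interior S) w x"
    and "(\<lambda>x. v x - w x) \<in> H1 (interior S)"
proof -
  have "is_weak_gradient (interior S) (\<lambda>x. 1 * v x + (-1) * w x)
      (\<lambda>x. 1 *\<^sub>R weak_gradient (interior S) v x + (-1) *\<^sub>R weak_gradient (interior S) w x)"
    by (intro is_weak_gradient_linear H1_weak_gradient H1_L2 assms convex_bodyD(9)[OF S])
  then have g: "is_weak_gradient (interior S) (\<lambda>x. v x - w x)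
      (\<lambda>x. weak_gradient (interior S) v x - weak_gradient (interior S) w x)" by simp
  have L: "(\<lambda>x. v x - w x) \<in> L2 (lebesgue_on (interior S))" by (intro L2_diff H1_L2 assms)
  show "(\<lambda>x. v x - w x) \<in> H1 (interior S)" by (rule H1I[OF L g])
  show "AE x in lebesgue_on S. weak_gradient (interior S) (\<lambda>x. v x - w x) x
      = weak_gradient (interior S) v x - weak_gradient (interior S) w x"
    by (rule weak_gradient_eq[OF g]) (use L in \<open>simp add: interior_null_change\<close>)
qed

text \<open>At every point of S the gradient of the smoothing of v is 1 - e times the smoothing of
  G, because the kernels are test functions of the interior. Convergence of the gradients on all of
  S follows from that of the smoothings.\<close>

lemma H1_smooth_approximation:
  assumes "is_weak_gradient (interior S) v G" "v \<in> L2 (lebesgue_on S)"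
  obtains \<phi> where "\<And>n::nat. smooth (\<phi> n)"
    "(\<lambda>n. L2_norm (lebesgue_on S) (\<lambda>x. \<phi> n x - v x)) \<longlonglongrightarrow> 0"
    "(\<lambda>n. L2_norm (lebesgue_on S) (\<lambda>x. gradient (\<phi> n) x - G x)) \<longlonglongrightarrow> 0"
proof -
  note S' = convex_bodyD[OF S]
  obtain k where k: "mollifier S k" using mollifier_exists[OF S'(3)] .
  let ?M = "lebesgue_on S" and ?e = "\<lambda>n. 1 / (real n + 2)"
  let ?\<phi> = "\<lambda>n. smoothing S k (?e n) v"
  have G: "G \<in> L2 ?M" using is_weak_gradient_L2[OF assms(1)] by (simp add: interior_null_change)
  note vi = L2_integrable_on[OF S'(1,2) k assms(2)]
  have gr: "gradient (?\<phi> n) x $ i = (1 - ?e n) * smoothing S k (?e n) (\<lambda>x. G x $ i) x" if "x \<in> S" for n x i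
  proof -
    have t: "kern k (?e n) x \<in> test_functions (interior S)"
      by (rule kernel_test_function[OF S'(1,2) k that]) simp_all
    have "gradient (?\<phi> n) x $ i = - (1 - ?e n) * (LINT y|?M. v y * gradient (kern k (?e n) x) y $ i)"
      by (subst gradient_smoothing[OF S'(1,2) k vi]) (simp add: mult.commute)
    then show ?thesis
      using is_weak_gradientD[OF assms(1) t, of i]
      by (simp add: interior_null_change smoothing_def mult.commute) (simp add: algebra_simps)
  qed
  have Gi: "(\<lambda>x. G x $ i) \<in> L2 ?M" for i by (rule L2_nth[OF G])
  have sm: "smooth (smoothing S k (?e n) (\<lambda>x. G x $ i))" for n i
    by (rule smooth_smoothing[OF S'(1,2) k L2_integrable_on[OF S'(1,2) k Gi]])
  have sL: "smoothing S k (?e n) (\<lambda>x. G x $ i) \<in> L2 ?M" for n i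
    by (rule L2_smooth[OF sm S'(4,6)])
  \<comment> \<open>Componentwise gradient error: the smoothing error of G weighted by 1 - e, and
    the part - e G caused by the contraction factor.\<close>
  let ?d = "\<lambda>n i x. (1 - ?e n) *\<^sub>R (smoothing S k (?e n) (\<lambda>x. G x $ i) x - G x $ i) + (- ?e n) *\<^sub>R (G x $ i)"
  have dL: "?d n i \<in> L2 ?M" for n i by (intro L2_add L2_scaleR L2_diff sL Gi)
  have dlim: "(\<lambda>n. L2_norm ?M (?d n i)) \<longlonglongrightarrow> 0" for i
  proof (rule Lim_null_comparison[OF always_eventually, rule_format])
    show "norm (L2_norm ?M (?d n i)) \<le> L2_norm ?M (\<lambda>x. smoothing S k (?e n) (\<lambda>x. G x $ i) x - G x $ i) + ?e n * L2_norm ?M (\<lambda>x. G x $ i)" for n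
    proof -
      have "L2_norm ?M (?d n i) \<le> (1 - ?e n) * L2_norm ?M (\<lambda>x. smoothing S k (?e n) (\<lambda>x. G x $ i) x - G x $ i) + ?e n * L2_norm ?M (\<lambda>x. G x $ i)"
        using L2_norm_triangle[OF L2_scaleR[OF L2_diff[OF sL Gi], of "1 - ?e n" n i i] L2_scaleR[OF Gi, of "- ?e n" i]]
        by (simp add: L2_norm_scaleR del: scaleR_minus_left real_scaleR_def)
      also have "(1 - ?e n) * L2_norm ?M (\<lambda>x. smoothing S k (?e n) (\<lambda>x. G x $ i) x - G x $ i)
          \<le> 1 * L2_norm ?M (\<lambda>x. smoothing S k (?e n) (\<lambda>x. G x $ i) x - G x $ i)"
        by (rule mult_right_mono) simp_all
      finally show ?thesis by simp
    qed
    have "(\<lambda>n. 1 / real (n + 2)) \<longlonglongrightarrow> 0" by (rule LIMSEQ_ignore_initial_segment[OF lim_1_over_n])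
    then have e0: "?e \<longlonglongrightarrow> 0" by (simp add: add.commute)
    show "(\<lambda>n. L2_norm ?M (\<lambda>x. smoothing S k (?e n) (\<lambda>x. G x $ i) x - G x $ i) + ?e n * L2_norm ?M (\<lambda>x. G x $ i)) \<longlonglongrightarrow> 0"
      using tendsto_add[OF smoothing_tendsto[OF S'(1,2) k Gi] tendsto_mult[OF e0 tendsto_const]] by simp
  qed
  show ?thesis
  proof (rule that[of ?\<phi>])
    show smv: "smooth (?\<phi> n)" for n by (rule smooth_smoothing[OF S'(1,2) k vi])
    show "(\<lambda>n. L2_norm ?M (\<lambda>x. ?\<phi> n x - v x)) \<longlonglongrightarrow> 0"
      by (rule smoothing_tendsto[OF S'(1,2) k assms(2)])
    show "(\<lambda>n. L2_norm ?M (\<lambda>x. gradient (?\<phi> n) x - G x)) \<longlonglongrightarrow> 0"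
    proof (rule Lim_null_comparison[OF always_eventually, rule_format])
      show "(\<lambda>n. L2_norm ?M (?d n 1) + L2_norm ?M (?d n 2)) \<longlonglongrightarrow> 0"
        using tendsto_add[OF dlim[of 1] dlim[of 2]] by simp
      fix n
      have lin: "bounded_linear (\<lambda>y::real. y *\<^sub>R (axis j 1 :: point))" for j
        by (rule bounded_linear_scaleR_left)
      have nax: "L2_norm ?M (\<lambda>x. ?d n i x *\<^sub>R (axis j 1 :: point)) = L2_norm ?M (?d n i)" for i j
        by (simp add: L2_norm_def L2_inner_def inner_axis')
      have "AE x in ?M. gradient (?\<phi> n) x - G x = ?d n 1 x *\<^sub>R axis 1 1 + ?d n 2 x *\<^sub>R axis 2 1"
        by (rule AE_I2) (simp add: space_restrict_space gr vec_eq_iff forall_2 axis_def algebra_simps)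
      then have "L2_norm ?M (\<lambda>x. gradient (?\<phi> n) x - G x)
          = L2_norm ?M (\<lambda>x. ?d n 1 x *\<^sub>R axis 1 1 + ?d n 2 x *\<^sub>R axis 2 1 :: point)"
        by (intro L2_norm_cong_AE L2_measurable L2_diff L2_gradient_smooth smv S'(4,6) G
            L2_add L2_bounded_linear[OF lin dL])
      also have "\<dots> \<le> L2_norm ?M (?d n 1) + L2_norm ?M (?d n 2)"
        using L2_norm_triangle[OF L2_bounded_linear[OF lin[of 1] dL[of n 1]] L2_bounded_linear[OF lin[of 2] dL[of n 2]]]
        unfolding nax .
      finally show "norm (L2_norm ?M (\<lambda>x. gradient (?\<phi> n) x - G x)) \<le> L2_norm ?M (?d n 1) + L2_norm ?M (?d n 2)"
        by simp
    qed
  qed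
qed

end

lemma weak_gradient_smooth_AE:
  assumes S: "convex_body S" and q: "smooth q" and v: "AE x in lebesgue_on S. v x = q x"
  shows "v \<in> H1 (interior S)" "AE x in lebesgue_on S. weak_gradient (interior S) v x = gradient q x"
proof -
  note S' = convex_bodyD[OF S]
  have qL: "q \<in> L2 (lebesgue_on S)" by (rule L2_smooth[OF q S'(4,6)])
  have v': "AE x in lebesgue_on S. q x = v x" using v by eventually_elim simp
  have vL: "v \<in> L2 (lebesgue_on S)" by (rule L2_lebesgue_on_cong_AE[OF S'(6) qL v'])
  have w: "is_weak_gradient (interior S) v (gradient q)"
    by (rule is_weak_gradient_cong_AE[OF is_weak_gradient_C1[OF smooth_Ck[OF q] S'(9)] _ S'(9)])
      (use qL v' in \<open>simp_all add: interior_null_change[OF S] L2_measurable\<close>)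
  show "v \<in> H1 (interior S)" by (rule H1I[OF _ w]) (simp add: interior_null_change[OF S] vL)
  show "AE x in lebesgue_on S. weak_gradient (interior S) v x = gradient q x"
    by (rule weak_gradient_eq[OF S w vL])
qed

subsection \<open>The divergence theorem on a triangle\<close>

lemma Basis_point: "(Basis :: point set) = {axis 1 1, axis 2 1}"
  by (auto simp: Basis_vec_def UNIV_2)

definition plane_point :: "real \<Rightarrow> real \<Rightarrow> point" where
  "plane_point s t = s *\<^sub>R axis 1 1 + t *\<^sub>R axis 2 1"

lemma plane_point_nth [simp]: "plane_point s t $ 1 = s" "plane_point s t $ 2 = t"
  by (simp_all add: plane_point_def axis_def)

text \<open>Iterated integration refers to pairs, whereas points are vectors of type
  \<open>real^2\<close>. The two measures agree on boxes and are therefore equal.\<close>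

lemma lborel_plane:
  "(lborel :: point measure) = distr (lborel \<Otimes>\<^sub>M lborel) borel (\<lambda>(s, t). plane_point s t)"
proof (rule lborel_eqI)
  have m: "(\<lambda>(s, t). plane_point s t) \<in> borel_measurable (lborel \<Otimes>\<^sub>M lborel)"
    unfolding lborel_prod plane_point_def case_prod_beta
    by (simp, intro borel_measurable_continuous_onI continuous_intros)
  fix l u :: point assume lu: "\<And>b. b \<in> Basis \<Longrightarrow> l \<bullet> b \<le> u \<bullet> b"
  have lu': "l $ 1 \<le> u $ 1" "l $ 2 \<le> u $ 2"
    using lu[of "axis 1 1"] lu[of "axis 2 1"] by (simp_all add: Basis_point inner_axis)
  have v: "(\<lambda>(s, t). plane_point s t) -` box l u \<inter> space (lborel \<Otimes>\<^sub>M lborel) = box (l $ 1) (u $ 1) \<times> box (l $ 2) (u $ 2)"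
    by (auto simp: mem_box_cart forall_2 space_pair_measure)
  have "emeasure (distr (lborel \<Otimes>\<^sub>M lborel) borel (\<lambda>(s, t). plane_point s t)) (box l u)
      = emeasure (lborel \<Otimes>\<^sub>M lborel) (box (l $ 1) (u $ 1) \<times> box (l $ 2) (u $ 2))"
    by (subst emeasure_distr[OF m]) (auto simp: v)
  also have "\<dots> = emeasure lborel (box (l $ 1) (u $ 1)) * emeasure lborel (box (l $ 2) (u $ 2))"
    by (rule lborel.emeasure_pair_measure_Times) auto
  also have "\<dots> = ennreal (u $ 1 - l $ 1) * ennreal (u $ 2 - l $ 2)"
    using lu' by simp
  also have "\<dots> = ennreal (prod ((\<bullet>) (u - l)) Basis)"
    using lu' by (simp add: Basis_point axis_eq_axis inner_axis ennreal_mult)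
  finally show "emeasure (distr (lborel \<Otimes>\<^sub>M lborel) borel (\<lambda>(s, t). plane_point s t)) (box l u)
      = ennreal (prod ((\<bullet>) (u - l)) Basis)" .
qed simp

section \<open>Integration over the reference triangle and its affine images\<close>

definition reference_triangle :: "point set" where
  "reference_triangle = {y. 0 \<le> y $ 1 \<and> 0 \<le> y $ 2 \<and> y $ 1 + y $ 2 \<le> 1}"

lemma compact_reference_triangle: "compact reference_triangle"
proof -
  have "closed reference_triangle"
    unfolding reference_triangle_def
    by (intro closed_Collect_conj closed_Collect_le continuous_intros)
  moreover have "reference_triangle \<subseteq> cbox 0 1"
    by (auto simp: reference_triangle_def mem_box_cart forall_2)
  ultimately show ?thesis using bounded_cbox bounded_subset compact_eq_bounded_closed by blast
qed

lemma compact_lebesgue: "compact S \<Longrightarrow> S \<in> sets lebesgue"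
  for S :: "'a::euclidean_space set"
  by (simp add: lmeasurable_compact fmeasurableD)

lemma integral_lebesgue_on_lborel:
  fixes d :: "'a::euclidean_space \<Rightarrow> real"
  assumes "d \<in> borel_measurable borel" "S \<in> sets borel"
  shows "(LINT y|lebesgue_on S. d y) = (LINT y|lborel. indicator S y * d y)"
proof -
  have "(LINT y|lebesgue_on S. d y) = (LINT y|lebesgue. indicator S y *\<^sub>R d y)"
    using assms(2) by (subst integral_restrict_space) (auto intro: sets_completionI_sets)
  also have "\<dots> = (LINT y|lborel. indicator S y *\<^sub>R d y)"
    using assms by (intro integral_completion) simp
  finally show ?thesis by simp
qed

text \<open>The slice at height t is the interval from 0 to 1 - t, on which the fundamental theorem
  of calculus leaves the values on the slanted and on the left edge.\<close>

lemma integral_reference_triangle: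
  assumes d: "continuous_on UNIV d" and \<phi>: "continuous_on UNIV \<phi>"
    and deriv: "\<And>s t. ((\<lambda>s. \<phi> (plane_point s t)) has_real_derivative d (plane_point s t)) (at s)"
  shows "(LINT y|lebesgue_on reference_triangle. d y)
       = (LINT t|lebesgue_on {0..1}. \<phi> (plane_point (1 - t) t) - \<phi> (plane_point 0 t))"
proof -
  let ?R = reference_triangle
  let ?h = "\<lambda>y. indicator ?R y * d y"
  have dm: "d \<in> borel_measurable borel" by (rule borel_measurable_continuous_onI[OF d])
  have R: "?R \<in> sets borel" using compact_reference_triangle by (rule borel_compact)
  have hm: "?h \<in> borel_measurable borel" using dm R by measurable
  have m: "(\<lambda>(s, t). plane_point s t) \<in> borel_measurable (lborel \<Otimes>\<^sub>M lborel)"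
    unfolding lborel_prod plane_point_def case_prod_beta
    by (simp, intro borel_measurable_continuous_onI continuous_intros)
  have hi: "integrable lborel ?h"
    using borel_integrable_compact[OF compact_reference_triangle continuous_on_subset[OF d subset_UNIV]] by simp
  have hi': "integrable (lborel \<Otimes>\<^sub>M lborel) (\<lambda>(s, t). ?h (plane_point s t))"
    using hi unfolding lborel_plane
    by (subst (asm) integrable_distr_eq[OF m hm]) (simp add: case_prod_unfold)
  have "(LINT y|lebesgue_on ?R. d y) = (LINT y|lborel. ?h y)"
    by (rule integral_lebesgue_on_lborel[OF dm R])
  also have "\<dots> = (LINT (s, t)|(lborel \<Otimes>\<^sub>M lborel). ?h (plane_point s t))"
    unfolding lborel_plane by (subst integral_distr[OF m hm]) (simp add: case_prod_unfold)
  also have "\<dots> = (LBINT t. LBINT s. ?h (plane_point s t))"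
    by (rule lborel_pair.integral_snd[symmetric, OF hi'])
  also have "\<dots> = (LBINT t. indicator {0..1} t * (\<phi> (plane_point (1 - t) t) - \<phi> (plane_point 0 t)))"
  proof (rule Bochner_Integration.integral_cong[OF refl])
    fix t
    show "(LBINT s. ?h (plane_point s t)) = indicator {0..1} t * (\<phi> (plane_point (1 - t) t) - \<phi> (plane_point 0 t))"
    proof (cases "t \<in> {0..1}")
      case True
      have "(LBINT s. ?h (plane_point s t)) = (LBINT s. d (plane_point s t) * indicator {0..1 - t} s)"
        using True by (intro Bochner_Integration.integral_cong) (auto simp: reference_triangle_def indicator_def)
      also have "\<dots> = \<phi> (plane_point (1 - t) t) - \<phi> (plane_point 0 t)"
      proof (rule integral_FTC_Icc_real)
        have "continuous_on UNIV (\<lambda>s. d (plane_point s t))"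
          unfolding plane_point_def by (intro continuous_on_compose2[OF d] continuous_intros) auto
        then show "isCont (\<lambda>s. d (plane_point s t)) x" for x by (simp add: continuous_on_eq_continuous_at)
      qed (use True deriv in auto)
      finally show ?thesis using True by simp
    next
      case False
      then have "?h (plane_point s t) = 0" for s by (auto simp: reference_triangle_def indicator_def)
      then have h0: "(\<lambda>s. ?h (plane_point s t)) = (\<lambda>s. 0)" by blast
      show ?thesis unfolding h0 using False by simp
    qed
  qed
  also have "\<dots> = (LINT t|lebesgue_on {0..1}. \<phi> (plane_point (1 - t) t) - \<phi> (plane_point 0 t))"
  proof (rule integral_lebesgue_on_lborel[symmetric])
    have c: "continuous_on UNIV (\<lambda>t. \<phi> (plane_point (1 - t) t) - \<phi> (plane_point 0 t))"
      unfolding plane_point_def by (intro continuous_on_diff continuous_on_compose2[OF \<phi>] continuous_intros) auto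
    show "(\<lambda>t. \<phi> (plane_point (1 - t) t) - \<phi> (plane_point 0 t)) \<in> borel_measurable borel"
      by (rule borel_measurable_continuous_onI[OF c])
  qed simp
  finally show ?thesis .
qed

lemma integral_affine_image:
  fixes h :: "point \<Rightarrow> real" and L :: "point \<Rightarrow> point"
  assumes L: "linear L" "inj L" and S: "compact S" and h: "continuous_on UNIV h"
  shows "(LINT x|lebesgue_on ((\<lambda>y. a + L y) ` S). h x) = \<bar>det (matrix L)\<bar> * (LINT y|lebesgue_on S. h (a + L y))"
proof -
  let ?g = "\<lambda>y. a + L y"
  \<comment> \<open>The change of variables formula is applied to fields with values in
    \<open>real^1\<close>; \<open>eq\<close> below brings the integrals back to real
    functions.\<close>
  let ?f = "\<lambda>x. h x *\<^sub>R axis 1 1 :: real^1"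
  have Lc: "continuous_on A L" for A using L(1) by (simp add: linear_continuous_on linear_linear)
  have gc: "continuous_on A ?g" for A by (intro continuous_intros Lc)
  have gS: "compact (?g ` S)" by (rule compact_continuous_image[OF gc S])
  have hg: "continuous_on UNIV (\<lambda>y. h (?g y))" by (rule continuous_on_compose2[OF h gc]) auto
  have ai: "(\<lambda>x. k x *\<^sub>R axis 1 1 :: real^1) absolutely_integrable_on A"
    and ii: "integrable (lebesgue_on A) k"
    if "compact A" "continuous_on UNIV k" for A :: "point set" and k :: "point \<Rightarrow> real"
  proof -
    have A: "bounded A" "A \<in> sets lebesgue" using that by (auto simp: compact_imp_bounded compact_lebesgue)
    show "integrable (lebesgue_on A) k"
      by (rule L2_imp_integrable[OF finite_measure_lebesgue_on[OF A] L2_continuous[OF that(2) A]])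
    have c: "continuous_on UNIV (\<lambda>x. k x *\<^sub>R axis 1 1 :: real^1)" by (intro continuous_intros that)
    have "integrable (lebesgue_on A) (\<lambda>x. k x *\<^sub>R axis 1 1 :: real^1)"
      by (rule L2_imp_integrable[OF finite_measure_lebesgue_on[OF A] L2_continuous[OF c A]])
    moreover have "integrable (lebesgue_on A) (\<lambda>x. norm (k x *\<^sub>R axis 1 1 :: real^1))"
      using calculation by (rule integrable_norm)
    ultimately show "(\<lambda>x. k x *\<^sub>R axis 1 1 :: real^1) absolutely_integrable_on A"
      using A(2) by (auto simp: absolutely_integrable_measurable o_def)
  qed
  have eq: "integral A (\<lambda>x. k x *\<^sub>R axis 1 1 :: real^1) = (LINT x|lebesgue_on A. k x) *\<^sub>R axis 1 1"
    if "compact A" "continuous_on UNIV k" for A :: "point set" and k :: "point \<Rightarrow> real"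
  proof -
    have "(k has_integral (LINT x|lebesgue_on A. k x)) A"
      by (rule has_integral_integral_lebesgue_on[OF ii[OF that] compact_lebesgue[OF that(1)]])
    then show ?thesis by (intro integral_unique has_integral_scaleR_left)
  qed
  have "(\<lambda>x. \<bar>det (matrix L)\<bar> *\<^sub>R ?f (?g x)) absolutely_integrable_on S \<and>
           integral S (\<lambda>x. \<bar>det (matrix L)\<bar> *\<^sub>R ?f (?g x)) = integral (?g ` S) ?f
     \<longleftrightarrow> ?f absolutely_integrable_on (?g ` S) \<and> integral (?g ` S) ?f = integral (?g ` S) ?f"
  proof (rule has_absolute_integral_change_of_variables[OF compact_lebesgue[OF S]])
    have "(L has_derivative L) (at x within S)" for x
      using L(1) by (simp add: linear_imp_has_derivative)
    then show "(?g has_derivative L) (at x within S)" for x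
      by (auto intro!: derivative_eq_intros)
    show "inj_on ?g S" using L(2) by (auto simp: inj_on_def)
  qed
  then have "integral (?g ` S) ?f = integral S (\<lambda>x. \<bar>det (matrix L)\<bar> *\<^sub>R ?f (?g x))"
    using ai[OF gS h] by simp
  also have "\<dots> = \<bar>det (matrix L)\<bar> *\<^sub>R integral S (\<lambda>x. ?f (?g x))"
    by (rule integral_cmul)
  finally have "(LINT x|lebesgue_on (?g ` S). h x) *\<^sub>R (axis 1 1 :: real^1)
      = (\<bar>det (matrix L)\<bar> * (LINT y|lebesgue_on S. h (?g y))) *\<^sub>R axis 1 1"
    unfolding eq[OF gS h] eq[OF S hg] by simp
  then show ?thesis by (simp add: axis_eq_0_iff)
qed

section \<open>Averages along segments and the gradient theorem on a triangle\<close>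

definition segment_average :: "point \<Rightarrow> point \<Rightarrow> scalar_field \<Rightarrow> real" where
  "segment_average p q f = (LINT t|lebesgue_on {0..1}. f (linepath p q t))"

text \<open>Twice the signed area of the triangle \<open>a b c\<close>.\<close>

definition orient :: "point \<Rightarrow> point \<Rightarrow> point \<Rightarrow> real" where
  "orient a b c = (b - a) $ 1 * (c - a) $ 2 - (b - a) $ 2 * (c - a) $ 1"

lemma orient_swap: "orient a c b = - orient a b c"
  by (simp add: orient_def)

lemma triangle_image:
  "convex hull {a, b, c} = (\<lambda>y. a + (y $ 1 *\<^sub>R (b - a) + y $ 2 *\<^sub>R (c - a))) ` reference_triangle"
proof -
  have "x \<in> (\<lambda>y. a + (y $ 1 *\<^sub>R (b - a) + y $ 2 *\<^sub>R (c - a))) ` reference_triangle"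
    if "x = a + u *\<^sub>R (b - a) + v *\<^sub>R (c - a)" "0 \<le> u" "0 \<le> v" "u + v \<le> 1" for x u v
    by (rule image_eqI[of _ _ "plane_point u v"]) (use that in \<open>auto simp: reference_triangle_def add.assoc\<close>)
  moreover have "a + (y $ 1 *\<^sub>R (b - a) + y $ 2 *\<^sub>R (c - a)) \<in> {a + u *\<^sub>R (b - a) + v *\<^sub>R (c - a) | u v. 0 \<le> u \<and> 0 \<le> v \<and> u + v \<le> 1}"
    if "y \<in> reference_triangle" for y
    using that unfolding reference_triangle_def
    by (intro CollectI exI[of _ "y $ 1"] exI[of _ "y $ 2"]) (simp add: add.assoc)
  ultimately show ?thesis unfolding convex_hull_3_alt by blast
qed

text \<open>The substitution of 1 - t for t. It matters because the direction of a chosen edge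
  parametrization is unknown.\<close>

lemma segment_average_reverse:
  assumes "continuous_on UNIV f"
  shows "segment_average q p f = segment_average p q f"
proof -
  have c: "continuous_on UNIV (\<lambda>t. f (linepath p q t))" for p q
    unfolding linepath_def by (intro continuous_on_compose2[OF assms] continuous_intros) auto
  have m: "(\<lambda>t. f (linepath p q t)) \<in> borel_measurable borel" for p q
    by (rule borel_measurable_continuous_onI[OF c])
  have "segment_average q p f = (LBINT t. indicator {0..1} t * f (linepath q p t))"
    unfolding segment_average_def by (rule integral_lebesgue_on_lborel[OF m]) simp
  also have "\<dots> = \<bar>-1\<bar> *\<^sub>R (LBINT t. indicator {0..1} (1 + (-1) * t) * f (linepath q p (1 + (-1) * t)))"
    by (rule lborel_integral_real_affine) simp
  also have "\<dots> = (LBINT t. indicator {0..1} t * f (linepath p q t))"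
    by (auto intro!: Bochner_Integration.integral_cong simp: linepath_def indicator_def algebra_simps)
  also have "\<dots> = segment_average p q f"
    unfolding segment_average_def by (rule integral_lebesgue_on_lborel[OF m, symmetric]) simp
  finally show ?thesis .
qed

lemma integrable_segment:
  assumes "continuous_on UNIV f"
  shows "integrable (lebesgue_on {0..1}) (\<lambda>t. f (linepath p q t) :: real)"
proof -
  have c: "continuous_on UNIV (\<lambda>t. f (linepath p q t))"
    unfolding linepath_def by (intro continuous_on_compose2[OF assms] continuous_intros) auto
  show ?thesis
    by (rule L2_imp_integrable[OF finite_measure_lebesgue_on L2_continuous[OF c]]) auto
qed

text \<open>In the affine coordinates of the reference triangle b - a is the first direction, so the
  slices run from the edge between a and c to the edge between b and c, and only these two
  contribute. The factor is the Jacobian.\<close>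

lemma integral_directional_derivative:
  assumes f: "Ck 1 f" and abc: "orient a b c \<noteq> 0"
  shows "(LINT x|lebesgue_on (convex hull {a, b, c}). gradient f x \<bullet> (b - a))
       = \<bar>orient a b c\<bar> * (segment_average b c f - segment_average a c f)"
proof -
  let ?L = "\<lambda>y::point. y $ 1 *\<^sub>R (b - a) + y $ 2 *\<^sub>R (c - a)"
  let ?d = "\<lambda>x. gradient f x \<bullet> (b - a)"
  have L: "linear ?L" by (rule linearI) (simp_all add: algebra_simps)
  have m: "matrix ?L $ i $ j = (if j = 1 then (b - a) $ i else (c - a) $ i)" for i j
    using exhaust_2[of j] by (auto simp: matrix_def axis_def)
  have det: "det (matrix ?L) = orient a b c"
    by (simp add: det_2 m orient_def mult.commute)
  have inj: "inj ?L"
    unfolding det_nz_iff_inj[OF L, symmetric] det by (rule abc)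
  have fc: "continuous_on UNIV f" by (rule Ck_imp_continuous[OF f])
  have gc: "continuous_on UNIV ?d" by (intro continuous_intros C1_gradient_continuous f)
  have Lc: "continuous_on UNIV (\<lambda>y. a + ?L y)" by (intro continuous_intros)
  have "(LINT x|lebesgue_on (convex hull {a, b, c}). ?d x)
      = \<bar>orient a b c\<bar> * (LINT y|lebesgue_on reference_triangle. ?d (a + ?L y))"
    unfolding triangle_image using integral_affine_image[OF L inj compact_reference_triangle gc, of a] det by simp
  also have "(LINT y|lebesgue_on reference_triangle. ?d (a + ?L y))
      = (LINT t|lebesgue_on {0..1}. f (a + ?L (plane_point (1 - t) t)) - f (a + ?L (plane_point 0 t)))"
  proof (rule integral_reference_triangle)
    show "continuous_on UNIV (\<lambda>y. ?d (a + ?L y))" by (rule continuous_on_compose2[OF gc Lc]) auto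
    show "continuous_on UNIV (\<lambda>y. f (a + ?L y))" by (rule continuous_on_compose2[OF fc Lc]) auto
    fix s t
    have "((\<lambda>s. a + ?L (plane_point s t)) has_derivative (\<lambda>h. h *\<^sub>R (b - a))) (at s)"
      by (auto intro!: derivative_eq_intros)
    from has_derivative_compose[OF this has_derivative_gradient[OF C1_differentiable[OF f]]]
    show "((\<lambda>s. f (a + ?L (plane_point s t))) has_real_derivative ?d (a + ?L (plane_point s t))) (at s)"
      unfolding has_field_derivative_def by (rule has_derivative_eq_rhs) (simp add: mult.commute fun_eq_iff)
  qed
  also have "\<dots> = (LINT t|lebesgue_on {0..1}. f (linepath b c t) - f (linepath a c t))"
    by (simp add: linepath_def algebra_simps)
  also have "\<dots> = segment_average b c f - segment_average a c f"
    unfolding segment_average_def using integrable_segment[OF fc] by simp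
  finally show ?thesis .
qed

text \<open>The clockwise quarter turn. On a counterclockwise triangle it maps an edge vector to the
  outward normal times the edge length.\<close>

definition perp :: "point \<Rightarrow> point" where
  "perp v = (\<chi> i. if i = 1 then v $ 2 else - v $ 1)"

lemma perp_nth [simp]: "perp v $ 1 = v $ 2" "perp v $ 2 = - v $ 1"
  by (simp_all add: perp_def)

text \<open>Two edge vectors of a nondegenerate triangle span the plane; the identities in the proof
  are Cramer's rule for v - w.\<close>

lemma orient_nz_eqI:
  assumes "orient a b c \<noteq> 0" "v \<bullet> (b - a) = w \<bullet> (b - a)" "v \<bullet> (c - a) = w \<bullet> (c - a)"
  shows "v = w"
proof -
  let ?p = "b - a" and ?q = "c - a" and ?z = "v - w"
  have e: "?z $ 1 * ?p $ 1 + ?z $ 2 * ?p $ 2 = 0" "?z $ 1 * ?q $ 1 + ?z $ 2 * ?q $ 2 = 0"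
    using assms(2,3) by (simp_all add: inner_vec_def sum_2 algebra_simps)
  have "orient a b c * ?z $ 1 = ?q $ 2 * (?z $ 1 * ?p $ 1 + ?z $ 2 * ?p $ 2) - ?p $ 2 * (?z $ 1 * ?q $ 1 + ?z $ 2 * ?q $ 2)"
    unfolding orient_def by algebra
  then have "?z $ 1 = 0" unfolding e using assms(1) by simp
  moreover have "orient a b c * ?z $ 2 = ?p $ 1 * (?z $ 1 * ?q $ 1 + ?z $ 2 * ?q $ 2) - ?q $ 1 * (?z $ 1 * ?p $ 1 + ?z $ 2 * ?p $ 2)"
    unfolding orient_def by algebra
  then have "?z $ 2 = 0" unfolding e using assms(1) by simp
  ultimately show ?thesis by (simp add: vec_eq_iff forall_2)
qed

text \<open>A vector is determined by its products with two edge vectors, and these products are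
  directional derivatives, the second one with b and c exchanged. The sign accounts for clockwise
  triangles.\<close>

lemma integral_gradient_triangle:
  assumes f: "Ck 1 f" and abc: "orient a b c \<noteq> 0"
  shows "(LINT x|lebesgue_on (convex hull {a, b, c}). gradient f x)
       = sgn (orient a b c) *\<^sub>R (segment_average a b f *\<^sub>R perp (b - a)
           + segment_average b c f *\<^sub>R perp (c - b) + segment_average c a f *\<^sub>R perp (a - c))"
    (is "?I = ?E")
proof (rule orient_nz_eqI[OF abc])
  let ?T = "convex hull {a, b, c}"
  have T: "bounded ?T" "?T \<in> sets lebesgue"
    by (auto intro!: compact_imp_bounded compact_lebesgue compact_convex_hull)
  have fc: "continuous_on UNIV f" by (rule Ck_imp_continuous[OF f])
  have gi: "integrable (lebesgue_on ?T) (gradient f)"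
    by (rule L2_imp_integrable[OF finite_measure_lebesgue_on[OF T] L2_C1(2)[OF f T]])
  define sg where "sg = sgn (orient a b c)"
  have s: "\<bar>orient a b c\<bar> = sg * orient a b c" by (simp add: sg_def sgn_if abs_if)
  have dir: "?I \<bullet> w = (LINT x|lebesgue_on ?T. gradient f x \<bullet> w)" for w
    using gi by simp
  have p1: "perp (b - a) \<bullet> (b - a) = 0" "perp (c - b) \<bullet> (b - a) = orient a b c" "perp (a - c) \<bullet> (b - a) = - orient a b c"
    "perp (b - a) \<bullet> (c - a) = - orient a b c" "perp (c - b) \<bullet> (c - a) = orient a b c" "perp (a - c) \<bullet> (c - a) = 0"
    by (simp_all add: inner_vec_def sum_2 orient_def algebra_simps)
  show "?I \<bullet> (b - a) = ?E \<bullet> (b - a)"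
    unfolding dir integral_directional_derivative[OF f abc] segment_average_reverse[OF fc, of c a]
    unfolding s sg_def[symmetric] inner_scaleR_left inner_add_left p1 by (simp add: algebra_simps)
  have acb: "orient a c b \<noteq> 0" using abc orient_swap[of a c b] by simp
  have T': "?T = convex hull {a, c, b}" by (simp add: insert_commute)
  have "?I \<bullet> (c - a) = \<bar>orient a c b\<bar> * (segment_average c b f - segment_average a b f)"
    unfolding dir unfolding T' by (rule integral_directional_derivative[OF f acb])
  then show "?I \<bullet> (c - a) = ?E \<bullet> (c - a)"
    unfolding segment_average_reverse[OF fc, of c b] orient_swap[of a c b] abs_minus_cancel s sg_def[symmetric]
      inner_scaleR_left inner_add_left p1 by (simp add: algebra_simps)
qed

subsection \<open>Triangles and their edges\<close>

lemma orient_eq_0_iff: "orient a b c = 0 \<longleftrightarrow> collinear {b, a, c}"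
proof -
  let ?p = "b - a" and ?q = "c - a"
  have "collinear {b, a, c} \<longleftrightarrow> ?p = 0 \<or> ?q = 0 \<or> (\<exists>k. ?q = k *\<^sub>R ?p)"
    using collinear_lemma[of ?p ?q] collinear_3[of b a c] by (cases "b = 0") (auto simp: collinear_3 insert_commute)
  also have "\<dots> \<longleftrightarrow> orient a b c = 0"
  proof
    assume "?p = 0 \<or> ?q = 0 \<or> (\<exists>k. ?q = k *\<^sub>R ?p)"
    then show "orient a b c = 0" unfolding orient_def by (elim disjE exE) (simp_all del: eq_iff_diff_eq_0 right_minus_eq)
  next
    assume o: "orient a b c = 0"
    show "?p = 0 \<or> ?q = 0 \<or> (\<exists>k. ?q = k *\<^sub>R ?p)"
    proof (cases "?p $ 1 = 0")
      case False
      have "?q $ 2 = (?q $ 1 / ?p $ 1) * ?p $ 2"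
        using o False unfolding orient_def by (simp add: field_simps)
      then have "?q = (?q $ 1 / ?p $ 1) *\<^sub>R ?p" using False by (simp add: vec_eq_iff forall_2)
      then show ?thesis by blast
    next
      case True
      show ?thesis
      proof (cases "?p $ 2 = 0")
        case False
        have "?q $ 1 = 0" using o True False unfolding orient_def by simp
        then have "?q = (?q $ 2 / ?p $ 2) *\<^sub>R ?p" using True False by (simp add: vec_eq_iff forall_2)
        then show ?thesis by blast
      next
        case False': True
        then have "?p = 0" using True by (simp add: vec_eq_iff forall_2)
        then show ?thesis by blast
      qed
    qed
  qed
  finally show ?thesis by simp
qed

lemma orient_rotate: "orient b c a = orient a b c"
  by (simp add: orient_def algebra_simps)

lemma orient_distinct: "orient a b c \<noteq> 0 \<Longrightarrow> a \<noteq> b \<and> b \<noteq> c \<and> c \<noteq> a"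
  by (auto simp: orient_def)

lemma orient_nz_independent:
  assumes "orient a b c \<noteq> 0" shows "\<not> affine_dependent {a, b, c}"
  using assms affine_dependent_imp_collinear_3[of b a c] orient_eq_0_iff[of a b c]
  by (auto simp: insert_commute)

text \<open>Exchanging two vertices reverses the sign of \<open>orient\<close>, so a
  counterclockwise order always exists.\<close>

lemma simplex_2_vertices:
  assumes "2 simplex T"
  obtains a b c where "T = convex hull {a, b, c}" "0 < orient a b c"
proof -
  obtain C where C: "\<not> affine_dependent C" "int (card C) = 3" "T = convex hull C"
    using assms by (auto simp: simplex_def)
  then have "card C = 3" by simp
  then obtain a b c where abc: "C = {a, b, c}" "a \<noteq> b" "b \<noteq> c" "a \<noteq> c"
    by (auto simp: card_3_iff)
  have "\<not> collinear {b, a, c}"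
    using C(1) abc by (auto simp: collinear_3_eq_affine_dependent insert_commute)
  then have "orient a b c \<noteq> 0" by (simp add: orient_eq_0_iff)
  then consider "0 < orient a b c" | "0 < orient a c b" using orient_swap[of a c b] by linarith
  then show ?thesis
  proof cases
    case 1 then show ?thesis using that[of a b c] C(3) abc(1) by simp
  next
    case 2 then show ?thesis using that[of a c b] C(3) abc(1) by (simp add: insert_commute)
  qed
qed

text \<open>The faces of a simplex are the hulls of its vertex subsets, and dimension one means two
  vertices.\<close>

lemma edge_of_triangle_iff:
  assumes o: "orient a b c \<noteq> 0"
  shows "E edge_of convex hull {a, b, c} \<longleftrightarrow> E \<in> {closed_segment a b, closed_segment b c, closed_segment c a}"
proof -
  note ind = orient_nz_independent[OF o] and dist = orient_distinct[OF o]
  have dim: "aff_dim (convex hull d) = int (card d) - 1" if "d \<subseteq> {a, b, c}" for d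
    using affine_independent_subset[OF ind that] aff_dim_affine_independent[of d]
    by (simp add: aff_dim_convex_hull)
  have "E edge_of convex hull {a, b, c} \<longleftrightarrow> (\<exists>d\<subseteq>{a, b, c}. E = convex hull d \<and> card d = 2)"
    unfolding edge_of_def face_of_convex_hull_affine_independent[OF ind]
    using dim by auto
  also have "\<dots> \<longleftrightarrow> (\<exists>d\<in>{{a, b}, {b, c}, {c, a}}. E = convex hull d)"
  proof -
    have "d \<subseteq> {a, b, c} \<and> card d = 2 \<longleftrightarrow> d \<in> {{a, b}, {b, c}, {c, a}}" for d
    proof
      assume d: "d \<subseteq> {a, b, c} \<and> card d = 2"
      then obtain x y where "d = {x, y}" "x \<noteq> y" by (auto simp: card_2_iff)
      with d show "d \<in> {{a, b}, {b, c}, {c, a}}" by auto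
    qed (use dist in auto)
    then show ?thesis by blast
  qed
  finally show ?thesis by (simp add: segment_convex_hull)
qed

lemma triangle_edge:
  assumes T: "2 simplex T" and E: "E edge_of T"
  obtains p q r where "E = closed_segment p q" "T = convex hull {p, q, r}" "0 < orient p q r"
proof -
  obtain a b c where abc: "T = convex hull {a, b, c}" "0 < orient a b c"
    using simplex_2_vertices[OF T] .
  have "E \<in> {closed_segment a b, closed_segment b c, closed_segment c a}"
    using E abc edge_of_triangle_iff[of a b c E] by simp
  then consider "E = closed_segment a b" | "E = closed_segment b c" | "E = closed_segment c a" by blast
  then show ?thesis
  proof cases
    case 1 then show ?thesis using that abc by blast
  next
    case 2 then show ?thesis using that[of b c a] abc orient_rotate[of b c a] by (simp add: insert_commute)
  next
    case 3 then show ?thesis using that[of c a b] abc orient_rotate[of c a b] orient_rotate[of b c a] by (simp add: insert_commute)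
  qed
qed

lemma sum_edges_of_triangle:
  fixes f :: "point set \<Rightarrow> 'b::comm_monoid_add"
  assumes "orient a b c \<noteq> 0"
  shows "(\<Sum>E | E edge_of convex hull {a, b, c}. f E)
     = f (closed_segment a b) + f (closed_segment b c) + f (closed_segment c a)"
proof -
  have "{E. E edge_of convex hull {a, b, c}} = {closed_segment a b, closed_segment b c, closed_segment c a}"
    using edge_of_triangle_iff[OF assms] by blast
  moreover have ne: "closed_segment a b \<noteq> closed_segment b c" "closed_segment b c \<noteq> closed_segment c a"
    "closed_segment a b \<noteq> closed_segment c a"
    using orient_distinct[OF assms] by (auto simp: doubleton_eq_iff)
  ultimately show ?thesis
    using ne by (simp add: add.assoc del: closed_segment_eq)
qed

lemma finite_edges_of_triangle:
  fixes T :: "point set"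
  assumes "2 simplex T" shows "finite {E. E edge_of T}"
proof -
  from assms obtain a b c where abc: "T = convex hull {a, b, c}" "0 < orient a b c"
    by (rule simplex_2_vertices)
  have "{E. E edge_of T} \<subseteq> {closed_segment a b, closed_segment b c, closed_segment c a}"
    using edge_of_triangle_iff[of a b c] abc by auto
  then show ?thesis using finite_subset by blast
qed

lemma triangle_convex_body:
  assumes "2 simplex T" shows "convex_body T"
proof -
  obtain a b c where abc: "T = convex hull {a, b, c}" "0 < orient a b c"
    using simplex_2_vertices[OF assms] .
  have "interior T \<noteq> {}"
    using aff_dim_simplex[OF assms] abc(1)
    by (simp add: interior_rel_interior_gen rel_interior_eq_empty)
  then show ?thesis by (auto simp: convex_body_def abc(1) compact_convex_hull)
qed

lemma norm_perp [simp]: "norm (perp v) = norm v"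
  by (simp add: norm_vec_def L2_set_def sum_2 add.commute)

lemma perp_inner_orient: "perp (q - p) \<bullet> (r - p) = - orient p q r"
  by (simp add: inner_vec_def sum_2 orient_def algebra_simps)

lemma perp_inner_self [simp]: "perp v \<bullet> v = 0"
  by (simp add: inner_vec_def sum_2)

lemma closed_segment_points: "x \<in> closed_segment p q \<Longrightarrow> \<exists>t. x = p + t *\<^sub>R (q - p)"
  by (auto simp: in_segment algebra_simps)

text \<open>As \<open>outward_normal\<close> is a choice, a candidate is not enough: the defining
  conditions must determine it. Orthogonality to the edge leaves a multiple of
  \<open>perp (q - p)\<close>, the third vertex fixes the sign and the unit norm fixes the
  length.\<close>

lemma outward_normal_triangle:
  assumes T: "T = convex hull {p, q, r}" and o: "0 < orient p q r"
  shows "dist p q *\<^sub>R outward_normal T (closed_segment p q) = perp (q - p)"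
proof -
  let ?E = "closed_segment p q"
  let ?P = "\<lambda>n. norm n = 1 \<and> (\<forall>x\<in>?E. \<forall>y\<in>?E. n \<bullet> (x - y) = 0) \<and> (\<forall>x\<in>T. \<forall>y\<in>?E. n \<bullet> (x - y) \<le> 0)"
  let ?d = "q - p"
  have pq: "p \<noteq> q" using o by (auto simp: orient_def)
  have d: "0 < norm ?d" using pq by simp
  have d2: "(?d $ 1)\<^sup>2 + (?d $ 2)\<^sup>2 = (norm ?d)\<^sup>2"
    by (simp add: norm_vec_def L2_set_def sum_2)
  have "?P ((1 / norm ?d) *\<^sub>R perp ?d)"
  proof (intro conjI ballI)
    show "norm ((1 / norm ?d) *\<^sub>R perp ?d) = 1" using d by simp
    fix x y assume y: "y \<in> ?E"
    from closed_segment_points[OF y] obtain t where t: "y = p + t *\<^sub>R ?d" ..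
    {
      assume "x \<in> ?E"
      from closed_segment_points[OF this] obtain s where "x = p + s *\<^sub>R ?d" ..
      then have "x - y = (s - t) *\<^sub>R ?d" unfolding t by (simp add: algebra_simps)
      then show "((1 / norm ?d) *\<^sub>R perp ?d) \<bullet> (x - y) = 0"
        by (simp only: inner_scaleR_left inner_scaleR_right perp_inner_self)
    next
      assume "x \<in> T"
      then obtain u v where uv: "x = p + u *\<^sub>R (q - p) + v *\<^sub>R (r - p)" "0 \<le> v"
        unfolding T convex_hull_3_alt by blast
      have "x - y = (u - t) *\<^sub>R ?d + v *\<^sub>R (r - p)" unfolding t uv(1) by (simp add: algebra_simps)
      then have "((1 / norm ?d) *\<^sub>R perp ?d) \<bullet> (x - y) = - (1 / norm ?d) * (v * orient p q r)"
        by (simp only: inner_scaleR_left inner_scaleR_right perp_inner_self inner_add_right perp_inner_orient, simp)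
      then show "((1 / norm ?d) *\<^sub>R perp ?d) \<bullet> (x - y) \<le> 0"
        using d o uv(2) by simp
    }
  qed
  then have n: "?P (outward_normal T ?E)"
    unfolding outward_normal_def by (rule someI)
  define n where "n = outward_normal T ?E"
  have nd: "n \<bullet> ?d = 0" and nr: "n \<bullet> (r - p) \<le> 0" and n1: "norm n = 1"
  proof -
    have "r \<in> T" unfolding T by (simp add: hull_inc)
    with n[folded n_def] ends_in_segment[of p q]
    show "n \<bullet> ?d = 0" "n \<bullet> (r - p) \<le> 0" "norm n = 1" by blast+
  qed
  \<comment> \<open>The coefficient of n along \<open>perp ?d\<close>; as n has no component along
    \<open>?d\<close>, it is k times \<open>perp ?d\<close>.\<close>
  define k where "k = n \<bullet> perp ?d / (norm ?d)\<^sup>2"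
  have e: "n $ 1 * ?d $ 1 + n $ 2 * ?d $ 2 = 0" using nd by (simp add: inner_vec_def sum_2)
  have kd: "k * (norm ?d)\<^sup>2 = n $ 1 * ?d $ 2 - n $ 2 * ?d $ 1"
  proof -
    have "k * (norm ?d)\<^sup>2 = n \<bullet> perp ?d" using pq by (simp add: k_def)
    then show ?thesis by (simp add: inner_vec_def sum_2 algebra_simps)
  qed
  have "(norm ?d)\<^sup>2 * (k * ?d $ 2) = (norm ?d)\<^sup>2 * n $ 1" "(norm ?d)\<^sup>2 * (k * - ?d $ 1) = (norm ?d)\<^sup>2 * n $ 2"
    using kd e d2 by algebra+
  moreover have nz: "(norm ?d)\<^sup>2 \<noteq> 0" using d by simp
  ultimately have "k * ?d $ 2 = n $ 1" "k * - ?d $ 1 = n $ 2"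
    by (simp_all only: mult_left_cancel[OF nz])
  then have nk: "n = k *\<^sub>R perp ?d"
    by (simp only: vec_eq_iff forall_2 vector_scaleR_component perp_nth real_scaleR_def simp_thms)
  have k0: "0 \<le> k"
    using nr o unfolding nk by (simp add: perp_inner_orient zero_le_mult_iff)
  have "\<bar>k\<bar> * norm ?d = 1" using n1 unfolding nk by simp
  then have "k * norm ?d = 1" using k0 by simp
  then have "dist p q *\<^sub>R n = perp ?d"
    unfolding nk by (simp add: dist_norm norm_minus_commute mult.commute)
  then show ?thesis by (simp add: n_def)
qed

text \<open>The chosen parametrization is known only up to its direction, so all later statements on
  edges are insensitive to reversal.\<close>

lemma edge_path_segment:
  "edge_path (closed_segment p q) = linepath p q \<or> edge_path (closed_segment p q) = linepath q p"
proof -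
  have "\<exists>a b. closed_segment p q = closed_segment a b \<and> edge_path (closed_segment p q) = linepath a b"
    unfolding edge_path_def by (rule someI[of _ "linepath p q"]) blast
  then show ?thesis by (auto simp: doubleton_eq_iff)
qed

lemma edge_path_continuous: "continuous_on UNIV (edge_path (closed_segment p q))"
proof -
  have "continuous_on UNIV (linepath a b)" for a b :: point
    unfolding linepath_def by (intro continuous_intros)
  then show ?thesis using edge_path_segment[of p q] by metis
qed

lemma edge_path_in: "t \<in> {0..1} \<Longrightarrow> edge_path (closed_segment p q) t \<in> closed_segment p q"
  using edge_path_segment[of p q] linepath_in_path[of t p q] linepath_in_path[of t q p]
  by (auto simp: closed_segment_commute)

lemma edge_path_length: "dist (edge_path (closed_segment p q) 0) (edge_path (closed_segment p q) 1) = dist p q"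
  using edge_path_segment[of p q] by (auto simp: linepath_def dist_commute)

lemma edge_integral_segment:
  assumes "continuous_on UNIV f"
  shows "edge_integral (closed_segment p q) f = dist p q * segment_average p q f"
  using edge_path_segment[of p q] segment_average_reverse[OF assms, of p q]
  unfolding edge_integral_def edge_path_length segment_average_def by auto

lemma integral_gradient_simplex:
  assumes T: "2 simplex T" and f: "Ck 1 f"
  shows "(LINT x|lebesgue_on T. gradient f x) = (\<Sum>E | E edge_of T. edge_integral E f *\<^sub>R outward_normal T E)"
proof -
  obtain a b c where abc: "T = convex hull {a, b, c}" "0 < orient a b c"
    using simplex_2_vertices[OF T] .
  have o: "orient a b c \<noteq> 0" using abc by simp
  have fc: "continuous_on UNIV f" by (rule Ck_imp_continuous[OF f])
  have T': "T = convex hull {b, c, a}" "T = convex hull {c, a, b}" using abc by (simp_all add: insert_commute)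
  have o': "0 < orient b c a" "0 < orient c a b" using abc orient_rotate[of b c a] orient_rotate[of c a b] by simp_all
  note n = outward_normal_triangle[OF abc] outward_normal_triangle[OF T'(1) o'(1)] outward_normal_triangle[OF T'(2) o'(2)]
  have m: "(dist p q * s) *\<^sub>R v = s *\<^sub>R (dist p q *\<^sub>R v)" for p q v :: point and s by (simp add: mult.commute)
  show ?thesis
    unfolding abc(1) integral_gradient_triangle[OF f o] sum_edges_of_triangle[OF o] edge_integral_segment[OF fc]
      m n[unfolded abc(1)] using abc by simp
qed

definition vdiv :: "vector_field \<Rightarrow> scalar_field" where
  "vdiv F x = gradient (\<lambda>y. F y $ 1) x $ 1 + gradient (\<lambda>y. F y $ 2) x $ 2"

lemma edge_integral_add:
  assumes "continuous_on UNIV f" "continuous_on UNIV g" "E = closed_segment p q"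
  shows "edge_integral E (\<lambda>x. f x + g x) = edge_integral E f + edge_integral E g"
  unfolding assms(3) using assms(1,2)
  by (simp add: edge_integral_segment continuous_on_add segment_average_def integrable_segment distrib_left)

lemma edge_integral_cmult: "edge_integral E (\<lambda>x. c * f x) = c * edge_integral E f"
  by (simp add: edge_integral_def)

text \<open>The gradient theorem is applied to the product of \<phi> with each component of F, and
  the matching components of the results are added.\<close>

lemma green_C1:
  assumes T: "2 simplex T" and F: "\<And>i. Ck 1 (\<lambda>x. F x $ i)" and \<phi>: "Ck 1 \<phi>"
  shows "(LINT x|lebesgue_on T. F x \<bullet> gradient \<phi> x + vdiv F x * \<phi> x)
    = (\<Sum>E | E edge_of T. edge_integral E (\<lambda>x. (F x \<bullet> outward_normal T E) * \<phi> x))"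
proof -
  note T' = convex_bodyD[OF triangle_convex_body[OF T]]
  let ?f = "\<lambda>i x. F x $ i * \<phi> x"
  have f: "Ck 1 (?f i)" for i by (rule Ck_mult[OF F \<phi>])
  have gi: "integrable (lebesgue_on T) (gradient (?f i))" for i
    by (rule L2_imp_integrable[OF finite_measure_lebesgue_on[OF T'(4,6)] L2_C1(2)[OF f T'(4,6)]])
  have g: "gradient (?f i) x = F x $ i *\<^sub>R gradient \<phi> x + \<phi> x *\<^sub>R gradient (\<lambda>y. F y $ i) x" for i x
    by (rule gradient_mult[OF C1_differentiable[OF F] C1_differentiable[OF \<phi>]])
  have "(LINT x|lebesgue_on T. F x \<bullet> gradient \<phi> x + vdiv F x * \<phi> x)
      = (LINT x|lebesgue_on T. gradient (?f 1) x \<bullet> axis 1 1 + gradient (?f 2) x \<bullet> axis 2 1)"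
    unfolding g by (simp add: vdiv_def inner_axis) (simp add: inner_vec_def sum_2 algebra_simps)
  also have "\<dots> = (LINT x|lebesgue_on T. gradient (?f 1) x) \<bullet> axis 1 1 + (LINT x|lebesgue_on T. gradient (?f 2) x) \<bullet> axis 2 1"
    using gi[of 1] gi[of 2] by simp
  also have "\<dots> = (\<Sum>E | E edge_of T. edge_integral E (?f 1) * outward_normal T E $ 1 + edge_integral E (?f 2) * outward_normal T E $ 2)"
    unfolding integral_gradient_simplex[OF T f]
    by (simp add: inner_sum_left sum.distrib inner_axis)
  also have "\<dots> = (\<Sum>E | E edge_of T. edge_integral E (\<lambda>x. (F x \<bullet> outward_normal T E) * \<phi> x))"
  proof (rule sum.cong[OF refl])
    fix E assume "E \<in> {E. E edge_of T}"
    then obtain p q r where E: "E = closed_segment p q" using triangle_edge[OF T] by blast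
    let ?n = "outward_normal T E"
    have c: "continuous_on UNIV (\<lambda>x. ?n $ i * ?f i x)" for i
      by (intro continuous_intros Ck_imp_continuous[OF F] Ck_imp_continuous[OF \<phi>])
    have "edge_integral E (?f 1) * ?n $ 1 + edge_integral E (?f 2) * ?n $ 2
        = edge_integral E (\<lambda>x. ?n $ 1 * ?f 1 x) + edge_integral E (\<lambda>x. ?n $ 2 * ?f 2 x)"
      by (simp add: edge_integral_cmult mult.commute)
    also have "\<dots> = edge_integral E (\<lambda>x. ?n $ 1 * ?f 1 x + ?n $ 2 * ?f 2 x)"
      by (rule edge_integral_add[OF c c E, symmetric])
    also have "(\<lambda>x. ?n $ 1 * ?f 1 x + ?n $ 2 * ?f 2 x) = (\<lambda>x. (F x \<bullet> ?n) * \<phi> x)"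
      by (simp add: fun_eq_iff inner_vec_def sum_2 algebra_simps)
    finally show "edge_integral E (?f 1) * ?n $ 1 + edge_integral E (?f 2) * ?n $ 2
       = edge_integral E (\<lambda>x. (F x \<bullet> ?n) * \<phi> x)" .
  qed
  finally show ?thesis .
qed

subsection \<open>Traces\<close>

text \<open>The Riesz-Fischer argument. Along a subsequence with geometrically small steps the
  differences are absolutely summable almost everywhere, and Fatou's lemma turns the pointwise limit
  into a norm limit of the whole sequence.\<close>

lemma L2_complete:
  fixes f :: "nat \<Rightarrow> 'a \<Rightarrow> real"
  assumes M: "finite_measure M" and f: "\<And>n. f n \<in> L2 M"
    and cauchy: "\<And>e. 0 < e \<Longrightarrow> \<exists>N. \<forall>m\<ge>N. \<forall>n\<ge>N. L2_norm M (\<lambda>x. f m x - f n x) < e"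
  obtains g where "g \<in> L2 M" "(\<lambda>n. L2_norm M (\<lambda>x. f n x - g x)) \<longlonglongrightarrow> 0"
proof -
  have fm[measurable]: "f n \<in> borel_measurable M" for n by (rule L2_measurable[OF f])
  have "\<exists>N. \<forall>m\<ge>N. \<forall>n\<ge>N. L2_norm M (\<lambda>x. f m x - f n x) < (1/2) ^ k" for k
    by (rule cauchy) simp
  then obtain N where N: "\<And>k m n. N k \<le> m \<Longrightarrow> N k \<le> n \<Longrightarrow> L2_norm M (\<lambda>x. f m x - f n x) < (1/2) ^ k"
    by metis
  \<comment> \<open>Summing the thresholds makes \<open>r k\<close> at least \<open>N i\<close> for
    all i \<le> k, so that consecutive indices can be compared.\<close>
  define r where "r k = (\<Sum>i\<le>k. N i)" for k
  have rN: "N k \<le> r j" if "k \<le> j" for k j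
    unfolding r_def using that by (intro member_le_sum) auto
  let ?d = "\<lambda>k x. \<bar>f (r (Suc k)) x - f (r k) x\<bar>"
  define c where "c = L2_norm M (\<lambda>x. 1::real)"
  have c0: "0 \<le> c" by (simp add: c_def)
  have dL: "?d k \<in> L2 M" for k
  proof (rule L2_bounded_by)
    show "integrable M (\<lambda>x. (norm (f (r (Suc k)) x - f (r k) x))\<^sup>2)"
      by (rule L2_integrable_square[OF L2_diff[OF f f]])
  qed (auto intro: borel_measurable_abs)
  have one: "(\<lambda>x. 1::real) \<in> L2 M" using M by simp
  have di: "integrable M (?d k)" for k by (rule L2_imp_integrable[OF M dL])
  have d: "(LINT x|M. ?d k x) \<le> c * (1/2) ^ k" for k
  proof -
    have "(LINT x|M. ?d k x) = L2_inner M (?d k) (\<lambda>x. 1)" by (simp add: L2_inner_def)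
    also have "\<dots> \<le> L2_norm M (?d k) * c"
      unfolding c_def using L2_Cauchy_Schwarz[OF dL one, of k] by linarith
    also have "L2_norm M (?d k) = L2_norm M (\<lambda>x. f (r (Suc k)) x - f (r k) x)"
      by (simp add: L2_norm_def L2_inner_def)
    also have "\<dots> * c \<le> (1/2) ^ k * c"
      using N[of k "r (Suc k)" "r k"] rN[of k "Suc k"] rN[of k k] c0 by (intro mult_right_mono) auto
    finally show ?thesis by (simp add: mult.commute)
  qed
  have sc: "summable (\<lambda>k. c * (1/2) ^ k)" by (intro summable_mult summable_geometric) simp
  have "(\<integral>\<^sup>+x. (\<Sum>k. ennreal (?d k x)) \<partial>M) = (\<Sum>k. \<integral>\<^sup>+x. ennreal (?d k x) \<partial>M)"
    by (rule nn_integral_suminf) measurable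
  also have "\<dots> \<le> (\<Sum>k. ennreal (c * (1/2) ^ k))"
  proof (rule suminf_le)
    show "(\<integral>\<^sup>+x. ennreal (?d k x) \<partial>M) \<le> ennreal (c * (1/2) ^ k)" for k
      using d[of k] by (subst nn_integral_eq_integral[OF di]) (auto intro: ennreal_leI)
  qed (auto intro: summableI)
  also have "\<dots> = ennreal (\<Sum>k. c * (1/2) ^ k)"
    using sc c0 by (intro suminf_ennreal2) auto
  finally have "(\<integral>\<^sup>+x. (\<Sum>k. ennreal (?d k x)) \<partial>M) \<noteq> \<infinity>"
    by (metis ennreal_neq_top infinity_ennreal_def top.extremum_uniqueI)
  then have "AE x in M. (\<Sum>k. ennreal (?d k x)) \<noteq> \<infinity>"
    by (intro nn_integral_PInf_AE) measurable
  then have conv: "AE x in M. (\<lambda>k. f (r k) x) \<longlonglongrightarrow> lim (\<lambda>k. f (r k) x)"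
  proof eventually_elim
    case (elim x)
    then have "summable (\<lambda>k. ?d k x)" by (intro summable_suminf_not_top) auto
    then have "summable (\<lambda>k. f (r (Suc k)) x - f (r k) x)"
      by (rule summable_rabs_cancel)
    then have "convergent (\<lambda>n. \<Sum>k<n. f (r (Suc k)) x - f (r k) x)"
      by (rule summable_iff_convergent[THEN iffD1])
    moreover have "(\<Sum>k<n. f (r (Suc k)) x - f (r k) x) = f (r n) x - f (r 0) x" for n
      by (rule sum_lessThan_telescope)
    ultimately have "convergent (\<lambda>n. f (r n) x - f (r 0) x)" by (simp only:)
    then obtain l where "(\<lambda>n. f (r n) x - f (r 0) x) \<longlonglongrightarrow> l" by (auto simp: convergent_def)
    from tendsto_add[OF this tendsto_const[of "f (r 0) x"]]
    have "(\<lambda>n. f (r n) x) \<longlonglongrightarrow> l + f (r 0) x" by simp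
    then show ?case by (simp add: limI)
  qed
  define g where "g x = lim (\<lambda>k. f (r k) x)" for x
  have gm[measurable]: "g \<in> borel_measurable M" unfolding g_def by measurable
  have fatou: "(\<integral>\<^sup>+x. ennreal ((f n x - g x)\<^sup>2) \<partial>M) \<le> ennreal (((1/2) ^ k)\<^sup>2)" if n: "N k \<le> n" for n k
  proof -
    have "(\<integral>\<^sup>+x. ennreal ((f n x - g x)\<^sup>2) \<partial>M) = (\<integral>\<^sup>+x. liminf (\<lambda>j. ennreal ((f n x - f (r j) x)\<^sup>2)) \<partial>M)"
    proof (rule nn_integral_cong_AE, use conv in eventually_elim)
      fix x assume "(\<lambda>k. f (r k) x) \<longlonglongrightarrow> lim (\<lambda>k. f (r k) x)"
      then have "(\<lambda>j. ennreal ((f n x - f (r j) x)\<^sup>2)) \<longlonglongrightarrow> ennreal ((f n x - g x)\<^sup>2)"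
        unfolding g_def by (intro tendsto_ennrealI tendsto_intros)
      then show "ennreal ((f n x - g x)\<^sup>2) = liminf (\<lambda>j. ennreal ((f n x - f (r j) x)\<^sup>2))"
        by (intro lim_imp_Liminf[symmetric]) simp_all
    qed
    also have "\<dots> \<le> liminf (\<lambda>j. \<integral>\<^sup>+x. ennreal ((f n x - f (r j) x)\<^sup>2) \<partial>M)"
      by (rule nn_integral_liminf) measurable
    also have "\<dots> \<le> liminf (\<lambda>j. ennreal (((1/2) ^ k)\<^sup>2))"
    proof (rule Liminf_mono, rule eventually_sequentiallyI[of k])
      fix j assume j: "k \<le> j"
      have "L2_norm M (\<lambda>x. f n x - f (r j) x) \<le> (1/2) ^ k" using N[OF n rN[OF j]] by simp
      then have "(L2_norm M (\<lambda>x. f n x - f (r j) x))\<^sup>2 \<le> ((1/2) ^ k)\<^sup>2" by (rule power_mono) simp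
      moreover have "(\<integral>\<^sup>+x. ennreal ((f n x - f (r j) x)\<^sup>2) \<partial>M) = ennreal ((L2_norm M (\<lambda>x. f n x - f (r j) x))\<^sup>2)"
        using L2_integrable_square[OF L2_diff[OF f f]]
        by (simp add: L2_norm_square_integral nn_integral_eq_integral)
      ultimately show "(\<integral>\<^sup>+x. ennreal ((f n x - f (r j) x)\<^sup>2) \<partial>M) \<le> ennreal (((1/2) ^ k)\<^sup>2)"
        by (simp add: ennreal_leI)
    qed
    also have "\<dots> = ennreal (((1/2) ^ k)\<^sup>2)" by (simp add: Liminf_const)
    finally show ?thesis .
  qed
  have int: "integrable M (\<lambda>x. (f n x - g x)\<^sup>2)" if "N k \<le> n" for n k
  proof (rule integrableI_nonneg)
    show "(\<integral>\<^sup>+x. ennreal ((f n x - g x)\<^sup>2) \<partial>M) < \<infinity>"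
      using fatou[OF that] by (metis ennreal_less_top infinity_ennreal_def order_le_less_trans)
  qed auto
  have norm_le: "L2_norm M (\<lambda>x. f n x - g x) \<le> (1/2) ^ k" if "N k \<le> n" for n k
  proof (rule power2_le_imp_le)
    have "ennreal (LINT x|M. (f n x - g x)\<^sup>2) \<le> ennreal (((1/2) ^ k)\<^sup>2)"
      using fatou[OF that] by (subst (asm) nn_integral_eq_integral[OF int[OF that]]) simp_all
    then show "(L2_norm M (\<lambda>x. f n x - g x))\<^sup>2 \<le> ((1/2) ^ k)\<^sup>2"
      unfolding L2_norm_square_integral by simp
  qed simp
  have "(\<lambda>x. f (N 0) x - g x) \<in> L2 M" using int[of 0 "N 0"] by (intro L2I) auto
  from L2_diff[OF f[of "N 0"] this] have gL: "g \<in> L2 M" by simp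
  have "(\<lambda>n. L2_norm M (\<lambda>x. f n x - g x)) \<longlonglongrightarrow> 0"
  proof (rule LIMSEQ_I)
    fix e :: real assume "0 < e"
    then obtain k where k: "(1/2) ^ k < e" using real_arch_pow_inv[of e "1/2"] by auto
    show "\<exists>no. \<forall>n\<ge>no. norm (L2_norm M (\<lambda>x. f n x - g x) - 0) < e"
      using norm_le[of k] k by (intro exI[of _ "N k"]) force
  qed
  with gL show ?thesis by (rule that)
qed

abbreviation unit_measure :: "real measure" where
  "unit_measure \<equiv> lebesgue_on {0..1}"

lemma finite_unit_measure: "finite_measure unit_measure"
  by (rule finite_measure_lebesgue_on) auto

text \<open>The edge length is left out: it is a fixed positive factor on a nondegenerate edge and
  does not affect convergence.\<close>

definition edge_norm :: "point set \<Rightarrow> scalar_field \<Rightarrow> real" where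
  "edge_norm E g = L2_norm unit_measure (\<lambda>t. g (edge_path E t))"

lemma L2_edgeD: "g \<in> L2_edge E \<Longrightarrow> (\<lambda>t. g (edge_path E t)) \<in> L2 unit_measure"
  by (simp add: L2_edge_def)

lemma edge_norm_nonneg: "0 \<le> edge_norm E g"
  by (simp add: edge_norm_def)

lemma edge_integral_square:
  "edge_integral (closed_segment p q) (\<lambda>x. (f x)\<^sup>2) = dist p q * (edge_norm (closed_segment p q) f)\<^sup>2"
  unfolding edge_integral_def edge_path_length edge_norm_def L2_norm_square_integral by simp

lemma L2_edge_continuous:
  assumes "continuous_on UNIV f" shows "f \<in> L2_edge (closed_segment p q)"
  unfolding L2_edge_def
  by (intro CollectI L2_continuous continuous_on_compose2[OF assms edge_path_continuous]) auto

text \<open>Green's formula for the square of \<phi> with the field x - r, where r is the vertex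
  opposite to E. The normal component of this field is zero on the two edges through r and constant
  on E, which isolates the trace on E.\<close>

lemma trace_inequality:
  fixes T :: "point set"
  assumes T: "2 simplex T" and E: "E edge_of T"
  obtains C where "0 \<le> C"
    "\<And>\<phi>. Ck 1 \<phi> \<Longrightarrow> edge_norm E \<phi> \<le> C * (L2_norm (lebesgue_on T) \<phi> + L2_norm (lebesgue_on T) (gradient \<phi>))"
proof -
  obtain p q r where E: "E = closed_segment p q" and hull: "T = convex hull {p, q, r}" and o: "0 < orient p q r"
    using triangle_edge[OF T E] .
  note T' = convex_bodyD[OF triangle_convex_body[OF T]]
  let ?M = "lebesgue_on T"
  define D where "D = orient p q r"
  define B where "B = diameter T"
  have D: "0 < D" using o by (simp add: D_def)
  have B: "0 \<le> B" unfolding B_def by (rule diameter_ge_0[OF T'(4)])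
  have r: "r \<in> T" unfolding hull by (simp add: hull_inc)
  have hull': "T = convex hull {q, r, p}" "T = convex hull {r, p, q}" unfolding hull by (simp_all add: insert_commute)
  have o': "0 < orient q r p" "0 < orient r p q" using o orient_rotate[of q r p] orient_rotate[of r p q] by simp_all
  have n: "dist p q * (w \<bullet> outward_normal T (closed_segment p q)) = perp (q - p) \<bullet> w"
    "dist q r * (w \<bullet> outward_normal T (closed_segment q r)) = perp (r - q) \<bullet> w"
    "dist r p * (w \<bullet> outward_normal T (closed_segment r p)) = perp (p - r) \<bullet> w" for w
    unfolding outward_normal_triangle[OF hull o, symmetric] outward_normal_triangle[OF hull'(1) o'(1), symmetric]
      outward_normal_triangle[OF hull'(2) o'(2), symmetric] by (simp_all add: inner_commute)
  let ?F = "\<lambda>x. x - r"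
  have F: "Ck 1 (\<lambda>x. ?F x $ i)" for i
    using smooth_Ck[OF smooth_diff[OF smooth_vec_nth smooth_const]] by simp
  have vF: "vdiv ?F x = 2" for x
  proof -
    have "gradient (\<lambda>y. ?F y $ i) x = axis i 1" for i
      by (rule gradient_eqI) (auto intro!: derivative_eq_intros has_derivative_vec_nth simp: inner_axis')
    then show ?thesis by (simp add: vdiv_def)
  qed
  have ineq: "D * (edge_norm E \<phi>)\<^sup>2 \<le> (2 * B + 2) * (L2_norm ?M \<phi> + L2_norm ?M (gradient \<phi>))\<^sup>2" if \<phi>: "Ck 1 \<phi>" for \<phi>
  proof -
    let ?a = "L2_norm ?M \<phi>" and ?b = "L2_norm ?M (gradient \<phi>)"
    note L = L2_C1[OF \<phi> T'(4,6)]
    have \<phi>c: "continuous_on UNIV \<phi>" by (rule Ck_imp_continuous[OF \<phi>])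
    have FL: "(\<lambda>x. \<phi> x *\<^sub>R ?F x) \<in> L2 ?M"
      by (rule L2_continuous[OF _ T'(4,6)]) (intro continuous_intros \<phi>c)
    have path: "edge_integral E' (\<lambda>x. (?F x \<bullet> outward_normal T E') * (\<phi> x * \<phi> x)) = k * (edge_norm E' \<phi>)\<^sup>2"
      if "E' = closed_segment s s'" "\<And>x. x \<in> E' \<Longrightarrow> dist s s' * (?F x \<bullet> outward_normal T E') = k" for E' :: "point set" and s s' k
    proof -
      have "edge_integral E' (\<lambda>x. (?F x \<bullet> outward_normal T E') * (\<phi> x * \<phi> x))
        = (LINT t|unit_measure. (dist s s' * (?F (edge_path E' t) \<bullet> outward_normal T E')) * (\<phi> (edge_path E' t))\<^sup>2)"
        unfolding edge_integral_def that(1) edge_path_length by (simp add: power2_eq_square mult.assoc)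
      also have "\<dots> = (LINT t|unit_measure. k * (\<phi> (edge_path E' t))\<^sup>2)"
      proof (rule Bochner_Integration.integral_cong[OF refl])
        fix t assume "t \<in> space unit_measure"
        then have "t \<in> {0..1}" by (simp add: space_restrict_space)
        then show "(dist s s' * (?F (edge_path E' t) \<bullet> outward_normal T E')) * (\<phi> (edge_path E' t))\<^sup>2 = k * (\<phi> (edge_path E' t))\<^sup>2"
          using that(2)[of "edge_path E' t"] edge_path_in[of t s s'] that(1) by simp
      qed
      also have "\<dots> = k * (edge_norm E' \<phi>)\<^sup>2" unfolding edge_norm_def L2_norm_square_integral by simp
      finally show ?thesis .
    qed
    have e1: "edge_integral (closed_segment p q) (\<lambda>x. (?F x \<bullet> outward_normal T (closed_segment p q)) * (\<phi> x * \<phi> x))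
        = D * (edge_norm (closed_segment p q) \<phi>)\<^sup>2"
    proof (rule path[OF refl])
      fix x assume "x \<in> closed_segment p q"
      from closed_segment_points[OF this] obtain t where x: "x = p + t *\<^sub>R (q - p)" ..
      have "?F x = t *\<^sub>R (q - p) - (r - p)" unfolding x by simp
      then have "perp (q - p) \<bullet> ?F x = t * (perp (q - p) \<bullet> (q - p)) - perp (q - p) \<bullet> (r - p)"
        by (simp only: inner_diff_right[of _ "t *\<^sub>R (q - p)" "r - p"] inner_scaleR_right)
      then show "dist p q * (?F x \<bullet> outward_normal T (closed_segment p q)) = D"
        unfolding n perp_inner_self perp_inner_orient D_def by simp
    qed
    have e2: "edge_integral (closed_segment q r) (\<lambda>x. (?F x \<bullet> outward_normal T (closed_segment q r)) * (\<phi> x * \<phi> x))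
        = 0 * (edge_norm (closed_segment q r) \<phi>)\<^sup>2"
    proof (rule path[OF refl])
      fix x assume "x \<in> closed_segment q r"
      from closed_segment_points[OF this] obtain t where x: "x = q + t *\<^sub>R (r - q)" ..
      have "?F x = (t - 1) *\<^sub>R (r - q)" unfolding x by (simp add: algebra_simps)
      then show "dist q r * (?F x \<bullet> outward_normal T (closed_segment q r)) = 0"
        unfolding n by (simp only: inner_scaleR_right perp_inner_self)
    qed
    have e3: "edge_integral (closed_segment r p) (\<lambda>x. (?F x \<bullet> outward_normal T (closed_segment r p)) * (\<phi> x * \<phi> x))
        = 0 * (edge_norm (closed_segment r p) \<phi>)\<^sup>2"
    proof (rule path[OF refl])
      fix x assume "x \<in> closed_segment r p"
      from closed_segment_points[OF this] obtain t where x: "x = r + t *\<^sub>R (p - r)" ..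
      have "?F x = t *\<^sub>R (p - r)" unfolding x by (simp add: algebra_simps)
      then show "dist r p * (?F x \<bullet> outward_normal T (closed_segment r p)) = 0"
        unfolding n by (simp only: inner_scaleR_right perp_inner_self)
    qed
    have "D * (edge_norm E \<phi>)\<^sup>2 = (\<Sum>E' | E' edge_of T. edge_integral E' (\<lambda>x. (?F x \<bullet> outward_normal T E') * (\<phi> x * \<phi> x)))"
    proof -
      have "orient p q r \<noteq> 0" using o by simp
      note sum = sum_edges_of_triangle[OF this, folded hull]
      show ?thesis unfolding E sum e1 e2 e3 by simp
    qed
    also have "\<dots> = (LINT x|?M. ?F x \<bullet> gradient (\<lambda>x. \<phi> x * \<phi> x) x + vdiv ?F x * (\<phi> x * \<phi> x))"
      by (rule green_C1[OF T F Ck_mult[OF \<phi> \<phi>], symmetric])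
    also have "\<dots> = (LINT x|?M. 2 * ((\<phi> x *\<^sub>R ?F x) \<bullet> gradient \<phi> x) + 2 * (\<phi> x \<bullet> \<phi> x))"
    proof (rule Bochner_Integration.integral_cong[OF refl])
      fix x
      have g: "gradient (\<lambda>x. \<phi> x * \<phi> x) x = \<phi> x *\<^sub>R gradient \<phi> x + \<phi> x *\<^sub>R gradient \<phi> x"
        by (rule gradient_mult[OF C1_differentiable[OF \<phi>] C1_differentiable[OF \<phi>]])
      show "?F x \<bullet> gradient (\<lambda>x. \<phi> x * \<phi> x) x + vdiv ?F x * (\<phi> x * \<phi> x)
          = 2 * ((\<phi> x *\<^sub>R ?F x) \<bullet> gradient \<phi> x) + 2 * (\<phi> x \<bullet> \<phi> x)"
        unfolding g vF inner_add_right inner_scaleR_left inner_scaleR_right inner_real_def by simp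
    qed
    also have "\<dots> = 2 * L2_inner ?M (\<lambda>x. \<phi> x *\<^sub>R ?F x) (gradient \<phi>) + 2 * L2_inner ?M \<phi> \<phi>"
      using L2_inner_integrable[OF FL L(2)] L2_inner_integrable[OF L(1) L(1)]
      by (simp add: L2_inner_def del: inner_scaleR_left inner_real_def)
    also have "\<dots> \<le> 2 * (B * ?a * ?b) + 2 * ?a\<^sup>2"
    proof -
      have "L2_norm ?M (\<lambda>x. \<phi> x *\<^sub>R ?F x) \<le> B * ?a"
      proof (rule L2_norm_mono[OF L2_measurable[OF FL] L(1) _ B])
        show "AE x in ?M. norm (\<phi> x *\<^sub>R ?F x) \<le> B * norm (\<phi> x)"
        proof (rule AE_I2)
          fix x assume "x \<in> space ?M"
          then have "x \<in> T" by (simp add: space_restrict_space)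
          from diameter_bounded_bound[OF T'(4) this r] have "norm (?F x) \<le> B"
            by (simp add: B_def dist_norm)
          then show "norm (\<phi> x *\<^sub>R ?F x) \<le> B * norm (\<phi> x)"
            using mult_left_mono[of "norm (?F x)" B "\<bar>\<phi> x\<bar>"] by (simp add: mult.commute)
        qed
      qed
      then have "L2_norm ?M (\<lambda>x. \<phi> x *\<^sub>R ?F x) * ?b \<le> B * ?a * ?b" by (rule mult_right_mono) simp
      with L2_Cauchy_Schwarz[OF FL L(2)] show ?thesis unfolding L2_norm_square by linarith
    qed
    also have "\<dots> \<le> (2 * B + 2) * (?a + ?b)\<^sup>2"
    proof -
      have "0 \<le> ?a" "0 \<le> ?b" by simp_all
      then have "?a * ?b \<le> (?a + ?b)\<^sup>2" "?a\<^sup>2 \<le> (?a + ?b)\<^sup>2"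
        by (auto simp: power2_sum intro: power_mono)
      then have "2 * (B * (?a * ?b)) + 2 * ?a\<^sup>2 \<le> 2 * (B * (?a + ?b)\<^sup>2) + 2 * (?a + ?b)\<^sup>2"
        using B by (intro add_mono mult_left_mono) auto
      then show ?thesis by (simp add: algebra_simps)
    qed
    finally show ?thesis .
  qed
  show ?thesis
  proof (rule that[of "sqrt ((2 * B + 2) / D)"])
    show "0 \<le> sqrt ((2 * B + 2) / D)" using B D by simp
    fix \<phi> assume \<phi>: "Ck 1 \<phi>"
    let ?s = "L2_norm ?M \<phi> + L2_norm ?M (gradient \<phi>)"
    have "0 \<le> ?s" by (intro add_nonneg_nonneg) simp_all
    have "(edge_norm E \<phi>)\<^sup>2 \<le> (2 * B + 2) / D * ?s\<^sup>2"
      using ineq[OF \<phi>] D by (simp add: field_simps)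
    then have "(edge_norm E \<phi>)\<^sup>2 \<le> (sqrt ((2 * B + 2) / D) * ?s)\<^sup>2"
      using B D by (simp add: power_mult_distrib)
    then show "edge_norm E \<phi> \<le> sqrt ((2 * B + 2) / D) * ?s"
      by (rule power2_le_imp_le) (use B D \<open>0 \<le> ?s\<close> in simp)
  qed
qed

text \<open>The part of \<open>is_edge_trace\<close> that does not mention the edge, so that one
  approximating sequence can serve all edges of a triangle.\<close>

definition H1_limit :: "point set \<Rightarrow> (nat \<Rightarrow> scalar_field) \<Rightarrow> scalar_field \<Rightarrow> bool" where
  "H1_limit T \<phi> v \<longleftrightarrow> (\<forall>n. smooth (\<phi> n)) \<and>
    (\<lambda>n. L2_norm (lebesgue_on T) (\<lambda>x. \<phi> n x - v x)) \<longlonglongrightarrow> 0 \<and>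
    (\<lambda>n. L2_norm (lebesgue_on T) (\<lambda>x. gradient (\<phi> n) x - weak_gradient (interior T) v x)) \<longlonglongrightarrow> 0"

context
  fixes T E :: "point set" assumes T: "2 simplex T" and E: "E edge_of T"
begin

lemma T_body: "convex_body T"
  by (rule triangle_convex_body[OF T])

lemma is_edge_trace_iff:
  "is_edge_trace T E v g \<longleftrightarrow> v \<in> H1 (interior T) \<and> g \<in> L2_edge E \<and>
    (\<exists>\<phi>. H1_limit T \<phi> v \<and> (\<lambda>n. edge_norm E (\<lambda>x. \<phi> n x - g x)) \<longlonglongrightarrow> 0)"
proof -
  obtain p q r where pq: "E = closed_segment p q" and "0 < orient p q r"
    using triangle_edge[OF T E] .
  then have d: "0 < dist p q" using orient_distinct[of p q r] by simp
  have "(\<lambda>n. edge_integral E (\<lambda>x. (\<phi> n x - g x)\<^sup>2)) \<longlonglongrightarrow> 0 \<longleftrightarrow>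
      (\<lambda>n. edge_norm E (\<lambda>x. \<phi> n x - g x)) \<longlonglongrightarrow> 0" for \<phi> :: "nat \<Rightarrow> scalar_field"
    unfolding pq edge_integral_square
  proof
    let ?e = "\<lambda>n. edge_norm (closed_segment p q) (\<lambda>x. \<phi> n x - g x)"
    assume "(\<lambda>n. dist p q * (?e n)\<^sup>2) \<longlonglongrightarrow> 0"
    from tendsto_mult[OF tendsto_const[of "1 / dist p q"] this]
    have "(\<lambda>n. (?e n)\<^sup>2) \<longlonglongrightarrow> 0" using d by simp
    from tendsto_real_sqrt[OF this] show "?e \<longlonglongrightarrow> 0" by (simp add: edge_norm_nonneg)
  next
    let ?e = "\<lambda>n. edge_norm (closed_segment p q) (\<lambda>x. \<phi> n x - g x)"
    assume "?e \<longlonglongrightarrow> 0"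
    from tendsto_mult[OF tendsto_const[of "dist p q"] tendsto_power[OF this, of 2]]
    show "(\<lambda>n. dist p q * (?e n)\<^sup>2) \<longlonglongrightarrow> 0" by simp
  qed
  then show ?thesis unfolding is_edge_trace_def H1_limit_def by blast
qed

lemma smooth_L2_edge: "smooth \<phi> \<Longrightarrow> \<phi> \<in> L2_edge E"
  using triangle_edge[OF T E] L2_edge_continuous smooth_continuous by metis

lemma edge_norm_triangle:
  assumes "f \<in> L2_edge E" "g \<in> L2_edge E" "h \<in> L2_edge E"
  shows "edge_norm E (\<lambda>x. f x - h x) \<le> edge_norm E (\<lambda>x. f x - g x) + edge_norm E (\<lambda>x. g x - h x)"
  unfolding edge_norm_def by (intro L2_norm_triangle_diff L2_edgeD assms)

lemma edge_norm_commute: "edge_norm E (\<lambda>x. f x - g x) = edge_norm E (\<lambda>x. g x - f x)"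
  unfolding edge_norm_def by (rule L2_norm_minus_commute)

lemma H1_limit_edge_bound:
  assumes v: "v \<in> H1 (interior T)"
  obtains C where "0 \<le> C" "\<And>\<phi> \<psi>. smooth \<phi> \<Longrightarrow> smooth \<psi> \<Longrightarrow> edge_norm E (\<lambda>x. \<phi> x - \<psi> x)
    \<le> C * (L2_norm (lebesgue_on T) (\<lambda>x. \<phi> x - v x) + L2_norm (lebesgue_on T) (\<lambda>x. gradient \<phi> x - weak_gradient (interior T) v x)
         + (L2_norm (lebesgue_on T) (\<lambda>x. \<psi> x - v x) + L2_norm (lebesgue_on T) (\<lambda>x. gradient \<psi> x - weak_gradient (interior T) v x)))"
proof -
  obtain C where C: "0 \<le> C"
    "\<And>\<phi>. Ck 1 \<phi> \<Longrightarrow> edge_norm E \<phi> \<le> C * (L2_norm (lebesgue_on T) \<phi> + L2_norm (lebesgue_on T) (gradient \<phi>))"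
    by (rule trace_inequality[OF T E]) (rule that)
  note T' = convex_bodyD[OF T_body]
  let ?M = "lebesgue_on T"
  have vL: "v \<in> L2 ?M" "weak_gradient (interior T) v \<in> L2 ?M"
    using H1_L2[OF v] weak_gradient_L2[OF v] by (simp_all add: interior_null_change[OF T_body])
  show ?thesis
  proof (rule that[OF C(1)])
    fix \<phi> \<psi> assume s: "smooth \<phi>" "smooth \<psi>"
    note L = L2_smooth[OF s(1) T'(4,6)] L2_smooth[OF s(2) T'(4,6)] L2_gradient_smooth[OF s(1) T'(4,6)] L2_gradient_smooth[OF s(2) T'(4,6)]
    have g: "gradient (\<lambda>x. \<phi> x - \<psi> x) = (\<lambda>x. gradient \<phi> x - gradient \<psi> x)"
      using gradient_diff smooth_differentiable s by auto
    have "edge_norm E (\<lambda>x. \<phi> x - \<psi> x) \<le> C * (L2_norm ?M (\<lambda>x. \<phi> x - \<psi> x) + L2_norm ?M (\<lambda>x. gradient \<phi> x - gradient \<psi> x))"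
      using C(2)[OF smooth_Ck[OF smooth_diff[OF s]]] unfolding g .
    also have "\<dots> \<le> C * (L2_norm ?M (\<lambda>x. \<phi> x - v x) + L2_norm ?M (\<lambda>x. gradient \<phi> x - weak_gradient (interior T) v x)
         + (L2_norm ?M (\<lambda>x. \<psi> x - v x) + L2_norm ?M (\<lambda>x. gradient \<psi> x - weak_gradient (interior T) v x)))"
      using L2_norm_triangle_diff[OF L(1) vL(1) L(2)] L2_norm_triangle_diff[OF L(3) vL(2) L(4)]
        L2_norm_minus_commute[of ?M v \<psi>] L2_norm_minus_commute[of ?M "weak_gradient (interior T) v" "gradient \<psi>"]
      by (intro mult_left_mono[OF _ C(1)]) linarith
    finally show "edge_norm E (\<lambda>x. \<phi> x - \<psi> x) \<le> C * (L2_norm ?M (\<lambda>x. \<phi> x - v x) + L2_norm ?M (\<lambda>x. gradient \<phi> x - weak_gradient (interior T) v x)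
         + (L2_norm ?M (\<lambda>x. \<psi> x - v x) + L2_norm ?M (\<lambda>x. gradient \<psi> x - weak_gradient (interior T) v x)))" .
  qed
qed

lemma H1_limit_edge_diff:
  assumes v: "v \<in> H1 (interior T)" and "H1_limit T \<phi> v" "H1_limit T \<psi> v"
  shows "(\<lambda>n. edge_norm E (\<lambda>x. \<phi> n x - \<psi> n x)) \<longlonglongrightarrow> 0"
proof -
  obtain C where C: "\<And>\<phi> \<psi>. smooth \<phi> \<Longrightarrow> smooth \<psi> \<Longrightarrow> edge_norm E (\<lambda>x. \<phi> x - \<psi> x)
    \<le> C * (L2_norm (lebesgue_on T) (\<lambda>x. \<phi> x - v x) + L2_norm (lebesgue_on T) (\<lambda>x. gradient \<phi> x - weak_gradient (interior T) v x)
         + (L2_norm (lebesgue_on T) (\<lambda>x. \<psi> x - v x) + L2_norm (lebesgue_on T) (\<lambda>x. gradient \<psi> x - weak_gradient (interior T) v x)))"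
    by (rule H1_limit_edge_bound[OF v]) (rule that)
  let ?b = "\<lambda>\<phi> n. L2_norm (lebesgue_on T) (\<lambda>x. \<phi> n x - v x) + L2_norm (lebesgue_on T) (\<lambda>x. gradient (\<phi> n) x - weak_gradient (interior T) v x)"
  have b: "?b w \<longlonglongrightarrow> 0" if "H1_limit T w v" for w
    using that unfolding H1_limit_def by (auto intro: tendsto_add_zero)
  have "(\<lambda>n. C * (?b \<phi> n + ?b \<psi> n)) \<longlonglongrightarrow> 0"
    by (intro tendsto_mult_right_zero tendsto_add_zero b assms)
  then show ?thesis
  proof (rule Lim_null_comparison[rotated], intro always_eventually allI)
    show "norm (edge_norm E (\<lambda>x. \<phi> n x - \<psi> n x)) \<le> C * (?b \<phi> n + ?b \<psi> n)" for n
      using C[of "\<phi> n" "\<psi> n"] assms by (simp add: H1_limit_def edge_norm_nonneg)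
  qed
qed

lemma H1_limit_exists:
  assumes v: "v \<in> H1 (interior T)"
  obtains \<phi> where "H1_limit T \<phi> v"
proof -
  have vL: "v \<in> L2 (lebesgue_on T)" using H1_L2[OF v] by (simp add: interior_null_change[OF T_body])
  show ?thesis
  proof (rule H1_smooth_approximation[OF T_body H1_weak_gradient[OF v] vL])
    fix \<phi> assume "\<And>n. smooth (\<phi> n)" "(\<lambda>n. L2_norm (lebesgue_on T) (\<lambda>x. \<phi> n x - v x)) \<longlonglongrightarrow> 0"
      "(\<lambda>n. L2_norm (lebesgue_on T) (\<lambda>x. gradient (\<phi> n) x - weak_gradient (interior T) v x)) \<longlonglongrightarrow> 0"
    then have "H1_limit T \<phi> v" by (simp add: H1_limit_def)
    then show ?thesis by (rule that)
  qed
qed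

text \<open>By the trace inequality the restrictions of an approximating sequence form a Cauchy
  sequence on the edge, and completeness provides the limit.\<close>

lemma edge_trace_exists:
  assumes v: "v \<in> H1 (interior T)"
  shows "\<exists>g. is_edge_trace T E v g"
proof -
  obtain \<phi> where \<phi>: "H1_limit T \<phi> v" using H1_limit_exists[OF v] .
  obtain p q r where pq: "E = closed_segment p q" and "0 < orient p q r"
    using triangle_edge[OF T E] .
  then have d: "p \<noteq> q" using orient_distinct[of p q r] by simp
  \<comment> \<open>Injectivity allows the limit, a function of the parameter, to be read as a
    function of the points of the edge.\<close>
  have inj: "inj (edge_path E)"
  proof -
    have "inj (linepath a b)" if "a \<noteq> b" for a b :: point
    proof (rule injI)
      fix s t assume "linepath a b s = linepath a b t"
      then have "(t - s) *\<^sub>R (b - a) = 0" by (simp add: linepath_def algebra_simps)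
      then show "s = t" using that by simp
    qed
    then show ?thesis using edge_path_segment[of p q] d unfolding pq by metis
  qed
  obtain C where C: "0 \<le> C" "\<And>\<phi> \<psi>. smooth \<phi> \<Longrightarrow> smooth \<psi> \<Longrightarrow> edge_norm E (\<lambda>x. \<phi> x - \<psi> x)
    \<le> C * (L2_norm (lebesgue_on T) (\<lambda>x. \<phi> x - v x) + L2_norm (lebesgue_on T) (\<lambda>x. gradient \<phi> x - weak_gradient (interior T) v x)
         + (L2_norm (lebesgue_on T) (\<lambda>x. \<psi> x - v x) + L2_norm (lebesgue_on T) (\<lambda>x. gradient \<psi> x - weak_gradient (interior T) v x)))"
    by (rule H1_limit_edge_bound[OF v]) (rule that)
  let ?b = "\<lambda>n. L2_norm (lebesgue_on T) (\<lambda>x. \<phi> n x - v x) + L2_norm (lebesgue_on T) (\<lambda>x. gradient (\<phi> n) x - weak_gradient (interior T) v x)"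
  have b: "?b \<longlonglongrightarrow> 0" using \<phi> unfolding H1_limit_def by (auto intro: tendsto_add_zero)
  have sm: "smooth (\<phi> n)" for n using \<phi> by (simp add: H1_limit_def)
  obtain g0 where g0: "g0 \<in> L2 unit_measure"
    "(\<lambda>n. L2_norm unit_measure (\<lambda>t. \<phi> n (edge_path E t) - g0 t)) \<longlonglongrightarrow> 0"
  proof (rule L2_complete[OF finite_unit_measure, of "\<lambda>n t. \<phi> n (edge_path E t)"])
    show "(\<lambda>t. \<phi> n (edge_path E t)) \<in> L2 unit_measure" for n by (rule L2_edgeD[OF smooth_L2_edge[OF sm]])
    fix e :: real assume e: "0 < e"
    then have "0 < e / (2 * (C + 1))" using C(1) by simp
    from order_tendstoD(2)[OF b this] obtain N where N: "\<And>n. N \<le> n \<Longrightarrow> ?b n < e / (2 * (C + 1))"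
      by (auto simp: eventually_sequentially)
    show "\<exists>N. \<forall>m\<ge>N. \<forall>n\<ge>N. L2_norm unit_measure (\<lambda>t. \<phi> m (edge_path E t) - \<phi> n (edge_path E t)) < e"
    proof (intro exI allI impI)
      fix m n assume mn: "N \<le> m" "N \<le> n"
      have "edge_norm E (\<lambda>x. \<phi> m x - \<phi> n x) \<le> C * (?b m + ?b n)" by (rule C(2)[OF sm sm])
      also have "\<dots> \<le> C * (e / (2 * (C + 1)) + e / (2 * (C + 1)))"
        using N[OF mn(1)] N[OF mn(2)] by (intro mult_left_mono[OF _ C(1)]) linarith
      also have "e / (2 * (C + 1)) = (e / (C + 1)) / 2" by simp
      also have "C * ((e / (C + 1)) / 2 + (e / (C + 1)) / 2) = e * (C / (C + 1))"
        by (simp only: field_sum_of_halves) simp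
      also have "\<dots> < e * 1" using C(1) e by (intro mult_strict_left_mono) simp_all
      finally show "L2_norm unit_measure (\<lambda>t. \<phi> m (edge_path E t) - \<phi> n (edge_path E t)) < e"
        by (simp add: edge_norm_def)
    qed
  qed (rule that)
  let ?g = "\<lambda>x. g0 (inv (edge_path E) x)"
  have gp: "?g (edge_path E t) = g0 t" for t by (simp add: inv_f_f[OF inj])
  have "is_edge_trace T E v ?g"
    unfolding is_edge_trace_iff using v g0 \<phi> by (auto simp: L2_edge_def edge_norm_def gp)
  then show ?thesis by blast
qed

lemma edge_trace_is_trace: "v \<in> H1 (interior T) \<Longrightarrow> is_edge_trace T E v (edge_trace T E v)"
  unfolding edge_trace_def by (rule someI_ex[OF edge_trace_exists])

lemma edge_trace_L2: "v \<in> H1 (interior T) \<Longrightarrow> edge_trace T E v \<in> L2_edge E"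
  using edge_trace_is_trace by (simp add: is_edge_trace_def)

text \<open>The definition asks for one approximating sequence; here every sequence converging to v
  in H1 yields the same trace, since two such sequences have restrictions whose difference tends to
  zero. Uniqueness, differences and Green's formula rely on this freedom.\<close>

lemma is_edge_trace_limit:
  assumes g: "is_edge_trace T E v g" and \<phi>: "H1_limit T \<phi> v"
  shows "(\<lambda>n. edge_norm E (\<lambda>x. \<phi> n x - g x)) \<longlonglongrightarrow> 0"
proof -
  from g obtain \<psi> where v: "v \<in> H1 (interior T)" and gL: "g \<in> L2_edge E" and \<psi>: "H1_limit T \<psi> v"
      and lim: "(\<lambda>n. edge_norm E (\<lambda>x. \<psi> n x - g x)) \<longlonglongrightarrow> 0"
    unfolding is_edge_trace_iff by blast
  from tendsto_add_zero[OF H1_limit_edge_diff[OF v \<phi> \<psi>] lim]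
  show ?thesis
  proof (rule Lim_null_comparison[rotated], intro always_eventually allI)
    fix n
    have "\<phi> n \<in> L2_edge E" "\<psi> n \<in> L2_edge E" using \<phi> \<psi> smooth_L2_edge by (auto simp: H1_limit_def)
    from edge_norm_triangle[OF this gL]
    show "norm (edge_norm E (\<lambda>x. \<phi> n x - g x)) \<le> edge_norm E (\<lambda>x. \<phi> n x - \<psi> n x) + edge_norm E (\<lambda>x. \<psi> n x - g x)"
      by (simp add: edge_norm_nonneg)
  qed
qed

lemma is_edge_trace_unique:
  assumes g: "is_edge_trace T E v g" and h: "is_edge_trace T E v h"
  shows "AE_edge E (\<lambda>x. g x = h x)"
proof -
  from g obtain \<phi> where gL: "g \<in> L2_edge E" and \<phi>: "H1_limit T \<phi> v" unfolding is_edge_trace_iff by blast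
  have hL: "h \<in> L2_edge E" using h by (simp add: is_edge_trace_def)
  have "(\<lambda>n. edge_norm E (\<lambda>x. g x - h x)) \<longlonglongrightarrow> 0"
    using tendsto_add_zero[OF is_edge_trace_limit[OF g \<phi>] is_edge_trace_limit[OF h \<phi>]]
  proof (rule Lim_null_comparison[rotated], intro always_eventually allI)
    fix n
    have "\<phi> n \<in> L2_edge E" using \<phi> smooth_L2_edge by (auto simp: H1_limit_def)
    from edge_norm_triangle[OF gL this hL] edge_norm_commute[of g "\<phi> n"]
    show "norm (edge_norm E (\<lambda>x. g x - h x)) \<le> edge_norm E (\<lambda>x. \<phi> n x - g x) + edge_norm E (\<lambda>x. \<phi> n x - h x)"
      by (simp add: edge_norm_nonneg)
  qed
  then have "edge_norm E (\<lambda>x. g x - h x) = 0" by (simp add: LIMSEQ_const_iff)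
  then have "AE t in unit_measure. g (edge_path E t) - h (edge_path E t) = 0"
    unfolding edge_norm_def by (subst (asm) L2_norm_zero_iff) (intro L2_diff L2_edgeD gL hL)
  then show ?thesis unfolding AE_edge_def by simp
qed

lemma edge_trace_eqI: "is_edge_trace T E v g \<Longrightarrow> AE_edge E (\<lambda>x. edge_trace T E v x = g x)"
  by (rule is_edge_trace_unique[OF edge_trace_is_trace]) (simp_all add: is_edge_trace_def)

text \<open>The constant sequence q approximates v. Traces of piecewise polynomials are computed in
  this way.\<close>

lemma edge_trace_smooth:
  assumes q: "smooth q" and v: "AE x in lebesgue_on T. v x = q x"
  shows "AE_edge E (\<lambda>x. edge_trace T E v x = q x)"
proof -
  note T' = convex_bodyD[OF T_body]
  let ?M = "lebesgue_on T"
  note g = weak_gradient_smooth_AE(2)[OF T_body q v]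
  have qL: "q \<in> L2 ?M" by (rule L2_smooth[OF q T'(4,6)])
  have vH: "v \<in> H1 (interior T)" by (rule weak_gradient_smooth_AE(1)[OF T_body q v])
  have vL: "v \<in> L2 ?M" using H1_L2[OF vH] by (simp add: interior_null_change[OF T_body])
  have "L2_norm ?M (\<lambda>x. q x - v x) = 0"
    unfolding L2_norm_zero_iff[OF L2_diff[OF qL vL]] using v by eventually_elim simp
  moreover have "L2_norm ?M (\<lambda>x. gradient q x - weak_gradient (interior T) v x) = 0"
  proof -
    have "weak_gradient (interior T) v \<in> L2 ?M"
      using weak_gradient_L2[OF vH] by (simp add: interior_null_change[OF T_body])
    note L = L2_diff[OF L2_gradient_smooth[OF q T'(4,6)] this]
    show ?thesis unfolding L2_norm_zero_iff[OF L] using g by eventually_elim simp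
  qed
  ultimately have "H1_limit T (\<lambda>n. q) v" using q by (simp add: H1_limit_def)
  moreover have "edge_norm E (\<lambda>x. q x - q x) = 0" by (simp add: edge_norm_def L2_norm_def L2_inner_def)
  ultimately have "is_edge_trace T E v q"
    unfolding is_edge_trace_iff using vH smooth_L2_edge[OF q] by auto
  then show "AE_edge E (\<lambda>x. edge_trace T E v x = q x)" by (rule edge_trace_eqI)
qed

lemma edge_trace_diff:
  assumes v: "v \<in> H1 (interior T)" and w: "w \<in> H1 (interior T)"
  shows "AE_edge E (\<lambda>x. edge_trace T E (\<lambda>x. v x - w x) x = edge_trace T E v x - edge_trace T E w x)"
proof (rule edge_trace_eqI)
  note T' = convex_bodyD[OF T_body]
  let ?M = "lebesgue_on T" and ?tv = "edge_trace T E v" and ?tw = "edge_trace T E w"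
    and ?g = "weak_gradient (interior T)"
  obtain \<phi> where \<phi>: "H1_limit T \<phi> v" using H1_limit_exists[OF v] .
  obtain \<psi> where \<psi>: "H1_limit T \<psi> w" using H1_limit_exists[OF w] .
  note wd = weak_gradient_diff[OF T_body v w]
  have sm: "smooth (\<phi> n)" "smooth (\<psi> n)" for n using \<phi> \<psi> by (auto simp: H1_limit_def)
  have L: "v \<in> L2 ?M" "w \<in> L2 ?M" "?g v \<in> L2 ?M" "?g w \<in> L2 ?M" "?g (\<lambda>x. v x - w x) \<in> L2 ?M"
    using H1_L2[OF v] H1_L2[OF w] weak_gradient_L2[OF v] weak_gradient_L2[OF w] weak_gradient_L2[OF wd(2)]
    by (simp_all add: interior_null_change[OF T_body])
  note Ls = L2_smooth[OF sm(1) T'(4,6)] L2_smooth[OF sm(2) T'(4,6)] L2_gradient_smooth[OF sm(1) T'(4,6)] L2_gradient_smooth[OF sm(2) T'(4,6)]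
  have tri: "L2_norm M (\<lambda>x. (a x - b x) - (c x - d x)) \<le> L2_norm M (\<lambda>x. a x - c x) + L2_norm M (\<lambda>x. b x - d x)"
    if "a \<in> L2 M" "b \<in> L2 M" "c \<in> L2 M" "d \<in> L2 M" for M :: "'x measure" and a b c d :: "'x \<Rightarrow> 'y::euclidean_space"
  proof -
    have "(\<lambda>x. (a x - b x) - (c x - d x)) = (\<lambda>x. (a x - c x) + (d x - b x))" by (simp add: fun_eq_iff)
    then show ?thesis
      using L2_norm_triangle[OF L2_diff[OF that(1,3)] L2_diff[OF that(4,2)]] L2_norm_minus_commute[of M d b] by simp
  qed
  have "H1_limit T (\<lambda>n x. \<phi> n x - \<psi> n x) (\<lambda>x. v x - w x)"
    unfolding H1_limit_def
  proof (intro conjI allI smooth_diff sm)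
    have "(\<lambda>n. L2_norm ?M (\<lambda>x. \<phi> n x - v x) + L2_norm ?M (\<lambda>x. \<psi> n x - w x)) \<longlonglongrightarrow> 0"
      using \<phi> \<psi> by (intro tendsto_add_zero) (auto simp: H1_limit_def)
    then show "(\<lambda>n. L2_norm ?M (\<lambda>x. \<phi> n x - \<psi> n x - (v x - w x))) \<longlonglongrightarrow> 0"
      by (rule Lim_null_comparison[rotated], intro always_eventually allI)
        (simp add: tri Ls L)
    have "(\<lambda>n. L2_norm ?M (\<lambda>x. gradient (\<phi> n) x - ?g v x) + L2_norm ?M (\<lambda>x. gradient (\<psi> n) x - ?g w x)) \<longlonglongrightarrow> 0"
      using \<phi> \<psi> by (intro tendsto_add_zero) (auto simp: H1_limit_def)
    then show "(\<lambda>n. L2_norm ?M (\<lambda>x. gradient (\<lambda>x. \<phi> n x - \<psi> n x) x - ?g (\<lambda>x. v x - w x) x)) \<longlonglongrightarrow> 0"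
    proof (rule Lim_null_comparison[rotated], intro always_eventually allI)
      fix n
      have g: "gradient (\<lambda>x. \<phi> n x - \<psi> n x) x = gradient (\<phi> n) x - gradient (\<psi> n) x" for x
        by (intro gradient_diff smooth_differentiable sm)
      have "L2_norm ?M (\<lambda>x. gradient (\<lambda>x. \<phi> n x - \<psi> n x) x - ?g (\<lambda>x. v x - w x) x)
          = L2_norm ?M (\<lambda>x. (gradient (\<phi> n) x - gradient (\<psi> n) x) - (?g v x - ?g w x))"
        unfolding g
      proof (intro L2_norm_cong_AE L2_measurable L2_diff Ls L)
        show "AE x in ?M. gradient (\<phi> n) x - gradient (\<psi> n) x - ?g (\<lambda>x. v x - w x) x
          = gradient (\<phi> n) x - gradient (\<psi> n) x - (?g v x - ?g w x)"
          using wd(1) by eventually_elim simp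
      qed
      also have "\<dots> \<le> L2_norm ?M (\<lambda>x. gradient (\<phi> n) x - ?g v x) + L2_norm ?M (\<lambda>x. gradient (\<psi> n) x - ?g w x)"
        by (intro tri Ls L)
      finally show "norm (L2_norm ?M (\<lambda>x. gradient (\<lambda>x. \<phi> n x - \<psi> n x) x - ?g (\<lambda>x. v x - w x) x))
        \<le> L2_norm ?M (\<lambda>x. gradient (\<phi> n) x - ?g v x) + L2_norm ?M (\<lambda>x. gradient (\<psi> n) x - ?g w x)" by simp
    qed
  qed
  moreover have "(\<lambda>x. ?tv x - ?tw x) \<in> L2_edge E"
    unfolding L2_edge_def using L2_diff[OF L2_edgeD[OF edge_trace_L2[OF v]] L2_edgeD[OF edge_trace_L2[OF w]]] by simp
  moreover have "(\<lambda>n. edge_norm E (\<lambda>x. \<phi> n x - \<psi> n x - (?tv x - ?tw x))) \<longlonglongrightarrow> 0"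
    using tendsto_add_zero[OF is_edge_trace_limit[OF edge_trace_is_trace[OF v] \<phi>] is_edge_trace_limit[OF edge_trace_is_trace[OF w] \<psi>]]
    by (rule Lim_null_comparison[rotated], intro always_eventually allI)
      (simp add: edge_norm_def tri L2_edgeD smooth_L2_edge sm edge_trace_L2 v w)
  ultimately show "is_edge_trace T E (\<lambda>x. v x - w x) (\<lambda>x. ?tv x - ?tw x)"
    unfolding is_edge_trace_iff using wd(2) by blast
qed

end

lemma edge_integral_mult:
  "edge_integral E (\<lambda>x. h x * g x) = dist (edge_path E 0) (edge_path E 1) *
     L2_inner unit_measure (\<lambda>t. g (edge_path E t)) (\<lambda>t. h (edge_path E t))"
  by (simp add: edge_integral_def L2_inner_def mult.commute)

text \<open>Both sides of the formula for smooth functions pass to the limit: the volume terms by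
  convergence in H1, the edge terms by convergence of the traces.\<close>

lemma green_H1:
  assumes T: "2 simplex T" and F: "\<And>i. smooth (\<lambda>x. F x $ i)" and v: "v \<in> H1 (interior T)"
  shows "(LINT x|lebesgue_on T. F x \<bullet> weak_gradient (interior T) v x + vdiv F x * v x)
    = (\<Sum>E | E edge_of T. edge_integral E (\<lambda>x. (F x \<bullet> outward_normal T E) * edge_trace T E v x))"
proof -
  note body = triangle_convex_body[OF T]
  note T' = convex_bodyD[OF body]
  let ?M = "lebesgue_on T" and ?g = "weak_gradient (interior T) v"
  obtain \<phi> where \<phi>: "H1_limit T \<phi> v"
  proof -
    obtain E where "E edge_of T"
    proof -
      obtain a b c where "T = convex hull {a, b, c}" "0 < orient a b c" using simplex_2_vertices[OF T] .
      then have "closed_segment a b edge_of T" using edge_of_triangle_iff[of a b c] by simp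
      then show thesis by (rule that)
    qed
    from H1_limit_exists[OF T this v] show thesis using that .
  qed
  have sm: "smooth (\<phi> n)" for n using \<phi> by (simp add: H1_limit_def)
  have Fc: "continuous_on UNIV F"
    using continuous_on_vec_lambda[of UNIV "\<lambda>i x. F x $ i"] smooth_continuous[OF F] by simp
  have dc: "continuous_on UNIV (vdiv F)"
    unfolding vdiv_def[abs_def] by (intro continuous_on_add smooth_continuous smooth_gradient F)
  have FL: "F \<in> L2 ?M" by (rule L2_continuous[OF Fc T'(4,6)])
  have dL: "vdiv F \<in> L2 ?M" by (rule L2_continuous[OF dc T'(4,6)])
  have vL: "v \<in> L2 ?M" "?g \<in> L2 ?M"
    using H1_L2[OF v] weak_gradient_L2[OF v] by (simp_all add: interior_null_change[OF body])
  note Ls = L2_smooth[OF sm T'(4,6)] L2_gradient_smooth[OF sm T'(4,6)]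
  have eq: "(LINT x|?M. F x \<bullet> w x + vdiv F x * s x) = L2_inner ?M w F + L2_inner ?M s (vdiv F)"
    if "w \<in> L2 ?M" "s \<in> L2 ?M" for w s
    using L2_inner_integrable[OF that(1) FL] L2_inner_integrable[OF that(2) dL]
    by (simp add: L2_inner_def inner_commute mult.commute)
  have "(\<lambda>n. L2_inner ?M (gradient (\<phi> n)) F + L2_inner ?M (\<phi> n) (vdiv F)) \<longlonglongrightarrow> L2_inner ?M ?g F + L2_inner ?M v (vdiv F)"
    using \<phi> unfolding H1_limit_def by (intro tendsto_add L2_inner_tendsto Ls vL FL dL) auto
  moreover have "L2_inner ?M (gradient (\<phi> n)) F + L2_inner ?M (\<phi> n) (vdiv F)
      = (\<Sum>E | E edge_of T. edge_integral E (\<lambda>x. (F x \<bullet> outward_normal T E) * \<phi> n x))" for n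
    unfolding eq[OF Ls(2) Ls(1), symmetric] by (rule green_C1[OF T smooth_Ck[OF F] smooth_Ck[OF sm]])
  moreover have "(\<lambda>n. \<Sum>E | E edge_of T. edge_integral E (\<lambda>x. (F x \<bullet> outward_normal T E) * \<phi> n x))
     \<longlonglongrightarrow> (\<Sum>E | E edge_of T. edge_integral E (\<lambda>x. (F x \<bullet> outward_normal T E) * edge_trace T E v x))"
  proof (rule tendsto_sum)
    fix E assume "E \<in> {E. E edge_of T}"
    then have E: "E edge_of T" by simp
    then obtain p q r where pq: "E = closed_segment p q" using triangle_edge[OF T] by blast
    have hc: "continuous_on UNIV (\<lambda>x. F x \<bullet> outward_normal T E)" by (intro continuous_intros Fc)
    show "(\<lambda>n. edge_integral E (\<lambda>x. (F x \<bullet> outward_normal T E) * \<phi> n x))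
      \<longlonglongrightarrow> edge_integral E (\<lambda>x. (F x \<bullet> outward_normal T E) * edge_trace T E v x)"
      unfolding edge_integral_mult
    proof (intro tendsto_mult tendsto_const L2_inner_tendsto)
      show "(\<lambda>t. edge_trace T E v (edge_path E t)) \<in> L2 unit_measure"
        by (rule L2_edgeD[OF edge_trace_L2[OF T E v]])
      show "(\<lambda>t. \<phi> n (edge_path E t)) \<in> L2 unit_measure" for n
        by (rule L2_edgeD[OF smooth_L2_edge[OF T E sm]])
      show "(\<lambda>t. F (edge_path E t) \<bullet> outward_normal T E) \<in> L2 unit_measure"
        using L2_edgeD[OF L2_edge_continuous[OF hc, of p q]] pq by simp
      show "(\<lambda>n. L2_norm unit_measure (\<lambda>t. \<phi> n (edge_path E t) - edge_trace T E v (edge_path E t))) \<longlonglongrightarrow> 0"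
        using is_edge_trace_limit[OF T E edge_trace_is_trace[OF T E v] \<phi>] by (simp add: edge_norm_def)
    qed
  qed
  ultimately show ?thesis
    unfolding eq[OF vL(2) vL(1)] using LIMSEQ_unique by (simp only:)
qed

subsection \<open>Triangulations of polygonal domains\<close>

text \<open>The three values of \<open>orient\<close> at y are the barycentric coordinates of y
  multiplied by \<open>orient p q r\<close>. Undivided they are affine in y, and their signs decide
  membership in the triangle.\<close>

lemma orient_sum: "orient q r y + orient r p y + orient p q y = orient p q r"
  by (simp add: orient_def algebra_simps)

lemma orient_barycentric:
  "orient q r y *\<^sub>R p + orient r p y *\<^sub>R q + orient p q y *\<^sub>R r = orient p q r *\<^sub>R y"
  by (simp add: vec_eq_iff forall_2 orient_def algebra_simps)

lemma mem_triangle: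
  assumes "0 < orient p q r" "0 \<le> orient q r y" "0 \<le> orient r p y" "0 \<le> orient p q y"
  shows "y \<in> convex hull {p, q, r}"
proof -
  let ?D = "orient p q r"
  have "y = (1 / ?D) *\<^sub>R (?D *\<^sub>R y)" using assms(1) by simp
  also have "\<dots> = (orient q r y / ?D) *\<^sub>R p + (orient r p y / ?D) *\<^sub>R q + (orient p q y / ?D) *\<^sub>R r"
    unfolding orient_barycentric[of q r y p, symmetric] by (simp add: scaleR_add_right divide_inverse_commute mult.commute)
  finally have y: "y = (orient q r y / ?D) *\<^sub>R p + (orient r p y / ?D) *\<^sub>R q + (orient p q y / ?D) *\<^sub>R r" .
  have "orient q r y / ?D + orient r p y / ?D + orient p q y / ?D = 1"
    unfolding add_divide_distrib[symmetric] orient_sum using assms(1) by simp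
  then show ?thesis
    unfolding convex_hull_3 using y assms
    by (intro CollectI exI[of _ "orient q r y / ?D"] exI[of _ "orient r p y / ?D"] exI[of _ "orient p q y / ?D"]) simp
qed

lemma continuous_on_orient [continuous_intros]: "continuous_on UNIV (orient p q)"
  unfolding orient_def by (intro continuous_intros)

lemma interior_triangle:
  assumes "0 < orient p q r" "0 < orient q r y" "0 < orient r p y" "0 < orient p q y"
  shows "y \<in> interior (convex hull {p, q, r})"
proof (rule interiorI)
  let ?U = "{y. 0 < orient q r y \<and> 0 < orient r p y \<and> 0 < orient p q y}"
  show "open ?U" by (intro open_Collect_conj open_Collect_less continuous_intros)
  show "y \<in> ?U" using assms by simp
  show "?U \<subseteq> convex hull {p, q, r}" using mem_triangle[OF assms(1)] by (auto intro: less_imp_le)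
qed

lemma orient_on_segment:
  assumes "x = p + t *\<^sub>R (q - p)"
  shows "orient q r x = (1 - t) * orient p q r" "orient r p x = t * orient p q r" "orient p q x = 0"
  unfolding assms orient_def by (simp_all add: algebra_simps)

lemma open_segment_points:
  assumes "x \<in> open_segment p q" obtains t where "0 < t" "t < 1" "x = p + t *\<^sub>R (q - p)"
proof -
  obtain t where "0 < t" "t < 1" "x = (1 - t) *\<^sub>R p + t *\<^sub>R q"
    using assms by (auto simp: in_segment)
  then show ?thesis by (intro that[of t]) (auto simp: algebra_simps)
qed

context
  fixes \<Omega> :: "point set" and \<T> :: "point set set"
  assumes domain: "polygonal_domain \<Omega>" and mesh: "triangulates \<T> \<Omega>"
begin

lemma mesh_finite: "finite \<T>"
  and mesh_simplex: "T \<in> \<T> \<Longrightarrow> 2 simplex T"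
  and mesh_face: "T \<in> \<T> \<Longrightarrow> T' \<in> \<T> \<Longrightarrow> T \<inter> T' face_of T"
  and mesh_Union: "\<Union>\<T> = closure \<Omega>"
  using mesh by (auto simp: triangulates_def triangulation_def)

lemma domain_open: "open \<Omega>" and domain_bounded: "bounded \<Omega>" and domain_interior: "interior (closure \<Omega>) = \<Omega>"
  using domain by (auto simp: polygonal_domain_def)

lemma domain_bounded_open: "bounded_open \<Omega>"
  by (simp add: bounded_open_def domain_open domain_bounded)

lemma mesh_body: "T \<in> \<T> \<Longrightarrow> convex_body T"
  by (rule triangle_convex_body[OF mesh_simplex])

text \<open>A face of T that meets the interior of T is all of T; then T is a face of T' of the same
  dimension and the two coincide.\<close>

lemma mesh_interior_disjoint:
  assumes "T \<in> \<T>" "T' \<in> \<T>" "T \<noteq> T'" shows "interior T \<inter> T' = {}"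
proof (rule ccontr)
  assume ne: "interior T \<inter> T' \<noteq> {}"
  have f: "T \<inter> T' face_of T" by (rule mesh_face[OF assms(1,2)])
  have f': "T \<inter> T' face_of T'" using mesh_face[OF assms(2,1)] by (simp add: Int_commute)
  have eq: "T \<inter> T' = T"
  proof (rule ccontr)
    assume "T \<inter> T' \<noteq> T"
    from face_of_disjoint_interior[OF f this] ne interior_subset[of T] show False by blast
  qed
  have "T face_of T'" using f' eq by simp
  moreover have "aff_dim T = aff_dim T'"
    using aff_dim_simplex[OF mesh_simplex[OF assms(1)]] aff_dim_simplex[OF mesh_simplex[OF assms(2)]] by simp
  ultimately show False
    using face_of_aff_dim_lt[of T' T] convex_bodyD(2)[OF mesh_body[OF assms(2)]] assms(3) by auto
qed

lemma mesh_interior_subset: "T \<in> \<T> \<Longrightarrow> interior T \<subseteq> \<Omega>"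
  using interior_mono[of T "closure \<Omega>"] mesh_Union domain_interior by auto

lemma mesh_null: "negligible (\<Omega> - (\<Union>T\<in>\<T>. interior T))"
proof -
  have "negligible (\<Union>T\<in>\<T>. T - interior T)"
    by (rule negligible_Union) (auto intro: mesh_finite convex_bodyD(8) mesh_body)
  moreover have "\<Omega> - (\<Union>T\<in>\<T>. interior T) \<subseteq> (\<Union>T\<in>\<T>. T - interior T)"
  proof
    fix x assume x: "x \<in> \<Omega> - (\<Union>T\<in>\<T>. interior T)"
    then have "x \<in> \<Union>\<T>" unfolding mesh_Union using closure_subset by blast
    then show "x \<in> (\<Union>T\<in>\<T>. T - interior T)" using x by blast
  qed
  ultimately show ?thesis by (rule negligible_subset)
qed

text \<open>Closed triangles overlap along edges, so the decomposition uses interiors, which are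
  disjoint and exhaust \<Omega> up to a null set.\<close>

lemma mesh_pieces:
  fixes f :: "point \<Rightarrow> 'b::real_vector"
  shows "AE x in lebesgue. (\<Sum>T\<in>\<T>. if x \<in> interior T then f x else 0) = (if x \<in> \<Omega> then f x else 0)"
proof -
  have "AE x in lebesgue. x \<notin> \<Omega> - (\<Union>T\<in>\<T>. interior T)"
    using mesh_null by (intro AE_not_in) (simp add: negligible_iff_null_sets)
  then show ?thesis
  proof eventually_elim
    fix x assume x: "x \<notin> \<Omega> - (\<Union>T\<in>\<T>. interior T)"
    show "(\<Sum>T\<in>\<T>. if x \<in> interior T then f x else 0) = (if x \<in> \<Omega> then f x else 0)"
    proof (cases "\<exists>T\<in>\<T>. x \<in> interior T")
      case True
      then obtain T where T: "T \<in> \<T>" "x \<in> interior T" by blast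
      have "x \<notin> interior T'" if "T' \<in> \<T>" "T' \<noteq> T" for T'
        using mesh_interior_disjoint[OF that(1) T(1) that(2)] T interior_subset[of T] by blast
      then have "(\<Sum>T\<in>\<T>. if x \<in> interior T then f x else 0) = (\<Sum>T'\<in>\<T>. if T' = T then f x else 0)"
        using T by (intro sum.cong) auto
      also have "\<dots> = f x" using T(1) mesh_finite by simp
      finally show ?thesis using T mesh_interior_subset by auto
    next
      case False
      then have "(\<Sum>T\<in>\<T>. if x \<in> interior T then f x else 0) = 0" by (intro sum.neutral) auto
      then show ?thesis using False x by auto
    qed
  qed
qed

section \<open>Measurability and integration over the mesh\<close>

lemma domain_lebesgue: "\<Omega> \<in> sets lebesgue"
  using domain_open by simp

lemma measurable_mesh:
  fixes f :: "point \<Rightarrow> 'b::euclidean_space"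
  assumes "\<And>T. T \<in> \<T> \<Longrightarrow> f \<in> borel_measurable (lebesgue_on T)"
  shows "f \<in> borel_measurable (lebesgue_on \<Omega>)"
proof (rule borel_measurable_if_D)
  have "(\<lambda>x. if x \<in> interior T then f x else 0) \<in> borel_measurable lebesgue" if "T \<in> \<T>" for T
    using assms[OF that] by (intro borel_measurable_if_I) (simp_all add: interior_null_change(4)[OF mesh_body[OF that]])
  then have "(\<lambda>x. \<Sum>T\<in>\<T>. if x \<in> interior T then f x else 0) \<in> borel_measurable lebesgue"
    by (intro borel_measurable_sum)
  from borel_measurable_AE[OF this mesh_pieces]
  show "(\<lambda>x. if x \<in> \<Omega> then f x else 0) \<in> borel_measurable lebesgue" .
qed

lemma integrable_interior_lebesgue:
  fixes f :: "point \<Rightarrow> 'b::euclidean_space"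
  assumes "T \<in> \<T>"
  shows "integrable lebesgue (\<lambda>x. if x \<in> interior T then f x else 0) \<longleftrightarrow> integrable (lebesgue_on T) f"
  unfolding integral_lebesgue_on(2)[OF convex_bodyD(7)[OF mesh_body[OF assms]], symmetric]
  by (rule integrable_lebesgue_on_null_change[OF convex_bodyD(7)[OF mesh_body[OF assms]]
        convex_bodyD(6)[OF mesh_body[OF assms]] interior_subset convex_bodyD(8)[OF mesh_body[OF assms]]])

lemma
  fixes f :: "point \<Rightarrow> 'b::euclidean_space"
  assumes "\<And>T. T \<in> \<T> \<Longrightarrow> integrable (lebesgue_on T) f"
  shows integrable_mesh: "integrable (lebesgue_on \<Omega>) f"
    and integral_mesh: "(LINT x|lebesgue_on \<Omega>. f x) = (\<Sum>T\<in>\<T>. LINT x|lebesgue_on T. f x)"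
proof -
  let ?s = "\<lambda>x. \<Sum>T\<in>\<T>. if x \<in> interior T then f x else 0"
  have i: "integrable lebesgue (\<lambda>x. if x \<in> interior T then f x else 0)" if "T \<in> \<T>" for T
    using assms[OF that] integrable_interior_lebesgue[OF that, of f] by simp
  then have si: "integrable lebesgue ?s" by (rule Bochner_Integration.integrable_sum)
  have m: "f \<in> borel_measurable (lebesgue_on \<Omega>)"
    by (rule measurable_mesh) (rule borel_measurable_integrable[OF assms])
  note m' = borel_measurable_if_I[OF m domain_lebesgue]
  have "integrable lebesgue (\<lambda>x. if x \<in> \<Omega> then f x else 0)"
    by (rule integrable_cong_AE_imp[OF si m']) (use mesh_pieces[of f] in \<open>eventually_elim, simp\<close>)
  then show "integrable (lebesgue_on \<Omega>) f" by (simp add: integral_lebesgue_on(2)[OF domain_lebesgue])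
  have "(LINT x|lebesgue_on \<Omega>. f x) = (LINT x|lebesgue. (if x \<in> \<Omega> then f x else 0))"
    by (rule integral_lebesgue_on(1)[OF domain_lebesgue])
  also have "\<dots> = (LINT x|lebesgue. ?s x)"
    by (rule integral_cong_AE[OF m' borel_measurable_integrable[OF si]]) (use mesh_pieces[of f] in \<open>eventually_elim, simp\<close>)
  also have "\<dots> = (\<Sum>T\<in>\<T>. LINT x|lebesgue. (if x \<in> interior T then f x else 0))"
    by (rule Bochner_Integration.integral_sum[OF i])
  also have "\<dots> = (\<Sum>T\<in>\<T>. LINT x|lebesgue_on T. f x)"
  proof (rule sum.cong[OF refl])
    fix T assume T: "T \<in> \<T>"
    show "(LINT x|lebesgue. (if x \<in> interior T then f x else 0)) = (LINT x|lebesgue_on T. f x)"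
      using interior_null_change(1)[OF mesh_body[OF T], of f]
        integral_lebesgue_on(1)[OF convex_bodyD(7)[OF mesh_body[OF T]], of f] by simp
  qed
  finally show "(LINT x|lebesgue_on \<Omega>. f x) = (\<Sum>T\<in>\<T>. LINT x|lebesgue_on T. f x)" .
qed

lemma L2_mesh_element:
  fixes f :: "point \<Rightarrow> 'b::euclidean_space"
  assumes "f \<in> L2 (lebesgue_on \<Omega>)" "T \<in> \<T>" shows "f \<in> L2 (lebesgue_on T)"
  using L2_lebesgue_on_subset[OF convex_bodyD(7)[OF mesh_body[OF assms(2)]] domain_lebesgue mesh_interior_subset[OF assms(2)] assms(1)]
  by (simp add: interior_null_change[OF mesh_body[OF assms(2)]])

lemma L2_mesh:
  fixes f :: "point \<Rightarrow> 'b::euclidean_space"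
  assumes "\<And>T. T \<in> \<T> \<Longrightarrow> f \<in> L2 (lebesgue_on T)" shows "f \<in> L2 (lebesgue_on \<Omega>)"
  using assms by (intro L2I measurable_mesh integrable_mesh) (auto dest: L2_measurable L2_integrable_square)

lemma L2_inner_mesh:
  assumes "f \<in> L2 (lebesgue_on \<Omega>)" "g \<in> L2 (lebesgue_on \<Omega>)"
  shows "L2_inner (lebesgue_on \<Omega>) f g = (\<Sum>T\<in>\<T>. L2_inner (lebesgue_on T) f g)"
  unfolding L2_inner_def
  by (rule integral_mesh) (rule L2_inner_integrable[OF L2_mesh_element[OF assms(1)] L2_mesh_element[OF assms(2)]])

lemma AE_mesh_element:
  assumes "AE x in lebesgue_on \<Omega>. P x" "T \<in> \<T>" shows "AE x in lebesgue_on T. P x"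
  using AE_lebesgue_on_subset[OF convex_bodyD(7)[OF mesh_body[OF assms(2)]] domain_lebesgue mesh_interior_subset[OF assms(2)] assms(1)]
  by (simp add: interior_null_change(3)[OF mesh_body[OF assms(2)]])

text \<open>Near an inner point of the edge the two triangles either lie on opposite sides or on the
  same side. In the first case they fill a neighbourhood, and the point is in \<Omega> because
  \<Omega> is the interior of its closure; in the second case they would overlap.\<close>

lemma shared_edge:
  assumes T: "T \<in> \<T>" "T' \<in> \<T>" "T \<noteq> T'" and E: "E edge_of T" "E edge_of T'" and pq: "E = closed_segment p q"
  shows "open_segment p q \<subseteq> \<Omega>"
proof
  fix x assume x: "x \<in> open_segment p q"
  obtain a b r where ab: "E = closed_segment a b" and hull: "T = convex hull {a, b, r}" and o: "0 < orient a b r"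
    using triangle_edge[OF mesh_simplex[OF T(1)] E(1)] .
  obtain c d s where cd: "E = closed_segment c d" and hull': "T' = convex hull {c, d, s}" and o': "0 < orient c d s"
    using triangle_edge[OF mesh_simplex[OF T(2)] E(2)] .
  have "x \<in> open_segment a b" using x pq ab by (auto simp: doubleton_eq_iff open_segment_commute)
  from open_segment_points[OF this] obtain t where t: "0 < t" "t < 1" and xt: "x = a + t *\<^sub>R (b - a)" .
  have "x \<in> open_segment c d" using x pq cd by (auto simp: doubleton_eq_iff open_segment_commute)
  from open_segment_points[OF this] obtain t' where t': "0 < t'" "t' < 1" and xt': "x = c + t' *\<^sub>R (d - c)" .
  \<comment> \<open>On this open set the inequalities for the two other edges of both triangles
    hold, so that only the side of the common edge decides membership.\<close>
  let ?W = "{y. (0 < orient b r y \<and> 0 < orient r a y) \<and> (0 < orient d s y \<and> 0 < orient s c y)}"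
  have W: "open ?W" by (intro open_Collect_conj open_Collect_less continuous_intros)
  have xW: "x \<in> ?W"
    using t t' o o' by (simp add: orient_on_segment(1,2)[OF xt] orient_on_segment(1,2)[OF xt'])
  have "c = b \<and> d = a \<or> c = a \<and> d = b" using ab cd by (auto simp: doubleton_eq_iff)
  then show "x \<in> \<Omega>"
  proof
    assume "c = b \<and> d = a"
    then have or: "orient c d y = - orient a b y" for y by (simp add: orient_def algebra_simps)
    have "?W \<subseteq> T \<union> T'"
    proof
      fix y assume y: "y \<in> ?W"
      show "y \<in> T \<union> T'"
      proof (cases "0 \<le> orient a b y")
        case True then show ?thesis using mem_triangle[OF o, of y] y hull by simp
      next
        case False then show ?thesis using mem_triangle[OF o', of y] y hull' or by simp
      qed
    qed
    also have "\<dots> \<subseteq> closure \<Omega>" using mesh_Union T by blast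
    finally have "x \<in> interior (closure \<Omega>)" using W xW by (intro interiorI)
    then show ?thesis using domain_interior by simp
  next
    assume same: "c = a \<and> d = b"
    obtain e where e: "0 < e" "ball x e \<subseteq> ?W" using W xW open_contains_ball by blast
    \<comment> \<open>A small step from x towards the vertex r stays in \<open>?W\<close> and enters
      the interior of T.\<close>
    define n where "n = norm (r - x) + 1"
    have n1: "0 < n" by (simp add: n_def add_nonneg_pos)
    define h where "h = e / (2 * n)"
    have h: "0 < h" using e n1 by (simp add: h_def)
    let ?y = "x + h *\<^sub>R (r - x)"
    have "h * norm (r - x) \<le> h * n" using h by (simp add: n_def)
    also have "\<dots> = e / 2" using n1 by (simp add: h_def)
    also have "\<dots> < e" using e by simp
    finally have "?y \<in> ball x e" using h by (simp add: dist_norm)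
    then have yW: "?y \<in> ?W" using e by blast
    have "orient a b ?y = (1 - h) * orient a b x + h * orient a b r"
      by (simp add: orient_def algebra_simps)
    then have oy: "0 < orient a b ?y" using h o orient_on_segment(3)[OF xt] by simp
    have "?y \<in> interior T" using interior_triangle[OF o] yW oy hull by simp
    moreover have "?y \<in> T'" using mem_triangle[OF o', of ?y] yW oy hull' same by simp
    ultimately show ?thesis using mesh_interior_disjoint[OF T] by blast
  qed
qed

text \<open>An inner point x of the edge is in no other triangle: the common face would contain the
  edge and, by its dimension, equal it, so that the edge would be shared. If x were in \<Omega>, a
  neighbourhood of x would then lie in T, although x is on a proper face of T.\<close>

lemma unshared_edge:
  assumes T: "T \<in> \<T>" and E: "E edge_of T" and un: "\<And>T'. T' \<in> \<T> \<Longrightarrow> E edge_of T' \<Longrightarrow> T' = T"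
  shows "E \<subseteq> frontier \<Omega>"
proof -
  obtain p q r where pq: "E = closed_segment p q" and hull: "T = convex hull {p, q, r}" and o: "0 < orient p q r"
    using triangle_edge[OF mesh_simplex[OF T] E] .
  have pq': "p \<noteq> q" using o orient_distinct[of p q r] by simp
  have Ef: "E face_of T" and Ed: "aff_dim E = 1" using E by (auto simp: edge_of_def)
  have Td: "aff_dim T = 2" using aff_dim_simplex[OF mesh_simplex[OF T]] by simp
  have ri: "rel_interior E = open_segment p q" using pq' pq by (simp add: rel_interior_closed_segment)
  have "x \<in> frontier \<Omega>" if x: "x \<in> open_segment p q" for x
  proof -
    have xE: "x \<in> E" using x pq open_closed_segment by blast
    have xT: "x \<in> T" using xE face_of_imp_subset[OF Ef] by blast
    have other: "x \<notin> T'" if T': "T' \<in> \<T>" "T' \<noteq> T" for T'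
    proof
      assume "x \<in> T'"
      have f: "T \<inter> T' face_of T" by (rule mesh_face[OF T T'(1)])
      have sub: "E \<subseteq> T \<inter> T'"
      proof (rule subset_of_face_of[OF f face_of_imp_subset[OF Ef]])
        show "T \<inter> T' \<inter> rel_interior E \<noteq> {}" using x \<open>x \<in> T'\<close> xT ri by blast
      qed
      have Ef': "E face_of T \<inter> T'" by (rule face_of_subset[OF Ef sub]) simp
      have "T \<inter> T' \<noteq> T"
        using mesh_interior_disjoint[OF T T'(1)] T'(2) convex_bodyD(3)[OF mesh_body[OF T]] interior_subset[of T] by blast
      from face_of_aff_dim_lt[OF convex_bodyD(2)[OF mesh_body[OF T]] f this]
      have d: "aff_dim (T \<inter> T') < 2" using Td by simp
      have "E = T \<inter> T'"
      proof (rule ccontr)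
        assume "E \<noteq> T \<inter> T'"
        from face_of_aff_dim_lt[OF _ Ef' this] d Ed show False
          using convex_Int[OF convex_bodyD(2)[OF mesh_body[OF T]] convex_bodyD(2)[OF mesh_body[OF T'(1)]]] by simp
      qed
      moreover have "T \<inter> T' face_of T'" using mesh_face[OF T'(1) T] by (simp add: Int_commute)
      ultimately have "E edge_of T'" using Ed by (simp add: edge_of_def)
      from un[OF T'(1) this] T'(2) show False by simp
    qed
    have "x \<notin> \<Omega>"
    proof
      assume "x \<in> \<Omega>"
      let ?V = "\<Omega> - \<Union>(\<T> - {T})"
      have "closed (\<Union>(\<T> - {T}))"
        by (rule closed_Union) (use mesh_finite mesh_body convex_bodyD(5) in auto)
      then have "open ?V" using domain_open by (rule open_Diff[rotated])
      moreover have "x \<in> ?V" using \<open>x \<in> \<Omega>\<close> other by blast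
      moreover have "?V \<subseteq> T" using mesh_Union closure_subset[of \<Omega>] by blast
      ultimately have "x \<in> interior T" by (rule interiorI)
      moreover have "E \<noteq> T" using Ed Td by auto
      ultimately show False using face_of_disjoint_interior[OF Ef] xE by blast
    qed
    moreover have "x \<in> closure \<Omega>" using mesh_Union xT T by blast
    ultimately show ?thesis by (simp add: frontier_def interior_open[OF domain_open])
  qed
  then have "closure (open_segment p q) \<subseteq> frontier \<Omega>"
    by (intro closure_minimal frontier_closed) blast
  then show ?thesis using pq pq' by (simp add: closure_open_segment)
qed

lemma interior_edge_subset:
  assumes T: "T \<in> \<T>" and E: "E edge_of T" "\<not> E \<subseteq> frontier \<Omega>" and pq: "E = closed_segment p q"
  shows "open_segment p q \<subseteq> \<Omega>"
proof -
  obtain T' where "T' \<in> \<T>" "E edge_of T'" "T' \<noteq> T"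
    using unshared_edge[OF T E(1)] E(2) by blast
  then show ?thesis using shared_edge[OF T _ _ E(1) _ pq] by blast
qed

lemma boundary_edge_unique:
  assumes "T \<in> \<T>" "T' \<in> \<T>" "E edge_of T" "E edge_of T'" "E \<subseteq> frontier \<Omega>"
  shows "T = T'"
proof (rule ccontr)
  assume ne: "T \<noteq> T'"
  obtain p q r where pq: "E = closed_segment p q" and "0 < orient p q r"
    using triangle_edge[OF mesh_simplex[OF assms(1)] assms(3)] .
  then have "p \<noteq> q" using orient_distinct[of p q r] by simp
  then have "open_segment p q \<noteq> {}" by simp
  then obtain x where "x \<in> open_segment p q" by blast
  moreover have "open_segment p q \<subseteq> \<Omega>" by (rule shared_edge[OF assms(1,2) ne assms(3,4) pq])
  moreover have "open_segment p q \<subseteq> frontier \<Omega>" using assms(5) pq open_closed_segment by blast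
  ultimately show False using domain_open by (auto simp: frontier_def interior_open)
qed

lemma element_of_eq:
  assumes "T \<in> \<T>" "E edge_of T" "E \<subseteq> frontier \<Omega>" shows "element_of \<T> E = T"
  unfolding element_of_def using assms boundary_edge_unique by (intro the_equality) auto

lemma boundary_edge_element:
  assumes "E \<in> boundary_edges \<Omega> \<T>"
  shows "element_of \<T> E \<in> \<T>" "E edge_of element_of \<T> E"
proof -
  obtain T where T: "T \<in> \<T>" "E edge_of T" "E \<subseteq> frontier \<Omega>"
    using assms by (auto simp: boundary_edges_def edges_def)
  from element_of_eq[OF T] T show "element_of \<T> E \<in> \<T>" "E edge_of element_of \<T> E" by auto
qed

lemma finite_boundary_edges: "finite (boundary_edges \<Omega> \<T>)"
proof (rule finite_subset)
  show "boundary_edges \<Omega> \<T> \<subseteq> (\<Union>T\<in>\<T>. {E. E edge_of T})" by (auto simp: boundary_edges_def edges_def)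
  show "finite (\<Union>T\<in>\<T>. {E. E edge_of T})"
    by (intro finite_UN_I mesh_finite finite_edges_of_triangle mesh_simplex)
qed

text \<open>A boundary edge belongs to exactly one element, so exchanging the two sums leaves a
  single sum.\<close>

lemma sum_boundary_edges:
  fixes G :: "point set \<Rightarrow> point set \<Rightarrow> real"
  shows "(\<Sum>T\<in>\<T>. \<Sum>E | E edge_of T \<and> E \<subseteq> frontier \<Omega>. G T E) = (\<Sum>E\<in>boundary_edges \<Omega> \<T>. G (element_of \<T> E) E)"
proof -
  have "(\<Sum>T\<in>\<T>. \<Sum>E | E edge_of T \<and> E \<subseteq> frontier \<Omega>. G T E)
      = (\<Sum>T\<in>\<T>. \<Sum>E | E \<in> boundary_edges \<Omega> \<T> \<and> E edge_of T. G T E)"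
    by (intro sum.cong refl) (auto simp: boundary_edges_def edges_def)
  also have "\<dots> = (\<Sum>E\<in>boundary_edges \<Omega> \<T>. \<Sum>T | T \<in> \<T> \<and> E edge_of T. G T E)"
    by (rule sum.swap_restrict[OF mesh_finite finite_boundary_edges])
  also have "\<dots> = (\<Sum>E\<in>boundary_edges \<Omega> \<T>. G (element_of \<T> E) E)"
  proof (rule sum.cong[OF refl])
    fix E assume E: "E \<in> boundary_edges \<Omega> \<T>"
    then have "{T. T \<in> \<T> \<and> E edge_of T} = {element_of \<T> E}"
      using boundary_edge_element[OF E] boundary_edge_unique by (auto simp: boundary_edges_def)
    then show "(\<Sum>T | T \<in> \<T> \<and> E edge_of T. G T E) = G (element_of \<T> E) E" by simp
  qed
  finally show ?thesis .
qed

end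

subsection \<open>Green's formula on the domain\<close>

lemma L2_continuous_scaleR:
  fixes f :: "'a::euclidean_space \<Rightarrow> 'b::euclidean_space"
  assumes f: "f \<in> L2 (lebesgue_on S)" and S: "bounded S" "S \<in> sets lebesgue"
    and h: "continuous_on UNIV h"
  shows "(\<lambda>x. h x *\<^sub>R f x) \<in> L2 (lebesgue_on S)"
proof -
  have "compact (h ` closure S)"
    by (rule compact_continuous_image[OF continuous_on_subset[OF h subset_UNIV]]) (simp add: S)
  then obtain B where B: "\<And>y. y \<in> h ` closure S \<Longrightarrow> norm y \<le> B"
    by (meson bounded_iff compact_imp_bounded)
  show ?thesis
  proof (rule L2_bounded_mult[OF f])
    show "h \<in> borel_measurable (lebesgue_on S)"
      by (rule continuous_imp_measurable_on_sets_lebesgue[OF continuous_on_subset[OF h subset_UNIV] S(2)])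
    fix x assume "x \<in> space (lebesgue_on S)"
    then have "x \<in> closure S" using closure_subset[of S] by (auto simp: space_restrict_space)
    then show "\<bar>h x\<bar> \<le> B" using B[of "h x"] by simp
  qed
qed

lemma L2_continuous_inner:
  fixes f :: "point \<Rightarrow> point"
  assumes f: "f \<in> L2 (lebesgue_on S)" and S: "bounded S" "S \<in> sets lebesgue"
    and h: "continuous_on UNIV h"
  shows "(\<lambda>x. f x \<bullet> h x) \<in> L2 (lebesgue_on S)"
proof -
  have c: "continuous_on UNIV (\<lambda>x. h x $ i)" for i by (intro continuous_intros h)
  have "(\<lambda>x. \<Sum>i\<in>UNIV. h x $ i *\<^sub>R (f x $ i)) \<in> L2 (lebesgue_on S)"
    by (rule L2_sum) (rule L2_continuous_scaleR[OF L2_nth[OF f] S c])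
  then show ?thesis by (simp add: inner_vec_def mult.commute)
qed

lemma Hdiv_weak_div: "w \<in> Hdiv U \<Longrightarrow> is_weak_div U w (weak_div U w)"
  unfolding Hdiv_def weak_div_def using someI_ex[of "is_weak_div U w"] by blast

lemma smooth_RT1_local:
  assumes "q \<in> RT1_local" shows "smooth (\<lambda>x. q x $ i)"
proof -
  obtain a r where a: "\<And>i. (\<lambda>x. a x $ i) \<in> Pk 1" "r \<in> Pk 1" "q = (\<lambda>x. a x + r x *\<^sub>R x)"
    using assms unfolding RT1_local_def componentwise_def by blast
  have "smooth (\<lambda>x. a x $ i + r x * x $ i)"
    by (rule smooth_add[OF smooth_Pk[OF a(1)] smooth_mult[OF smooth_Pk[OF a(2)] smooth_vec_nth]])
  then show ?thesis by (simp add: a(3))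
qed

text \<open>Test functions supported in one element see only the classical piece F there, and the
  fundamental lemma identifies the divergences.\<close>

lemma weak_div_on_element:
  assumes S: "convex_body S" "interior S \<subseteq> U" and U: "bounded_open U"
    and w: "w \<in> L2 (lebesgue_on U)" and d: "is_weak_div U w d"
    and F: "\<And>i. Ck 1 (\<lambda>x. F x $ i)" and wF: "AE x in lebesgue_on S. w x = F x"
  shows "AE x in lebesgue_on S. d x = vdiv F x"
proof -
  note S' = convex_bodyD[OF S(1)]
  let ?M = "lebesgue_on S"
  have dL: "d \<in> L2 ?M"
  proof -
    have "d \<in> L2 (lebesgue_on U)" using d by (simp add: is_weak_div_def)
    from L2_lebesgue_on_subset[OF S'(7) bounded_openD(3)[OF U] S(2) this] show ?thesis
      by (simp only: interior_null_change(2)[OF S(1)])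
  qed
  have wL: "w \<in> L2 ?M"
    using L2_lebesgue_on_subset[OF S'(7) bounded_openD(3)[OF U] S(2) w]
    by (simp only: interior_null_change(2)[OF S(1)])
  have FL: "F \<in> L2 ?M" by (rule L2_vec) (rule L2_C1(1)[OF F S'(4,6)])
  have gL: "(\<lambda>x. gradient (\<lambda>y. F y $ i) x $ j) \<in> L2 ?M" for i j
    by (rule L2_nth[OF L2_C1(2)[OF F S'(4,6)]])
  have vL: "vdiv F \<in> L2 ?M" unfolding vdiv_def[abs_def] by (intro L2_add gL)
  have "AE x in ?M. d x - vdiv F x = 0"
  proof (rule fundamental_lemma_body[OF S(1) L2_diff[OF dL vL]])
    fix \<phi> assume t: "\<phi> \<in> test_functions (interior S)"
    then have tU: "\<phi> \<in> test_functions U" using test_functions_mono[OF S(2)] by blast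
    note \<phi> = L2_test_function[OF S'(4,6) t]
    have 1: "(LINT x|?M. w x \<bullet> gradient \<phi> x) = - (LINT x|?M. d x * \<phi> x)"
    proof -
      have "(LINT x|lebesgue_on (interior S). w x \<bullet> gradient \<phi> x) = (LINT x|lebesgue_on U. w x \<bullet> gradient \<phi> x)"
        using S' bounded_openD(3)[OF U] S(2) test_functions_gradient_eq_0[OF t]
        by (intro integral_test_function_mono) auto
      moreover have "(LINT x|lebesgue_on (interior S). d x * \<phi> x) = (LINT x|lebesgue_on U. d x * \<phi> x)"
        using S' bounded_openD(3)[OF U] S(2) test_functions_eq_0[OF t]
        by (intro integral_test_function_mono) auto
      ultimately show ?thesis
        using d tU by (simp add: is_weak_div_def interior_null_change[OF S(1)])
    qed
    have 2: "(LINT x|?M. F x $ i * gradient \<phi> x $ i) = - (LINT x|?M. gradient (\<lambda>y. F y $ i) x $ i * \<phi> x)" for i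
      using is_weak_gradientD[OF is_weak_gradient_C1[OF F S'(9)] t, of i i] by (simp add: interior_null_change[OF S(1)])
    have "(LINT x|?M. w x \<bullet> gradient \<phi> x) = (LINT x|?M. F x \<bullet> gradient \<phi> x)"
      by (rule integral_cong_AE) (use wF wL FL \<phi> in \<open>auto dest!: L2_measurable\<close>)
    also have "\<dots> = (LINT x|?M. F x $ 1 * gradient \<phi> x $ 1 + F x $ 2 * gradient \<phi> x $ 2)"
      by (simp add: inner_vec_def sum_2)
    also have "\<dots> = - (LINT x|?M. gradient (\<lambda>y. F y $ 1) x $ 1 * \<phi> x) - (LINT x|?M. gradient (\<lambda>y. F y $ 2) x $ 2 * \<phi> x)"
      using L2_mult_integrable[OF L2_nth[OF FL] \<phi>(2), of 1 1] L2_mult_integrable[OF L2_nth[OF FL] \<phi>(2), of 2 2]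
      by (simp add: 2)
    also have "\<dots> = - (LINT x|?M. vdiv F x * \<phi> x)"
      using L2_mult_integrable[OF gL \<phi>(1), of 1 1] L2_mult_integrable[OF gL \<phi>(1), of 2 2]
      by (simp add: vdiv_def distrib_right)
    finally show "(LINT x|?M. (d x - vdiv F x) * \<phi> x) = 0"
      using 1 L2_mult_integrable[OF dL \<phi>(1)] L2_mult_integrable[OF vL \<phi>(1)]
      by (simp add: left_diff_distrib)
  qed
  then show ?thesis by eventually_elim simp
qed

section \<open>The flux of an H(div) field weighted by an H1 function\<close>

context
  fixes U :: "point set" and w :: vector_field and d :: scalar_field and v :: scalar_field
  assumes U: "bounded_open U" and w: "w \<in> L2 (lebesgue_on U)" and d: "is_weak_div U w d"
    and v: "v \<in> H1 U"
begin

text \<open>Formally the divergence of the field \<eta> v w, with d in place of the divergence of w.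
  The weight \<eta> serves to localize to boxes and to cut off near the boundary.\<close>

definition flux_density :: "scalar_field \<Rightarrow> scalar_field" where
  "flux_density \<eta> x = \<eta> x * (w x \<bullet> weak_gradient U v x) + v x * (w x \<bullet> gradient \<eta> x) + (\<eta> x * d x) * v x"

lemma flux_L2:
  "d \<in> L2 (lebesgue_on U)" "v \<in> L2 (lebesgue_on U)" "weak_gradient U v \<in> L2 (lebesgue_on U)"
  using d H1_L2[OF v] weak_gradient_L2[OF v] by (simp_all add: is_weak_div_def)

lemma flux_density_integrable:
  assumes \<eta>: "smooth \<eta>" and S: "S \<in> sets lebesgue" "S \<subseteq> U"
  shows "integrable (lebesgue_on S) (flux_density \<eta>)"
proof -
  have Sb: "bounded S" using bounded_openD(2)[OF U] S(2) bounded_subset by blast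
  note r = L2_lebesgue_on_subset[OF S(1) bounded_openD(3)[OF U] S(2)]
  note L = r[OF w] r[OF flux_L2(1)] r[OF flux_L2(2)] r[OF flux_L2(3)]
  have "integrable (lebesgue_on S) (\<lambda>x. (\<eta> x *\<^sub>R w x) \<bullet> weak_gradient U v x)"
    by (rule L2_inner_integrable[OF L2_continuous_scaleR[OF L(1) Sb S(1) smooth_continuous[OF \<eta>]] L(4)])
  moreover have "integrable (lebesgue_on S) (\<lambda>x. v x * (w x \<bullet> gradient \<eta> x))"
    by (rule L2_mult_integrable[OF L(3) L2_continuous_inner[OF L(1) Sb S(1) smooth_gradient_continuous[OF \<eta>]]])
  moreover have "integrable (lebesgue_on S) (\<lambda>x. (\<eta> x *\<^sub>R d x) * v x)"
    by (rule L2_mult_integrable[OF L2_continuous_scaleR[OF L(2) Sb S(1) smooth_continuous[OF \<eta>]] L(3)])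
  ultimately show ?thesis unfolding flux_density_def[abs_def] by simp
qed

text \<open>On the box v is a limit of smooth functions, whose products with \<eta> are test
  functions for the weak divergence of w. The integral is zero along the sequence and hence in the
  limit.\<close>

lemma flux_box:
  assumes ab: "cbox a b \<subseteq> U" "box a b \<noteq> {}" and \<eta>: "smooth \<eta>" "\<And>x. x \<notin> cbox a b \<Longrightarrow> \<eta> x = 0"
  shows "(LINT x|lebesgue_on U. flux_density \<eta> x) = 0"
proof -
  let ?S = "cbox a b"
  let ?M = "lebesgue_on ?S"
  have S: "convex_body ?S" using ab(2) by (simp add: convex_body_def)
  note S' = convex_bodyD[OF S]
  have SU: "interior ?S \<subseteq> U" using ab(1) interior_subset[of ?S] by blast
  note r = L2_lebesgue_on_subset[OF S'(6) bounded_openD(3)[OF U] ab(1)]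
  note L = r[OF w] r[OF flux_L2(1)] r[OF flux_L2(2)] r[OF flux_L2(3)]
  have g: "is_weak_gradient (interior ?S) v (weak_gradient U v)"
    by (rule is_weak_gradient_restrict[OF H1_weak_gradient[OF v] U S'(9) SU])
  have g\<eta>: "gradient \<eta> x = 0" if "x \<notin> ?S" for x
    by (rule gradient_eq_0_outside[OF closed_cbox \<eta>(2) that])
  note cw = L2_continuous_scaleR[OF L(1) S'(4,6) smooth_continuous[OF \<eta>(1)]]
  note wg = L2_continuous_inner[OF L(1) S'(4,6) smooth_gradient_continuous[OF \<eta>(1)]]
  note cd = L2_continuous_scaleR[OF L(2) S'(4,6) smooth_continuous[OF \<eta>(1)]]
  show ?thesis
  proof (rule H1_smooth_approximation[OF S g L(3)])
    fix \<phi> assume sm: "\<And>n. smooth (\<phi> n)" and l1: "(\<lambda>n. L2_norm ?M (\<lambda>x. \<phi> n x - v x)) \<longlonglongrightarrow> 0"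
      and l2: "(\<lambda>n. L2_norm ?M (\<lambda>x. gradient (\<phi> n) x - weak_gradient U v x)) \<longlonglongrightarrow> 0"
    note Ls = L2_smooth[OF sm S'(4,6)] L2_gradient_smooth[OF sm S'(4,6)]
    let ?I = "\<lambda>f g. L2_inner ?M g (\<lambda>x. \<eta> x *\<^sub>R w x) + L2_inner ?M f (\<lambda>x. w x \<bullet> gradient \<eta> x) + L2_inner ?M f (\<lambda>x. \<eta> x *\<^sub>R d x)"
    have lim: "(\<lambda>n. ?I (\<phi> n) (gradient (\<phi> n))) \<longlonglongrightarrow> ?I v (weak_gradient U v)"
      by (intro tendsto_add L2_inner_tendsto Ls L cw wg cd l1 l2)
    have split: "?I f g = (LINT x|?M. \<eta> x * (w x \<bullet> g x) + f x * (w x \<bullet> gradient \<eta> x) + (\<eta> x * d x) * f x)"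
      if "f \<in> L2 ?M" "g \<in> L2 ?M" for f g
      using L2_inner_integrable[OF that(2) cw] L2_inner_integrable[OF that(1) wg] L2_inner_integrable[OF that(1) cd]
      by (simp add: L2_inner_def inner_commute mult.commute)
    have "?I (\<phi> n) (gradient (\<phi> n)) = 0" for n
    proof -
      have t: "(\<lambda>x. \<phi> n x * \<eta> x) \<in> test_functions U"
        by (rule test_functionsI[of _ ?S]) (use \<eta> ab(1) sm in auto)
      have gr: "gradient (\<lambda>x. \<phi> n x * \<eta> x) x = \<phi> n x *\<^sub>R gradient \<eta> x + \<eta> x *\<^sub>R gradient (\<phi> n) x" for x
        by (rule gradient_mult[OF smooth_differentiable[OF sm] smooth_differentiable[OF \<eta>(1)]])
      have "(LINT x|lebesgue_on U. w x \<bullet> gradient (\<lambda>x. \<phi> n x * \<eta> x) x) = - (LINT x|lebesgue_on U. d x * (\<phi> n x * \<eta> x))"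
        using d t by (simp add: is_weak_div_def)
      moreover have "(LINT x|?M. w x \<bullet> gradient (\<lambda>x. \<phi> n x * \<eta> x) x) = (LINT x|lebesgue_on U. w x \<bullet> gradient (\<lambda>x. \<phi> n x * \<eta> x) x)"
        by (rule integral_test_function_mono[OF S'(6) bounded_openD(3)[OF U] ab(1)]) (simp add: gr g\<eta> \<eta>(2))
      moreover have "(LINT x|?M. d x * (\<phi> n x * \<eta> x)) = (LINT x|lebesgue_on U. d x * (\<phi> n x * \<eta> x))"
        by (rule integral_test_function_mono[OF S'(6) bounded_openD(3)[OF U] ab(1)]) (simp add: \<eta>(2))
      moreover have "(LINT x|?M. w x \<bullet> gradient (\<lambda>x. \<phi> n x * \<eta> x) x)
         = L2_inner ?M (gradient (\<phi> n)) (\<lambda>x. \<eta> x *\<^sub>R w x) + L2_inner ?M (\<phi> n) (\<lambda>x. w x \<bullet> gradient \<eta> x)"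
        using L2_inner_integrable[OF Ls(2) cw, of n] L2_inner_integrable[OF Ls(1) wg, of n]
        by (simp add: L2_inner_def gr inner_add_right inner_commute add.commute)
      moreover have "(LINT x|?M. d x * (\<phi> n x * \<eta> x)) = L2_inner ?M (\<phi> n) (\<lambda>x. \<eta> x *\<^sub>R d x)"
        by (simp add: L2_inner_def mult_ac)
      ultimately show ?thesis by linarith
    qed
    then have "?I v (weak_gradient U v) = 0"
      using lim LIMSEQ_unique[OF lim] by (simp add: LIMSEQ_const_iff)
    moreover have "(LINT x|?M. flux_density \<eta> x) = (LINT x|lebesgue_on U. flux_density \<eta> x)"
      by (rule integral_test_function_mono[OF S'(6) bounded_openD(3)[OF U] ab(1)])
        (simp add: flux_density_def g\<eta> \<eta>(2))
    ultimately show ?thesis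
      unfolding split[OF L(3,4)] flux_density_def[abs_def] by simp
  qed
qed

lemma flux_add:
  assumes "smooth \<eta>" "smooth \<psi>" and "(LINT x|lebesgue_on U. flux_density \<eta> x) = 0" "(LINT x|lebesgue_on U. flux_density \<psi> x) = 0"
  shows "(LINT x|lebesgue_on U. flux_density (\<lambda>x. \<eta> x + \<psi> x) x) = 0"
proof -
  have "flux_density (\<lambda>x. \<eta> x + \<psi> x) x = flux_density \<eta> x + flux_density \<psi> x" for x
    using gradient_add[OF smooth_differentiable[OF assms(1)] smooth_differentiable[OF assms(2)], of x]
    by (simp add: flux_density_def inner_add_right algebra_simps)
  then show ?thesis
    using flux_density_integrable[OF assms(1) bounded_openD(3)[OF U] order_refl]
      flux_density_integrable[OF assms(2) bounded_openD(3)[OF U] order_refl] assms(3,4) by simp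
qed

text \<open>Each \<open>\<eta> n\<close> is a finite sum of functions supported in boxes inside \<open>U\<close>, so that smoothing on
  convex sets suffices although \<open>U\<close> is not convex.\<close>

lemma flux_cutoffs:
  obtains \<eta> where "\<And>n. smooth (\<eta> n)" "\<And>n x. 0 \<le> \<eta> n x \<and> \<eta> n x \<le> 1" "\<And>n x. x \<notin> U \<Longrightarrow> \<eta> n x = 0"
    "\<And>x. x \<in> U \<Longrightarrow> (\<lambda>n. \<eta> n x) \<longlonglongrightarrow> 1"
    "\<And>n. (LINT x|lebesgue_on U. flux_density (\<eta> n) x) = 0"
proof -
  let ?F = "{B. \<exists>a b. B = box a b \<and> cbox a b \<subseteq> U \<and> box a b \<noteq> {}}"
  have FU: "\<Union>?F = U"
  proof
    show "\<Union>?F \<subseteq> U" using box_subset_cbox by blast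
    show "U \<subseteq> \<Union>?F"
    proof
      fix x assume "x \<in> U"
      with open_contains_cbox[of U] bounded_openD(1)[OF U]
      obtain a b where "x \<in> box a b" "cbox a b \<subseteq> U" by metis
      then show "x \<in> \<Union>?F" by blast
    qed
  qed
  \<comment> \<open>Countably many boxes suffice, so they can be enumerated and added one at a
    time.\<close>
  obtain G where G: "G \<subseteq> ?F" "countable G" "\<Union>G = \<Union>?F"
  proof (rule Lindelof[of ?F])
    show "open B" if "B \<in> ?F" for B using that open_box by blast
  qed (rule that)
  show thesis
  proof (cases "G = {}")
    case True
    then have "U = {}" using G FU by auto
    have "flux_density (\<lambda>x. 0) = (\<lambda>x. 0)" by (simp add: flux_density_def[abs_def])
    then show thesis using \<open>U = {}\<close> by (intro that[of "\<lambda>n x. 0"]) auto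
  next
    case False
    let ?B = "from_nat_into G"
    let ?P = "\<lambda>i c. ?B i = box (fst c) (snd c) \<and> cbox (fst c) (snd c) \<subseteq> U \<and> box (fst c) (snd c) \<noteq> {}"
    have "\<exists>c. ?P i c" for i
    proof -
      from from_nat_into[OF False, of i] G(1) obtain a b
        where "?B i = box a b" "cbox a b \<subseteq> U" "box a b \<noteq> {}" by blast
      then show ?thesis by (intro exI[of _ "(a, b)"]) simp
    qed
    then have "\<exists>c. \<forall>i. ?P i (c i)" by (intro choice allI)
    then obtain c where c: "\<And>i. ?P i (c i)" by blast
    define a b where "a i = fst (c i)" and "b i = snd (c i)" for i
    have ab: "?B i = box (a i) (b i)" "cbox (a i) (b i) \<subseteq> U" "box (a i) (b i) \<noteq> {}" for i
      using c[of i] unfolding a_def b_def by blast+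
    have cover: "\<exists>i. x \<in> box (a i) (b i)" if "x \<in> U" for x
    proof -
      have "x \<in> \<Union>G" using that unfolding G(3) FU .
      then obtain X where X: "X \<in> G" "x \<in> X" by (rule UnionE)
      obtain i where "?B i = X" using from_nat_into_surj[OF G(2) X(1)] by blast
      with X(2) ab(1)[of i] show ?thesis by blast
    qed
    define \<beta> where "\<beta> i n = bump (a i) (b i) (real (Suc n))" for i n
    have \<beta>s: "smooth (\<beta> i n)" for i n unfolding \<beta>_def by (rule smooth_bump)
    have \<beta>01: "0 \<le> \<beta> i n x" "\<beta> i n x \<le> 1" for i n x
      unfolding \<beta>_def by (rule bump_nonneg, rule bump_le_1)
    have \<beta>0: "\<beta> i n x = 0" if "x \<notin> cbox (a i) (b i)" for i n x
      unfolding \<beta>_def by (rule bump_eq_0) (use that box_subset_cbox[of "a i" "b i"] in auto)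
    \<comment> \<open>\<open>1 - P m n\<close> is a smooth substitute for the indicator of the union
      of the first m boxes. The next box changes it by \<open>P m n * \<beta> m n\<close>, which is
      supported in that box alone.\<close>
    define P where "P m n x = (\<Prod>i<m. 1 - \<beta> i n x)" for m n x
    have Ps: "smooth (P m n)" for m n
      unfolding P_def by (intro smooth_prod smooth_diff smooth_const \<beta>s)
    have P01: "0 \<le> P m n x" "P m n x \<le> 1" for m n x
      unfolding P_def using \<beta>01 by (auto intro!: prod_nonneg prod_le_1)
    have fP: "(LINT x|lebesgue_on U. flux_density (\<lambda>x. 1 - P m n x) x) = 0" for m n
    proof (induction m)
      case 0
      have "flux_density (\<lambda>x. 0) = (\<lambda>x. 0)" by (simp add: flux_density_def[abs_def])
      then show ?case by (simp add: P_def)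
    next
      case (Suc m)
      have s1: "smooth (\<lambda>x. 1 - P m n x)" by (intro smooth_diff smooth_const Ps)
      have s2: "smooth (\<lambda>x. P m n x * \<beta> m n x)" by (intro smooth_mult Ps \<beta>s)
      have "(LINT x|lebesgue_on U. flux_density (\<lambda>x. P m n x * \<beta> m n x) x) = 0"
        by (rule flux_box[OF ab(2)[of m] ab(3)[of m] s2]) (simp add: \<beta>0)
      from flux_add[OF s1 s2 Suc.IH this]
      have "(LINT x|lebesgue_on U. flux_density (\<lambda>x. 1 - P m n x + P m n x * \<beta> m n x) x) = 0" .
      moreover have "(\<lambda>x. 1 - P m n x + P m n x * \<beta> m n x) = (\<lambda>x. 1 - P (Suc m) n x)"
        by (simp add: P_def fun_eq_iff algebra_simps)
      ultimately show ?case by simp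
    qed
    show thesis
    proof (rule that[of "\<lambda>n x. 1 - P n n x"])
      show "smooth (\<lambda>x. 1 - P n n x)" for n by (intro smooth_diff smooth_const Ps)
      show "0 \<le> 1 - P n n x \<and> 1 - P n n x \<le> 1" for n x using P01[of n n x] by simp
      show "1 - P n n x = 0" if "x \<notin> U" for n x
      proof -
        have "\<beta> i n x = 0" for i using \<beta>0 ab(2) that by blast
        then show ?thesis by (simp add: P_def)
      qed
      show "(LINT x|lebesgue_on U. flux_density (\<lambda>x. 1 - P n n x) x) = 0" for n by (rule fP)
      fix x assume "x \<in> U"
      then obtain j where j: "x \<in> box (a j) (b j)" using cover by blast
      have "(\<lambda>n. \<beta> j n x) \<longlonglongrightarrow> 1"
        unfolding \<beta>_def by (rule LIMSEQ_Suc[OF bump_tendsto_1[OF j]])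
      from tendsto_diff[OF tendsto_const[of 1] this] have l: "(\<lambda>n. 1 - \<beta> j n x) \<longlonglongrightarrow> 0" by simp
      \<comment> \<open>On the diagonal the number of boxes and the sharpness of the bumps grow
        together; once the factor of box j is present, it bounds the product, the others being at
        most 1.\<close>
      have "(\<lambda>n. P n n x) \<longlonglongrightarrow> 0"
      proof (rule Lim_null_comparison[OF eventually_sequentiallyI[of "Suc j"] l])
        fix n assume n: "Suc j \<le> n"
        then have j': "j \<in> {..<n}" by simp
        have "P n n x = (1 - \<beta> j n x) * (\<Prod>i\<in>{..<n} - {j}. 1 - \<beta> i n x)"
          unfolding P_def by (rule prod.remove[OF _ j']) simp
        also have "\<dots> \<le> (1 - \<beta> j n x) * 1"
          using \<beta>01 by (intro mult_left_mono prod_le_1) auto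
        finally show "norm (P n n x) \<le> 1 - \<beta> j n x" using P01[of n n x] by simp
      qed
      from tendsto_diff[OF tendsto_const[of 1] this] show "(\<lambda>n. 1 - P n n x) \<longlonglongrightarrow> 1" by simp
    qed
  qed
qed

text \<open>The weight is moved into the field: Green's formula on T for \<eta> F, whose divergence
  supplies the terms with d and with the gradient of \<eta>.\<close>

lemma flux_element:
  assumes T: "2 simplex T" "interior T \<subseteq> U" and F: "\<And>i. smooth (\<lambda>x. F x $ i)"
    and wF: "AE x in lebesgue_on T. w x = F x" and \<eta>: "smooth \<eta>"
  shows "(LINT x|lebesgue_on T. flux_density \<eta> x)
    = (\<Sum>E | E edge_of T. edge_integral E (\<lambda>x. \<eta> x * ((F x \<bullet> outward_normal T E) * edge_trace T E v x)))"
    and "v \<in> H1 (interior T)"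
proof -
  note body = triangle_convex_body[OF T(1)]
  note T' = convex_bodyD[OF body]
  let ?M = "lebesgue_on T"
  have g: "is_weak_gradient (interior T) v (weak_gradient U v)"
    by (rule is_weak_gradient_restrict[OF H1_weak_gradient[OF v] U T'(9) T(2)])
  note r = L2_lebesgue_on_subset[OF T'(7) bounded_openD(3)[OF U] T(2)]
  have L: "w \<in> L2 ?M" "d \<in> L2 ?M" "v \<in> L2 ?M" "weak_gradient U v \<in> L2 ?M"
    using r[OF w] r[OF flux_L2(1)] r[OF flux_L2(2)] r[OF flux_L2(3)] by (simp_all add: interior_null_change[OF body])
  show vH: "v \<in> H1 (interior T)" by (rule H1I[OF _ g]) (simp add: interior_null_change[OF body] L)
  have gT: "AE x in ?M. weak_gradient (interior T) v x = weak_gradient U v x"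
    by (rule weak_gradient_eq[OF body g L(3)])
  have dF: "AE x in ?M. d x = vdiv F x"
    by (rule weak_div_on_element[OF body T(2) U w d smooth_Ck[OF F] wF])
  let ?F = "\<lambda>x. \<eta> x *\<^sub>R F x"
  have sF: "smooth (\<lambda>x. ?F x $ i)" for i using smooth_mult[OF \<eta> F, of i] by simp
  have vdF: "vdiv ?F x = \<eta> x * vdiv F x + F x \<bullet> gradient \<eta> x" for x
    using gradient_mult[OF smooth_differentiable[OF \<eta>] smooth_differentiable[OF F]]
    by (simp add: vdiv_def inner_vec_def sum_2 algebra_simps)
  have Fc: "continuous_on UNIV F"
    using continuous_on_vec_lambda[of UNIV "\<lambda>i x. F x $ i"] smooth_continuous[OF F] by simp
  have dc: "continuous_on UNIV (vdiv F)"
    unfolding vdiv_def[abs_def] by (intro continuous_on_add smooth_continuous smooth_gradient F)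
  have m: "(\<lambda>x. F x) \<in> borel_measurable ?M" "vdiv F \<in> borel_measurable ?M" "\<eta> \<in> borel_measurable ?M"
    "gradient \<eta> \<in> borel_measurable ?M"
    by (rule L2_measurable, rule L2_continuous[OF _ T'(4,6)], rule Fc dc smooth_continuous[OF \<eta>] smooth_gradient_continuous[OF \<eta>])+
  have wgL: "weak_gradient (interior T) v \<in> borel_measurable ?M"
    using weak_gradient_L2[OF vH] by (simp add: interior_null_change[OF body] L2_measurable)
  note Lm = L2_measurable[OF L(1)] L2_measurable[OF L(2)] L2_measurable[OF L(3)] L2_measurable[OF L(4)]
  have "(LINT x|?M. flux_density \<eta> x) = (LINT x|?M. ?F x \<bullet> weak_gradient (interior T) v x + vdiv ?F x * v x)"
  proof (rule integral_cong_AE)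
    show "flux_density \<eta> \<in> borel_measurable ?M"
      unfolding flux_density_def[abs_def] using Lm m by measurable
    show "(\<lambda>x. ?F x \<bullet> weak_gradient (interior T) v x + vdiv ?F x * v x) \<in> borel_measurable ?M"
      unfolding vdF using Lm m wgL by measurable
    show "AE x in ?M. flux_density \<eta> x = ?F x \<bullet> weak_gradient (interior T) v x + vdiv ?F x * v x"
      using wF gT dF by eventually_elim (simp add: flux_density_def vdF algebra_simps)
  qed
  also have "\<dots> = (\<Sum>E | E edge_of T. edge_integral E (\<lambda>x. (?F x \<bullet> outward_normal T E) * edge_trace T E v x))"
    by (rule green_H1[OF T(1) sF vH])
  finally show "(LINT x|?M. flux_density \<eta> x)
    = (\<Sum>E | E edge_of T. edge_integral E (\<lambda>x. \<eta> x * ((F x \<bullet> outward_normal T E) * edge_trace T E v x)))"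
    by (simp add: mult.assoc)
qed

end

lemma edge_path_open_segment:
  "0 < t \<Longrightarrow> t < 1 \<Longrightarrow> p \<noteq> q \<Longrightarrow> edge_path (closed_segment p q) t \<in> open_segment p q"
  using edge_path_segment[of p q] by (auto simp: in_segment linepath_def add.commute intro: exI[of _ t] exI[of _ "1 - t"])

text \<open>Cutoffs that tend to 1 in \<Omega> vanish on boundary edges and tend to 1 along interior
  edges, so in the limit the terms of the interior edges alone sum to zero. With the constant weight
  1 exactly the boundary edges remain. Continuity of the normal component is thus used in total and
  not edge by edge.\<close>

theorem green_domain:
  assumes domain: "polygonal_domain \<Omega>" and mesh: "triangulates \<T> \<Omega>"
    and w: "w \<in> L2 (lebesgue_on \<Omega>)" and d: "is_weak_div \<Omega> w d" and v: "v \<in> H1 \<Omega>"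
    and F: "\<And>T i. T \<in> \<T> \<Longrightarrow> smooth (\<lambda>x. F T x $ i)"
    and wF: "\<And>T. T \<in> \<T> \<Longrightarrow> AE x in lebesgue_on T. w x = F T x"
  shows "(LINT x|lebesgue_on \<Omega>. w x \<bullet> weak_gradient \<Omega> v x + d x * v x)
    = (\<Sum>E\<in>boundary_edges \<Omega> \<T>. edge_integral E
        (\<lambda>x. (F (element_of \<T> E) x \<bullet> outward_normal (element_of \<T> E) E) * boundary_trace \<T> E v x))"
proof -
  note U = domain_bounded_open[OF domain mesh]
  let ?fd = "flux_density \<Omega> w d v"
  let ?h = "\<lambda>T E x. (F T x \<bullet> outward_normal T E) * edge_trace T E v x"
  note el = flux_element[OF U w d v mesh_simplex[OF domain mesh] mesh_interior_subset[OF domain mesh] F wF]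
  note fd = flux_density_integrable[OF U w d v]
  have fdT: "integrable (lebesgue_on T) (?fd \<eta>)" if "T \<in> \<T>" "smooth \<eta>" for T \<eta>
    using fd[OF that(2) convex_bodyD(7)[OF mesh_body[OF domain mesh that(1)]] mesh_interior_subset[OF domain mesh that(1)]]
    integrable_lebesgue_on_null_change[OF convex_bodyD(7)[OF mesh_body[OF domain mesh that(1)]]
        convex_bodyD(6)[OF mesh_body[OF domain mesh that(1)]] interior_subset convex_bodyD(8)[OF mesh_body[OF domain mesh that(1)]]]
    by blast
  have total: "(LINT x|lebesgue_on \<Omega>. ?fd \<eta> x) = (\<Sum>T\<in>\<T>. \<Sum>E | E edge_of T. edge_integral E (\<lambda>x. \<eta> x * ?h T E x))"
    if "smooth \<eta>" for \<eta>
    unfolding integral_mesh[OF domain mesh fdT[OF _ that], simplified]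
    by (rule sum.cong[OF refl], rule el(1)) (use that in auto)
  have vH: "v \<in> H1 (interior T)" if "T \<in> \<T>" for T
    by (rule el(2)[OF that that that that smooth_const[of 0]])
  obtain \<eta> where \<eta>: "\<And>n. smooth (\<eta> n)" "\<And>n x. 0 \<le> \<eta> n x \<and> \<eta> n x \<le> 1" "\<And>n x. x \<notin> \<Omega> \<Longrightarrow> \<eta> n x = 0"
    "\<And>x. x \<in> \<Omega> \<Longrightarrow> (\<lambda>n. \<eta> n x) \<longlonglongrightarrow> 1"
    and \<eta>0: "\<And>n. (LINT x|lebesgue_on \<Omega>. ?fd (\<eta> n) x) = 0"
    by (rule flux_cutoffs[OF U w d v]) (rule that)
  have edge_lim: "(\<lambda>n. edge_integral E (\<lambda>x. \<eta> n x * ?h T E x))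
      \<longlonglongrightarrow> (if E \<subseteq> frontier \<Omega> then 0 else edge_integral E (?h T E))"
    if T: "T \<in> \<T>" and E: "E edge_of T" for T E
  proof -
    note T2 = mesh_simplex[OF domain mesh T]
    obtain p q r where pq: "E = closed_segment p q" and "0 < orient p q r" using triangle_edge[OF T2 E] .
    then have ne: "p \<noteq> q" using orient_distinct[of p q r] by simp
    have path: "edge_path E t \<in> E" if "t \<in> {0..1}" for t using edge_path_in[OF that, of p q] pq by simp
    show ?thesis
    proof (cases "E \<subseteq> frontier \<Omega>")
      case True
      have "edge_integral E (\<lambda>x. \<eta> n x * ?h T E x) = 0" for n
      proof -
        have "(LINT t|unit_measure. \<eta> n (edge_path E t) * ?h T E (edge_path E t)) = (LINT t|unit_measure. 0)"
        proof (rule Bochner_Integration.integral_cong[OF refl])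
          fix t assume "t \<in> space unit_measure"
          then have "edge_path E t \<in> frontier \<Omega>" using path True by (auto simp: space_restrict_space)
          then have "edge_path E t \<notin> \<Omega>"
            using domain_open[OF domain mesh] by (simp add: frontier_def interior_open)
          then show "\<eta> n (edge_path E t) * ?h T E (edge_path E t) = 0" using \<eta>(3) by simp
        qed
        then show ?thesis by (simp add: edge_integral_def)
      qed
      then show ?thesis using True by simp
    next
      case False
      have Fc: "continuous_on UNIV (F T)"
        using continuous_on_vec_lambda[of UNIV "\<lambda>i x. F T x $ i"] smooth_continuous[OF F[OF T]] by simp
      have hc: "continuous_on UNIV (\<lambda>x. F T x \<bullet> outward_normal T E)" by (intro continuous_intros Fc)
      have hi: "integrable unit_measure (\<lambda>t. ?h T E (edge_path E t))"
        using L2_mult_integrable[OF L2_edgeD[OF L2_edge_continuous[OF hc, of p q]] L2_edgeD[OF edge_trace_L2[OF T2 E vH[OF T], unfolded pq]]]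
        by (simp add: pq)
      have "continuous_on UNIV (\<lambda>t. \<eta> n (edge_path E t))" for n
        unfolding pq by (rule continuous_on_compose2[OF smooth_continuous[OF \<eta>(1)] edge_path_continuous]) auto
      then have \<eta>m: "(\<lambda>t. \<eta> n (edge_path E t)) \<in> borel_measurable unit_measure" for n
        by (rule continuous_imp_measurable_on_sets_lebesgue[OF continuous_on_subset]) auto
      have "(\<lambda>n. LINT t|unit_measure. \<eta> n (edge_path E t) * ?h T E (edge_path E t))
          \<longlonglongrightarrow> (LINT t|unit_measure. ?h T E (edge_path E t))"
      proof (rule integral_dominated_convergence[where w="\<lambda>t. \<bar>?h T E (edge_path E t)\<bar>"])
        show "(\<lambda>t. ?h T E (edge_path E t)) \<in> borel_measurable unit_measure" using hi by (rule borel_measurable_integrable)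
        then show "(\<lambda>t. \<eta> n (edge_path E t) * ?h T E (edge_path E t)) \<in> borel_measurable unit_measure" for n
          by (rule borel_measurable_times[OF \<eta>m])
        show "integrable unit_measure (\<lambda>t. \<bar>?h T E (edge_path E t)\<bar>)" using hi by (rule integrable_abs)
        show "AE t in unit_measure. norm (\<eta> n (edge_path E t) * ?h T E (edge_path E t)) \<le> \<bar>?h T E (edge_path E t)\<bar>" for n
        proof (rule AE_I2)
          fix t
          have "\<bar>\<eta> n (edge_path E t)\<bar> \<le> 1" using \<eta>(2)[of n "edge_path E t"] by simp
          from mult_right_mono[OF this abs_ge_zero[of "?h T E (edge_path E t)"]]
          show "norm (\<eta> n (edge_path E t) * ?h T E (edge_path E t)) \<le> \<bar>?h T E (edge_path E t)\<bar>"
            by (simp only: real_norm_def abs_mult mult_1_left)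
        qed
        \<comment> \<open>The end points of an interior edge may lie on the boundary of the domain,
          where the cutoffs vanish; they form a null set.\<close>
        have "AE t in lebesgue. t \<notin> {0, 1::real}"
          by (rule AE_not_in) (simp add: negligible_iff_null_sets[symmetric])
        then have "AE t in lebesgue. t \<in> {0..1} \<longrightarrow> (\<lambda>n. \<eta> n (edge_path E t) * ?h T E (edge_path E t)) \<longlonglongrightarrow> ?h T E (edge_path E t)"
        proof eventually_elim
          fix t :: real assume t: "t \<notin> {0, 1}"
          show "t \<in> {0..1} \<longrightarrow> (\<lambda>n. \<eta> n (edge_path E t) * ?h T E (edge_path E t)) \<longlonglongrightarrow> ?h T E (edge_path E t)"
          proof
            assume "t \<in> {0..1}"
            with t have "0 < t" "t < 1" by auto
            from edge_path_open_segment[OF this ne] interior_edge_subset[OF domain mesh T E False pq]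
            have "edge_path E t \<in> \<Omega>" unfolding pq by blast
            from tendsto_mult[OF \<eta>(4)[OF this] tendsto_const[of "?h T E (edge_path E t)"]]
            show "(\<lambda>n. \<eta> n (edge_path E t) * ?h T E (edge_path E t)) \<longlonglongrightarrow> ?h T E (edge_path E t)" by simp
          qed
        qed
        then show "AE t in unit_measure. (\<lambda>n. \<eta> n (edge_path E t) * ?h T E (edge_path E t)) \<longlonglongrightarrow> ?h T E (edge_path E t)"
          by (simp add: AE_restrict_space_iff)
      qed
      from tendsto_mult[OF tendsto_const this] show ?thesis using False by (simp add: edge_integral_def)
    qed
  qed
  have fin: "finite {E. E edge_of T}" if "T \<in> \<T>" for T
    by (rule finite_edges_of_triangle[OF mesh_simplex[OF domain mesh that]])
  have "(\<lambda>n. \<Sum>T\<in>\<T>. \<Sum>E | E edge_of T. edge_integral E (\<lambda>x. \<eta> n x * ?h T E x))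
      \<longlonglongrightarrow> (\<Sum>T\<in>\<T>. \<Sum>E | E edge_of T. if E \<subseteq> frontier \<Omega> then 0 else edge_integral E (?h T E))"
    by (intro tendsto_sum edge_lim) auto
  then have inner0: "(\<Sum>T\<in>\<T>. \<Sum>E | E edge_of T. if E \<subseteq> frontier \<Omega> then 0 else edge_integral E (?h T E)) = 0"
    unfolding total[OF \<eta>(1), symmetric] \<eta>0 by (simp add: LIMSEQ_const_iff)
  have "(LINT x|lebesgue_on \<Omega>. w x \<bullet> weak_gradient \<Omega> v x + d x * v x) = (LINT x|lebesgue_on \<Omega>. ?fd (\<lambda>x. 1) x)"
    by (simp add: flux_density_def[OF U w d v, abs_def])
  also have "\<dots> = (\<Sum>T\<in>\<T>. \<Sum>E | E edge_of T. edge_integral E (?h T E))"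
    using total[OF smooth_const[of 1]] by simp
  also have "\<dots> = (\<Sum>T\<in>\<T>. (\<Sum>E | E edge_of T. if E \<subseteq> frontier \<Omega> then edge_integral E (?h T E) else 0)
      + (\<Sum>E | E edge_of T. if E \<subseteq> frontier \<Omega> then 0 else edge_integral E (?h T E)))"
    unfolding sum.distrib[symmetric] by (intro sum.cong refl) simp
  also have "\<dots> = (\<Sum>T\<in>\<T>. \<Sum>E | E edge_of T. if E \<subseteq> frontier \<Omega> then edge_integral E (?h T E) else 0)"
    unfolding sum.distrib inner0 by simp
  also have "\<dots> = (\<Sum>T\<in>\<T>. \<Sum>E | E edge_of T \<and> E \<subseteq> frontier \<Omega>. edge_integral E (?h T E))"
  proof (rule sum.cong[OF refl])
    fix T assume "T \<in> \<T>"
    from sum.inter_filter[OF fin[OF this], of "\<lambda>E. edge_integral E (?h T E)" "\<lambda>E. E \<subseteq> frontier \<Omega>"]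
    show "(\<Sum>E | E edge_of T. if E \<subseteq> frontier \<Omega> then edge_integral E (?h T E) else 0)
        = (\<Sum>E | E edge_of T \<and> E \<subseteq> frontier \<Omega>. edge_integral E (?h T E))" by simp
  qed
  also have "\<dots> = (\<Sum>E\<in>boundary_edges \<Omega> \<T>. edge_integral E (?h (element_of \<T> E) E))"
    by (rule sum_boundary_edges[OF domain mesh])
  finally show ?thesis unfolding boundary_trace_def .
qed

subsection \<open>Stream functions\<close>

text \<open>The Poincare lemma: the potential at x is the integral of W along the segment from c to
  x. W is smooth on the plane but curl free only on S, so the potential is C1 everywhere and its
  gradient is identified with W only on S.\<close>

lemma smooth_curl_free_potential:
  assumes W: "\<And>i. smooth (\<lambda>x. W x $ i)" and S: "convex S" "c \<in> S"
    and curl: "\<And>x. x \<in> S \<Longrightarrow> gradient (\<lambda>y. W y $ 1) x $ 2 = gradient (\<lambda>y. W y $ 2) x $ 1"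
  obtains \<psi> where "Ck 1 \<psi>" "\<And>x. x \<in> S \<Longrightarrow> gradient \<psi> x = W x"
proof -
  let ?z = "\<lambda>x t. c + t *\<^sub>R (x - c)"
  let ?f = "\<lambda>x t. W (?z x t) \<bullet> (x - c)"
  \<comment> \<open>The gradient in x of the integrand \<open>?f x t\<close>, by the product
    rule.\<close>
  define g where "g x t = W (?z x t) + t *\<^sub>R ((x - c) $ 1 *\<^sub>R gradient (\<lambda>y. W y $ 1) (?z x t)
      + (x - c) $ 2 *\<^sub>R gradient (\<lambda>y. W y $ 2) (?z x t))" for x :: point and t :: real
  have Wc: "continuous_on UNIV W"
    using continuous_on_vec_lambda[of UNIV "\<lambda>i x. W x $ i"] smooth_continuous[OF W] by simp
  have zc: "continuous_on A (\<lambda>p. ?z (fst p) (snd p))" for A by (intro continuous_intros)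
  have gc: "continuous_on A (\<lambda>p. g (fst p) (snd p))" for A
    unfolding g_def
    by (intro continuous_intros continuous_on_compose2[OF Wc zc] continuous_on_compose2[OF smooth_gradient_continuous[OF W, of UNIV] zc]) auto
  have gc': "continuous_on (A \<times> B) (\<lambda>(x, t). g x t)" for A B
    using gc[of "A \<times> B"] by (simp add: case_prod_unfold)
  have fd: "((\<lambda>x. ?f x t) has_derivative (\<lambda>h. g x t \<bullet> h)) (at x)" for x t
  proof -
    have dz: "((\<lambda>x. ?z x t) has_derivative (\<lambda>h. t *\<^sub>R h)) (at x)" by (auto intro!: derivative_eq_intros)
    have dW: "((\<lambda>x. W (?z x t) $ i) has_derivative (\<lambda>h. gradient (\<lambda>y. W y $ i) (?z x t) \<bullet> (t *\<^sub>R h))) (at x)" for i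
      by (rule has_derivative_compose[OF dz has_derivative_gradient[OF smooth_differentiable[OF W]]])
    have dx: "((\<lambda>x. (x - c) $ i) has_derivative (\<lambda>h. h $ i)) (at x)" for i
      by (auto intro!: derivative_eq_intros has_derivative_vec_nth)
    have "((\<lambda>x. W (?z x t) $ 1 * (x - c) $ 1 + W (?z x t) $ 2 * (x - c) $ 2) has_derivative
       (\<lambda>h. (W (?z x t) $ 1 * h $ 1 + gradient (\<lambda>y. W y $ 1) (?z x t) \<bullet> (t *\<^sub>R h) * (x - c) $ 1)
         + (W (?z x t) $ 2 * h $ 2 + gradient (\<lambda>y. W y $ 2) (?z x t) \<bullet> (t *\<^sub>R h) * (x - c) $ 2))) (at x)"
      by (intro has_derivative_add has_derivative_mult dW dx)
    moreover have "(\<lambda>x. W (?z x t) $ 1 * (x - c) $ 1 + W (?z x t) $ 2 * (x - c) $ 2) = (\<lambda>x. ?f x t)"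
      by (simp add: fun_eq_iff inner_vec_def sum_2)
    moreover have "(\<lambda>h. (W (?z x t) $ 1 * h $ 1 + gradient (\<lambda>y. W y $ 1) (?z x t) \<bullet> (t *\<^sub>R h) * (x - c) $ 1)
         + (W (?z x t) $ 2 * h $ 2 + gradient (\<lambda>y. W y $ 2) (?z x t) \<bullet> (t *\<^sub>R h) * (x - c) $ 2)) = (\<lambda>h. g x t \<bullet> h)"
      by (simp add: fun_eq_iff g_def inner_vec_def sum_2 algebra_simps)
    ultimately show ?thesis by simp
  qed
  define \<psi> where "\<psi> x = integral (cbox 0 1) (?f x)" for x
  define G where "G x = integral (cbox 0 1) (g x)" for x
  have gi: "g x integrable_on cbox 0 1" for x
  proof (rule integrable_continuous)
    have "continuous_on UNIV (\<lambda>t. g (fst (x, t)) (snd (x, t)))"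
      by (rule continuous_on_compose2[OF gc[of UNIV]]) (auto intro!: continuous_intros)
    then show "continuous_on (cbox 0 1) (g x)" using continuous_on_subset by simp blast
  qed
  have d\<psi>: "(\<psi> has_derivative (\<lambda>h. G x \<bullet> h)) (at x)" for x
  proof -
    have bl: "bounded_linear (blinfun_inner_right :: point \<Rightarrow> _)" by (rule bounded_linear_blinfun_inner_right)
    have "((\<lambda>x. integral (cbox 0 1) (?f x)) has_derivative
        blinfun_apply (integral (cbox 0 1) (\<lambda>t. blinfun_inner_right (g x t)))) (at x within UNIV)"
    proof (rule leibniz_rule)
      show "((\<lambda>x. ?f x t) has_derivative blinfun_apply (blinfun_inner_right (g x t))) (at x within UNIV)" for x t
        using fd[of t x] by simp
      show "?f x integrable_on cbox 0 1" for x
      proof (rule integrable_continuous)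
        have "continuous_on UNIV (\<lambda>t. ?z x t)" by (intro continuous_intros)
        from continuous_on_compose2[OF Wc this] have "continuous_on UNIV (?f x)" by (intro continuous_intros) auto
        then show "continuous_on (cbox 0 1) (?f x)" by (rule continuous_on_subset) simp
      qed
      show "continuous_on (UNIV \<times> cbox 0 1) (\<lambda>(x, t). blinfun_inner_right (g x t))"
        using bounded_linear.continuous_on[OF bl gc'[of UNIV "cbox 0 1"]] by (simp add: case_prod_unfold)
    qed auto
    moreover have "integral (cbox 0 1) (\<lambda>t. blinfun_inner_right (g x t)) = blinfun_inner_right (G x)"
      unfolding G_def using integral_linear[OF gi bl, of x] by (simp add: o_def)
    ultimately show ?thesis unfolding \<psi>_def[abs_def] by simp
  qed
  have grad\<psi>: "gradient \<psi> x = G x" for x by (rule gradient_eqI[OF d\<psi>])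
  have Gc: "continuous_on UNIV G"
    unfolding G_def[abs_def] by (rule integral_continuous_on_param[OF gc'])
  have GW: "G x = W x" if x: "x \<in> S" for x
  proof -
    have zS: "?z x t \<in> S" if "t \<in> {0..1}" for t
    proof -
      have "(1 - t) *\<^sub>R c + t *\<^sub>R x \<in> S" using S x that by (intro convexD) auto
      then show ?thesis by (simp add: algebra_simps)
    qed
    have "G x $ i = W x $ i" for i
    proof -
      let ?Wi = "\<lambda>y. W y $ i"
      \<comment> \<open>The integrand is the derivative of t times the component of W along the
        segment; the vanishing curl is what makes it agree with \<open>g x t $ i\<close>.\<close>
      have "((\<lambda>t. ?Wi (?z x t) + t * (gradient ?Wi (?z x t) \<bullet> (x - c))) has_integral 1 * ?Wi (?z x 1) - 0 * ?Wi (?z x 0)) {0..1}"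
      proof (rule fundamental_theorem_of_calculus)
        fix t :: real
        have "((\<lambda>t. ?z x t) has_derivative (\<lambda>h. h *\<^sub>R (x - c))) (at t)" by (auto intro!: derivative_eq_intros)
        from has_derivative_compose[OF this has_derivative_gradient[OF smooth_differentiable[OF W]]]
        have "((\<lambda>t. ?Wi (?z x t)) has_real_derivative gradient ?Wi (?z x t) \<bullet> (x - c)) (at t)"
          unfolding has_field_derivative_def by (rule has_derivative_eq_rhs) (simp add: fun_eq_iff mult.commute)
        from DERIV_mult[OF DERIV_ident this]
        have "((\<lambda>t. t * ?Wi (?z x t)) has_real_derivative ?Wi (?z x t) + t * (gradient ?Wi (?z x t) \<bullet> (x - c))) (at t)"
          by (simp add: add.commute mult.commute)
        then show "((\<lambda>t. t * ?Wi (?z x t)) has_vector_derivative ?Wi (?z x t) + t * (gradient ?Wi (?z x t) \<bullet> (x - c))) (at t within {0..1})"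
          by (simp add: has_real_derivative_iff_has_vector_derivative[symmetric] has_field_derivative_at_within)
      qed simp
      then have h: "((\<lambda>t. ?Wi (?z x t) + t * (gradient ?Wi (?z x t) \<bullet> (x - c))) has_integral ?Wi x) {0..1}" by simp
      have "((\<lambda>t. g x t $ i) has_integral ?Wi x) {0..1}"
      proof (rule has_integral_eq[OF _ h])
        fix t :: real assume "t \<in> {0..1}"
        from curl[OF zS[OF this]]
        show "?Wi (?z x t) + t * (gradient ?Wi (?z x t) \<bullet> (x - c)) = g x t $ i"
          using exhaust_2[of i] by (auto simp: g_def inner_vec_def sum_2 algebra_simps)
      qed
      moreover have "integral (cbox 0 1) (\<lambda>t. g x t $ i) = G x $ i"
        unfolding G_def using integral_linear[OF gi[of x] bounded_linear_vec_nth[of i]] by (simp add: o_def)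
      ultimately show ?thesis by (simp add: integral_unique)
    qed
    then show ?thesis by (simp add: vec_eq_iff)
  qed
  show ?thesis
  proof (rule that[of \<psi>])
    have "continuous_on UNIV (\<lambda>x. gradient \<psi> x $ i)" for i
      unfolding grad\<psi> by (intro continuous_intros Gc)
    then show "Ck 1 \<psi>" using differentiableI[OF d\<psi>] by simp
    show "gradient \<psi> x = W x" if "x \<in> S" for x using GW[OF that] grad\<psi> by simp
  qed
qed

subsection \<open>Divergence-free fields and Korn's inequality\<close>

definition deviator :: "real^2^2 \<Rightarrow> real^2^2" where
  "deviator A = A - (trace A / 2) *\<^sub>R mat 1"

definition sym_part :: "real^2^2 \<Rightarrow> real^2^2" where
  "sym_part A = (1/2) *\<^sub>R (A + transpose A)"

text \<open>Each row is turned counterclockwise by a quarter, so that rows of zero divergence become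
  rows of zero curl.\<close>

definition rotate :: "real^2^2 \<Rightarrow> real^2^2" where
  "rotate A = (\<chi> i. - perp (A $ i))"

lemma trace_2: "trace A = A $ 1 $ 1 + A $ 2 $ 2" for A :: "real^2^2"
  by (simp add: trace_def sum_2)

lemma inner_matrix_2: "A \<bullet> B = A $ 1 $ 1 * B $ 1 $ 1 + A $ 1 $ 2 * B $ 1 $ 2 + A $ 2 $ 1 * B $ 2 $ 1 + A $ 2 $ 2 * B $ 2 $ 2"
  for A B :: "real^2^2"
  by (simp add: inner_vec_def sum_2)

lemma J_mat_nth [simp]: "J_mat $ 1 $ 1 = 0" "J_mat $ 1 $ 2 = 1" "J_mat $ 2 $ 1 = -1" "J_mat $ 2 $ 2 = 0"
  by (simp_all add: J_mat_def)

lemma rotate_nth [simp]: "rotate A $ i $ 1 = - A $ i $ 2" "rotate A $ i $ 2 = A $ i $ 1"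
  by (simp_all add: rotate_def)

lemma mat_nth [simp]: "(mat 1 :: real^2^2) $ 1 $ 1 = 1" "(mat 1 :: real^2^2) $ 1 $ 2 = 0"
  "(mat 1 :: real^2^2) $ 2 $ 1 = 0" "(mat 1 :: real^2^2) $ 2 $ 2 = 1"
  by (simp_all add: mat_def)

lemma transpose_nth [simp]: "transpose A $ i $ j = A $ j $ i"
  by (simp add: transpose_def)

lemma bounded_linear_matrix_maps:
  "bounded_linear deviator" "bounded_linear sym_part" "bounded_linear rotate" "bounded_linear skew_part"
  "bounded_linear (trace :: real^2^2 \<Rightarrow> real)"
  by (auto intro!: linear_conv_bounded_linear[THEN iffD1] linearI
      simp: vec_eq_iff forall_2 deviator_def sym_part_def skew_part_def trace_2 field_simps)

lemma rotate_inner: "rotate A \<bullet> rotate B = A \<bullet> B"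
  by (simp add: inner_matrix_2)

text \<open>Rotation sends the identity matrix to \<open>J_mat\<close>. Hence a field whose trace
  has mean zero is, after rotation, orthogonal to constant multiples of
  \<open>J_mat\<close>.\<close>

lemma rotate_inner_J: "rotate A \<bullet> J_mat = trace A"
  by (simp add: inner_matrix_2 trace_2)

text \<open>Rotation maps the identity to a skew matrix and trace-free matrices to symmetric ones.
  The symmetric part of the rotated matrix is thus the rotated deviator, and rotation preserves the
  norm.\<close>

lemma norm_sym_part_rotate: "norm (sym_part (rotate A)) = norm (deviator A)"
  by (simp add: norm_eq_sqrt_inner inner_matrix_2 sym_part_def deviator_def trace_2)
    (simp add: field_simps)

lemma norm_deviator_le: "norm (deviator A) \<le> norm A"
proof -
  have "A \<bullet> A - deviator A \<bullet> deviator A = (trace A)\<^sup>2 / 2"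
    by (simp add: inner_matrix_2 deviator_def trace_2) (simp add: power2_eq_square field_simps)
  then have "deviator A \<bullet> deviator A \<le> A \<bullet> A" using zero_le_power2[of "trace A"] by linarith
  then show ?thesis by (simp add: norm_eq_sqrt_inner)
qed

lemma L2_norm_square_vec:
  fixes f :: "'a \<Rightarrow> ('b::euclidean_space)^2"
  assumes "f \<in> L2 M"
  shows "(L2_norm M f)\<^sup>2 = (L2_norm M (\<lambda>x. f x $ 1))\<^sup>2 + (L2_norm M (\<lambda>x. f x $ 2))\<^sup>2"
  using L2_inner_integrable[OF L2_nth[OF assms] L2_nth[OF assms], of 1 1] L2_inner_integrable[OF L2_nth[OF assms] L2_nth[OF assms], of 2 2]
  by (simp add: L2_norm_square L2_inner_def inner_vec_def sum_2)

lemma L2_tendsto_vec: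
  fixes f :: "'a \<Rightarrow> ('b::euclidean_space)^2"
  assumes f: "f \<in> L2 M" "\<And>n. F n \<in> L2 M" and lim: "\<And>i. (\<lambda>n. L2_norm M (\<lambda>x. F n x $ i - f x $ i)) \<longlonglongrightarrow> 0"
  shows "(\<lambda>n. L2_norm M (\<lambda>x. F n x - f x)) \<longlonglongrightarrow> 0"
proof -
  have "(\<lambda>n. (L2_norm M (\<lambda>x. F n x $ 1 - f x $ 1))\<^sup>2 + (L2_norm M (\<lambda>x. F n x $ 2 - f x $ 2))\<^sup>2) \<longlonglongrightarrow> 0\<^sup>2 + 0\<^sup>2"
    by (intro tendsto_add tendsto_power lim)
  moreover have "(L2_norm M (\<lambda>x. F n x $ 1 - f x $ 1))\<^sup>2 + (L2_norm M (\<lambda>x. F n x $ 2 - f x $ 2))\<^sup>2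
      = (L2_norm M (\<lambda>x. F n x - f x))\<^sup>2" for n
    using L2_norm_square_vec[OF L2_diff[OF f(2) f(1)], of n] by simp
  ultimately have "(\<lambda>n. (L2_norm M (\<lambda>x. F n x - f x))\<^sup>2) \<longlonglongrightarrow> 0" by simp
  from tendsto_real_sqrt[OF this] show ?thesis by simp
qed

lemma L2_norm_cong_norm_AE:
  assumes "f \<in> borel_measurable M" "g \<in> borel_measurable M" "AE x in M. norm (f x) = norm (g x)"
  shows "L2_norm M f = L2_norm M g"
proof -
  have "(LINT x|M. (norm (f x))\<^sup>2) = (LINT x|M. (norm (g x))\<^sup>2)"
    using assms by (intro integral_cong_AE) auto
  then show ?thesis
    unfolding L2_norm_square_integral[symmetric] by (rule power2_eq_imp_eq) simp_all
qed

text \<open>What matters about a rigid body mode is that its gradient is a constant multiple of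
  \<open>J_mat\<close>.\<close>

lemma RM_gradient:
  assumes "\<rho> \<in> RM"
  obtains \<alpha> where "\<And>i. smooth (\<lambda>x. \<rho> x $ i)" "\<And>x. (\<chi> i. gradient (\<lambda>y. \<rho> y $ i) x) = \<alpha> *\<^sub>R J_mat"
proof -
  obtain a \<alpha> where \<rho>: "\<rho> = (\<lambda>x. a + \<alpha> *\<^sub>R vector [x $ 2, - (x $ 1)])" using assms by (auto simp: RM_def)
  have c: "(\<lambda>x. \<rho> x $ 1) = (\<lambda>x. a $ 1 + \<alpha> * x $ 2)" "(\<lambda>x. \<rho> x $ 2) = (\<lambda>x. a $ 2 + (- \<alpha>) * x $ 1)"
    by (simp_all add: \<rho> fun_eq_iff)
  have s: "smooth (\<lambda>x. \<rho> x $ 1)" "smooth (\<lambda>x. \<rho> x $ 2)"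
    unfolding c by (rule smooth_add[OF smooth_const smooth_mult[OF smooth_const smooth_vec_nth]])+
  have g: "gradient (\<lambda>x. b + \<beta> * x $ j) x = \<beta> *\<^sub>R axis j 1" for b \<beta> j and x :: point
    by (rule gradient_eqI) (auto intro!: derivative_eq_intros has_derivative_vec_nth simp: inner_axis')
  show ?thesis
  proof (rule that[of \<alpha>])
    show "smooth (\<lambda>x. \<rho> x $ i)" for i using s exhaust_2[of i] by auto
    show "(\<chi> i. gradient (\<lambda>y. \<rho> y $ i) x) = \<alpha> *\<^sub>R J_mat" for x
      unfolding vec_eq_iff forall_2 vec_lambda_beta c g by (simp add: axis_def)
  qed
qed

text \<open>The rotated rows of \<tau> have potentials, which are stacked into one vector field
  \<open>?v\<close>. The product of e and \<tau> is that of the rotated e with the gradient of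
  \<open>?v\<close>, from which multiples of \<open>J_mat\<close> may be subtracted, and Korn's
  inequality is applied to \<open>?v\<close>.\<close>

lemma korn_smooth_divergence_free:
  fixes \<tau> e :: tensor_field
  assumes S: "convex_body S" and K: "korn_constant S C"
    and \<tau>: "\<And>i j. smooth (\<lambda>x. \<tau> x $ i $ j)" and div0: "\<And>i x. x \<in> S \<Longrightarrow> vdiv (\<lambda>y. \<tau> y $ i) x = 0"
    and e: "e \<in> L2 (lebesgue_on S)" and tr: "(LINT x|lebesgue_on S. trace (e x)) = 0"
  shows "\<bar>L2_inner (lebesgue_on S) e \<tau>\<bar> \<le> C * L2_norm (lebesgue_on S) e * L2_norm (lebesgue_on S) (\<lambda>x. deviator (\<tau> x))"
proof -
  note S' = convex_bodyD[OF S]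
  let ?M = "lebesgue_on S"
  obtain c where c: "c \<in> S" using S'(3) interior_subset by blast
  have "\<exists>\<psi>. Ck 1 \<psi> \<and> (\<forall>x\<in>S. gradient \<psi> x = rotate (\<tau> x) $ i)" for i
  proof -
    have sm: "smooth (\<lambda>x. rotate (\<tau> x) $ i $ j)" for j
      using exhaust_2[of j] \<tau>[of i 1] smooth_uminus[OF \<tau>[of i 2]] by auto
    have "gradient (\<lambda>y. rotate (\<tau> y) $ i $ 1) x $ 2 = gradient (\<lambda>y. rotate (\<tau> y) $ i $ 2) x $ 1" if "x \<in> S" for x
    proof -
      have "gradient (\<lambda>y. - \<tau> y $ i $ 2) x = - gradient (\<lambda>y. \<tau> y $ i $ 2) x"
        using gradient_diff[OF smooth_differentiable[OF smooth_const[of 0]] smooth_differentiable[OF \<tau>[of i 2]]] by simp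
      then show ?thesis using div0[OF that, of i] by (simp add: vdiv_def)
    qed
    from smooth_curl_free_potential[OF sm S'(2) c this] show ?thesis by metis
  qed
  then have "\<exists>\<psi>. \<forall>i. Ck 1 (\<psi> i) \<and> (\<forall>x\<in>S. gradient (\<psi> i) x = rotate (\<tau> x) $ i)" by (intro choice allI)
  then obtain \<psi> where \<psi>: "\<And>i. Ck 1 (\<psi> i)" "\<And>i x. x \<in> S \<Longrightarrow> gradient (\<psi> i) x = rotate (\<tau> x) $ i" by blast
  let ?v = "\<lambda>x. \<chi> i. \<psi> i x"
  let ?G = "\<lambda>x. \<chi> i. gradient (\<psi> i) x"
  have GL: "?G \<in> L2 ?M"
    by (rule L2_vec) (simp add: L2_C1(2)[OF \<psi>(1) S'(4,6)])
  have \<tau>L: "\<tau> \<in> L2 ?M"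
    by (intro L2_vec) (rule L2_smooth[OF \<tau> S'(4,6)])
  have vH: "?v \<in> componentwise (H1 (interior S))"
    by (simp add: componentwise_def H1_C1[OF S \<psi>(1)])
  have grv: "AE x in ?M. grad (interior S) ?v x = ?G x"
  proof -
    have "AE x in ?M. weak_gradient (interior S) (\<psi> 1) x = gradient (\<psi> 1) x"
      "AE x in ?M. weak_gradient (interior S) (\<psi> 2) x = gradient (\<psi> 2) x"
      by (rule weak_gradient_C1[OF S \<psi>(1)])+
    then show ?thesis by eventually_elim (simp add: grad_def vec_eq_iff forall_2)
  qed
  have wgL: "(\<lambda>x. grad (interior S) ?v x) \<in> L2 ?M"
    by (rule L2_lebesgue_on_cong_AE[OF S'(6) GL]) (use grv in \<open>eventually_elim, simp\<close>)
  have epsL: "(\<lambda>x. eps (interior S) ?v x) \<in> L2 ?M"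
    using L2_bounded_linear[OF bounded_linear_matrix_maps(2) wgL] by (simp add: eps_def sym_part_def)
  have eps: "L2_norm ?M (eps (interior S) ?v) = L2_norm ?M (\<lambda>x. deviator (\<tau> x))"
  proof (rule L2_norm_cong_norm_AE[OF L2_measurable[OF epsL] L2_measurable[OF L2_bounded_linear[OF bounded_linear_matrix_maps(1) \<tau>L]]])
    have "AE x in ?M. x \<in> S" by (rule AE_I2) (simp add: space_restrict_space)
    then show "AE x in ?M. norm (eps (interior S) ?v x) = norm (deviator (\<tau> x))"
      using grv
    proof eventually_elim
      case (elim x)
      have "?G x = rotate (\<tau> x)" using \<psi>(2)[OF elim(1)] by (simp add: vec_eq_iff)
      then have "eps (interior S) ?v x = sym_part (rotate (\<tau> x))"
        using elim(2) by (simp add: eps_def sym_part_def)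
      then show ?case by (simp add: norm_sym_part_rotate)
    qed
  qed
  let ?r = "\<lambda>x. rotate (e x)"
  have rL: "?r \<in> L2 ?M" by (rule L2_bounded_linear[OF bounded_linear_matrix_maps(3) e])
  have rn: "L2_norm ?M ?r = L2_norm ?M e" by (simp add: L2_norm_def L2_inner_def rotate_inner)
  have bound: "\<bar>L2_inner ?M e \<tau>\<bar> \<le> L2_norm ?M e * L2_norm ?M (grad (interior S) (\<lambda>x. ?v x - \<rho> x))" if RM: "\<rho> \<in> RM" for \<rho>
  proof -
    obtain \<alpha> where \<rho>: "\<And>i. smooth (\<lambda>x. \<rho> x $ i)" "\<And>x. (\<chi> i. gradient (\<lambda>y. \<rho> y $ i) x) = \<alpha> *\<^sub>R J_mat"
      by (rule RM_gradient[OF RM]) (rule that)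
    have row: "gradient (\<lambda>y. \<rho> y $ i) x = \<alpha> *\<^sub>R J_mat $ i" for i x
      using \<rho>(2)[of x] by (simp add: vec_eq_iff)
    have C1: "Ck 1 (\<lambda>x. (?v x - \<rho> x) $ i)" for i
      using Ck_add[OF \<psi>(1)[of i] smooth_Ck[OF smooth_uminus[OF \<rho>(1)[of i]]]] by simp
    have gd: "gradient (\<lambda>x. (?v x - \<rho> x) $ i) x = gradient (\<psi> i) x - \<alpha> *\<^sub>R J_mat $ i" for i x
      using gradient_diff[OF C1_differentiable[OF \<psi>(1)[of i]] smooth_differentiable[OF \<rho>(1)[of i]], of x] row[of i x] by simp
    have JL: "(\<lambda>x. \<alpha> *\<^sub>R J_mat) \<in> L2 ?M"
      by (rule L2_const[OF finite_measure_lebesgue_on[OF S'(4,6)]])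
    have DL: "(\<lambda>x. ?G x - \<alpha> *\<^sub>R J_mat) \<in> L2 ?M" by (rule L2_diff[OF GL JL])
    have ae: "AE x in ?M. ?G x - \<alpha> *\<^sub>R J_mat = grad (interior S) (\<lambda>x. ?v x - \<rho> x) x"
    proof -
      have "AE x in ?M. weak_gradient (interior S) (\<lambda>x. (?v x - \<rho> x) $ 1) x = gradient (\<lambda>x. (?v x - \<rho> x) $ 1) x"
        "AE x in ?M. weak_gradient (interior S) (\<lambda>x. (?v x - \<rho> x) $ 2) x = gradient (\<lambda>x. (?v x - \<rho> x) $ 2) x"
        by (rule weak_gradient_C1[OF S C1])+
      then show ?thesis unfolding gd by eventually_elim (simp add: grad_def vec_eq_iff forall_2)
    qed
    have "L2_inner ?M e \<tau> = L2_inner ?M ?r (\<lambda>x. ?G x)"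
      unfolding L2_inner_def
    proof (rule Bochner_Integration.integral_cong[OF refl])
      fix x assume "x \<in> space ?M"
      then have "x \<in> S" by (simp add: space_restrict_space)
      then have "?G x = rotate (\<tau> x)" using \<psi>(2) by (simp add: vec_eq_iff)
      then show "e x \<bullet> \<tau> x = ?r x \<bullet> ?G x" by (simp add: rotate_inner)
    qed
    moreover have "L2_inner ?M ?r (\<lambda>x. \<alpha> *\<^sub>R J_mat) = 0"
      using tr by (simp add: L2_inner_def rotate_inner_J)
    ultimately have "L2_inner ?M e \<tau> = L2_inner ?M ?r (\<lambda>x. ?G x - \<alpha> *\<^sub>R J_mat)"
      using L2_inner_diff_right[OF GL JL rL] by simp
    also have "\<bar>\<dots>\<bar> \<le> L2_norm ?M e * L2_norm ?M (\<lambda>x. ?G x - \<alpha> *\<^sub>R J_mat)"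
      using L2_Cauchy_Schwarz[OF rL DL] unfolding rn .
    also have "L2_norm ?M (\<lambda>x. ?G x - \<alpha> *\<^sub>R J_mat) = L2_norm ?M (grad (interior S) (\<lambda>x. ?v x - \<rho> x))"
      using L2_measurable[OF L2_lebesgue_on_cong_AE[OF S'(6) DL ae]] L2_measurable[OF DL] ae by (intro L2_norm_cong_AE)
    finally show ?thesis .
  qed
  \<comment> \<open>The bound for each \<rho> passes to the infimum after division by the norm of e;
    if that norm is zero, both sides are zero.\<close>
  have "\<bar>L2_inner ?M e \<tau>\<bar> \<le> L2_norm ?M e * (INF \<rho>\<in>RM. L2_norm ?M (grad (interior S) (\<lambda>x. ?v x - \<rho> x)))"
  proof (cases "L2_norm ?M e = 0")
    case True
    have "(\<lambda>x. 0) \<in> RM" unfolding RM_def by (auto intro!: exI[of _ 0])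
    from bound[OF this] True show ?thesis by simp
  next
    case False
    then have pos: "0 < L2_norm ?M e" using L2_norm_nonneg[of ?M e] by linarith
    have "\<bar>L2_inner ?M e \<tau>\<bar> / L2_norm ?M e \<le> (INF \<rho>\<in>RM. L2_norm ?M (grad (interior S) (\<lambda>x. ?v x - \<rho> x)))"
    proof (rule cINF_greatest)
      show "RM \<noteq> {}" by (auto simp: RM_def)
      show "\<bar>L2_inner ?M e \<tau>\<bar> / L2_norm ?M e \<le> L2_norm ?M (grad (interior S) (\<lambda>x. ?v x - \<rho> x))" if "\<rho> \<in> RM" for \<rho>
        using bound[OF that] pos by (simp add: field_simps)
    qed
    then show ?thesis using pos by (simp add: field_simps)
  qed
  also have "\<dots> \<le> L2_norm ?M e * (C * L2_norm ?M (eps (interior S) ?v))"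
    using K vH by (intro mult_left_mono) (auto simp: korn_constant_def)
  finally show ?thesis unfolding eps by (simp add: mult_ac)
qed

text \<open>The field with components x_1 and 0 has a nonzero constant strain, while the infimum in
  Korn's inequality is nonnegative. The sign is needed to multiply inequalities by the constant and
  to compare squares of constants.\<close>

lemma korn_constant_nonneg:
  assumes S: "convex_body S" and K: "korn_constant S C"
  shows "0 \<le> C"
proof -
  note S' = convex_bodyD[OF S]
  let ?M = "lebesgue_on S"
  let ?v = "\<lambda>x::point. (\<chi> i. if i = 1 then x $ 1 else 0) :: point"
  let ?A = "(\<chi> i. if i = 1 then axis 1 1 else 0) :: real^2^2"
  have C1: "Ck 1 (\<lambda>x. ?v x $ i)" for i
    using exhaust_2[of i] Ck_vec_nth[of 1 1] Ck_const[of 1 0] by auto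
  have g: "gradient (\<lambda>x. ?v x $ i) x = ?A $ i" for i x
    using exhaust_2[of i] gradient_vec_nth[of 1 x] by auto
  have vH: "?v \<in> componentwise (H1 (interior S))"
    using H1_C1[OF S C1] by (simp add: componentwise_def)
  have ae: "AE x in ?M. sym_part ?A = eps (interior S) ?v x"
  proof -
    have "AE x in ?M. weak_gradient (interior S) (\<lambda>x. ?v x $ 1) x = gradient (\<lambda>x. ?v x $ 1) x"
      "AE x in ?M. weak_gradient (interior S) (\<lambda>x. ?v x $ 2) x = gradient (\<lambda>x. ?v x $ 2) x"
      by (rule weak_gradient_C1[OF S C1])+
    then show ?thesis
    proof eventually_elim
      case (elim x)
      then have "grad (interior S) ?v x $ i = ?A $ i" for i
        using exhaust_2[of i] unfolding g grad_def by auto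
      then have "grad (interior S) ?v x = ?A" by (rule vec_eq_iff[THEN iffD2, OF allI])
      then show ?case by (simp add: eps_def sym_part_def)
    qed
  qed
  have AL: "(\<lambda>x. sym_part ?A) \<in> L2 ?M" by (rule L2_const[OF finite_measure_lebesgue_on[OF S'(4,6)]])
  have epsL: "eps (interior S) ?v \<in> L2 ?M" by (rule L2_lebesgue_on_cong_AE[OF S'(6) AL ae])
  have "L2_norm ?M (eps (interior S) ?v) \<noteq> 0"
  proof
    assume "L2_norm ?M (eps (interior S) ?v) = 0"
    then have "AE x in ?M. eps (interior S) ?v x = 0" using L2_norm_zero_iff[OF epsL] by simp
    with ae have "AE x in ?M. False"
    proof eventually_elim
      case (elim x)
      then have "sym_part ?A = 0" by simp
      then have "sym_part ?A $ 1 $ 1 = 0" by simp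
      then show False by (simp add: sym_part_def axis_def)
    qed
    then have "AE x in lebesgue. x \<notin> S" using S'(6) by (simp add: AE_restrict_space_iff)
    then have "S \<in> null_sets lebesgue" using S'(6) by (simp add: AE_iff_null_sets)
    then have "negligible (interior S)"
      using negligible_iff_null_sets negligible_subset[OF _ interior_subset] by blast
    then show False using open_not_negligible[OF open_interior S'(3)] by simp
  qed
  then have pos: "0 < L2_norm ?M (eps (interior S) ?v)"
    using L2_norm_nonneg[of ?M "eps (interior S) ?v"] by linarith
  have "0 \<le> (INF \<rho>\<in>RM. L2_norm ?M (grad (interior S) (\<lambda>x. ?v x - \<rho> x)))"
    by (rule cINF_greatest) (auto simp: RM_def)
  also have "\<dots> \<le> C * L2_norm ?M (eps (interior S) ?v)"
    by (rule bspec[OF K[unfolded korn_constant_def] vH])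
  finally show ?thesis using pos by (simp add: zero_le_mult_iff)
qed

text \<open>Smoothing keeps \<tau> divergence free at every point of S, since the divergence of the
  smoothed field is a test of \<tau> against a kernel. The smooth case passes to the limit because
  taking the deviator does not increase norms.\<close>

theorem korn_divergence_free:
  fixes \<tau> e :: tensor_field
  assumes S: "convex_body S" and K: "korn_constant S C" and \<tau>: "\<tau> \<in> L2 (lebesgue_on S)"
    and div0: "\<And>i \<phi>. \<phi> \<in> test_functions (interior S) \<Longrightarrow> (LINT x|lebesgue_on S. \<tau> x $ i \<bullet> gradient \<phi> x) = 0"
    and e: "e \<in> L2 (lebesgue_on S)" and tr: "(LINT x|lebesgue_on S. trace (e x)) = 0"
  shows "\<bar>L2_inner (lebesgue_on S) e \<tau>\<bar> \<le> C * L2_norm (lebesgue_on S) e * L2_norm (lebesgue_on S) (\<lambda>x. deviator (\<tau> x))"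
proof -
  note S' = convex_bodyD[OF S]
  obtain k where k: "mollifier S k" using mollifier_exists[OF S'(3)] .
  let ?M = "lebesgue_on S"
  define T where "T n x = (\<chi> i j. smoothing S k (1 / (real n + 2)) (\<lambda>y. \<tau> y $ i $ j) x)" for n x
  have \<tau>ij: "(\<lambda>y. \<tau> y $ i $ j) \<in> L2 ?M" for i j by (intro L2_nth \<tau>)
  note \<tau>int = L2_integrable_on[OF S'(1,2) k \<tau>ij]
  have Tij: "(\<lambda>x. T n x $ i $ j) = smoothing S k (1 / (real n + 2)) (\<lambda>y. \<tau> y $ i $ j)" for n i j
    by (simp add: T_def fun_eq_iff)
  have sm: "smooth (\<lambda>x. T n x $ i $ j)" for n i j
    unfolding Tij by (rule smooth_smoothing[OF S'(1,2) k \<tau>int])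
  have TL: "T n \<in> L2 ?M" for n
    by (intro L2_vec) (rule L2_smooth[OF sm S'(4,6)])
  have Tdiv: "vdiv (\<lambda>y. T n y $ i) x = 0" if "x \<in> S" for n i x
  proof -
    let ?e = "1 / (real n + 2)"
    have t: "kern k ?e x \<in> test_functions (interior S)"
      by (rule kernel_test_function[OF S'(1,2) k that]) simp_all
    note L = L2_test_function(2)[OF S'(4,6) t]
    have "vdiv (\<lambda>y. T n y $ i) x = - (1 - ?e) * ((LINT y|?M. gradient (kern k ?e x) y $ 1 * \<tau> y $ i $ 1)
        + (LINT y|?M. gradient (kern k ?e x) y $ 2 * \<tau> y $ i $ 2))"
      unfolding vdiv_def Tij gradient_smoothing[OF S'(1,2) k \<tau>int] by (simp add: algebra_simps)
    also have "(LINT y|?M. gradient (kern k ?e x) y $ 1 * \<tau> y $ i $ 1)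
        + (LINT y|?M. gradient (kern k ?e x) y $ 2 * \<tau> y $ i $ 2) = (LINT y|?M. \<tau> y $ i \<bullet> gradient (kern k ?e x) y)"
      using L2_mult_integrable[OF L \<tau>ij, of 1 i 1] L2_mult_integrable[OF L \<tau>ij, of 2 i 2]
      by (simp add: inner_vec_def sum_2 mult.commute)
    also have "\<dots> = 0" by (rule div0[OF t])
    finally show ?thesis by simp
  qed
  have lim: "(\<lambda>n. L2_norm ?M (\<lambda>x. T n x - \<tau> x)) \<longlonglongrightarrow> 0"
  proof (intro L2_tendsto_vec \<tau> TL L2_nth)
    fix i j
    have "(\<lambda>n. L2_norm ?M (\<lambda>x. smoothing S k (1 / (real n + 2)) (\<lambda>y. \<tau> y $ i $ j) x - \<tau> x $ i $ j)) \<longlonglongrightarrow> 0"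
      by (rule smoothing_tendsto[OF S'(1,2) k \<tau>ij])
    then show "(\<lambda>n. L2_norm ?M (\<lambda>x. T n x $ i $ j - \<tau> x $ i $ j)) \<longlonglongrightarrow> 0"
      by (simp add: T_def)
  qed
  note dl = bounded_linear_matrix_maps(1)
  have dL: "(\<lambda>x. deviator (T n x)) \<in> L2 ?M" "(\<lambda>x. deviator (\<tau> x)) \<in> L2 ?M" for n
    by (intro L2_bounded_linear[OF dl] TL \<tau>)+
  have dd: "L2_norm ?M (\<lambda>x. deviator (T n x) - deviator (\<tau> x)) \<le> 1 * L2_norm ?M (\<lambda>x. T n x - \<tau> x)" for n
    by (rule L2_norm_mono[OF L2_measurable[OF L2_diff[OF dL]] L2_diff[OF TL \<tau>]])
      (auto simp: linear_diff[OF bounded_linear.linear[OF dl], symmetric] norm_deviator_le)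
  have upper: "L2_norm ?M (\<lambda>x. deviator (T n x)) \<le> L2_norm ?M (\<lambda>x. T n x - \<tau> x) + L2_norm ?M (\<lambda>x. deviator (\<tau> x))" for n
    using L2_norm_triangle[OF L2_diff[OF dL(1)[of n] dL(2)] dL(2)] dd[of n] by simp
  have C0: "0 \<le> C" by (rule korn_constant_nonneg[OF S K])
  have "\<bar>L2_inner ?M e (T n)\<bar> \<le> C * L2_norm ?M e * (L2_norm ?M (\<lambda>x. T n x - \<tau> x) + L2_norm ?M (\<lambda>x. deviator (\<tau> x)))" for n
    using korn_smooth_divergence_free[OF S K sm Tdiv e tr, of n]
      mult_left_mono[OF upper[of n], of "C * L2_norm ?M e"] C0 by simp
  moreover have "(\<lambda>n. \<bar>L2_inner ?M e (T n)\<bar>) \<longlonglongrightarrow> \<bar>L2_inner ?M e \<tau>\<bar>"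
    unfolding L2_inner_commute[of ?M e] by (intro tendsto_rabs L2_inner_tendsto \<tau> TL e lim)
  moreover have "(\<lambda>n. C * L2_norm ?M e * (L2_norm ?M (\<lambda>x. T n x - \<tau> x) + L2_norm ?M (\<lambda>x. deviator (\<tau> x))))
     \<longlonglongrightarrow> C * L2_norm ?M e * (0 + L2_norm ?M (\<lambda>x. deviator (\<tau> x)))"
    by (intro tendsto_intros lim)
  ultimately show ?thesis
    using LIMSEQ_le[of "\<lambda>n. \<bar>L2_inner ?M e (T n)\<bar>" "\<bar>L2_inner ?M e \<tau>\<bar>"] by simp
qed

subsection \<open>Fields on the mesh\<close>

lemma componentwiseD: "v \<in> componentwise A \<Longrightarrow> (\<lambda>x. v x $ i) \<in> A"
  by (simp add: componentwise_def)

lemma grad_nth: "grad U v x $ i = weak_gradient U (\<lambda>y. v y $ i) x"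
  by (simp add: grad_def)

lemma grad_L2: "v \<in> componentwise (H1 U) \<Longrightarrow> grad U v \<in> L2 (lebesgue_on U)"
  by (rule L2_vec) (simp add: grad_nth weak_gradient_L2 componentwiseD)

lemma grad_diff_AE:
  assumes S: "convex_body S" and v: "v \<in> componentwise (H1 (interior S))" "w \<in> componentwise (H1 (interior S))"
  shows "AE x in lebesgue_on S. grad (interior S) (\<lambda>x. v x - w x) x = grad (interior S) v x - grad (interior S) w x"
    and "(\<lambda>x. v x - w x) \<in> componentwise (H1 (interior S))"
proof -
  note d = weak_gradient_diff[OF S componentwiseD[OF v(1)] componentwiseD[OF v(2)]]
  show "(\<lambda>x. v x - w x) \<in> componentwise (H1 (interior S))"
    using d(2) by (simp add: componentwise_def)
  show "AE x in lebesgue_on S. grad (interior S) (\<lambda>x. v x - w x) x = grad (interior S) v x - grad (interior S) w x"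
    using d(1)[of 1 1] d(1)[of 2 2]
    by eventually_elim (simp add: vec_eq_iff[of "grad _ _ _"] forall_2 grad_nth)
qed

lemma eps_sym_part: "eps U v x = sym_part (grad U v x)"
  by (simp add: eps_def sym_part_def)

text \<open>Since s is orthogonal to \<open>J_mat\<close>, the gradient of a rigid body mode can be
  subtracted from that of v before the Cauchy-Schwarz inequality is applied.\<close>

lemma korn_skew:
  assumes S: "convex_body S" and K: "korn_constant S C" and v: "v \<in> componentwise (H1 (interior S))"
    and s: "s \<in> L2 (lebesgue_on S)" and J: "L2_inner (lebesgue_on S) s (\<lambda>x. J_mat) = 0"
  shows "\<bar>L2_inner (lebesgue_on S) (grad (interior S) v) s\<bar>
    \<le> C * L2_norm (lebesgue_on S) (eps (interior S) v) * L2_norm (lebesgue_on S) s"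
proof -
  note S' = convex_bodyD[OF S]
  let ?M = "lebesgue_on S" and ?g = "grad (interior S)"
  have gL: "?g w \<in> L2 ?M" if "w \<in> componentwise (H1 (interior S))" for w
    using grad_L2[OF that] by (simp add: interior_null_change[OF S])
  have bound: "\<bar>L2_inner ?M (?g v) s\<bar> \<le> L2_norm ?M s * L2_norm ?M (?g (\<lambda>x. v x - \<rho> x))" if RM: "\<rho> \<in> RM" for \<rho>
  proof -
    obtain \<alpha> where \<rho>: "\<And>i. smooth (\<lambda>x. \<rho> x $ i)" "\<And>x. (\<chi> i. gradient (\<lambda>y. \<rho> y $ i) x) = \<alpha> *\<^sub>R J_mat"
      by (rule RM_gradient[OF RM]) (rule that)
    have \<rho>H: "\<rho> \<in> componentwise (H1 (interior S))"
      by (simp add: componentwise_def H1_C1[OF S smooth_Ck[OF \<rho>(1)]])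
    note d = grad_diff_AE[OF S v \<rho>H]
    have "AE x in ?M. weak_gradient (interior S) (\<lambda>x. \<rho> x $ 1) x = gradient (\<lambda>x. \<rho> x $ 1) x"
        "AE x in ?M. weak_gradient (interior S) (\<lambda>x. \<rho> x $ 2) x = gradient (\<lambda>x. \<rho> x $ 2) x"
      by (rule weak_gradient_C1[OF S smooth_Ck[OF \<rho>(1)]])+
    then have ae: "AE x in ?M. ?g v x = ?g (\<lambda>x. v x - \<rho> x) x + \<alpha> *\<^sub>R J_mat"
      using d(1)
    proof eventually_elim
      case (elim x)
      have "?g \<rho> x = (\<chi> i. gradient (\<lambda>y. \<rho> y $ i) x)"
        using elim(1,2) by (simp add: vec_eq_iff[of "grad _ _ _"] forall_2 grad_nth)
      then show ?case using elim(3) \<rho>(2)[of x] by simp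
    qed
    have JL: "(\<lambda>x. \<alpha> *\<^sub>R J_mat) \<in> L2 ?M"
      by (rule L2_const[OF finite_measure_lebesgue_on[OF S'(4,6)]])
    have "L2_inner ?M (?g v) s = L2_inner ?M (\<lambda>x. ?g (\<lambda>x. v x - \<rho> x) x + \<alpha> *\<^sub>R J_mat) s"
      using ae by (intro L2_inner_cong_AE) (auto intro!: L2_measurable L2_add gL[OF v] gL[OF d(2)] JL s)
    also have "\<dots> = L2_inner ?M (?g (\<lambda>x. v x - \<rho> x)) s"
      using J L2_inner_commute[of ?M "\<lambda>x. J_mat" s] by (simp add: L2_inner_add_left gL[OF d(2)] JL s)
    finally show ?thesis
      using L2_Cauchy_Schwarz[OF gL[OF d(2)] s] by (simp add: mult.commute)
  qed
  have "\<bar>L2_inner ?M (?g v) s\<bar> \<le> L2_norm ?M s * (INF \<rho>\<in>RM. L2_norm ?M (?g (\<lambda>x. v x - \<rho> x)))"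
  proof (cases "L2_norm ?M s = 0")
    case True
    have "(\<lambda>x. 0) \<in> RM" unfolding RM_def by (auto intro!: exI[of _ 0])
    from bound[OF this] True show ?thesis by simp
  next
    case False
    then have pos: "0 < L2_norm ?M s" using L2_norm_nonneg[of ?M s] by linarith
    have "\<bar>L2_inner ?M (?g v) s\<bar> / L2_norm ?M s \<le> (INF \<rho>\<in>RM. L2_norm ?M (?g (\<lambda>x. v x - \<rho> x)))"
    proof (rule cINF_greatest)
      show "RM \<noteq> {}" by (auto simp: RM_def)
      show "\<bar>L2_inner ?M (?g v) s\<bar> / L2_norm ?M s \<le> L2_norm ?M (?g (\<lambda>x. v x - \<rho> x))" if "\<rho> \<in> RM" for \<rho>
        using bound[OF that] pos by (simp add: field_simps)
    qed
    then show ?thesis using pos by (simp add: field_simps)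
  qed
  also have "\<dots> \<le> L2_norm ?M s * (C * L2_norm ?M (eps (interior S) v))"
    using K v by (intro mult_left_mono) (auto simp: korn_constant_def)
  finally show ?thesis by (simp add: mult_ac)
qed

lemma AE_edge_cong: "AE_edge E P \<Longrightarrow> (\<And>x. P x \<Longrightarrow> Q x) \<Longrightarrow> AE_edge E Q"
  unfolding AE_edge_def by (rule AE_mp[rotated]) auto

lemma edge_integral_eq_0:
  assumes "AE_edge E (\<lambda>x. f x = 0)" shows "edge_integral E f = 0"
proof -
  have "(LINT t|unit_measure. f (edge_path E t)) = 0"
    using assms unfolding AE_edge_def by (rule integral_eq_zero_AE)
  then show ?thesis by (simp add: edge_integral_def)
qed

lemma edge_integral_cong_AE:
  assumes "(\<lambda>t. f (edge_path E t)) \<in> borel_measurable unit_measure" "AE_edge E (\<lambda>x. f x = g x)"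
  shows "edge_integral E f = edge_integral E g"
proof -
  have ae: "AE t in unit_measure. f (edge_path E t) = g (edge_path E t)"
    using assms(2) by (simp add: AE_edge_def)
  have "(LINT t|unit_measure. f (edge_path E t)) = (LINT t|unit_measure. g (edge_path E t))"
    by (rule integral_cong_AE[OF assms(1) borel_measurable_lebesgue_on_cong_AE[OF _ assms(1) ae] ae]) simp
  then show ?thesis by (simp add: edge_integral_def)
qed

section \<open>Sobolev functions on the mesh and their boundary values\<close>

context
  fixes \<Omega> :: "point set" and \<T> \<D> :: "point set set"
  assumes domain: "polygonal_domain \<Omega>" and mesh: "triangulates \<T> \<Omega>" and \<D>: "\<D> \<subseteq> boundary_edges \<Omega> \<T>"
begin

lemma AE_mesh:
  assumes "\<And>T. T \<in> \<T> \<Longrightarrow> AE x in lebesgue_on T. P x"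
  shows "AE x in lebesgue_on \<Omega>. P x"
proof -
  have "AE x in lebesgue. x \<in> T \<longrightarrow> P x" if "T \<in> \<T>" for T
    using assms[OF that] convex_bodyD(6)[OF mesh_body[OF domain mesh that]] by (simp add: AE_restrict_space_iff)
  then have "AE x in lebesgue. \<forall>T\<in>\<T>. x \<in> T \<longrightarrow> P x"
    using mesh_finite[OF domain mesh] by (intro AE_finite_allI) auto
  then have "AE x in lebesgue. x \<in> \<Omega> \<longrightarrow> P x"
  proof eventually_elim
    case (elim x)
    show ?case
    proof
      assume "x \<in> \<Omega>"
      then have "x \<in> \<Union>\<T>" unfolding mesh_Union[OF domain mesh] using closure_subset by blast
      with elim show "P x" by blast
    qed
  qed
  then show ?thesis using domain_lebesgue[OF domain mesh] by (simp add: AE_restrict_space_iff)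
qed

lemma H1_element:
  assumes v: "v \<in> H1 \<Omega>" and T: "T \<in> \<T>"
  shows "v \<in> H1 (interior T)" "AE x in lebesgue_on T. weak_gradient (interior T) v x = weak_gradient \<Omega> v x"
proof -
  note body = mesh_body[OF domain mesh T]
  have g: "is_weak_gradient (interior T) v (weak_gradient \<Omega> v)"
    by (rule is_weak_gradient_restrict[OF H1_weak_gradient[OF v] domain_bounded_open[OF domain mesh]
          convex_bodyD(9)[OF body] mesh_interior_subset[OF domain mesh T]])
  have vL: "v \<in> L2 (lebesgue_on T)" by (rule L2_mesh_element[OF domain mesh H1_L2[OF v] T])
  show "v \<in> H1 (interior T)" by (rule H1I[OF _ g]) (simp add: interior_null_change[OF body] vL)
  show "AE x in lebesgue_on T. weak_gradient (interior T) v x = weak_gradient \<Omega> v x"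
    by (rule weak_gradient_eq[OF body g vL])
qed

lemma H1_element_vec:
  assumes v: "v \<in> componentwise (H1 \<Omega>)" and T: "T \<in> \<T>"
  shows "v \<in> componentwise (H1 (interior T))" "AE x in lebesgue_on T. grad (interior T) v x = grad \<Omega> v x"
proof -
  show "v \<in> componentwise (H1 (interior T))"
    using H1_element(1)[OF componentwiseD[OF v] T] by (simp add: componentwise_def)
  show "AE x in lebesgue_on T. grad (interior T) v x = grad \<Omega> v x"
    using H1_element(2)[OF componentwiseD[OF v] T, of 1] H1_element(2)[OF componentwiseD[OF v] T, of 2]
    by eventually_elim (simp add: vec_eq_iff[of "grad _ _ _"] forall_2 grad_nth)
qed

lemma H1_D_H1: "v \<in> componentwise (H1_D \<Omega> \<T> \<D>) \<Longrightarrow> v \<in> componentwise (H1 \<Omega>)"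
  by (simp add: componentwise_def H1_D_def)

lemma boundary_edgeD:
  assumes "E \<in> boundary_edges \<Omega> \<T>"
  shows "element_of \<T> E \<in> \<T>" "2 simplex (element_of \<T> E)" "E edge_of element_of \<T> E" "E \<subseteq> frontier \<Omega>"
  using boundary_edge_element[OF domain mesh assms] mesh_simplex[OF domain mesh] assms
  by (auto simp: boundary_edges_def)

lemma H1_diff_domain:
  assumes v: "v \<in> H1 \<Omega>" and w: "w \<in> H1 \<Omega>" shows "(\<lambda>x. v x - w x) \<in> H1 \<Omega>"
proof -
  have "is_weak_gradient \<Omega> (\<lambda>x. 1 * v x + (-1) * w x) (\<lambda>x. 1 *\<^sub>R weak_gradient \<Omega> v x + (-1) *\<^sub>R weak_gradient \<Omega> w x)"
    by (intro is_weak_gradient_linear H1_weak_gradient H1_L2 v w domain_bounded_open[OF domain mesh])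
  then have g: "is_weak_gradient \<Omega> (\<lambda>x. v x - w x) (\<lambda>x. weak_gradient \<Omega> v x - weak_gradient \<Omega> w x)" by simp
  show ?thesis by (rule H1I[OF L2_diff[OF H1_L2[OF v] H1_L2[OF w]] g])
qed

lemma H1_D_diff:
  assumes v: "v \<in> H1_D \<Omega> \<T> \<D>" and w: "w \<in> H1_D \<Omega> \<T> \<D>" shows "(\<lambda>x. v x - w x) \<in> H1_D \<Omega> \<T> \<D>"
proof -
  have H: "v \<in> H1 \<Omega>" "w \<in> H1 \<Omega>" using v w by (auto simp: H1_D_def)
  have "AE_edge E (\<lambda>x. boundary_trace \<T> E (\<lambda>x. v x - w x) x = 0)" if E: "E \<in> \<D>" for E
  proof -
    note b = boundary_edgeD[OF subsetD[OF \<D> E]]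
    from edge_trace_diff[OF b(2,3) H1_element(1)[OF H(1) b(1)] H1_element(1)[OF H(2) b(1)]]
    have "AE t in unit_measure. boundary_trace \<T> E (\<lambda>x. v x - w x) (edge_path E t)
        = boundary_trace \<T> E v (edge_path E t) - boundary_trace \<T> E w (edge_path E t)"
      by (simp add: AE_edge_def boundary_trace_def)
    moreover have "AE t in unit_measure. boundary_trace \<T> E v (edge_path E t) = 0"
      "AE t in unit_measure. boundary_trace \<T> E w (edge_path E t) = 0"
      using v w E by (auto simp: H1_D_def AE_edge_def)
    ultimately show ?thesis unfolding AE_edge_def by eventually_elim simp
  qed
  then show ?thesis using H1_diff_domain[OF H] by (simp add: H1_D_def)
qed

text \<open>A boundary edge lies in the frontier of the open set \<Omega>, where test functions
  vanish pointwise, and the trace of a smooth function is its restriction.\<close>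

lemma test_function_trace:
  assumes \<phi>: "\<phi> \<in> test_functions \<Omega>" and E: "E \<in> boundary_edges \<Omega> \<T>"
  shows "AE_edge E (\<lambda>x. boundary_trace \<T> E \<phi> x = 0)"
proof -
  note b = boundary_edgeD[OF E]
  have "AE_edge E (\<lambda>x. edge_trace (element_of \<T> E) E \<phi> x = \<phi> x)"
    by (rule edge_trace_smooth[OF b(2,3) test_functions_smooth[OF \<phi>]]) simp
  moreover have "\<phi> (edge_path E t) = 0" if "t \<in> {0..1}" for t
  proof -
    obtain p q r where "E = closed_segment p q" using triangle_edge[OF b(2,3)] by blast
    then have "edge_path E t \<in> frontier \<Omega>" using edge_path_in[OF that, of p q] b(4) by auto
    then show ?thesis
      using test_functions_eq_0[OF \<phi>] domain_open[OF domain mesh] by (auto simp: frontier_def interior_open)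
  qed
  moreover have "AE t in unit_measure. t \<in> {0..1}" by (rule AE_I2) (simp add: space_restrict_space)
  ultimately show ?thesis unfolding AE_edge_def boundary_trace_def
    by (auto elim!: eventually_elim2)
qed

lemma test_function_H1:
  assumes \<phi>: "\<phi> \<in> test_functions \<Omega>"
  shows "\<phi> \<in> H1 \<Omega>" "AE x in lebesgue_on \<Omega>. weak_gradient \<Omega> \<phi> x = gradient \<phi> x"
proof -
  note C1 = smooth_Ck[OF test_functions_smooth[OF \<phi>], of 1]
  note bo = domain_bounded_open[OF domain mesh]
  show H: "\<phi> \<in> H1 \<Omega>"
    by (rule H1I[OF L2_C1(1)[OF C1 bounded_openD(2)[OF bo] bounded_openD(3)[OF bo]] is_weak_gradient_C1[OF C1 bo]])
  show "AE x in lebesgue_on \<Omega>. weak_gradient \<Omega> \<phi> x = gradient \<phi> x"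
  proof (rule AE_mesh)
    fix T assume T: "T \<in> \<T>"
    show "AE x in lebesgue_on T. weak_gradient \<Omega> \<phi> x = gradient \<phi> x"
      using H1_element(2)[OF H T] weak_gradient_C1[OF mesh_body[OF domain mesh T] C1]
      by eventually_elim simp
  qed
qed

lemma test_function_H1_D: "\<phi> \<in> test_functions \<Omega> \<Longrightarrow> \<phi> \<in> H1_D \<Omega> \<T> \<D>"
  using test_function_H1(1) test_function_trace \<D> by (auto simp: H1_D_def)

section \<open>The exact stress\<close>

context
  fixes \<mu> :: real and lam :: ereal and f g u :: vector_field and p :: scalar_field
  assumes exact: "continuous_solution \<Omega> \<T> \<D> \<mu> lam f g u p" and f: "f \<in> L2 (lebesgue_on \<Omega>)"
begin

definition exact_stress :: tensor_field where
  "exact_stress x = (2 * \<mu>) *\<^sub>R sym_part (grad \<Omega> u x) + p x *\<^sub>R mat 1"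

lemma u_H1_D: "u \<in> componentwise (H1_D \<Omega> \<T> \<D>)" and p_L2: "p \<in> L2 (lebesgue_on \<Omega>)"
  using exact by (auto simp: continuous_solution_def)

lemma exact_stress_L2: "exact_stress \<in> L2 (lebesgue_on \<Omega>)"
proof -
  have "bounded_linear (\<lambda>s::real. s *\<^sub>R (mat 1 :: real^2^2))" by (rule bounded_linear_scaleR_left)
  then show ?thesis
    unfolding exact_stress_def[abs_def]
    by (intro L2_add L2_scaleR L2_bounded_linear[OF bounded_linear_matrix_maps(2)] grad_L2 H1_D_H1 u_H1_D
        L2_bounded_linear[OF _ p_L2])
qed

text \<open>The exact stress is symmetric and its multiple of the identity pairs to the divergence,
  so strain and divergence terms merge into one product with the full gradient. In this form it can
  be compared with a stress that is not symmetric.\<close>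

lemma exact_weak_form:
  assumes v: "v \<in> componentwise (H1_D \<Omega> \<T> \<D>)"
  shows "L2_inner (lebesgue_on \<Omega>) exact_stress (grad \<Omega> v)
    = L2_inner (lebesgue_on \<Omega>) f v + neumann_load \<T> (neumann_edges \<Omega> \<T> \<D>) g v"
proof -
  let ?M = "lebesgue_on \<Omega>"
  have uL: "grad \<Omega> u \<in> L2 ?M" and vL: "grad \<Omega> v \<in> L2 ?M"
    by (intro grad_L2 H1_D_H1 u_H1_D v)+
  note bl = L2_bounded_linear[OF bounded_linear_matrix_maps(2)]
  have L: "eps \<Omega> u \<in> L2 ?M" "eps \<Omega> v \<in> L2 ?M" "divergence \<Omega> v \<in> L2 ?M"
    using bl[OF uL] bl[OF vL] L2_bounded_linear[OF bounded_linear_matrix_maps(5) vL]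
    by (simp_all add: eps_sym_part[abs_def] divergence_def[abs_def])
  have "L2_inner ?M exact_stress (grad \<Omega> v)
      = (LINT x|?M. 2 * \<mu> * (eps \<Omega> u x \<bullet> eps \<Omega> v x) + p x \<bullet> divergence \<Omega> v x)"
    unfolding L2_inner_def
    by (intro Bochner_Integration.integral_cong refl)
      (simp add: exact_stress_def eps_sym_part divergence_def sym_part_def inner_matrix_2 trace_2, simp add: field_simps)
  also have "\<dots> = 2 * \<mu> * L2_inner ?M (eps \<Omega> u) (eps \<Omega> v) + L2_inner ?M p (divergence \<Omega> v)"
    using L2_inner_integrable[OF L(1,2)] L2_inner_integrable[OF p_L2 L(3)] by (simp add: L2_inner_def)
  finally show ?thesis using exact v by (simp add: continuous_solution_def)
qed

text \<open>The residual of the constraint is square integrable and hence admissible as q; tested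
  with itself it has norm zero.\<close>

lemma exact_divergence: "AE x in lebesgue_on \<Omega>. divergence \<Omega> u x = inv_lam lam * p x"
proof -
  let ?M = "lebesgue_on \<Omega>"
  have dL: "divergence \<Omega> u \<in> L2 ?M"
    using L2_bounded_linear[OF bounded_linear_matrix_maps(5) grad_L2[OF H1_D_H1[OF u_H1_D]]]
    by (simp add: divergence_def[abs_def])
  let ?q = "\<lambda>x. divergence \<Omega> u x - inv_lam lam *\<^sub>R p x"
  have qL: "?q \<in> L2 ?M" by (intro L2_diff dL L2_scaleR p_L2)
  have "L2_inner ?M ?q ?q = 0"
    using exact qL L2_inner_diff_left[OF dL L2_scaleR[OF p_L2] qL, of "inv_lam lam"]
      L2_inner_scaleR_left[of ?M "inv_lam lam" p ?q]
    by (simp add: continuous_solution_def)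
  then have "L2_norm ?M ?q = 0" by (simp add: L2_norm_def)
  then have "AE x in ?M. ?q x = 0" using L2_norm_zero_iff[OF qL] by simp
  then show ?thesis by eventually_elim simp
qed

section \<open>The equilibrated stress reconstruction\<close>

context
  fixes \<sigma> :: tensor_field
  assumes stress: "equilibrated_stress \<Omega> \<T> \<D> f g \<sigma>"
    and f_proj: "AE x in lebesgue_on \<Omega>. f x = proj \<Omega> \<T> f x"
    and g_proj: "\<forall>E \<in> neumann_edges \<Omega> \<T> \<D>.
        AE_edge E (\<lambda>x. g x = edge_proj (neumann_edges \<Omega> \<T> \<D>) g x)"
begin

lemma stress_rows: "(\<lambda>x. \<sigma> x $ i) \<in> RT1 \<Omega> \<T>"
  using stress by (simp add: equilibrated_stress_def)

lemma stress_L2: "\<sigma> \<in> L2 (lebesgue_on \<Omega>)"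
  by (rule L2_vec) (use stress_rows in \<open>simp add: RT1_def Hdiv_def\<close>)

lemma stress_row_div: "is_weak_div \<Omega> (\<lambda>x. \<sigma> x $ i) (weak_div \<Omega> (\<lambda>x. \<sigma> x $ i))"
  using stress_rows[of i] by (intro Hdiv_weak_div) (simp add: RT1_def)

lemma stress_div_eq: "AE x in lebesgue_on \<Omega>. weak_div \<Omega> (\<lambda>x. \<sigma> x $ i) x = - f x $ i"
proof -
  have "AE x in lebesgue_on \<Omega>. row_div \<Omega> \<sigma> x + proj \<Omega> \<T> f x = 0"
    using stress by (simp add: equilibrated_stress_def)
  with f_proj show ?thesis
  proof eventually_elim
    case (elim x)
    then have "(row_div \<Omega> \<sigma> x + f x) $ i = 0" by simp
    then show ?case by (simp add: row_div_def)
  qed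
qed

lemma stress_test:
  assumes \<phi>: "\<phi> \<in> test_functions \<Omega>"
  shows "(LINT x|lebesgue_on \<Omega>. \<sigma> x $ i \<bullet> gradient \<phi> x) = (LINT x|lebesgue_on \<Omega>. f x $ i * \<phi> x)"
proof -
  let ?M = "lebesgue_on \<Omega>" and ?d = "weak_div \<Omega> (\<lambda>x. \<sigma> x $ i)"
  have dL: "?d \<in> L2 ?M" using stress_row_div[of i] by (simp add: is_weak_div_def)
  have "(LINT x|?M. \<sigma> x $ i \<bullet> gradient \<phi> x) = - (LINT x|?M. ?d x * \<phi> x)"
    using stress_row_div[of i] \<phi> by (simp add: is_weak_div_def)
  also have "(LINT x|?M. ?d x * \<phi> x) = (LINT x|?M. - f x $ i * \<phi> x)"
  proof (rule integral_cong_AE)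
    note \<phi>L = L2_test_function(1)[OF domain_bounded[OF domain mesh] domain_lebesgue[OF domain mesh] \<phi>]
    show "(\<lambda>x. ?d x * \<phi> x) \<in> borel_measurable ?M" using dL \<phi>L by (auto dest!: L2_measurable)
    show "(\<lambda>x. - f x $ i * \<phi> x) \<in> borel_measurable ?M"
      using L2_measurable[OF L2_nth[OF f]] L2_measurable[OF \<phi>L] by measurable
    show "AE x in ?M. ?d x * \<phi> x = - f x $ i * \<phi> x" using stress_div_eq[of i] by eventually_elim simp
  qed
  finally show ?thesis by simp
qed

text \<open>Both stresses balance the same load f. It suffices to test with fields that have \<phi>
  as one component and 0 as the other; their traces vanish on the whole boundary, so that no Neumann
  load enters.\<close>

lemma stress_divergence_free:
  assumes T: "T \<in> \<T>" and \<phi>: "\<phi> \<in> test_functions (interior T)"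
  shows "(LINT x|lebesgue_on T. (exact_stress x - \<sigma> x) $ i \<bullet> gradient \<phi> x) = 0"
proof -
  let ?M = "lebesgue_on \<Omega>"
  note bo = domain_bounded[OF domain mesh] domain_lebesgue[OF domain mesh]
  have \<phi>\<Omega>: "\<phi> \<in> test_functions \<Omega>" using test_functions_mono[OF mesh_interior_subset[OF domain mesh T]] \<phi> by blast
  note \<phi>L = L2_test_function[OF bo \<phi>\<Omega>]
  let ?w = "\<lambda>x. (\<chi> j. if j = i then \<phi> x else 0) :: point"
  have wi: "(\<lambda>x. ?w x $ j) = (if j = i then \<phi> else (\<lambda>x. 0))" for j by auto
  have z: "(\<lambda>x. 0) \<in> test_functions \<Omega>"
    by (rule test_functionsI[of _ "{}"]) (auto simp: smooth_const)
  have "(\<lambda>x. ?w x $ j) \<in> H1_D \<Omega> \<T> \<D>" for j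
    unfolding wi using test_function_H1_D[OF \<phi>\<Omega>] test_function_H1_D[OF z] by simp
  then have w: "?w \<in> componentwise (H1_D \<Omega> \<T> \<D>)" unfolding componentwise_def by blast
  have "AE x in ?M. weak_gradient \<Omega> (\<lambda>x. ?w x $ j) x = (if j = i then gradient \<phi> x else 0)" for j
    using test_function_H1(2)[OF \<phi>\<Omega>] test_function_H1(2)[OF z] unfolding wi by simp
  from this[of 1] this[of 2]
  have gw: "AE x in ?M. grad \<Omega> ?w x = (\<chi> j. if j = i then gradient \<phi> x else 0)"
    by eventually_elim (simp add: vec_eq_iff[of "grad _ _ _"] forall_2 grad_nth del: vec_lambda_beta, simp)
  have eL: "(\<lambda>x. exact_stress x $ i) \<in> L2 ?M" by (rule L2_nth[OF exact_stress_L2])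
  have sL: "(\<lambda>x. \<sigma> x $ i) \<in> L2 ?M" by (rule L2_nth[OF stress_L2])
  have "L2_inner ?M exact_stress (grad \<Omega> ?w) = (LINT x|?M. exact_stress x $ i \<bullet> gradient \<phi> x)"
    unfolding L2_inner_def
  proof (rule integral_cong_AE)
    show "(\<lambda>x. exact_stress x \<bullet> grad \<Omega> ?w x) \<in> borel_measurable ?M"
      by (rule borel_measurable_integrable[OF L2_inner_integrable[OF exact_stress_L2 grad_L2[OF H1_D_H1[OF w]]]])
    show "(\<lambda>x. exact_stress x $ i \<bullet> gradient \<phi> x) \<in> borel_measurable ?M"
      by (rule borel_measurable_integrable[OF L2_inner_integrable[OF eL \<phi>L(3)]])
    show "AE x in ?M. exact_stress x \<bullet> grad \<Omega> ?w x = exact_stress x $ i \<bullet> gradient \<phi> x"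
      using gw
    proof eventually_elim
      case (elim x)
      show ?case unfolding elim using exhaust_2[of i] by (auto simp: inner_vec_def[where 'a="real^2"] sum_2)
    qed
  qed
  moreover have "L2_inner ?M f ?w = (LINT x|?M. f x $ i * \<phi> x)"
    unfolding L2_inner_def
    by (intro Bochner_Integration.integral_cong refl) (use exhaust_2[of i] in \<open>auto simp: inner_vec_def sum_2\<close>)
  moreover have "neumann_load \<T> (neumann_edges \<Omega> \<T> \<D>) g ?w = 0"
    unfolding neumann_load_def
  proof (intro sum.neutral ballI edge_integral_eq_0)
    fix E assume "E \<in> neumann_edges \<Omega> \<T> \<D>"
    then have E: "E \<in> boundary_edges \<Omega> \<T>" by (simp add: neumann_edges_def)
    have "AE_edge E (\<lambda>x. boundary_trace \<T> E (\<lambda>x. ?w x $ j) x = 0)" for j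
      unfolding wi using test_function_trace[OF \<phi>\<Omega> E] test_function_trace[OF z E] by simp
    from this[of 1] this[of 2]
    show "AE_edge E (\<lambda>x. g x \<bullet> boundary_trace_vec \<T> E ?w x = 0)"
      unfolding AE_edge_def boundary_trace_vec_def
      by eventually_elim (simp add: inner_vec_def sum_2)
  qed
  ultimately have "(LINT x|?M. exact_stress x $ i \<bullet> gradient \<phi> x) = (LINT x|?M. f x $ i * \<phi> x)"
    using exact_weak_form[OF w] by simp
  then have "(LINT x|?M. (exact_stress x - \<sigma> x) $ i \<bullet> gradient \<phi> x) = 0"
    using stress_test[OF \<phi>\<Omega>, of i] L2_inner_integrable[OF eL \<phi>L(3)] L2_inner_integrable[OF sL \<phi>L(3)]
    by (simp add: inner_diff_left)
  moreover have "(LINT x|lebesgue_on (interior T). (exact_stress x - \<sigma> x) $ i \<bullet> gradient \<phi> x)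
     = (LINT x|?M. (exact_stress x - \<sigma> x) $ i \<bullet> gradient \<phi> x)"
    by (rule integral_test_function_mono[OF convex_bodyD(7)[OF mesh_body[OF domain mesh T]] bo(2) mesh_interior_subset[OF domain mesh T]])
      (simp add: test_functions_gradient_eq_0[OF \<phi>])
  ultimately show ?thesis by (simp add: interior_null_change[OF mesh_body[OF domain mesh T]])
qed

text \<open>Green's formula is used row by row. On Dirichlet edges the trace of v vanishes; on
  Neumann edges the normal trace of \<sigma> is the projected load, which agrees with g by
  assumption.\<close>

lemma stress_green:
  assumes v: "v \<in> componentwise (H1_D \<Omega> \<T> \<D>)"
  shows "L2_inner (lebesgue_on \<Omega>) \<sigma> (grad \<Omega> v)
    = L2_inner (lebesgue_on \<Omega>) f v + neumann_load \<T> (neumann_edges \<Omega> \<T> \<D>) g v"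
proof -
  let ?M = "lebesgue_on \<Omega>" and ?N = "neumann_edges \<Omega> \<T> \<D>" and ?d = "\<lambda>i. weak_div \<Omega> (\<lambda>x. \<sigma> x $ i)"
  let ?n = "\<lambda>E. outward_normal (element_of \<T> E) E"
  \<comment> \<open>Polynomial representatives of the rows on each element; through them the traces
    of \<sigma> on edges become computable.\<close>
  define q where "q T i = (SOME q. q \<in> RT1_local \<and> (AE x in lebesgue_on T. \<sigma> x $ i = q x))" for T i
  have q: "q T i \<in> RT1_local" "AE x in lebesgue_on T. \<sigma> x $ i = q T i x" if "T \<in> \<T>" for T i
  proof -
    have "\<exists>q. q \<in> RT1_local \<and> (AE x in lebesgue_on T. \<sigma> x $ i = q x)"
      using stress_rows[of i] that unfolding RT1_def by blast
    from someI_ex[OF this] show "q T i \<in> RT1_local" "AE x in lebesgue_on T. \<sigma> x $ i = q T i x"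
      unfolding q_def by blast+
  qed
  have vH: "(\<lambda>x. v x $ i) \<in> H1 \<Omega>" for i by (rule componentwiseD[OF H1_D_H1[OF v]])
  have vL: "v \<in> L2 ?M" by (rule L2_vec) (rule H1_L2[OF vH])
  have sL: "(\<lambda>x. \<sigma> x $ i) \<in> L2 ?M" for i by (rule L2_nth[OF stress_L2])
  have dL: "?d i \<in> L2 ?M" for i using stress_row_div[of i] by (simp add: is_weak_div_def)
  let ?I = "\<lambda>i E. edge_integral E (\<lambda>x. (q (element_of \<T> E) i x \<bullet> ?n E) * boundary_trace \<T> E (\<lambda>x. v x $ i) x)"
  have row: "(LINT x|?M. \<sigma> x $ i \<bullet> grad \<Omega> v x $ i) - (LINT x|?M. f x $ i * v x $ i) = (\<Sum>E\<in>boundary_edges \<Omega> \<T>. ?I i E)" for i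
  proof -
    have "(LINT x|?M. \<sigma> x $ i \<bullet> weak_gradient \<Omega> (\<lambda>x. v x $ i) x + ?d i x * v x $ i) = (\<Sum>E\<in>boundary_edges \<Omega> \<T>. ?I i E)"
      by (rule green_domain[OF domain mesh sL stress_row_div vH]) (use q smooth_RT1_local in auto)
    moreover have "(LINT x|?M. ?d i x * v x $ i) = (LINT x|?M. - f x $ i * v x $ i)"
    proof (rule integral_cong_AE)
      show "(\<lambda>x. ?d i x * v x $ i) \<in> borel_measurable ?M"
        using L2_measurable[OF dL] L2_measurable[OF H1_L2[OF vH]] by measurable
      show "(\<lambda>x. - f x $ i * v x $ i) \<in> borel_measurable ?M"
        using L2_measurable[OF L2_nth[OF f]] L2_measurable[OF H1_L2[OF vH]] by measurable
      show "AE x in ?M. ?d i x * v x $ i = - f x $ i * v x $ i" using stress_div_eq[of i] by eventually_elim simp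
    qed
    ultimately show ?thesis
      using L2_inner_integrable[OF sL weak_gradient_L2[OF vH], of i i] L2_mult_integrable[OF dL H1_L2[OF vH], of i i]
      by (simp add: grad_nth)
  qed
  have "L2_inner ?M \<sigma> (grad \<Omega> v) = (LINT x|?M. \<sigma> x $ 1 \<bullet> grad \<Omega> v x $ 1) + (LINT x|?M. \<sigma> x $ 2 \<bullet> grad \<Omega> v x $ 2)"
    using L2_inner_integrable[OF sL weak_gradient_L2[OF vH], of 1 1] L2_inner_integrable[OF sL weak_gradient_L2[OF vH], of 2 2]
    by (simp add: L2_inner_def inner_vec_def[where 'a="real^2"] sum_2 grad_nth)
  moreover have "L2_inner ?M f v = (LINT x|?M. f x $ 1 * v x $ 1) + (LINT x|?M. f x $ 2 * v x $ 2)"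
    using L2_mult_integrable[OF L2_nth[OF f] L2_nth[OF vL], of 1 1] L2_mult_integrable[OF L2_nth[OF f] L2_nth[OF vL], of 2 2]
    by (simp add: L2_inner_def inner_vec_def sum_2)
  ultimately have "L2_inner ?M \<sigma> (grad \<Omega> v) - L2_inner ?M f v = (\<Sum>E\<in>boundary_edges \<Omega> \<T>. ?I 1 E + ?I 2 E)"
    using row[of 1] row[of 2] by (simp add: sum.distrib)
  also have "\<dots> = (\<Sum>E\<in>?N. ?I 1 E + ?I 2 E)"
  proof (rule sum.mono_neutral_right[OF finite_boundary_edges[OF domain mesh]])
    show "?N \<subseteq> boundary_edges \<Omega> \<T>" by (auto simp: neumann_edges_def)
    show "\<forall>E\<in>boundary_edges \<Omega> \<T> - ?N. ?I 1 E + ?I 2 E = 0"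
    proof
      fix E assume "E \<in> boundary_edges \<Omega> \<T> - ?N"
      then have E: "E \<in> \<D>" by (auto simp: neumann_edges_def)
      have "?I i E = 0" for i
      proof (rule edge_integral_eq_0)
        have "AE_edge E (\<lambda>x. boundary_trace \<T> E (\<lambda>x. v x $ i) x = 0)"
          using componentwiseD[OF v, of i] E by (simp add: H1_D_def)
        then show "AE_edge E (\<lambda>x. (q (element_of \<T> E) i x \<bullet> ?n E) * boundary_trace \<T> E (\<lambda>x. v x $ i) x = 0)"
          by (rule AE_edge_cong) simp
      qed
      then show "?I 1 E + ?I 2 E = 0" by simp
    qed
  qed
  also have "\<dots> = neumann_load \<T> ?N g v"
    unfolding neumann_load_def
  proof (rule sum.cong[OF refl])
    fix E assume EN: "E \<in> ?N"
    then have E: "E \<in> boundary_edges \<Omega> \<T>" by (simp add: neumann_edges_def)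
    let ?T = "element_of \<T> E"
    note b = boundary_edgeD[OF E]
    obtain a c r where ac: "E = closed_segment a c" using triangle_edge[OF b(2,3)] by blast
    have sm: "smooth (\<lambda>x. q ?T i x $ j)" for i j by (rule smooth_RT1_local[OF q(1)[OF b(1)]])
    have hc: "continuous_on UNIV (\<lambda>x. q ?T i x \<bullet> ?n E)" for i
      using continuous_on_vec_lambda[of UNIV "\<lambda>j x. q ?T i x $ j"] smooth_continuous[OF sm]
      by (intro continuous_intros) simp
    have hL: "(\<lambda>t. q ?T i (edge_path E t) \<bullet> ?n E) \<in> L2 unit_measure" for i
      using L2_edgeD[OF L2_edge_continuous[OF hc[of i], of a c]] ac by simp
    have tL: "(\<lambda>t. boundary_trace \<T> E (\<lambda>x. v x $ i) (edge_path E t)) \<in> L2 unit_measure" for i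
      unfolding boundary_trace_def by (rule L2_edgeD[OF edge_trace_L2[OF b(2,3) H1_element(1)[OF vH b(1)]]])
    note int = L2_mult_integrable[OF hL tL]
    have "?I 1 E + ?I 2 E = edge_integral E (\<lambda>x. (q ?T 1 x \<bullet> ?n E) * boundary_trace \<T> E (\<lambda>x. v x $ 1) x
        + (q ?T 2 x \<bullet> ?n E) * boundary_trace \<T> E (\<lambda>x. v x $ 2) x)"
      unfolding edge_integral_def using int[of 1 1] int[of 2 2] by (simp add: distrib_left)
    also have "\<dots> = edge_integral E (\<lambda>x. g x \<bullet> boundary_trace_vec \<T> E v x)"
    proof (rule edge_integral_cong_AE)
      show "(\<lambda>t. (q ?T 1 (edge_path E t) \<bullet> ?n E) * boundary_trace \<T> E (\<lambda>x. v x $ 1) (edge_path E t)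
        + (q ?T 2 (edge_path E t) \<bullet> ?n E) * boundary_trace \<T> E (\<lambda>x. v x $ 2) (edge_path E t)) \<in> borel_measurable unit_measure"
        by (rule borel_measurable_integrable[OF Bochner_Integration.integrable_add[OF int int]])
      have tr: "AE t in unit_measure. edge_trace ?T E (\<lambda>y. \<sigma> y $ i $ j) (edge_path E t) = q ?T i (edge_path E t) $ j" for i j
      proof -
        have "AE x in lebesgue_on ?T. \<sigma> x $ i $ j = q ?T i x $ j" using q(2)[OF b(1), of i] by eventually_elim simp
        from edge_trace_smooth[OF b(2,3) sm this] show ?thesis by (simp add: AE_edge_def)
      qed
      have nt: "AE t in unit_measure. normal_trace \<T> E \<sigma> (edge_path E t) = edge_proj ?N g (edge_path E t)"
        using stress EN by (simp add: equilibrated_stress_def AE_edge_def)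
      have gp: "AE t in unit_measure. g (edge_path E t) = edge_proj ?N g (edge_path E t)"
        using g_proj EN by (simp add: AE_edge_def)
      show "AE_edge E (\<lambda>x. (q ?T 1 x \<bullet> ?n E) * boundary_trace \<T> E (\<lambda>x. v x $ 1) x
        + (q ?T 2 x \<bullet> ?n E) * boundary_trace \<T> E (\<lambda>x. v x $ 2) x = g x \<bullet> boundary_trace_vec \<T> E v x)"
        unfolding AE_edge_def
        using nt gp tr[of 1 1] tr[of 1 2] tr[of 2 1] tr[of 2 2]
      proof eventually_elim
        case (elim t)
        have "g (edge_path E t) = normal_trace \<T> E \<sigma> (edge_path E t)" using elim(1,2) by simp
        also have "\<dots> = (\<chi> i. q ?T i (edge_path E t) \<bullet> ?n E)"
          using elim(3-6)
          by (simp add: vec_eq_iff forall_2 normal_trace_def boundary_trace_vec_def boundary_trace_def inner_vec_def sum_2)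
        finally show ?case by (simp add: inner_vec_def[of "\<chi> i. _ i"] inner_vec_def[of "g _"] sum_2 boundary_trace_vec_def)
      qed
    qed
    finally show "?I 1 E + ?I 2 E = edge_integral E (\<lambda>x. g x \<bullet> boundary_trace_vec \<T> E v x)" .
  qed
  finally show ?thesis by simp
qed

end
end
end

subsection \<open>The discrete solution\<close>

lemma Pk_1: "q \<in> Pk 1 \<longleftrightarrow> (\<exists>a b c. q = (\<lambda>x. a + b * x $ 1 + c * x $ 2))"
proof -
  have idx: "{(i, j). i + j \<le> 1} = {(0, 0), (1, 0), (0, 1 :: nat)}" for i j :: nat by auto
  have sum: "(\<Sum>(i, j) \<in> {(i, j). i + j \<le> 1}. d i j * (x $ 1) ^ i * (x $ 2) ^ j) = d 0 0 + d 1 0 * x $ 1 + d 0 1 * x $ 2"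
    for d :: "nat \<Rightarrow> nat \<Rightarrow> real" and x :: point
    unfolding idx by simp
  show ?thesis
  proof
    assume "\<exists>a b c. q = (\<lambda>x. a + b * x $ 1 + c * x $ 2)"
    then obtain a b c where q: "q = (\<lambda>x. a + b * x $ 1 + c * x $ 2)" by blast
    show "q \<in> Pk 1"
      unfolding Pk_def sum q
      by (intro CollectI exI[of _ "\<lambda>i j. if i = 1 then b else if j = 1 then c else a"]) simp
  qed (unfold Pk_def sum, blast)
qed

lemma Pk_1_linear:
  assumes "q \<in> Pk 1" "r \<in> Pk 1" shows "(\<lambda>x. s * q x + t * r x) \<in> Pk 1"
proof -
  obtain a b c a' b' c' where "q = (\<lambda>x. a + b * x $ 1 + c * x $ 2)" "r = (\<lambda>x. a' + b' * x $ 1 + c' * x $ 2)"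
    using assms unfolding Pk_1 by blast
  then have "(\<lambda>x. s * q x + t * r x) = (\<lambda>x. (s * a + t * a') + (s * b + t * b') * x $ 1 + (s * c + t * c') * x $ 2)"
    by (auto simp: algebra_simps)
  then show ?thesis unfolding Pk_1 by blast
qed

lemma gradient_Pk_2:
  assumes "q \<in> Pk 2" shows "(\<lambda>x. gradient q x $ i) \<in> Pk 1"
proof -
  have idx: "{(i, j). i + j \<le> 2} = {(0, 0), (1, 0), (0, 1), (2, 0), (1, 1), (0, 2 :: nat)}" for i j :: nat by auto
  obtain d where "q = (\<lambda>x. \<Sum>(i, j) \<in> {(i, j). i + j \<le> 2}. d i j * (x $ 1) ^ i * (x $ 2) ^ j)"
    using assms unfolding Pk_def by blast
  then have q: "q = (\<lambda>x. d 0 0 + d 1 0 * x $ 1 + d 0 1 * x $ 2 + d 2 0 * (x $ 1)^2 + d 1 1 * x $ 1 * x $ 2 + d 0 2 * (x $ 2)^2)"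
    unfolding idx by (simp add: add.assoc)
  have g: "gradient q x = vector [d 1 0 + 2 * d 2 0 * x $ 1 + d 1 1 * x $ 2, d 0 1 + d 1 1 * x $ 1 + 2 * d 0 2 * x $ 2]" for x
    unfolding q
    by (rule gradient_eqI, rule has_derivative_eq_rhs)
      (auto intro!: derivative_eq_intros has_derivative_vec_nth simp: inner_vec_def sum_2 algebra_simps)
  show ?thesis unfolding Pk_1 using exhaust_2[of i]
    by (elim disjE) (force simp: g)+
qed

lemma DG_smooth_AE:
  assumes "v \<in> DG k \<T>" "T \<in> \<T>"
  obtains q where "q \<in> Pk k" "AE x in lebesgue_on T. v x = q x"
  using assms by (auto simp: DG_def)

context
  fixes \<Omega> :: "point set" and \<T> \<D> :: "point set set"
  assumes domain: "polygonal_domain \<Omega>" and mesh: "triangulates \<T> \<Omega>"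
begin

lemma DG_L2_element: "v \<in> DG k \<T> \<Longrightarrow> T \<in> \<T> \<Longrightarrow> v \<in> L2 (lebesgue_on T)"
proof -
  assume v: "v \<in> DG k \<T>" and T: "T \<in> \<T>"
  note body = convex_bodyD[OF mesh_body[OF domain mesh T]]
  obtain q where q: "q \<in> Pk k" "AE x in lebesgue_on T. v x = q x" by (rule DG_smooth_AE[OF v T])
  have "AE x in lebesgue_on T. q x = v x" using q(2) by eventually_elim simp
  with L2_smooth[OF smooth_Pk[OF q(1)] body(4,6)] show ?thesis by (rule L2_lebesgue_on_cong_AE[OF body(6)])
qed

text \<open>Adding the pieces over the interiors avoids a choice on common edges.\<close>

lemma DG_glue:
  assumes P: "\<And>T. T \<in> \<T> \<Longrightarrow> P T \<in> Pk k"
  obtains q where "q \<in> DG k \<T>" "\<And>T. T \<in> \<T> \<Longrightarrow> AE x in lebesgue_on T. q x = P T x"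
proof
  define q where "q x = (\<Sum>T\<in>\<T>. if x \<in> interior T then P T x else 0)" for x
  show *: "AE x in lebesgue_on T. q x = P T x" if T: "T \<in> \<T>" for T
  proof -
    have "q x = P T x" if x: "x \<in> interior T" for x
    proof -
      have "x \<notin> interior T'" if "T' \<in> \<T> - {T}" for T'
        using mesh_interior_disjoint[OF domain mesh, of T' T] that T x interior_subset by blast
      then have "(\<Sum>T'\<in>\<T> - {T}. if x \<in> interior T' then P T' x else 0) = 0" by (intro sum.neutral) auto
      then show ?thesis unfolding q_def using sum.remove[OF mesh_finite[OF domain mesh] T, of "\<lambda>T. if x \<in> interior T then P T x else 0"] x
        by simp
    qed
    then have "AE x in lebesgue_on (interior T). q x = P T x"
      by (intro AE_I2) (simp add: space_restrict_space)
    then show ?thesis by (simp add: interior_null_change[OF mesh_body[OF domain mesh T]])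
  qed
  show "q \<in> DG k \<T>" unfolding DG_def using P * by blast
qed

text \<open>On an element the components are quadratic up to a null set, so weak derivatives are
  classical ones and the divergence is affine. That makes it comparable with the discrete
  pressure.\<close>

lemma V_h_element:
  assumes v: "v \<in> componentwise (V_h \<Omega> \<T> \<D>)" and T: "T \<in> \<T>"
  shows "v \<in> componentwise (H1 (interior T))" "\<exists>q\<in>Pk 1. AE x in lebesgue_on T. div_h v T x = q x"
proof -
  note body = mesh_body[OF domain mesh T]
  have DG: "(\<lambda>x. v x $ i) \<in> DG 2 \<T>" for i using componentwiseD[OF v, of i] by (simp add: V_h_def)
  have "\<exists>Q. \<forall>i. Q i \<in> Pk 2 \<and> (AE x in lebesgue_on T. v x $ i = Q i x)"
    by (rule choice) (use DG T in \<open>auto simp: DG_def\<close>)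
  then obtain Q where Q: "\<And>i. Q i \<in> Pk 2" "\<And>i. AE x in lebesgue_on T. v x $ i = Q i x" by blast
  note w = weak_gradient_smooth_AE[OF body smooth_Pk[OF Q(1)] Q(2)]
  show "v \<in> componentwise (H1 (interior T))" using w(1) by (simp add: componentwise_def)
  have pk: "(\<lambda>x. 1 * gradient (Q 1) x $ 1 + 1 * gradient (Q 2) x $ 2) \<in> Pk 1"
    by (rule Pk_1_linear[OF gradient_Pk_2[OF Q(1)] gradient_Pk_2[OF Q(1)]])
  have ae: "AE x in lebesgue_on T. div_h v T x = 1 * gradient (Q 1) x $ 1 + 1 * gradient (Q 2) x $ 2"
    using w(2)[of 1] w(2)[of 2] by eventually_elim (simp add: div_h_def divergence_def trace_2 grad_nth)
  show "\<exists>q\<in>Pk 1. AE x in lebesgue_on T. div_h v T x = q x" by (rule bexI, rule ae, rule pk)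
qed

text \<open>Since \<open>div_h u\<^sub>h\<close> is itself a piecewise linear function, the discrete constraint holds pointwise.\<close>

lemma discrete_divergence:
  assumes discrete: "discrete_solution \<Omega> \<T> \<D> \<mu> lam f g u\<^sub>h p\<^sub>h" and T: "T \<in> \<T>"
  shows "AE x in lebesgue_on T. div_h u\<^sub>h T x = inv_lam lam * p\<^sub>h x"
proof -
  let ?k = "inv_lam lam"
  have uh: "u\<^sub>h \<in> componentwise (V_h \<Omega> \<T> \<D>)" and ph: "p\<^sub>h \<in> DG 1 \<T>"
    and eq: "\<And>q. q \<in> DG 1 \<T> \<Longrightarrow> inner_h \<T> (div_h u\<^sub>h) (\<lambda>T. q) - ?k * L2_inner (lebesgue_on \<Omega>) p\<^sub>h q = 0"
    using discrete by (auto simp: discrete_solution_def)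
  have "\<exists>P\<in>Pk 1. AE x in lebesgue_on T. div_h u\<^sub>h T x - ?k * p\<^sub>h x = P x" if T: "T \<in> \<T>" for T
  proof -
    obtain q where q: "q \<in> Pk 1" "AE x in lebesgue_on T. div_h u\<^sub>h T x = q x" using V_h_element(2)[OF uh T] by blast
    obtain r where r: "r \<in> Pk 1" "AE x in lebesgue_on T. p\<^sub>h x = r x" by (rule DG_smooth_AE[OF ph T])
    have ae: "AE x in lebesgue_on T. div_h u\<^sub>h T x - ?k * p\<^sub>h x = 1 * q x + (- ?k) * r x"
      using q(2) r(2) by eventually_elim simp
    show ?thesis by (rule bexI, rule ae, rule Pk_1_linear[OF q(1) r(1)])
  qed
  then have "\<forall>T\<in>\<T>. \<exists>P. P \<in> Pk 1 \<and> (AE x in lebesgue_on T. div_h u\<^sub>h T x - ?k * p\<^sub>h x = P x)" by blast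
  from bchoice[OF this]
  obtain P where P: "\<And>T. T \<in> \<T> \<Longrightarrow> P T \<in> Pk 1"
    "\<And>T. T \<in> \<T> \<Longrightarrow> AE x in lebesgue_on T. div_h u\<^sub>h T x - ?k * p\<^sub>h x = P T x"
    by blast
  \<comment> \<open>The elementwise residuals are glued into one admissible test function. Tested
    with itself, the residual gives a vanishing sum of squares, hence zero on each element.\<close>
  obtain q where q: "q \<in> DG 1 \<T>" "\<And>T. T \<in> \<T> \<Longrightarrow> AE x in lebesgue_on T. q x = P T x"
    by (rule DG_glue[OF P(1)]) (assumption, rule that)
  have L2: "div_h u\<^sub>h T \<in> L2 (lebesgue_on T)" "p\<^sub>h \<in> L2 (lebesgue_on T)" "q \<in> L2 (lebesgue_on T)" "P T \<in> L2 (lebesgue_on T)"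
    if T: "T \<in> \<T>" for T
  proof -
    note body = mesh_body[OF domain mesh T]
    have "grad (interior T) u\<^sub>h \<in> L2 (lebesgue_on T)"
      using grad_L2[OF V_h_element(1)[OF uh T]] by (simp add: interior_null_change[OF body])
    from L2_bounded_linear[OF bounded_linear_matrix_maps(5) this] show "div_h u\<^sub>h T \<in> L2 (lebesgue_on T)"
      by (simp add: div_h_def divergence_def[abs_def])
    show "p\<^sub>h \<in> L2 (lebesgue_on T)" "q \<in> L2 (lebesgue_on T)" by (rule DG_L2_element[OF _ T], fact)+
    show "P T \<in> L2 (lebesgue_on T)" by (rule L2_smooth[OF smooth_Pk[OF P(1)[OF T]] convex_bodyD(4,6)[OF body]])
  qed
  have "(\<Sum>T\<in>\<T>. (L2_norm (lebesgue_on T) (P T))\<^sup>2)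
    = (\<Sum>T\<in>\<T>. L2_inner (lebesgue_on T) (div_h u\<^sub>h T) q - ?k * L2_inner (lebesgue_on T) p\<^sub>h q)"
  proof (rule sum.cong[OF refl])
    fix T assume T: "T \<in> \<T>"
    let ?M = "lebesgue_on T"
    have d: "(\<lambda>x. div_h u\<^sub>h T x - ?k *\<^sub>R p\<^sub>h x) \<in> L2 ?M" by (rule L2_diff[OF L2(1)[OF T] L2_scaleR[OF L2(2)[OF T]]])
    have ae: "AE x in ?M. P T x = div_h u\<^sub>h T x - ?k *\<^sub>R p\<^sub>h x" "AE x in ?M. P T x = q x"
      using P(2)[OF T] q(2)[OF T] by (eventually_elim, simp)+
    have "(L2_norm ?M (P T))\<^sup>2 = L2_inner ?M (\<lambda>x. div_h u\<^sub>h T x - ?k *\<^sub>R p\<^sub>h x) q"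
      unfolding L2_norm_square
      by (rule L2_inner_cong_AE[OF L2_measurable[OF L2(4)[OF T]] L2_measurable[OF d] L2_measurable[OF L2(4)[OF T]] L2_measurable[OF L2(3)[OF T]] ae])
    then show "(L2_norm ?M (P T))\<^sup>2 = L2_inner ?M (div_h u\<^sub>h T) q - ?k * L2_inner ?M p\<^sub>h q"
      using L2_inner_diff_left[OF L2(1)[OF T] L2_scaleR[OF L2(2)[OF T]] L2(3)[OF T]]
      by (simp del: real_scaleR_def)
  qed
  also have "\<dots> = inner_h \<T> (div_h u\<^sub>h) (\<lambda>T. q) - ?k * L2_inner (lebesgue_on \<Omega>) p\<^sub>h q"
    using L2_inner_mesh[OF domain mesh L2_mesh[OF domain mesh L2(2)] L2_mesh[OF domain mesh L2(3)]]
    by (simp add: inner_h_def sum_subtractf sum_distrib_left)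
  also have "\<dots> = 0" by (rule eq[OF q(1)])
  finally have "(L2_norm (lebesgue_on T) (P T))\<^sup>2 = 0"
    using sum_nonneg_eq_0_iff[OF mesh_finite[OF domain mesh], of "\<lambda>T. (L2_norm (lebesgue_on T) (P T))\<^sup>2"] T by simp
  then have "AE x in lebesgue_on T. P T x = 0" using L2_norm_zero_iff[OF L2(4)[OF T]] by simp
  then show ?thesis using P(2)[OF T] by eventually_elim simp
qed

end

subsection \<open>The error in the energy norm\<close>

text \<open>The first identity says that \<open>lam_ratio\<close> times the trace of 2\<mu> X + q I
  returns q whenever X has trace q/\<lambda>. Written with the reciprocal of \<lambda>, all three
  statements include the incompressible limit.\<close>

lemma lame_coefficients:
  assumes "0 < \<mu>" "0 < lam"
  shows "lam_ratio \<mu> lam * (2 * \<mu> * inv_lam lam + 2) = 1" "0 \<le> inv_lam lam" "lam_ratio \<mu> lam \<le> 1/2"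
proof -
  have "lam_ratio \<mu> lam * (2 * \<mu> * inv_lam lam + 2) = 1 \<and> 0 \<le> inv_lam lam \<and> lam_ratio \<mu> lam \<le> 1/2"
  proof (cases "lam = \<infinity>")
    case False
    with assms obtain l where l: "lam = ereal l" "0 < l" by (cases lam) auto
    have m: "0 < 2 * (\<mu> + l)" using l assms by simp
    have "l * (2 * \<mu> * (1 / l) + 2) = 2 * (\<mu> + l)" using l by (simp add: field_simps)
    with m have a: "l / (2 * (\<mu> + l)) * (2 * \<mu> * (1 / l) + 2) = 1" by (metis div_self less_irrefl times_divide_eq_left)
    have b: "l / (2 * (\<mu> + l)) \<le> 1/2" using m assms by (simp add: divide_le_eq)
    have "lam_ratio \<mu> lam = l / (2 * (\<mu> + l))" "inv_lam lam = 1 / l"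
      using l by (simp_all add: lam_ratio_def inv_lam_def)
    then show ?thesis by (intro conjI) (use a b l in \<open>simp_all only: zero_le_divide_1_iff less_imp_le\<close>)
  qed (simp add: lam_ratio_def inv_lam_def)
  then show "lam_ratio \<mu> lam * (2 * \<mu> * inv_lam lam + 2) = 1" "0 \<le> inv_lam lam" "lam_ratio \<mu> lam \<le> 1/2"
    by auto
qed

lemma bounded_linear_A_map: "bounded_linear (A_map \<mu> lam)"
proof -
  have "bounded_linear (\<lambda>A :: real^2^2. (lam_ratio \<mu> lam * trace A) *\<^sub>R (mat 1 :: real^2^2))"
    using bounded_linear_compose[OF bounded_linear_scaleR_left[of "mat 1 :: real^2^2"]
      bounded_linear_compose[OF bounded_linear_mult_right[of "lam_ratio \<mu> lam"] bounded_linear_matrix_maps(5)]] .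
  then show ?thesis
    unfolding A_map_def
    by (rule bounded_linear_compose[OF bounded_linear_scaleR_right bounded_linear_sub[OF bounded_linear_ident]])
qed

lemma inner_mat_1: "A \<bullet> mat 1 = trace A" for A :: "real^2^2"
  by (simp add: inner_matrix_2 trace_2)

lemma A_map_commute: "A_map \<mu> lam A \<bullet> B = A \<bullet> A_map \<mu> lam B"
  by (simp add: A_map_def inner_matrix_2 trace_2 algebra_simps)

text \<open>The energy density is (|A|^2 - c (trace A)^2) / (2\<mu>) with c =
  \<open>lam_ratio \<mu> lam\<close>, and the left side is the same expression with c = 1/2. As c is
  at most 1/2 for every \<open>lam\<close>, nothing degenerates in the incompressible limit.\<close>

lemma deviator_le_A_map:
  assumes "0 < \<mu>" "0 < lam"
  shows "(norm (deviator A))\<^sup>2 / (2 * \<mu>) \<le> A_map \<mu> lam A \<bullet> A"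
proof -
  have "0 \<le> (1/2 - lam_ratio \<mu> lam) * (trace A)\<^sup>2"
    using lame_coefficients(3)[OF assms] by (intro mult_nonneg_nonneg) auto
  also have "\<dots> = A \<bullet> A - lam_ratio \<mu> lam * (trace A)\<^sup>2 - (norm (deviator A))\<^sup>2"
    unfolding power2_norm_eq_inner
    by (simp add: deviator_def inner_matrix_2 trace_2 power2_eq_square field_simps)
  finally have "(norm (deviator A))\<^sup>2 \<le> A \<bullet> A - lam_ratio \<mu> lam * (trace A)\<^sup>2" by simp
  moreover have "A_map \<mu> lam A \<bullet> A = (A \<bullet> A - lam_ratio \<mu> lam * (trace A)\<^sup>2) / (2 * \<mu>)"
    by (simp add: A_map_def inner_diff_left inner_commute[of "mat 1"] inner_mat_1 power2_eq_square)
  ultimately show ?thesis using assms by (simp add: divide_right_mono)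
qed

text \<open>The hypotheses say that X is the image of \<tau> + r under \<open>A_map\<close>.
  Expanding the product of X with \<tau> + r and using the symmetry of \<open>A_map\<close> gives
  the energy of r, minus that of \<tau>, plus twice the product of X and \<tau>; the energy of
  \<tau> is then bounded below by its deviator.\<close>

lemma energy_splitting_pointwise:
  fixes X \<tau> r :: "real^2^2"
  assumes lame: "0 < \<mu>" "0 < lam" and tr: "trace X = inv_lam lam * q"
    and \<delta>: "(2 * \<mu>) *\<^sub>R X + q *\<^sub>R mat 1 = \<tau> + r"
  shows "2 * \<mu> * (norm X)\<^sup>2 + inv_lam lam * q\<^sup>2 + (norm (deviator \<tau>))\<^sup>2 / (2 * \<mu>)
    \<le> A_map \<mu> lam r \<bullet> r + 2 * (X \<bullet> \<tau>)"
proof -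
  let ?A = "A_map \<mu> lam" and ?\<delta> = "\<tau> + r"
  have X: "?A ?\<delta> = X"
  proof -
    have tr\<delta>: "trace ?\<delta> = (2 * \<mu> * inv_lam lam + 2) * q"
    proof -
      have "trace ?\<delta> = 2 * \<mu> * trace X + 2 * q" unfolding \<delta>[symmetric] by (simp add: trace_2 algebra_simps)
      then show ?thesis by (simp add: tr algebra_simps)
    qed
    have "lam_ratio \<mu> lam * trace ?\<delta> = q"
      unfolding tr\<delta> using lame_coefficients(1)[OF lame] by (simp add: mult.assoc[symmetric])
    then have "?A ?\<delta> = (1 / (2 * \<mu>)) *\<^sub>R ((2 * \<mu>) *\<^sub>R X + q *\<^sub>R mat 1 - q *\<^sub>R mat 1)"
      unfolding A_map_def \<delta> by simp
    then show ?thesis using lame by simp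
  qed
  have add: "?A ?\<delta> = ?A \<tau> + ?A r"
    using bounded_linear.linear[OF bounded_linear_A_map] by (rule linear_add)
  have "2 * \<mu> * (norm X)\<^sup>2 + inv_lam lam * q\<^sup>2 = X \<bullet> ((2 * \<mu>) *\<^sub>R X + q *\<^sub>R mat 1)"
    unfolding power2_norm_eq_inner by (simp add: inner_add_right inner_mat_1 tr power2_eq_square)
  also have "\<dots> = X \<bullet> \<tau> + ?A ?\<delta> \<bullet> r"
    unfolding \<delta> by (simp add: X inner_add_right)
  also have "?A ?\<delta> \<bullet> r = \<tau> \<bullet> ?A r + ?A r \<bullet> r"
    unfolding add by (simp add: inner_add_left A_map_commute)
  also have "\<tau> \<bullet> ?A r = X \<bullet> \<tau> - ?A \<tau> \<bullet> \<tau>"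
    using X add by (simp add: inner_commute[of X] inner_commute[of "?A \<tau>"] inner_add_right[symmetric] algebra_simps)
  finally show ?thesis using deviator_le_A_map[OF lame, of \<tau>] by simp
qed

lemma sym_part_diff: "sym_part (A - B) = sym_part A - sym_part B"
  by (simp add: sym_part_def vec_eq_iff forall_2 algebra_simps add_divide_distrib diff_divide_distrib)

text \<open>A, B and D stand for the gradients of the exact, the discrete and the conforming
  displacement. D is inserted so that A - D is the gradient of a conforming field, for which Green's
  formula is available.\<close>

lemma energy_splitting:
  fixes A B D \<sigma> \<tau> r :: "'a \<Rightarrow> real^2^2" and p q :: "'a \<Rightarrow> real"
  assumes lame: "0 < \<mu>" "0 < lam"
    and L2: "A \<in> L2 M" "B \<in> L2 M" "D \<in> L2 M" "\<sigma> \<in> L2 M" "p \<in> L2 M" "q \<in> L2 M"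
    and tr: "AE x in M. trace (A x) = inv_lam lam * p x" "AE x in M. trace (B x) = inv_lam lam * q x"
  defines "\<tau> \<equiv> \<lambda>x. (2 * \<mu>) *\<^sub>R sym_part (A x) + p x *\<^sub>R mat 1 - \<sigma> x"
    and "r \<equiv> \<lambda>x. \<sigma> x - (2 * \<mu>) *\<^sub>R sym_part (B x) - q x *\<^sub>R mat 1"
  shows "2 * \<mu> * (L2_norm M (\<lambda>x. sym_part (A x - B x)))\<^sup>2 + inv_lam lam * (L2_norm M (\<lambda>x. p x - q x))\<^sup>2
      + (L2_norm M (\<lambda>x. deviator (\<tau> x)))\<^sup>2 / (2 * \<mu>)
    \<le> L2_inner M (\<lambda>x. A_map \<mu> lam (r x)) r + 2 * L2_inner M (\<lambda>x. A x - D x) \<tau>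
      + 2 * L2_inner M (\<lambda>x. A x - D x) (\<lambda>x. skew_part (\<sigma> x)) + 2 * L2_inner M (\<lambda>x. sym_part (D x - B x)) \<tau>"
proof -
  note bl = L2_bounded_linear[OF bounded_linear_matrix_maps(1)] L2_bounded_linear[OF bounded_linear_matrix_maps(2)]
    L2_bounded_linear[OF bounded_linear_matrix_maps(4)] L2_bounded_linear[OF bounded_linear_A_map]
  have \<tau>: "\<tau> \<in> L2 M"
    unfolding \<tau>_def by (rule L2_diff[OF L2_add[OF L2_scaleR[OF bl(2)[OF L2(1)]]] L2(4)])
      (rule L2_bounded_linear[OF bounded_linear_scaleR_left L2(5)])
  have r: "r \<in> L2 M"
    unfolding r_def by (rule L2_diff[OF L2_diff[OF L2(4) L2_scaleR[OF bl(2)[OF L2(2)]]]])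
      (rule L2_bounded_linear[OF bounded_linear_scaleR_left L2(6)])
  have X: "(\<lambda>x. sym_part (A x - B x)) \<in> L2 M" and AD: "(\<lambda>x. A x - D x) \<in> L2 M"
    and DB: "(\<lambda>x. sym_part (D x - B x)) \<in> L2 M" and pq: "(\<lambda>x. p x - q x) \<in> L2 M"
    by (rule bl(2)[OF L2_diff[OF L2(1,2)]] L2_diff[OF L2(1,3)] bl(2)[OF L2_diff[OF L2(3,2)]] L2_diff[OF L2(5,6)])+
  note sk = bl(3)[OF L2(4)] and dv = bl(1)[OF \<tau>]
  note int = L2_inner_integrable[OF bl(4)[OF r] r] L2_inner_integrable[OF AD \<tau>]
    L2_inner_integrable[OF AD sk] L2_inner_integrable[OF DB \<tau>]
  note int' = L2_integrable_square[OF X] L2_integrable_square[OF pq] L2_integrable_square[OF dv]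
  have "(LINT x|M. 2 * \<mu> * (norm (sym_part (A x - B x)))\<^sup>2 + inv_lam lam * (norm (p x - q x))\<^sup>2
      + (norm (deviator (\<tau> x)))\<^sup>2 / (2 * \<mu>))
    \<le> (LINT x|M. A_map \<mu> lam (r x) \<bullet> r x + 2 * ((A x - D x) \<bullet> \<tau> x) + 2 * ((A x - D x) \<bullet> skew_part (\<sigma> x))
      + 2 * (sym_part (D x - B x) \<bullet> \<tau> x))"
  proof (rule integral_mono_AE)
    show "AE x in M. 2 * \<mu> * (norm (sym_part (A x - B x)))\<^sup>2 + inv_lam lam * (norm (p x - q x))\<^sup>2
        + (norm (deviator (\<tau> x)))\<^sup>2 / (2 * \<mu>)
      \<le> A_map \<mu> lam (r x) \<bullet> r x + 2 * ((A x - D x) \<bullet> \<tau> x) + 2 * ((A x - D x) \<bullet> skew_part (\<sigma> x))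
        + 2 * (sym_part (D x - B x) \<bullet> \<tau> x)"
      using tr
    proof eventually_elim
      case (elim x)
      let ?X = "sym_part (A x - B x)"
      have "trace ?X = inv_lam lam * (p x - q x)"
        using elim by (simp add: sym_part_def trace_2 algebra_simps)
      moreover have "(2 * \<mu>) *\<^sub>R ?X + (p x - q x) *\<^sub>R mat 1 = \<tau> x + r x"
        by (simp add: \<tau>_def r_def sym_part_diff algebra_simps)
      ultimately have "2 * \<mu> * (norm ?X)\<^sup>2 + inv_lam lam * (p x - q x)\<^sup>2 + (norm (deviator (\<tau> x)))\<^sup>2 / (2 * \<mu>)
        \<le> A_map \<mu> lam (r x) \<bullet> r x + 2 * (?X \<bullet> \<tau> x)"
        by (rule energy_splitting_pointwise[OF lame])
      \<comment> \<open>The symmetric part of A - D sees only the symmetric part of \<tau>.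
        Replacing it by A - D itself brings in the skew part of \<tau>, which is minus that of
        \<sigma> because the rest of \<tau> is symmetric.\<close>
      moreover have "?X \<bullet> \<tau> x = (A x - D x) \<bullet> \<tau> x + (A x - D x) \<bullet> skew_part (\<sigma> x) + sym_part (D x - B x) \<bullet> \<tau> x"
        by (simp add: \<tau>_def sym_part_def skew_part_def inner_matrix_2 field_simps)
      ultimately show ?case by simp
    qed
  qed (use int int' in auto)
  then show ?thesis
    using int int' by (simp add: L2_inner_def L2_norm_square_integral[symmetric] del: real_norm_def)
qed

text \<open>The term with d is absorbed by d^2 / (2\<mu>) at the cost of 2\<mu> (C e)^2. The bound
  on Y splits the skew term in two: each part costs C^2 s^2 / \<mu>, one takes half of 2\<mu> X^2
  and the other adds \<mu> e^2. Doubling restores 2\<mu> X^2 and yields the factors 2, 2 C^2 + 1 and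
  8 C^2, the last two relative to 2\<mu> e^2 and s^2 / (2\<mu>).\<close>

lemma error_splitting_young:
  fixes \<mu> :: real
  assumes \<mu>: "0 < \<mu>" and nonneg: "0 \<le> C" "0 \<le> s" "0 \<le> Q"
    and split: "2 * \<mu> * X\<^sup>2 + Q + d\<^sup>2 / (2 * \<mu>) \<le> R + 2 * G + 2 * (C * Y * s) + 2 * (C * e * d)"
    and Y: "Y \<le> X + e"
  shows "2 * \<mu> * X\<^sup>2 + Q \<le> 2 * R + (2 * C\<^sup>2 + 1) * (2 * \<mu> * e\<^sup>2) + 8 * C\<^sup>2 * (s\<^sup>2 / (2 * \<mu>)) + 4 * G"
proof -
  define c where "c = C * s"
  have "C * Y * s \<le> c * X + c * e"
    unfolding c_def using mult_left_mono[OF Y, of "C * s"] nonneg by (simp add: algebra_simps)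
  moreover have "2 * (C * e * d) \<le> d\<^sup>2 / (2 * \<mu>) + 2 * \<mu> * (C * e)\<^sup>2"
    "2 * (c * X) \<le> c\<^sup>2 / \<mu> + \<mu> * X\<^sup>2" "2 * (c * e) \<le> c\<^sup>2 / \<mu> + \<mu> * e\<^sup>2"
  proof -
    have young: "2 * (a * b) \<le> a\<^sup>2 / m + m * b\<^sup>2" if "0 < m" for a b m :: real
    proof -
      have "0 \<le> (a - m * b)\<^sup>2 / m" using that by simp
      also have "\<dots> = a\<^sup>2 / m + m * b\<^sup>2 - 2 * (a * b)"
        using that by (simp add: power2_eq_square field_simps)
      finally show ?thesis by simp
    qed
    show "2 * (c * X) \<le> c\<^sup>2 / \<mu> + \<mu> * X\<^sup>2" "2 * (c * e) \<le> c\<^sup>2 / \<mu> + \<mu> * e\<^sup>2"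
      by (rule young[OF \<mu>])+
    show "2 * (C * e * d) \<le> d\<^sup>2 / (2 * \<mu>) + 2 * \<mu> * (C * e)\<^sup>2"
      using young[of "2 * \<mu>" d "C * e"] \<mu> by (simp add: mult.commute)
  qed
  moreover have "C\<^sup>2 * (s\<^sup>2 / (2 * \<mu>)) = c\<^sup>2 / \<mu> / 2" "(2 * C\<^sup>2 + 1) * (2 * \<mu> * e\<^sup>2) = 4 * (\<mu> * (C * e)\<^sup>2) + 2 * (\<mu> * e\<^sup>2)"
    by (simp_all add: c_def power_mult_distrib algebra_simps)
  ultimately show ?thesis using split nonneg(3) by linarith
qed

text \<open>Here u, v and w are the exact, the conforming and the discrete displacement. Korn's
  inequality enters twice, for the skew part of \<sigma> against the gradient of u - v and for
  \<tau> against the strain of v - w, both times on S itself.\<close>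

lemma element_estimate:
  fixes u w v :: vector_field and p q :: scalar_field and \<sigma> \<tau> r :: tensor_field
  assumes lame: "0 < \<mu>" "0 < lam" and S: "convex_body S" and K: "korn_constant S C"
    and H1: "u \<in> componentwise (H1 (interior S))" "w \<in> componentwise (H1 (interior S))" "v \<in> componentwise (H1 (interior S))"
    and L2: "\<sigma> \<in> L2 (lebesgue_on S)" "p \<in> L2 (lebesgue_on S)" "q \<in> L2 (lebesgue_on S)"
    and div: "AE x in lebesgue_on S. divergence (interior S) u x = inv_lam lam * p x"
      "AE x in lebesgue_on S. divergence (interior S) w x = inv_lam lam * q x"
    and mean: "(LINT x|lebesgue_on S. divergence (interior S) v x) = (LINT x|lebesgue_on S. divergence (interior S) w x)"
    and J: "L2_inner (lebesgue_on S) (\<lambda>x. skew_part (\<sigma> x)) (\<lambda>x. J_mat) = 0"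
  defines "\<tau> \<equiv> \<lambda>x. (2 * \<mu>) *\<^sub>R sym_part (grad (interior S) u x) + p x *\<^sub>R mat 1 - \<sigma> x"
    and "r \<equiv> \<lambda>x. \<sigma> x - (2 * \<mu>) *\<^sub>R eps (interior S) w x - q x *\<^sub>R mat 1"
  assumes div0: "\<And>i \<phi>. \<phi> \<in> test_functions (interior S) \<Longrightarrow> (LINT x|lebesgue_on S. \<tau> x $ i \<bullet> gradient \<phi> x) = 0"
  shows "2 * \<mu> * (L2_norm (lebesgue_on S) (eps (interior S) (\<lambda>x. u x - w x)))\<^sup>2
      + inv_lam lam * (L2_norm (lebesgue_on S) (\<lambda>x. p x - q x))\<^sup>2
    \<le> 2 * L2_inner (lebesgue_on S) (\<lambda>x. A_map \<mu> lam (r x)) r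
      + (2 * C\<^sup>2 + 1) * (2 * \<mu> * (L2_norm (lebesgue_on S) (eps (interior S) (\<lambda>x. v x - w x)))\<^sup>2)
      + 8 * C\<^sup>2 * ((L2_norm (lebesgue_on S) (\<lambda>x. skew_part (\<sigma> x)))\<^sup>2 / (2 * \<mu>))
      + 4 * L2_inner (lebesgue_on S) (grad (interior S) (\<lambda>x. u x - v x)) \<tau>"
proof -
  note S' = convex_bodyD[OF S]
  let ?M = "lebesgue_on S" and ?g = "grad (interior S)" and ?e = "eps (interior S)"
  note bl = L2_bounded_linear[OF bounded_linear_matrix_maps(2)] L2_bounded_linear[OF bounded_linear_matrix_maps(4)]
  have gL: "?g z \<in> L2 ?M" if "z \<in> componentwise (H1 (interior S))" for z
    using grad_L2[OF that] by (simp add: interior_null_change[OF S])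
  have eL: "?e z \<in> L2 ?M" if "z \<in> componentwise (H1 (interior S))" for z
    using bl(1)[OF gL[OF that]] by (simp add: eps_sym_part[abs_def])
  have uv: "(\<lambda>x. u x - v x) \<in> componentwise (H1 (interior S))" "AE x in ?M. ?g (\<lambda>x. u x - v x) x = ?g u x - ?g v x"
    by (rule grad_diff_AE[OF S H1(1,3)])+
  have uw: "(\<lambda>x. u x - w x) \<in> componentwise (H1 (interior S))" "AE x in ?M. ?g (\<lambda>x. u x - w x) x = ?g u x - ?g w x"
    by (rule grad_diff_AE[OF S H1(1,2)])+
  have vw: "(\<lambda>x. v x - w x) \<in> componentwise (H1 (interior S))" "AE x in ?M. ?g (\<lambda>x. v x - w x) x = ?g v x - ?g w x"
    by (rule grad_diff_AE[OF S H1(3,2)])+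
  have \<tau>: "\<tau> \<in> L2 ?M"
    unfolding \<tau>_def by (rule L2_diff[OF L2_add[OF L2_scaleR[OF bl(1)[OF gL[OF H1(1)]]]] L2(1)])
      (rule L2_bounded_linear[OF bounded_linear_scaleR_left L2(2)])
  have sk: "(\<lambda>x. skew_part (\<sigma> x)) \<in> L2 ?M" by (rule bl(2)[OF L2(1)])
  have dv: "(\<lambda>x. ?g v x - ?g w x) \<in> L2 ?M" by (rule L2_diff[OF gL[OF H1(3)] gL[OF H1(2)]])
  have du: "(\<lambda>x. ?g u x - ?g v x) \<in> L2 ?M" by (rule L2_diff[OF gL[OF H1(1)] gL[OF H1(3)]])
  have dw: "(\<lambda>x. ?g u x - ?g w x) \<in> L2 ?M" by (rule L2_diff[OF gL[OF H1(1)] gL[OF H1(2)]])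
  let ?X = "L2_norm ?M (?e (\<lambda>x. u x - w x))" and ?Y = "L2_norm ?M (?e (\<lambda>x. u x - v x))"
    and ?E = "L2_norm ?M (?e (\<lambda>x. v x - w x))" and ?s = "L2_norm ?M (\<lambda>x. skew_part (\<sigma> x))"
    and ?d = "L2_norm ?M (\<lambda>x. deviator (\<tau> x))"
  have e: "L2_norm ?M (\<lambda>x. sym_part (?g u x - ?g w x)) = ?X" "L2_norm ?M (\<lambda>x. sym_part (?g v x - ?g w x)) = ?E"
    by (rule L2_norm_cong_AE[OF L2_measurable[OF bl(1)[OF dw]] L2_measurable[OF eL[OF uw(1)]]],
        use uw(2) in eventually_elim, simp add: eps_sym_part)
      (rule L2_norm_cong_AE[OF L2_measurable[OF bl(1)[OF dv]] L2_measurable[OF eL[OF vw(1)]]],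
        use vw(2) in eventually_elim, simp add: eps_sym_part)
  have i: "L2_inner ?M (\<lambda>x. ?g u x - ?g v x) h = L2_inner ?M (?g (\<lambda>x. u x - v x)) h" if "h \<in> L2 ?M" for h
    by (rule L2_inner_cong_AE[OF L2_measurable[OF du] L2_measurable[OF gL[OF uv(1)]] L2_measurable[OF that] L2_measurable[OF that]])
      (use uv(2) in eventually_elim, simp, simp)
  have "2 * \<mu> * ?X\<^sup>2 + inv_lam lam * (L2_norm ?M (\<lambda>x. p x - q x))\<^sup>2 + ?d\<^sup>2 / (2 * \<mu>)
    \<le> L2_inner ?M (\<lambda>x. A_map \<mu> lam (r x)) r + 2 * L2_inner ?M (?g (\<lambda>x. u x - v x)) \<tau>
      + 2 * L2_inner ?M (?g (\<lambda>x. u x - v x)) (\<lambda>x. skew_part (\<sigma> x)) + 2 * L2_inner ?M (\<lambda>x. sym_part (?g v x - ?g w x)) \<tau>"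
    using energy_splitting[OF lame gL[OF H1(1)] gL[OF H1(2)] gL[OF H1(3)] L2] div
    unfolding e i[OF \<tau>, unfolded \<tau>_def] i[OF sk] divergence_def \<tau>_def r_def eps_sym_part by blast
  moreover have "\<bar>L2_inner ?M (?g (\<lambda>x. u x - v x)) (\<lambda>x. skew_part (\<sigma> x))\<bar> \<le> C * ?Y * ?s"
    by (rule korn_skew[OF S K uv(1) sk J])
  moreover have "\<bar>L2_inner ?M (\<lambda>x. sym_part (?g v x - ?g w x)) \<tau>\<bar> \<le> C * ?E * ?d"
  proof -
    have tri: "integrable ?M (\<lambda>x. trace (?g z x))" if "z \<in> componentwise (H1 (interior S))" for z
      by (rule L2_imp_integrable[OF finite_measure_lebesgue_on[OF S'(4,6)] L2_bounded_linear[OF bounded_linear_matrix_maps(5) gL[OF that]]])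
    have "(LINT x|?M. trace (sym_part (?g v x - ?g w x))) = (LINT x|?M. trace (?g v x) - trace (?g w x))"
      by (simp add: sym_part_def trace_2 algebra_simps)
    also have "\<dots> = 0" using mean tri[OF H1(2)] tri[OF H1(3)] by (simp add: divergence_def)
    finally show ?thesis
      using korn_divergence_free[OF S K \<tau> div0 bl(1)[OF dv]] unfolding e by simp
  qed
  \<comment> \<open>The strain of u - v is not computable; it is traded for the error itself and the
    computable distance between v and w.\<close>
  moreover have "?Y \<le> ?X + ?E"
  proof -
    have "?Y = L2_norm ?M (\<lambda>x. ?e (\<lambda>x. u x - w x) x - ?e (\<lambda>x. v x - w x) x)"
      by (rule L2_norm_cong_AE[OF L2_measurable[OF eL[OF uv(1)]] L2_measurable[OF L2_diff[OF eL[OF uw(1)] eL[OF vw(1)]]]])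
        (use uv(2) uw(2) vw(2) in eventually_elim, simp add: eps_sym_part sym_part_diff)
    also have "\<dots> \<le> ?X + ?E"
      using L2_norm_triangle[OF eL[OF uw(1)] L2_uminus[OF eL[OF vw(1)]]] by (simp add: L2_norm_uminus)
    finally show ?thesis .
  qed
  moreover have "0 \<le> inv_lam lam * (L2_norm ?M (\<lambda>x. p x - q x))\<^sup>2"
    using lame_coefficients(2)[OF lame] by simp
  ultimately show ?thesis
    by (intro error_splitting_young[where d = ?d and Y = ?Y] lame korn_constant_nonneg[OF S K] L2_norm_nonneg) auto
qed

theorem theorem4p2:
  fixes \<Omega> :: "(real^2) set" and \<T> \<D> :: "(real^2) set set"
    and \<mu> :: real and lam :: ereal
    and f g u u\<^sub>h u\<^sub>C :: "real^2 \<Rightarrow> real^2" and p p\<^sub>h :: "real^2 \<Rightarrow> real"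
    and \<sigma> :: "real^2 \<Rightarrow> real^2^2" and CK :: "(real^2) set \<Rightarrow> real" and C :: real
  assumes domain: "polygonal_domain \<Omega>"
    and mesh: "triangulates \<T> \<Omega>"
    and dirichlet: "\<D> \<subseteq> boundary_edges \<Omega> \<T>" "\<D> \<noteq> {}"
    and lame: "0 < \<mu>" "0 < lam"
    and f_L2: "f \<in> L2 (lebesgue_on \<Omega>)"
    and g_L2: "\<forall>E \<in> neumann_edges \<Omega> \<T> \<D>. g \<in> L2_edge E"
    and exact: "continuous_solution \<Omega> \<T> \<D> \<mu> lam f g u p"
    and discrete: "discrete_solution \<Omega> \<T> \<D> \<mu> lam f g u\<^sub>h p\<^sub>h"
    and f_proj: "AE x in lebesgue_on \<Omega>. f x = proj \<Omega> \<T> f x"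
    and g_proj: "\<forall>E \<in> neumann_edges \<Omega> \<T> \<D>.
        AE_edge E (\<lambda>x. g x = edge_proj (neumann_edges \<Omega> \<T> \<D>) g x)"
    and stress: "equilibrated_stress \<Omega> \<T> \<D> f g \<sigma>"
    and conforming: "u\<^sub>C \<in> componentwise (H1_D \<Omega> \<T> \<D>)"
    and div_mean: "\<forall>T\<in>\<T>. L2_inner (lebesgue_on T) (div_h u\<^sub>C T) (\<lambda>x. 1)
                        = L2_inner (lebesgue_on T) (div_h u\<^sub>h T) (\<lambda>x. 1)"
    and korn: "\<forall>T\<in>\<T>. korn_constant T (CK T)"
    and C_def: "C = Max (CK ` \<T>)"
  shows "energy_norm \<Omega> \<T> \<mu> lam (\<lambda>x. u x - u\<^sub>h x) (\<lambda>x. p x - p\<^sub>h x)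
    \<le> sqrt (2 * (eta_R \<mu> lam \<T> \<sigma> u\<^sub>h p\<^sub>h)\<^sup>2
          + (2 * C\<^sup>2 + 1) * (eta_C \<mu> \<T> u\<^sub>C u\<^sub>h)\<^sup>2
          + 8 * C\<^sup>2 * (eta_S \<mu> \<Omega> \<sigma>)\<^sup>2)"
proof -
  let ?S = "exact_stress \<Omega> \<mu> u p" and ?M = "lebesgue_on" and ?g = "\<lambda>T. grad (interior T)"
  let ?v = "\<lambda>x. u x - u\<^sub>C x"
  let ?\<tau> = "\<lambda>T x. (2 * \<mu>) *\<^sub>R sym_part (?g T u x) + p x *\<^sub>R mat 1 - \<sigma> x"
  let ?r = "\<lambda>T x. \<sigma> x - (2 * \<mu>) *\<^sub>R eps (interior T) u\<^sub>h x - p\<^sub>h x *\<^sub>R mat 1"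
  let ?X = "\<lambda>T. L2_norm (?M T) (eps (interior T) (\<lambda>x. u x - u\<^sub>h x))"
    and ?E = "\<lambda>T. L2_norm (?M T) (eps (interior T) (\<lambda>x. u\<^sub>C x - u\<^sub>h x))"
    and ?P = "\<lambda>T. L2_norm (?M T) (\<lambda>x. p x - p\<^sub>h x)" and ?s = "\<lambda>T. L2_norm (?M T) (\<lambda>x. skew_part (\<sigma> x))"
    and ?R = "\<lambda>T. L2_inner (?M T) (\<lambda>x. A_map \<mu> lam (?r T x)) (?r T)" and ?G = "\<lambda>T. L2_inner (?M T) (?g T ?v) (?\<tau> T)"
  note ctx = domain mesh dirichlet(1)
  note body = mesh_body[OF domain mesh] and fin = mesh_finite[OF domain mesh]
  have uD: "u \<in> componentwise (H1_D \<Omega> \<T> \<D>)" and pL: "p \<in> L2 (?M \<Omega>)"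
    and uh: "u\<^sub>h \<in> componentwise (V_h \<Omega> \<T> \<D>)" and ph: "p\<^sub>h \<in> DG 1 \<T>"
    using exact discrete by (auto simp: continuous_solution_def discrete_solution_def)
  have uH: "u \<in> componentwise (H1 \<Omega>)" and CH: "u\<^sub>C \<in> componentwise (H1 \<Omega>)"
    by (rule H1_D_H1[OF ctx uD] H1_D_H1[OF ctx conforming])+
  have vD: "?v \<in> componentwise (H1_D \<Omega> \<T> \<D>)"
    using H1_D_diff[OF ctx componentwiseD[OF uD] componentwiseD[OF conforming]] by (simp add: componentwise_def)
  note vH = H1_D_H1[OF ctx vD]
  have SL: "?S \<in> L2 (?M \<Omega>)" by (rule exact_stress_L2[OF ctx exact f_L2])
  have \<sigma>L: "\<sigma> \<in> L2 (?M \<Omega>)" by (rule stress_L2[OF ctx exact f_L2 stress f_proj g_proj])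
  have phL: "p\<^sub>h \<in> L2 (?M T)" if "T \<in> \<T>" for T by (rule DG_L2_element[OF domain mesh ph that])
  have phL': "p\<^sub>h \<in> L2 (?M \<Omega>)" by (rule L2_mesh[OF domain mesh phL])
  have skL: "(\<lambda>x. skew_part (\<sigma> x)) \<in> L2 (?M \<Omega>)" by (rule L2_bounded_linear[OF bounded_linear_matrix_maps(4) \<sigma>L])
  have \<tau>: "?\<tau> T \<in> L2 (?M T)" "AE x in ?M T. ?\<tau> T x = ?S x - \<sigma> x" if T: "T \<in> \<T>" for T
  proof -
    have d: "(\<lambda>x. ?S x - \<sigma> x) \<in> L2 (?M T)" by (rule L2_mesh_element[OF domain mesh L2_diff[OF SL \<sigma>L] T])
    have ae: "AE x in ?M T. ?S x - \<sigma> x = ?\<tau> T x"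
      using H1_element_vec(2)[OF ctx uH T] by eventually_elim (simp add: exact_stress_def[OF ctx exact f_L2])
    show "?\<tau> T \<in> L2 (?M T)" by (rule L2_lebesgue_on_cong_AE[OF convex_bodyD(6)[OF body[OF T]] d ae])
    show "AE x in ?M T. ?\<tau> T x = ?S x - \<sigma> x" using ae by eventually_elim simp
  qed
  have element: "2 * \<mu> * (?X T)\<^sup>2 + inv_lam lam * (?P T)\<^sup>2
      \<le> 2 * ?R T + (2 * C\<^sup>2 + 1) * (2 * \<mu> * (?E T)\<^sup>2) + 8 * C\<^sup>2 * ((?s T)\<^sup>2 / (2 * \<mu>)) + 4 * ?G T"
    if T: "T \<in> \<T>" for T
  proof -
    have "2 * \<mu> * (?X T)\<^sup>2 + inv_lam lam * (?P T)\<^sup>2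
      \<le> 2 * ?R T + (2 * (CK T)\<^sup>2 + 1) * (2 * \<mu> * (?E T)\<^sup>2) + 8 * (CK T)\<^sup>2 * ((?s T)\<^sup>2 / (2 * \<mu>)) + 4 * ?G T"
    proof (rule element_estimate[OF lame body[OF T]])
      show "korn_constant T (CK T)" using korn T by blast
      show "u \<in> componentwise (H1 (interior T))" "u\<^sub>C \<in> componentwise (H1 (interior T))"
        by (rule H1_element_vec(1)[OF ctx uH T] H1_element_vec(1)[OF ctx CH T])+
      show "u\<^sub>h \<in> componentwise (H1 (interior T))" by (rule V_h_element(1)[OF domain mesh uh T])
      show "\<sigma> \<in> L2 (?M T)" "p \<in> L2 (?M T)" "p\<^sub>h \<in> L2 (?M T)"
        by (rule L2_mesh_element[OF domain mesh \<sigma>L T] L2_mesh_element[OF domain mesh pL T] phL[OF T])+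
      show "AE x in ?M T. divergence (interior T) u x = inv_lam lam * p x"
        using H1_element_vec(2)[OF ctx uH T] AE_mesh_element[OF domain mesh exact_divergence[OF ctx exact f_L2] T]
        by eventually_elim (simp add: divergence_def)
      show "AE x in ?M T. divergence (interior T) u\<^sub>h x = inv_lam lam * p\<^sub>h x"
        using discrete_divergence[OF domain mesh discrete T] by (simp add: div_h_def)
      show "(LINT x|?M T. divergence (interior T) u\<^sub>C x) = (LINT x|?M T. divergence (interior T) u\<^sub>h x)"
        using div_mean T by (simp add: div_h_def L2_inner_def)
      show "L2_inner (?M T) (\<lambda>x. skew_part (\<sigma> x)) (\<lambda>x. J_mat) = 0"
        using stress T by (simp add: equilibrated_stress_def)
      fix i \<phi> assume \<phi>: "\<phi> \<in> test_functions (interior T)"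
      have gm: "gradient \<phi> \<in> borel_measurable (?M T)"
        by (rule L2_measurable[OF L2_gradient_smooth[OF test_functions_smooth[OF \<phi>] convex_bodyD(4,6)[OF body[OF T]]]])
      have "(LINT x|?M T. ?\<tau> T x $ i \<bullet> gradient \<phi> x) = (LINT x|?M T. (?S x - \<sigma> x) $ i \<bullet> gradient \<phi> x)"
      proof (rule integral_cong_AE)
        show "(\<lambda>x. ?\<tau> T x $ i \<bullet> gradient \<phi> x) \<in> borel_measurable (?M T)"
          by (rule borel_measurable_inner[OF L2_measurable[OF L2_nth[OF \<tau>(1)[OF T]]] gm])
        show "(\<lambda>x. (?S x - \<sigma> x) $ i \<bullet> gradient \<phi> x) \<in> borel_measurable (?M T)"
          by (rule borel_measurable_inner[OF L2_measurable[OF L2_nth[OF L2_mesh_element[OF domain mesh L2_diff[OF SL \<sigma>L] T]]] gm])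
        show "AE x in ?M T. ?\<tau> T x $ i \<bullet> gradient \<phi> x = (?S x - \<sigma> x) $ i \<bullet> gradient \<phi> x"
          using \<tau>(2)[OF T] by eventually_elim simp
      qed
      also have "\<dots> = 0" by (rule stress_divergence_free[OF ctx exact f_L2 stress f_proj g_proj T \<phi>])
      finally show "(LINT x|?M T. ?\<tau> T x $ i \<bullet> gradient \<phi> x) = 0" .
    qed
    \<comment> \<open>Squares are monotone only on nonnegative numbers; the sign of
      \<open>CK T\<close> follows from Korn's inequality.\<close>
    moreover have "(CK T)\<^sup>2 \<le> C\<^sup>2"
      using korn_constant_nonneg[OF body[OF T], of "CK T"] korn T fin by (intro power_mono) (auto simp: C_def)
    then have "(2 * (CK T)\<^sup>2 + 1) * (2 * \<mu> * (?E T)\<^sup>2) \<le> (2 * C\<^sup>2 + 1) * (2 * \<mu> * (?E T)\<^sup>2)"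
      "8 * (CK T)\<^sup>2 * ((?s T)\<^sup>2 / (2 * \<mu>)) \<le> 8 * C\<^sup>2 * ((?s T)\<^sup>2 / (2 * \<mu>))"
      using lame by (intro mult_right_mono; simp)+
    ultimately show ?thesis by linarith
  qed
  \<comment> \<open>Summed over the mesh, the local products form one product over \<Omega>, and
    both stresses satisfy the same variational equation for the test field
    \<open>?v\<close>.\<close>
  have G: "(\<Sum>T\<in>\<T>. ?G T) = 0"
  proof -
    have gL: "grad \<Omega> ?v \<in> L2 (?M \<Omega>)" by (rule grad_L2[OF vH])
    have "?G T = L2_inner (?M T) (grad \<Omega> ?v) (\<lambda>x. ?S x - \<sigma> x)" if T: "T \<in> \<T>" for T
    proof (rule L2_inner_cong_AE)
      show "?g T ?v \<in> borel_measurable (?M T)"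
        using L2_measurable[OF grad_L2[OF H1_element_vec(1)[OF ctx vH T]]] by (simp add: interior_null_change[OF body[OF T]])
      show "grad \<Omega> ?v \<in> borel_measurable (?M T)" by (rule L2_measurable[OF L2_mesh_element[OF domain mesh gL T]])
      show "?\<tau> T \<in> borel_measurable (?M T)" by (rule L2_measurable[OF \<tau>(1)[OF T]])
      show "(\<lambda>x. ?S x - \<sigma> x) \<in> borel_measurable (?M T)"
        by (rule L2_measurable[OF L2_mesh_element[OF domain mesh L2_diff[OF SL \<sigma>L] T]])
      show "AE x in ?M T. ?g T ?v x = grad \<Omega> ?v x" by (rule H1_element_vec(2)[OF ctx vH T])
      show "AE x in ?M T. ?\<tau> T x = ?S x - \<sigma> x" by (rule \<tau>(2)[OF T])
    qed
    then have "(\<Sum>T\<in>\<T>. ?G T) = L2_inner (?M \<Omega>) (grad \<Omega> ?v) (\<lambda>x. ?S x - \<sigma> x)"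
      using L2_inner_mesh[OF domain mesh gL L2_diff[OF SL \<sigma>L]] by simp
    also have "\<dots> = 0"
      using exact_weak_form[OF ctx exact f_L2 vD] stress_green[OF ctx exact f_L2 stress f_proj g_proj vD]
        L2_inner_diff_right[OF SL \<sigma>L gL] by (simp add: L2_inner_commute[of _ "grad \<Omega> ?v"])
    finally show ?thesis .
  qed
  have "(\<Sum>T\<in>\<T>. 2 * \<mu> * (?X T)\<^sup>2 + inv_lam lam * (?P T)\<^sup>2)
    \<le> (\<Sum>T\<in>\<T>. 2 * ?R T + (2 * C\<^sup>2 + 1) * (2 * \<mu> * (?E T)\<^sup>2) + 8 * C\<^sup>2 * ((?s T)\<^sup>2 / (2 * \<mu>)) + 4 * ?G T)"
    by (rule sum_mono) (rule element)
  also have "\<dots> = 2 * (\<Sum>T\<in>\<T>. ?R T) + (2 * C\<^sup>2 + 1) * (2 * \<mu> * (\<Sum>T\<in>\<T>. (?E T)\<^sup>2))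
      + 8 * C\<^sup>2 * ((\<Sum>T\<in>\<T>. (?s T)\<^sup>2) / (2 * \<mu>)) + 4 * (\<Sum>T\<in>\<T>. ?G T)"
    by (simp only: sum.distrib sum_distrib_left[symmetric] sum_divide_distrib[symmetric])
  finally have total: "(\<Sum>T\<in>\<T>. 2 * \<mu> * (?X T)\<^sup>2 + inv_lam lam * (?P T)\<^sup>2)
    \<le> 2 * (\<Sum>T\<in>\<T>. ?R T) + (2 * C\<^sup>2 + 1) * (2 * \<mu> * (\<Sum>T\<in>\<T>. (?E T)\<^sup>2)) + 8 * C\<^sup>2 * ((\<Sum>T\<in>\<T>. (?s T)\<^sup>2) / (2 * \<mu>))"
    unfolding G by (simp only: mult_zero_right add_0_right)
  have nh: "(norm_h \<T> (eps_h w))\<^sup>2 = (\<Sum>T\<in>\<T>. (L2_norm (?M T) (eps (interior T) w))\<^sup>2)" for w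
    unfolding norm_h_def inner_h_def eps_h_def L2_norm_square by (rule real_sqrt_pow2) (simp add: sum_nonneg)
  have mesh_sq: "(L2_norm (?M \<Omega>) h)\<^sup>2 = (\<Sum>T\<in>\<T>. (L2_norm (?M T) h)\<^sup>2)" if "h \<in> L2 (?M \<Omega>)"
    for h :: "point \<Rightarrow> 'b::euclidean_space"
    unfolding L2_norm_square by (rule L2_inner_mesh[OF domain mesh that that])
  \<comment> \<open>Squaring removes the root because the energy density is nonnegative, being
    bounded below by the squared deviator.\<close>
  have "(eta_R \<mu> lam \<T> \<sigma> u\<^sub>h p\<^sub>h)\<^sup>2 = (\<Sum>T\<in>\<T>. ?R T)"
    unfolding eta_R_def A_norm_h_def inner_h_def eps_h_def
  proof (rule real_sqrt_pow2, rule sum_nonneg)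
    show "0 \<le> ?R T" for T
      unfolding L2_inner_def
    proof (rule Bochner_Integration.integral_nonneg)
      show "0 \<le> A_map \<mu> lam (?r T x) \<bullet> ?r T x" for x
        by (rule order_trans[OF _ deviator_le_A_map[OF lame]]) (use lame in simp)
    qed
  qed
  moreover have "(eta_C \<mu> \<T> u\<^sub>C u\<^sub>h)\<^sup>2 = 2 * \<mu> * (\<Sum>T\<in>\<T>. (?E T)\<^sup>2)"
    using lame by (simp add: eta_C_def power_mult_distrib nh)
  moreover have "(eta_S \<mu> \<Omega> \<sigma>)\<^sup>2 = (\<Sum>T\<in>\<T>. (?s T)\<^sup>2) / (2 * \<mu>)"
    using lame by (simp add: eta_S_def power_divide mesh_sq[OF skL])
  moreover have "2 * \<mu> * (norm_h \<T> (eps_h (\<lambda>x. u x - u\<^sub>h x)))\<^sup>2 + inv_lam lam * (L2_norm (?M \<Omega>) (\<lambda>x. p x - p\<^sub>h x))\<^sup>2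
    = (\<Sum>T\<in>\<T>. 2 * \<mu> * (?X T)\<^sup>2 + inv_lam lam * (?P T)\<^sup>2)"
    by (simp add: nh mesh_sq[OF L2_diff[OF pL phL']] sum.distrib sum_distrib_left)
  ultimately show ?thesis unfolding energy_norm_def using total by (intro real_sqrt_le_mono) simp
qed

end
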